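(* Let $(N,\Sigma,\beta)$ be a stacky fan. Let $N'\subset N$ denote the image of $\beta$, let $\Sigma'$ be the fan in $N'\otimes\mathbb{R}$ corresponding to $\Sigma$ under the natural isomorphism $N'\otimes\mathbb{R}\cong N\otimes\mathbb{R}$, and let $\beta':\mathbb{Z}^n\to N'$ be $\beta$ with restricted codomain. Then the toric Deligne-Mumford stack $\mathcal{X}(N',\Sigma',\beta')$ is the universal cover of $\mathcal{X}(N,\Sigma,\beta)$.
   Context: A stacky fan is a triple $(N,\Sigma,\beta)$ consisting of a finitely generated abelian group $N$ of rank $d$, a rational simplicial fan $\Sigma$ in $N\otimes\mathbb{R}$ with rays $\rho_1,\dots,\rho_n$, and a homomorphism $\beta:\mathbb{Z}^n\to N$ such that the rays span $N\otimes\mathbb{R}$ and $\beta(e_j)\otimes 1$ lies on $\rho_j$ for $1\le j\le n$ ($e_j$ the standard basis). The triple $(N',\Sigma',\beta')$ in the claim is again a stacky fan. The toric DM stack is $\mathcal{X}(N,\Sigma,\beta)=[Z_\Sigma/G]$, where $Z_\Sigma=\mathbb{C}^n\setminus V(J_\Sigma)$ with $J_\Sigma$ the ideal generated by the monomials $\prod_{\rho_i\not\subset\sigma}z_i$, $\sigma\in\Sigma$, and $G$ is as follows. Choose a free resolution $0\to\mathbb{Z}^r\xrightarrow{Q}\mathbb{Z}^{d+r}\to N\to 0$ and a lift $B:\mathbb{Z}^n\to\mathbb{Z}^{d+r}$ of $\beta$; with $(-)^\star=\operatorname{Hom}_{\mathbb{Z}}(-,\mathbb{Z})$, put $\mathrm{DG}(\beta)=(\mathbb{Z}^{n+r})^\star/\operatorname{im}[B\,Q]^\star$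 and let $\beta^\vee:(\mathbb{Z}^n)^\star\to\mathrm{DG}(\beta)$ be the inclusion into the first $n$ coordinates of $(\mathbb{Z}^{n+r})^\star$ followed by the quotient map. Then $G=\operatorname{Hom}_{\mathbb{Z}}(\mathrm{DG}(\beta),\mathbb{C}^* )$ acts on $Z_\Sigma\subset\mathbb{C}^n$ via $\operatorname{Hom}_{\mathbb{Z}}(\beta^\vee,\mathbb{C}^* ):G\to(\mathbb{C}^* )^n$. For a Lie group $G$ acting on a manifold $X$, the quotient stack $[X/G]$ has as objects over $B$ pairs $(B\leftarrow E\to X)$ of a principal $G$-bundle $E\to B$ and a $G$-equivariant map $E\to X$; it is viewed as a stack over topological spaces when discussing coverings and $\pi_1$. A morphism of stacks $\mathcal{Y}\to\mathcal{X}$ is representable if for every morphism $\underline{W}\to\mathcal{X}$ from (the stack associated to) a space the fiber product $\mathcal{Y}\times_{\mathcal{X}}\underline{W}$ is equivalent to a space; it is a covering projection if it is representable and each such map $\mathcal{Y}\times_{\mathcal{X}}\underline{W}\to\underline{W}$ is a covering projection of spaces. For a point $x:\underline{\star}\to\mathcal{X}$, $\pi_1(\mathcal{X},x)$ is the group of pointed homotopy classes of pointed maps $(\underline{S^1},\underline{1})\to(\mathcal{X},x)$ (morphisms $f$ with a 2-isomorphism $x\Rightarrow f\circ\underline{1}$; homotopies are morphisms $\underline{[0,1]\times S^1}\to\mathcal{X}$ with a 2-isomorphism to the constant map at $x$ along $[0,1]\times\{1\}$ and pointed 2-isomorphisms at the ends). A universal covering projection is a covering projection $\tilde{\mathcal{X}}\to\mathcal{X}$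 with $\pi_1(\tilde{\mathcal{X}},\tilde{x})$ trivial; its source is the universal cover. *)

theory Defs
  imports
    "HOL-Algebra.Free_Abelian_Groups"
    "HOL-Algebra.Product_Groups"
    "HOL-Analysis.Analysis"
begin

section \<open>Abelian groups\<close>

text \<open>All abelian groups are written multiplicatively, following HOL-Algebra.\<close>

definition int_power :: "nat \<Rightarrow> (nat \<Rightarrow> int) monoid"
  where "int_power n = product_group {..<n} (\<lambda>_. integer_group)"

definition std_basis :: "nat \<Rightarrow> nat \<Rightarrow> nat \<Rightarrow> int"
  where "std_basis n j = (\<lambda>i\<in>{..<n}. if i = j then 1 else 0)"

definition real_group :: "real monoid"
  where "real_group = \<lparr>carrier = UNIV, monoid.mult = (+), one = 0\<rparr>"

definition complex_units :: "complex monoid"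
  where "complex_units = \<lparr>carrier = UNIV - {0}, monoid.mult = (*), one = 1\<rparr>"

definition finitely_generated :: "'a monoid \<Rightarrow> bool"
  where "finitely_generated A \<longleftrightarrow> (\<exists>S. finite S \<and> S \<subseteq> carrier A \<and> generate A S = carrier A)"

definition int_independent :: "'a monoid \<Rightarrow> 'a set \<Rightarrow> bool"
  where "int_independent A S \<longleftrightarrow> finite S \<and> S \<subseteq> carrier A \<and>
    (\<forall>c :: 'a \<Rightarrow> int. finprod A (\<lambda>a. a [^]\<^bsub>A\<^esub> c a) S = \<one>\<^bsub>A\<^esub> \<longrightarrow> (\<forall>a\<in>S. c a = 0))"

text \<open>The maximum exists when \<open>A\<close> is a finitely generated abelian group, the only case used.\<close>

definition abelian_rank :: "'a monoid \<Rightarrow> nat"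
  where "abelian_rank A = Max {card S | S. int_independent A S}"

text \<open>Homomorphisms are made extensional so that equality in the group is equality on the source.\<close>

definition hom_group :: "'a monoid \<Rightarrow> 'b monoid \<Rightarrow> ('a \<Rightarrow> 'b) monoid"
  where "hom_group A C =
    \<lparr>carrier = hom A C \<inter> extensional (carrier A),
     monoid.mult = (\<lambda>f g. \<lambda>x\<in>carrier A. f x \<otimes>\<^bsub>C\<^esub> g x),
     one = (\<lambda>x\<in>carrier A. \<one>\<^bsub>C\<^esub>)\<rparr>"

definition hom_map :: "'a monoid \<Rightarrow> ('a \<Rightarrow> 'b) \<Rightarrow> ('b \<Rightarrow> 'c) \<Rightarrow> 'a \<Rightarrow> 'c"
  where "hom_map A h f = (\<lambda>x\<in>carrier A. f (h x))"

abbreviation dual_group :: "'a monoid \<Rightarrow> ('a \<Rightarrow> int) monoid"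
  where "dual_group A \<equiv> hom_group A integer_group"

section \<open>The tensor product of abelian groups\<close>

abbreviation tensor_free :: "'a monoid \<Rightarrow> 'b monoid \<Rightarrow> ('a \<times> 'b \<Rightarrow>\<^sub>0 int) monoid"
  where "tensor_free A B \<equiv> free_Abelian_group (carrier A \<times> carrier B)"

definition tensor_relations :: "'a monoid \<Rightarrow> 'b monoid \<Rightarrow> ('a \<times> 'b \<Rightarrow>\<^sub>0 int) set"
  where "tensor_relations A B = generate (tensor_free A B)
    ({frag_of (a \<otimes>\<^bsub>A\<^esub> a', b) - frag_of (a, b) - frag_of (a', b) | a a' b.
        a \<in> carrier A \<and> a' \<in> carrier A \<and> b \<in> carrier B} \<union>
     {frag_of (a, b \<otimes>\<^bsub>B\<^esub> b') - frag_of (a, b) - frag_of (a, b') | a b b'.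
        a \<in> carrier A \<and> b \<in> carrier B \<and> b' \<in> carrier B})"

definition tensor_product :: "'a monoid \<Rightarrow> 'b monoid \<Rightarrow> ('a \<times> 'b \<Rightarrow>\<^sub>0 int) set monoid"
  where "tensor_product A B = tensor_free A B Mod tensor_relations A B"

definition pure_tensor :: "'a monoid \<Rightarrow> 'b monoid \<Rightarrow> 'a \<Rightarrow> 'b \<Rightarrow> ('a \<times> 'b \<Rightarrow>\<^sub>0 int) set"
  where "pure_tensor A B a b = tensor_relations A B #>\<^bsub>tensor_free A B\<^esub> frag_of (a, b)"

text \<open>The map \<open>f \<otimes> g : A \<otimes> B \<rightarrow> A' \<otimes> B'\<close>: the coset containing the image of the coset \<open>X\<close>.\<close>

definition tensor_map ::
    "'c monoid \<Rightarrow> 'd monoid \<Rightarrow> ('a \<Rightarrow> 'c) \<Rightarrow> ('b \<Rightarrow> 'd)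
      \<Rightarrow> ('a \<times> 'b \<Rightarrow>\<^sub>0 int) set \<Rightarrow> ('c \<times> 'd \<Rightarrow>\<^sub>0 int) set"
  where "tensor_map A' B' f g X = tensor_relations A' B' <#>\<^bsub>tensor_free A' B'\<^esub>
    frag_extend (\<lambda>(a, b). frag_of (f a, g b)) ` X"

section \<open>Fans in \<open>N \<otimes> \<real>\<close>\<close>

type_synonym 'a tensor_real = "('a \<times> real \<Rightarrow>\<^sub>0 int) set"

abbreviation real_ext :: "'a monoid \<Rightarrow> 'a tensor_real monoid"
  where "real_ext N \<equiv> tensor_product N real_group"

abbreviation real_scale :: "'a monoid \<Rightarrow> real \<Rightarrow> 'a tensor_real \<Rightarrow> 'a tensor_real"
  where "real_scale N c \<equiv> tensor_map N real_group (\<lambda>a. a) (\<lambda>s. c * s)"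

abbreviation lattice_point :: "'a monoid \<Rightarrow> 'a \<Rightarrow> 'a tensor_real"
  where "lattice_point N a \<equiv> pure_tensor N real_group a 1"

definition real_comb ::
    "'a monoid \<Rightarrow> ('a tensor_real \<Rightarrow> real) \<Rightarrow> 'a tensor_real set \<Rightarrow> 'a tensor_real"
  where "real_comb N c S = finprod (real_ext N) (\<lambda>v. real_scale N (c v) v) S"

definition real_independent :: "'a monoid \<Rightarrow> 'a tensor_real set \<Rightarrow> bool"
  where "real_independent N S \<longleftrightarrow> finite S \<and> S \<subseteq> carrier (real_ext N) \<and>
    (\<forall>c. real_comb N c S = \<one>\<^bsub>real_ext N\<^esub> \<longrightarrow> (\<forall>v\<in>S. c v = 0))"

definition real_span :: "'a monoid \<Rightarrow> 'a tensor_real set \<Rightarrow> 'a tensor_real set"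
  where "real_span N S = {real_comb N c T | c T. finite T \<and> T \<subseteq> S}"

definition cone_generated :: "'a monoid \<Rightarrow> 'a tensor_real set \<Rightarrow> 'a tensor_real set"
  where "cone_generated N S = {real_comb N c S | c. \<forall>v\<in>S. 0 \<le> c v}"

definition rational_simplicial_cone :: "'a monoid \<Rightarrow> 'a tensor_real set \<Rightarrow> bool"
  where "rational_simplicial_cone N \<sigma> \<longleftrightarrow>
    (\<exists>S. S \<subseteq> lattice_point N ` carrier N \<and> real_independent N S \<and> \<sigma> = cone_generated N S)"

definition real_functional :: "'a monoid \<Rightarrow> ('a tensor_real \<Rightarrow> real) \<Rightarrow> bool"
  where "real_functional N u \<longleftrightarrow> u \<in> hom (real_ext N) real_group \<and>
    (\<forall>c. \<forall>v\<in>carrier (real_ext N). u (real_scale N c v) = c * u v)"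

definition face_of_cone :: "'a monoid \<Rightarrow> 'a tensor_real set \<Rightarrow> 'a tensor_real set \<Rightarrow> bool"
  where "face_of_cone N \<tau> \<sigma> \<longleftrightarrow>
    (\<exists>u. real_functional N u \<and> (\<forall>v\<in>\<sigma>. 0 \<le> u v) \<and> \<tau> = {v \<in> \<sigma>. u v = 0})"

definition rational_simplicial_fan :: "'a monoid \<Rightarrow> 'a tensor_real set set \<Rightarrow> bool"
  where "rational_simplicial_fan N \<Sigma> \<longleftrightarrow>
    finite \<Sigma> \<and> \<Sigma> \<noteq> {} \<and>
    (\<forall>\<sigma>\<in>\<Sigma>. rational_simplicial_cone N \<sigma>) \<and>
    (\<forall>\<sigma>\<in>\<Sigma>. \<forall>\<tau>. face_of_cone N \<tau> \<sigma> \<longrightarrow> \<tau> \<in> \<Sigma>) \<and>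
    (\<forall>\<sigma>\<in>\<Sigma>. \<forall>\<tau>\<in>\<Sigma>. face_of_cone N (\<sigma> \<inter> \<tau>) \<sigma> \<and> face_of_cone N (\<sigma> \<inter> \<tau>) \<tau>)"

definition fan_rays :: "'a monoid \<Rightarrow> 'a tensor_real set set \<Rightarrow> 'a tensor_real set set"
  where "fan_rays N \<Sigma> = {\<rho> \<in> \<Sigma>. \<exists>v\<in>carrier (real_ext N).
    v \<noteq> \<one>\<^bsub>real_ext N\<^esub> \<and> \<rho> = cone_generated N {v}}"

text \<open>
  The enumeration \<open>\<rho> 0, \<dots>, \<rho> (n - 1)\<close> of the rays is part of the data.  That the image of
  \<open>\<beta> e\<^sub>j\<close> lies on a ray is understood to include that it is not the origin; otherwise
  the image of \<open>\<beta>\<close> need not have full rank in \<open>N\<close>.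
\<close>

definition stacky_fan ::
    "'a monoid \<Rightarrow> 'a tensor_real set set \<Rightarrow> nat \<Rightarrow> (nat \<Rightarrow> 'a tensor_real set)
      \<Rightarrow> ((nat \<Rightarrow> int) \<Rightarrow> 'a) \<Rightarrow> bool"
  where "stacky_fan N \<Sigma> n \<rho> \<beta> \<longleftrightarrow>
    comm_group N \<and> finitely_generated N \<and>
    rational_simplicial_fan N \<Sigma> \<and>
    bij_betw \<rho> {..<n} (fan_rays N \<Sigma>) \<and>
    \<beta> \<in> hom (int_power n) N \<and>
    real_span N (\<Union>j<n. \<rho> j) = carrier (real_ext N) \<and>
    (\<forall>j<n. lattice_point N (\<beta> (std_basis n j)) \<in> \<rho> j - {\<one>\<^bsub>real_ext N\<^esub>})"

definition image_subgroup :: "'a monoid \<Rightarrow> nat \<Rightarrow> ((nat \<Rightarrow> int) \<Rightarrow> 'a) \<Rightarrow> 'a monoid"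
  where "image_subgroup N n \<beta> = N\<lparr>carrier := \<beta> ` carrier (int_power n)\<rparr>"

text \<open>The set corresponding to \<open>\<sigma>\<close> under the natural map \<open>N' \<otimes> \<real> \<rightarrow> N \<otimes> \<real>\<close> for a subgroup \<open>N'\<close>.\<close>

definition pullback_cone ::
    "'a monoid \<Rightarrow> 'a monoid \<Rightarrow> 'a tensor_real set \<Rightarrow> 'a tensor_real set"
  where "pullback_cone N' N \<sigma> =
    {v \<in> carrier (real_ext N'). tensor_map N real_group (\<lambda>a. a) (\<lambda>s. s) v \<in> \<sigma>}"

section \<open>The group \<open>G\<close> and its action\<close>

text \<open>
  A free resolution of \<open>N\<close> with last map \<open>q\<close>, and a lift \<open>B\<close> of \<open>\<beta>\<close> along \<open>q\<close>.
\<close>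

definition resolution_with_lift ::
    "'a monoid \<Rightarrow> nat \<Rightarrow> ((nat \<Rightarrow> int) \<Rightarrow> 'a) \<Rightarrow> nat \<Rightarrow> ((nat \<Rightarrow> int) \<Rightarrow> nat \<Rightarrow> int)
      \<Rightarrow> ((nat \<Rightarrow> int) \<Rightarrow> nat \<Rightarrow> int) \<Rightarrow> ((nat \<Rightarrow> int) \<Rightarrow> 'a) \<Rightarrow> bool"
  where "resolution_with_lift N n \<beta> r B Q q \<longleftrightarrow>
    (let F = int_power (abelian_rank N + r) in
      Q \<in> hom (int_power r) F \<and> inj_on Q (carrier (int_power r)) \<and>
      q \<in> hom F N \<and> q ` carrier F = carrier N \<and>
      Q ` carrier (int_power r) = kernel F N q \<and>
      B \<in> hom (int_power n) F \<and> (\<forall>x\<in>carrier (int_power n). q (B x) = \<beta> x))"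

text \<open>
  Below, \<open>m\<close> is the rank of the common target of \<open>B\<close> and \<open>Q\<close>; the last \<open>r\<close> coordinates of
  a vector of length \<open>n + r\<close> are the argument of \<open>Q\<close>.
\<close>

definition block_map ::
    "nat \<Rightarrow> nat \<Rightarrow> nat \<Rightarrow> ((nat \<Rightarrow> int) \<Rightarrow> nat \<Rightarrow> int) \<Rightarrow> ((nat \<Rightarrow> int) \<Rightarrow> nat \<Rightarrow> int)
      \<Rightarrow> (nat \<Rightarrow> int) \<Rightarrow> nat \<Rightarrow> int"
  where "block_map n r m B Q v =
    B (restrict v {..<n}) \<otimes>\<^bsub>int_power m\<^esub> Q (\<lambda>i\<in>{..<r}. v (n + i))"

definition dual_image ::
    "nat \<Rightarrow> nat \<Rightarrow> nat \<Rightarrow> ((nat \<Rightarrow> int) \<Rightarrow> nat \<Rightarrow> int) \<Rightarrow> ((nat \<Rightarrow> int) \<Rightarrow> nat \<Rightarrow> int)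
      \<Rightarrow> ((nat \<Rightarrow> int) \<Rightarrow> int) set"
  where "dual_image n r m B Q =
    hom_map (int_power (n + r)) (block_map n r m B Q) ` carrier (dual_group (int_power m))"

definition DG ::
    "nat \<Rightarrow> nat \<Rightarrow> nat \<Rightarrow> ((nat \<Rightarrow> int) \<Rightarrow> nat \<Rightarrow> int) \<Rightarrow> ((nat \<Rightarrow> int) \<Rightarrow> nat \<Rightarrow> int)
      \<Rightarrow> ((nat \<Rightarrow> int) \<Rightarrow> int) set monoid"
  where "DG n r m B Q = dual_group (int_power (n + r)) Mod dual_image n r m B Q"

definition beta_dual ::
    "nat \<Rightarrow> nat \<Rightarrow> nat \<Rightarrow> ((nat \<Rightarrow> int) \<Rightarrow> nat \<Rightarrow> int) \<Rightarrow> ((nat \<Rightarrow> int) \<Rightarrow> nat \<Rightarrow> int)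
      \<Rightarrow> ((nat \<Rightarrow> int) \<Rightarrow> int) \<Rightarrow> ((nat \<Rightarrow> int) \<Rightarrow> int) set"
  where "beta_dual n r m B Q f =
    dual_image n r m B Q #>\<^bsub>dual_group (int_power (n + r))\<^esub>
      hom_map (int_power (n + r)) (\<lambda>v. restrict v {..<n}) f"

type_synonym gale_char = "((nat \<Rightarrow> int) \<Rightarrow> int) set \<Rightarrow> complex"

definition toric_group ::
    "nat \<Rightarrow> nat \<Rightarrow> nat \<Rightarrow> ((nat \<Rightarrow> int) \<Rightarrow> nat \<Rightarrow> int) \<Rightarrow> ((nat \<Rightarrow> int) \<Rightarrow> nat \<Rightarrow> int)
      \<Rightarrow> gale_char monoid"
  where "toric_group n r m B Q = hom_group (DG n r m B Q) complex_units"

text \<open>The Lie group topology on \<open>Hom(DG(\<beta>), \<complex>\<^sup>*)\<close> is that of pointwise convergence.\<close>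

definition toric_group_topology ::
    "nat \<Rightarrow> nat \<Rightarrow> nat \<Rightarrow> ((nat \<Rightarrow> int) \<Rightarrow> nat \<Rightarrow> int) \<Rightarrow> ((nat \<Rightarrow> int) \<Rightarrow> nat \<Rightarrow> int)
      \<Rightarrow> gale_char topology"
  where "toric_group_topology n r m B Q =
    subtopology (product_topology (\<lambda>_. euclidean) (carrier (DG n r m B Q)))
      (carrier (toric_group n r m B Q))"

text \<open>
  The group \<open>Hom((\<int>\<^sup>n)\<^sup>\<star>, \<complex>\<^sup>*)\<close> is identified with \<open>(\<complex>\<^sup>*)\<^sup>n\<close> by evaluation on the dual
  basis, that is, on the coordinate functions.
\<close>

definition toric_action ::
    "nat \<Rightarrow> nat \<Rightarrow> nat \<Rightarrow> ((nat \<Rightarrow> int) \<Rightarrow> nat \<Rightarrow> int) \<Rightarrow> ((nat \<Rightarrow> int) \<Rightarrow> nat \<Rightarrow> int)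
      \<Rightarrow> gale_char \<Rightarrow> (nat \<Rightarrow> complex) \<Rightarrow> nat \<Rightarrow> complex"
  where "toric_action n r m B Q g z =
    (\<lambda>i\<in>{..<n}. hom_map (dual_group (int_power n)) (beta_dual n r m B Q) g
                   (\<lambda>v\<in>carrier (int_power n). v i) * z i)"

section \<open>The space \<open>Z\<^sub>\<Sigma>\<close>\<close>

text \<open>
  A polynomial is a finitely supported family of coefficients indexed by finitely supported
  exponent vectors; multiplication is convolution.
\<close>

type_synonym cpoly = "(nat \<Rightarrow>\<^sub>0 nat) \<Rightarrow>\<^sub>0 complex"

definition poly_ring :: "nat \<Rightarrow> cpoly set"
  where "poly_ring n = {p. \<forall>e\<in>Poly_Mapping.keys p. Poly_Mapping.keys e \<subseteq> {..<n}}"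

definition poly_var :: "nat \<Rightarrow> cpoly"
  where "poly_var i = Poly_Mapping.single (Poly_Mapping.single i 1) 1"

definition poly_value :: "cpoly \<Rightarrow> (nat \<Rightarrow> complex) \<Rightarrow> complex"
  where "poly_value p z = (\<Sum>e\<in>Poly_Mapping.keys p. Poly_Mapping.lookup p e *
    (\<Prod>i\<in>Poly_Mapping.keys e. z i ^ Poly_Mapping.lookup e i))"

definition poly_ideal :: "nat \<Rightarrow> cpoly set \<Rightarrow> cpoly set"
  where "poly_ideal n S = {\<Sum>s\<in>T. c s * s | c T. finite T \<and> T \<subseteq> S \<and> (\<forall>s\<in>T. c s \<in> poly_ring n)}"

definition vanishing_locus :: "nat \<Rightarrow> cpoly set \<Rightarrow> (nat \<Rightarrow> complex) set"
  where "vanishing_locus n J = {z \<in> {..<n} \<rightarrow>\<^sub>E UNIV. \<forall>p\<in>J. poly_value p z = 0}"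

definition irrelevant_ideal :: "nat \<Rightarrow> (nat \<Rightarrow> 'v set) \<Rightarrow> 'v set set \<Rightarrow> cpoly set"
  where "irrelevant_ideal n \<rho> \<Sigma> =
    poly_ideal n ((\<lambda>\<sigma>. \<Prod>i | i < n \<and> \<not> \<rho> i \<subseteq> \<sigma>. poly_var i) ` \<Sigma>)"

definition Z_space :: "nat \<Rightarrow> (nat \<Rightarrow> 'v set) \<Rightarrow> 'v set set \<Rightarrow> (nat \<Rightarrow> complex) topology"
  where "Z_space n \<rho> \<Sigma> =
    subtopology (product_topology (\<lambda>_. euclidean) {..<n})
      (({..<n} \<rightarrow>\<^sub>E UNIV) - vanishing_locus n (irrelevant_ideal n \<rho> \<Sigma>))"

section \<open>Stacks over topological spaces\<close>

text \<open>
  The site consists of the topological spaces whose points lie in a fixed type \<open>'u\<close>, which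
  plays the role of a universe; it must have at least the cardinality of the continuum for the
  site to contain copies of the circle and of principal bundles under the groups \<open>G\<close>.  A stack is represented by its underlying category over this
  site: \<open>Base\<close> and \<open>BaseMap\<close> are the projection, and \<open>Cmp g f\<close> is the composite \<open>g \<circ> f\<close>.
  Maps of spaces are extensional functions.  The record carries no axioms; all notions below
  refer only to the underlying category over the site.
\<close>

record ('u, 'o, 'm) stk =
  Obj :: "'o set"
  Arr :: "'m set"
  Dom :: "'m \<Rightarrow> 'o"
  Cod :: "'m \<Rightarrow> 'o"
  Idn :: "'o \<Rightarrow> 'm"
  Cmp :: "'m \<Rightarrow> 'm \<Rightarrow> 'm"
  Base :: "'o \<Rightarrow> 'u topology"
  BaseMap :: "'m \<Rightarrow> 'u \<Rightarrow> 'u"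

record ('o, 'm, 'p, 'n) stk_map =
  MapO :: "'o \<Rightarrow> 'p"
  MapA :: "'m \<Rightarrow> 'n"

definition stack_morphism ::
    "('u, 'o, 'm) stk \<Rightarrow> ('u, 'p, 'n) stk \<Rightarrow> ('o, 'm, 'p, 'n) stk_map \<Rightarrow> bool"
  where "stack_morphism X Y F \<longleftrightarrow>
    (\<forall>x\<in>Obj X. MapO F x \<in> Obj Y \<and> Base Y (MapO F x) = Base X x \<and>
        MapA F (Idn X x) = Idn Y (MapO F x)) \<and>
    (\<forall>a\<in>Arr X. MapA F a \<in> Arr Y \<and> Dom Y (MapA F a) = MapO F (Dom X a) \<and>
        Cod Y (MapA F a) = MapO F (Cod X a) \<and> BaseMap Y (MapA F a) = BaseMap X a) \<and>
    (\<forall>a\<in>Arr X. \<forall>b\<in>Arr X. Dom X b = Cod X a \<longrightarrow>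
        MapA F (Cmp X b a) = Cmp Y (MapA F b) (MapA F a))"

definition id_map :: "('o, 'm, 'o, 'm) stk_map"
  where "id_map = \<lparr>MapO = (\<lambda>x. x), MapA = (\<lambda>a. a)\<rparr>"

definition comp_map ::
    "('p, 'n, 'q, 'l) stk_map \<Rightarrow> ('o, 'm, 'p, 'n) stk_map \<Rightarrow> ('o, 'm, 'q, 'l) stk_map"
  where "comp_map K F = \<lparr>MapO = MapO K \<circ> MapO F, MapA = MapA K \<circ> MapA F\<rparr>"

definition vertical_iso :: "('u, 'o, 'm) stk \<Rightarrow> 'o \<Rightarrow> 'o \<Rightarrow> 'm \<Rightarrow> bool"
  where "vertical_iso X x y a \<longleftrightarrow>
    a \<in> Arr X \<and> Dom X a = x \<and> Cod X a = y \<and> Base X x = Base X y \<and>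
    BaseMap X a = (\<lambda>t\<in>topspace (Base X x). t) \<and>
    (\<exists>b\<in>Arr X. Dom X b = y \<and> Cod X b = x \<and> Cmp X b a = Idn X x \<and> Cmp X a b = Idn X y)"

definition two_iso ::
    "('u, 'o, 'm) stk \<Rightarrow> ('u, 'p, 'n) stk \<Rightarrow> ('o, 'm, 'p, 'n) stk_map
      \<Rightarrow> ('o, 'm, 'p, 'n) stk_map \<Rightarrow> ('o \<Rightarrow> 'n) \<Rightarrow> bool"
  where "two_iso X Y F F' \<eta> \<longleftrightarrow>
    (\<forall>x\<in>Obj X. vertical_iso Y (MapO F x) (MapO F' x) (\<eta> x)) \<and>
    (\<forall>a\<in>Arr X. Cmp Y (\<eta> (Cod X a)) (MapA F a) = Cmp Y (MapA F' a) (\<eta> (Dom X a)))"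

definition stack_equivalence ::
    "('u, 'o, 'm) stk \<Rightarrow> ('u, 'p, 'n) stk \<Rightarrow> ('o, 'm, 'p, 'n) stk_map \<Rightarrow> bool"
  where "stack_equivalence X Y F \<longleftrightarrow>
    stack_morphism X Y F \<and>
    (\<exists>K. stack_morphism Y X K \<and>
      (\<exists>\<eta>. two_iso X X id_map (comp_map K F) \<eta>) \<and> (\<exists>\<epsilon>. two_iso Y Y (comp_map F K) id_map \<epsilon>))"

text \<open>
  The stack associated to a space \<open>W\<close>: objects over \<open>T\<close> are the maps \<open>T \<rightarrow> W\<close>.  The points
  of \<open>W\<close> need not lie in the universe type.
\<close>

type_synonym ('u, 'w) space_obj = "'u topology \<times> ('u \<Rightarrow> 'w)"
type_synonym ('u, 'w) space_arr = "('u, 'w) space_obj \<times> ('u, 'w) space_obj \<times> ('u \<Rightarrow> 'u)"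

definition ext_maps :: "'a topology \<Rightarrow> 'b topology \<Rightarrow> ('a \<Rightarrow> 'b) set"
  where "ext_maps S T = {f. continuous_map S T f \<and> f \<in> extensional (topspace S)}"

definition space_stack ::
    "'w topology \<Rightarrow> ('u, ('u, 'w) space_obj, ('u, 'w) space_arr) stk"
  where "space_stack W =
    \<lparr>Obj = {(T, f). f \<in> ext_maps T W},
     Arr = {((T, f), (T', f'), h). f \<in> ext_maps T W \<and> f' \<in> ext_maps T' W \<and>
              h \<in> ext_maps T T' \<and> compose (topspace T) f' h = f},
     Dom = (\<lambda>(x, y, h). x),
     Cod = (\<lambda>(x, y, h). y),
     Idn = (\<lambda>(T, f). ((T, f), (T, f), \<lambda>t\<in>topspace T. t)),
     Cmp = (\<lambda>(y, z, k) (x, y', h). (x, z, compose (topspace (fst x)) k h)),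
     Base = fst,
     BaseMap = (\<lambda>(x, y, h). h)\<rparr>"

definition space_map ::
    "('w \<Rightarrow> 'v) \<Rightarrow> (('u, 'w) space_obj, ('u, 'w) space_arr, ('u, 'v) space_obj, ('u, 'v) space_arr) stk_map"
  where "space_map q =
    (let c = (\<lambda>(T, f). (T, compose (topspace T) q f))
     in \<lparr>MapO = c, MapA = (\<lambda>(x, y, h). (c x, c y, h))\<rparr>)"

section \<open>Quotient stacks\<close>

text \<open>
  Groups act from the left.  An object over \<open>btarget\<close> consists of a principal bundle
  \<open>bproj : btotal \<rightarrow> btarget\<close> with action \<open>bact\<close> and an equivariant map \<open>bmap\<close> to \<open>X\<close>.
\<close>

record ('u, 'g, 'x) bundle_obj =
  btarget :: "'u topology"
  btotal :: "'u topology"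
  bact :: "'g \<Rightarrow> 'u \<Rightarrow> 'u"
  bproj :: "'u \<Rightarrow> 'u"
  bmap :: "'u \<Rightarrow> 'x"

definition continuous_action :: "'g monoid \<Rightarrow> 'g topology \<Rightarrow> 'e topology \<Rightarrow> ('g \<Rightarrow> 'e \<Rightarrow> 'e) \<Rightarrow> bool"
  where "continuous_action G TG E act \<longleftrightarrow>
    continuous_map (prod_topology TG E) E (\<lambda>(g, e). act g e) \<and>
    (\<forall>e\<in>topspace E. act \<one>\<^bsub>G\<^esub> e = e) \<and>
    (\<forall>g\<in>carrier G. \<forall>h\<in>carrier G. \<forall>e\<in>topspace E. act (g \<otimes>\<^bsub>G\<^esub> h) e = act g (act h e))"

definition principal_bundle ::
    "'g monoid \<Rightarrow> 'g topology \<Rightarrow> 'b topology \<Rightarrow> 'e topology \<Rightarrow> ('g \<Rightarrow> 'e \<Rightarrow> 'e) \<Rightarrow> ('e \<Rightarrow> 'b) \<Rightarrow> bool"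
  where "principal_bundle G TG T E act \<pi> \<longleftrightarrow>
    continuous_action G TG E act \<and> continuous_map E T \<pi> \<and>
    (\<forall>t\<in>topspace T. \<exists>U \<psi>. openin T U \<and> t \<in> U \<and>
      homeomorphic_map (prod_topology TG (subtopology T U))
        (subtopology E {e \<in> topspace E. \<pi> e \<in> U}) \<psi> \<and>
      (\<forall>g\<in>carrier G. \<forall>u\<in>U. \<pi> (\<psi> (g, u)) = u \<and>
        (\<forall>h\<in>carrier G. \<psi> (h \<otimes>\<^bsub>G\<^esub> g, u) = act h (\<psi> (g, u)))))"

definition equivariant ::
    "'g monoid \<Rightarrow> 'e topology \<Rightarrow> ('g \<Rightarrow> 'e \<Rightarrow> 'e) \<Rightarrow> ('g \<Rightarrow> 'x \<Rightarrow> 'x) \<Rightarrow> ('e \<Rightarrow> 'x) \<Rightarrow> bool"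
  where "equivariant G E actE actX f \<longleftrightarrow>
    (\<forall>g\<in>carrier G. \<forall>e\<in>topspace E. f (actE g e) = actX g (f e))"

definition quotient_obj ::
    "'g monoid \<Rightarrow> 'g topology \<Rightarrow> 'x topology \<Rightarrow> ('g \<Rightarrow> 'x \<Rightarrow> 'x) \<Rightarrow> ('u, 'g, 'x) bundle_obj \<Rightarrow> bool"
  where "quotient_obj G TG X actX P \<longleftrightarrow>
    principal_bundle G TG (btarget P) (btotal P) (bact P) (bproj P) \<and>
    continuous_map (btotal P) X (bmap P) \<and>
    equivariant G (btotal P) (bact P) actX (bmap P)"

type_synonym ('u, 'g, 'x) bundle_arr =
  "('u, 'g, 'x) bundle_obj \<times> ('u, 'g, 'x) bundle_obj \<times> ('u \<Rightarrow> 'u) \<times> ('u \<Rightarrow> 'u)"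

definition quotient_stack ::
    "'u itself \<Rightarrow> 'g monoid \<Rightarrow> 'g topology \<Rightarrow> 'x topology \<Rightarrow> ('g \<Rightarrow> 'x \<Rightarrow> 'x)
      \<Rightarrow> ('u, ('u, 'g, 'x) bundle_obj, ('u, 'g, 'x) bundle_arr) stk"
  where "quotient_stack _ G TG X actX =
    \<lparr>Obj = {P. quotient_obj G TG X actX P},
     Arr = {(P, P', h, k). quotient_obj G TG X actX P \<and> quotient_obj G TG X actX P' \<and>
              h \<in> ext_maps (btarget P) (btarget P') \<and> k \<in> ext_maps (btotal P) (btotal P') \<and>
              equivariant G (btotal P) (bact P) (bact P') k \<and>
              (\<forall>e\<in>topspace (btotal P). bproj P' (k e) = h (bproj P e) \<and> bmap P' (k e) = bmap P e)},
     Dom = (\<lambda>(P, P', h, k). P),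
     Cod = (\<lambda>(P, P', h, k). P'),
     Idn = (\<lambda>P. (P, P, \<lambda>t\<in>topspace (btarget P). t, \<lambda>e\<in>topspace (btotal P). e)),
     Cmp = (\<lambda>(P', P'', h', k') (P, P1, h, k).
              (P, P'', compose (topspace (btarget P)) h' h, compose (topspace (btotal P)) k' k)),
     Base = btarget,
     BaseMap = (\<lambda>(P, P', h, k). h)\<rparr>"

definition toric_DM_stack ::
    "'u itself \<Rightarrow> nat \<Rightarrow> (nat \<Rightarrow> 'v set) \<Rightarrow> 'v set set \<Rightarrow> nat \<Rightarrow> nat
      \<Rightarrow> ((nat \<Rightarrow> int) \<Rightarrow> nat \<Rightarrow> int) \<Rightarrow> ((nat \<Rightarrow> int) \<Rightarrow> nat \<Rightarrow> int)
      \<Rightarrow> ('u, ('u, gale_char, nat \<Rightarrow> complex) bundle_obj, ('u, gale_char, nat \<Rightarrow> complex) bundle_arr) stk"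
  where "toric_DM_stack u n \<rho> \<Sigma> r m B Q =
    quotient_stack u (toric_group n r m B Q) (toric_group_topology n r m B Q)
      (Z_space n \<rho> \<Sigma>) (toric_action n r m B Q)"

section \<open>Covering projections\<close>

definition fiber_product ::
    "('u, 'o, 'm) stk \<Rightarrow> ('u, 'p, 'n) stk \<Rightarrow> ('u, 'q, 'l) stk
      \<Rightarrow> ('o, 'm, 'q, 'l) stk_map \<Rightarrow> ('p, 'n, 'q, 'l) stk_map
      \<Rightarrow> ('u, 'o \<times> 'p \<times> 'l, ('o \<times> 'p \<times> 'l) \<times> ('o \<times> 'p \<times> 'l) \<times> 'm \<times> 'n) stk"
  where "fiber_product Y W X F K =
    (let Ob = {(y, w, \<alpha>). y \<in> Obj Y \<and> w \<in> Obj W \<and> Base Y y = Base W w \<and>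
                 vertical_iso X (MapO F y) (MapO K w) \<alpha>}
     in \<lparr>Obj = Ob,
         Arr = {((y, w, \<alpha>), (y', w', \<alpha>'), a, b).
                  (y, w, \<alpha>) \<in> Ob \<and> (y', w', \<alpha>') \<in> Ob \<and>
                  a \<in> Arr Y \<and> Dom Y a = y \<and> Cod Y a = y' \<and>
                  b \<in> Arr W \<and> Dom W b = w \<and> Cod W b = w' \<and>
                  BaseMap Y a = BaseMap W b \<and>
                  Cmp X \<alpha>' (MapA F a) = Cmp X (MapA K b) \<alpha>},
         Dom = (\<lambda>(s, t, a, b). s),
         Cod = (\<lambda>(s, t, a, b). t),
         Idn = (\<lambda>(y, w, \<alpha>). ((y, w, \<alpha>), (y, w, \<alpha>), Idn Y y, Idn W w)),
         Cmp = (\<lambda>(t, v, a', b') (s, t', a, b). (s, v, Cmp Y a' a, Cmp W b' b)),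
         Base = (\<lambda>(y, w, \<alpha>). Base Y y),
         BaseMap = (\<lambda>(s, t, a, b). BaseMap Y a)\<rparr>)"

definition fiber_proj :: "('o \<times> 'p \<times> 'l, ('o \<times> 'p \<times> 'l) \<times> ('o \<times> 'p \<times> 'l) \<times> 'm \<times> 'n, 'p, 'n) stk_map"
  where "fiber_proj = \<lparr>MapO = (\<lambda>(y, w, \<alpha>). w), MapA = (\<lambda>(s, t, a, b). b)\<rparr>"

definition representable ::
    "('u, 'o, 'm) stk \<Rightarrow> ('u, 'p, 'n) stk \<Rightarrow> ('o, 'm, 'p, 'n) stk_map \<Rightarrow> bool"
  where "representable Y X F \<longleftrightarrow>
    (\<forall>(W :: 'u topology) K. stack_morphism (space_stack W) X K \<longrightarrow>
      (\<exists>(E :: 'u topology) \<epsilon>.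
        stack_equivalence (space_stack E) (fiber_product Y (space_stack W) X F K) \<epsilon>))"

text \<open>The analogue of the library's \<open>covering_space\<close> for abstract topologies.\<close>

definition covering_map :: "'a topology \<Rightarrow> 'b topology \<Rightarrow> ('a \<Rightarrow> 'b) \<Rightarrow> bool"
  where "covering_map E W q \<longleftrightarrow>
    continuous_map E W q \<and> q ` topspace E = topspace W \<and>
    (\<forall>w\<in>topspace W. \<exists>U. openin W U \<and> w \<in> U \<and>
      (\<exists>\<V>. \<Union>\<V> = {e \<in> topspace E. q e \<in> U} \<and> (\<forall>V\<in>\<V>. openin E V) \<and> disjoint \<V> \<and>
        (\<forall>V\<in>\<V>. homeomorphic_map (subtopology E V) (subtopology W U) q)))"

text \<open>
  The projection \<open>Y \<times>\<^sub>X W \<rightarrow> W\<close> is compared with a map of spaces \<open>q : E \<rightarrow> W\<close> through an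
  equivalence of \<open>Y \<times>\<^sub>X W\<close> with a space \<open>E\<close>.
\<close>

definition covering_projection ::
    "('u, 'o, 'm) stk \<Rightarrow> ('u, 'p, 'n) stk \<Rightarrow> ('o, 'm, 'p, 'n) stk_map \<Rightarrow> bool"
  where "covering_projection Y X F \<longleftrightarrow>
    stack_morphism Y X F \<and> representable Y X F \<and>
    (\<forall>(W :: 'u topology) K. stack_morphism (space_stack W) X K \<longrightarrow>
      (\<exists>(E :: 'u topology) \<epsilon> q \<eta>.
        stack_equivalence (space_stack E) (fiber_product Y (space_stack W) X F K) \<epsilon> \<and>
        covering_map E W q \<and>
        two_iso (space_stack E) (space_stack W) (comp_map fiber_proj \<epsilon>) (space_map q) \<eta>))"

section \<open>The fundamental group\<close>

definition pt_space :: "unit topology"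
  where "pt_space = discrete_topology {()}"

definition circle_space :: "complex topology"
  where "circle_space = top_of_set (sphere 0 1)"

definition cylinder_space :: "(real \<times> complex) topology"
  where "cylinder_space = prod_topology (top_of_set {0..1}) circle_space"

type_synonym ('u, 'o, 'm) stk_point =
  "(('u, unit) space_obj, ('u, unit) space_arr, 'o, 'm) stk_map"

text \<open>A morphism from the circle together with a 2-isomorphism at the base point.\<close>

type_synonym ('u, 'o, 'm) stk_loop =
  "(('u, complex) space_obj, ('u, complex) space_arr, 'o, 'm) stk_map \<times> (('u, unit) space_obj \<Rightarrow> 'm)"

definition point_of_stack :: "('u, 'o, 'm) stk \<Rightarrow> ('u, 'o, 'm) stk_point \<Rightarrow> bool"
  where "point_of_stack X x \<longleftrightarrow> stack_morphism (space_stack pt_space) X x"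

definition pointed_loops :: "('u, 'o, 'm) stk \<Rightarrow> ('u, 'o, 'm) stk_point \<Rightarrow> ('u, 'o, 'm) stk_loop set"
  where "pointed_loops X x = {(f, \<phi>). stack_morphism (space_stack circle_space) X f \<and>
    two_iso (space_stack pt_space) X x (comp_map f (space_map (\<lambda>_. 1))) \<phi>}"

text \<open>
  \<open>\<epsilon>\<close> identifies \<open>H\<close> along \<open>[0,1] \<times> {1}\<close> with the constant map at \<open>x\<close>, and \<open>\<theta>\<^sub>0\<close>, \<open>\<theta>\<^sub>1\<close>
  identify the ends of \<open>H\<close> with the two loops, compatibly with the base point.
\<close>

definition loop_homotopic ::
    "('u, 'o, 'm) stk \<Rightarrow> ('u, 'o, 'm) stk_point \<Rightarrow> ('u, 'o, 'm) stk_loop \<Rightarrow> ('u, 'o, 'm) stk_loop \<Rightarrow> bool"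
  where "loop_homotopic X x = (\<lambda>(f0, \<phi>0) (f1, \<phi>1).
    \<exists>H \<epsilon> \<theta>0 \<theta>1.
      stack_morphism (space_stack cylinder_space) X H \<and>
      two_iso (space_stack (top_of_set {0..1::real})) X
        (comp_map x (space_map (\<lambda>_. ()))) (comp_map H (space_map (\<lambda>t. (t, 1)))) \<epsilon> \<and>
      two_iso (space_stack circle_space) X (comp_map H (space_map (\<lambda>s. (0, s)))) f0 \<theta>0 \<and>
      two_iso (space_stack circle_space) X (comp_map H (space_map (\<lambda>s. (1, s)))) f1 \<theta>1 \<and>
      (\<forall>p\<in>Obj (space_stack pt_space).
        Cmp X (\<theta>0 (MapO (space_map (\<lambda>_. 1)) p)) (\<epsilon> (MapO (space_map (\<lambda>_. 0)) p)) = \<phi>0 p \<and>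
        Cmp X (\<theta>1 (MapO (space_map (\<lambda>_. 1)) p)) (\<epsilon> (MapO (space_map (\<lambda>_. 1)) p)) = \<phi>1 p))"

text \<open>
  Only the underlying set of \<open>\<pi>\<^sub>1(X, x)\<close> is defined; a group is trivial iff this set is a
  singleton.
\<close>

definition pi1 :: "('u, 'o, 'm) stk \<Rightarrow> ('u, 'o, 'm) stk_point \<Rightarrow> ('u, 'o, 'm) stk_loop set set"
  where "pi1 X x = pointed_loops X x //
    {(p, q). p \<in> pointed_loops X x \<and> q \<in> pointed_loops X x \<and> loop_homotopic X x p q}"

definition universal_covering_projection ::
    "('u, 'o, 'm) stk \<Rightarrow> ('u, 'p, 'n) stk \<Rightarrow> ('o, 'm, 'p, 'n) stk_map \<Rightarrow> bool"
  where "universal_covering_projection Y X F \<longleftrightarrow>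
    covering_projection Y X F \<and>
    (\<exists>y. point_of_stack Y y) \<and> (\<forall>y. point_of_stack Y y \<longrightarrow> is_singleton (pi1 Y y))"

definition universal_cover :: "('u, 'o, 'm) stk \<Rightarrow> ('u, 'p, 'n) stk \<Rightarrow> bool"
  where "universal_cover Y X \<longleftrightarrow> (\<exists>F. universal_covering_projection Y X F)"

end

theory Submission
  imports Defs
begin

text \<open>
  Write \<open>G\<close> and \<open>G'\<close> for the groups of \<open>(N, \<Sigma>, \<beta>)\<close> and \<open>(N', \<Sigma>', \<beta>')\<close>.  Both stacks are
  quotients of the same space: a ray is spanned by the image of some \<open>\<beta> e\<^sub>i\<close>, which lies in \<open>N'\<close>,
  so pulling cones back to \<open>N' \<otimes> \<real>\<close> does not change which rays lie in which cones
  (\<open>pulled_back_Z_space\<close>), and that is all that \<open>Z\<^sub>\<Sigma>\<close> depends on (\<open>topspace_Z_space_iff\<close>).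

  The groups are compared as follows.  Both \<open>DG(\<beta>)\<close> and \<open>DG(\<beta>')\<close> are cokernels of dual maps
  \<open>M\<^sup>*\<close>, where \<open>M = [B Q]\<close>, and in both cases the kernel of \<open>M\<close> is isomorphic to that of \<open>\<beta>\<close>.
  Since \<open>\<beta>'\<close> is onto, so is \<open>M'\<close>, and \<open>DG(\<beta>')\<close> is the dual of this kernel, which is free; while
  the surjection from \<open>DG(\<beta>)\<close> to that dual has finite kernel.  The surjection splits because the
  kernel of \<open>M\<close> is a direct summand of \<open>\<int>\<^sup>n\<^sup>+\<^sup>r\<close>.  Applying \<open>Hom(-, \<complex>\<^sup>*)\<close> gives a product
  decomposition \<open>G = A \<times> G'\<close> with \<open>A\<close> finite, hence discrete, and \<open>G'\<close> a torus, hence path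
  connected (\<open>toric_group_splitting\<close>).

  Extension of the structure group along \<open>G' \<rightarrow> G\<close> sends a principal \<open>G'\<close>-bundle \<open>E\<close> to
  \<open>E \<times> A\<close>.  This is a covering projection \<open>[Z/G'] \<rightarrow> [Z/G]\<close> (\<open>induced_covering_projection\<close>):
  over a map \<open>W \<rightarrow> [Z/G]\<close>, that is, a principal \<open>G\<close>-bundle \<open>P \<rightarrow> W\<close>, an object of the fibre
  product is a reduction of a pullback of \<open>P\<close> to \<open>G'\<close>, that is, a section of \<open>P/G'\<close>; so the
  fibre product is the space \<open>P/G'\<close>, which is locally \<open>A \<times> W\<close> with \<open>A\<close> discrete.

  It remains to see that \<open>[Z/G']\<close> has trivial \<open>\<pi>\<^sub>1\<close> (\<open>pi1_singleton\<close>).  A principal bundle over the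
  circle whose group is path connected has a section through any given point of the fibre over \<open>1\<close>.
  A loop in \<open>[Z/G']\<close> is therefore, compatibly with base points, a loop in \<open>Z\<close>.  Finally \<open>Z\<close> is
  simply connected (\<open>Zp_based_homotopy\<close>): every single ray is a cone of the fan, so only subspaces of
  complex codimension at least two are missing from \<open>\<complex>\<^sup>n\<close>, and a loop can be moved off all the
  coordinate hyperplanes and then contracted one coordinate at a time, passing through at most one
  coordinate hyperplane at any moment.

  Objects of a stack have their points in the universe type.  Total spaces such as \<open>T \<times> G\<close> or
  \<open>E \<times> A\<close> are moved there by an injection of the product of the universe with the group into the
  universe; it exists since a character is determined by finitely many complex numbers
  (\<open>char_code_exists\<close>).
\<close>

section \<open>Topologies and continuous maps\<close>

text \<open>
  The quotient topology on the image; for injective \<open>f\<close> this is the copy of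
  \<open>X\<close> with its points renamed by \<open>f\<close>. Both uses occur: for orbit spaces
  and for moving spaces into the universe type.
\<close>

definition push_top :: "'a topology \<Rightarrow> ('a \<Rightarrow> 'b) \<Rightarrow> 'b topology"
  where "push_top X f = topology (\<lambda>V. V \<subseteq> f ` topspace X \<and> openin X {x \<in> topspace X. f x \<in> V})"

lemma openin_push_top:
  "openin (push_top X f) V \<longleftrightarrow> V \<subseteq> f ` topspace X \<and> openin X {x \<in> topspace X. f x \<in> V}"
proof -
  have "istopology (\<lambda>V. V \<subseteq> f ` topspace X \<and> openin X {x \<in> topspace X. f x \<in> V})"
    unfolding istopology_def
  proof (intro conjI allI impI)
    fix S T assume "S \<subseteq> f ` topspace X \<and> openin X {x \<in> topspace X. f x \<in> S}"
      and "T \<subseteq> f ` topspace X \<and> openin X {x \<in> topspace X. f x \<in> T}"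
    moreover have "{x \<in> topspace X. f x \<in> S \<inter> T}
        = {x \<in> topspace X. f x \<in> S} \<inter> {x \<in> topspace X. f x \<in> T}" by auto
    ultimately show "S \<inter> T \<subseteq> f ` topspace X" "openin X {x \<in> topspace X. f x \<in> S \<inter> T}"
      by auto
  next
    fix \<K> assume K: "\<forall>K\<in>\<K>. K \<subseteq> f ` topspace X \<and> openin X {x \<in> topspace X. f x \<in> K}"
    have "{x \<in> topspace X. f x \<in> \<Union>\<K>} = (\<Union>K\<in>\<K>. {x \<in> topspace X. f x \<in> K})" by auto
    then show "\<Union>\<K> \<subseteq> f ` topspace X" "openin X {x \<in> topspace X. f x \<in> \<Union>\<K>}"
      using K by auto
  qed
  then show ?thesis by (simp add: push_top_def topology_inverse')
qed

lemma topspace_push_top [simp]: "topspace (push_top X f) = f ` topspace X"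
proof -
  have "openin (push_top X f) (f ` topspace X)"
    using openin_topspace by (auto simp: openin_push_top intro: back_subst[of "openin X"])
  then show ?thesis
    by (meson openin_push_top openin_subset openin_topspace subset_antisym)
qed

lemma quotient_map_push_top: "quotient_map X (push_top X f) f"
  by (auto simp: quotient_map_def openin_push_top)

lemma continuous_map_push_top: "continuous_map X (push_top X f) f"
  by (simp add: quotient_imp_continuous_map quotient_map_push_top)

lemma continuous_map_from_push_top:
  assumes "continuous_map X Y (\<lambda>x. g (f x))"
  shows "continuous_map (push_top X f) Y g"
  using assms continuous_compose_quotient_map[OF quotient_map_push_top, of X Y g f]
  by (simp add: o_def)

lemma homeomorphic_map_push_top: "inj_on f (topspace X) \<Longrightarrow> homeomorphic_map X (push_top X f) f"
  by (simp add: homeomorphic_map_def quotient_map_push_top)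

lemma continuous_map_inv_push_top:
  assumes "inj_on f (topspace X)"
  shows "continuous_map (push_top X f) X (inv_into (topspace X) f)"
proof (rule continuous_map_from_push_top)
  show "continuous_map X X (\<lambda>x. inv_into (topspace X) f (f x))"
    by (rule continuous_map_eq[OF continuous_map_id]) (use assms in auto)
qed

lemma cont_comp:
  "continuous_map X Y f \<Longrightarrow> continuous_map Y Z g \<Longrightarrow> continuous_map X Z (\<lambda>x. g (f x))"
  using continuous_map_compose[of X Y f Z g] by (simp add: o_def)

lemma cont_closed: "continuous_map X Y f \<Longrightarrow> x \<in> topspace X \<Longrightarrow> f x \<in> topspace Y"
  by (auto simp: continuous_map_def)

lemma cont_subtopologies:
  assumes "continuous_map X Y f" "\<And>x. x \<in> topspace X \<Longrightarrow> x \<in> S \<Longrightarrow> f x \<in> T"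
  shows "continuous_map (subtopology X S) (subtopology Y T) f"
  using assms by (intro continuous_map_into_subtopology continuous_map_from_subtopology) auto

lemma cont_locally:
  assumes "\<And>x. x \<in> topspace X \<Longrightarrow> \<exists>U. openin X U \<and> x \<in> U \<and> continuous_map (subtopology X U) Y f"
  shows "continuous_map X Y f"
proof -
  define I where "I = {U. openin X U \<and> continuous_map (subtopology X U) Y f}"
  show ?thesis
    by (rule pasting_lemma[of I X "\<lambda>U. U" Y "\<lambda>_. f"]) (use assms in \<open>auto simp: I_def\<close>)
qed

section \<open>Topological groups and principal bundles\<close>

locale topgroup = group G for G :: "'g monoid" (structure) +
  fixes TG :: "'g topology"
  assumes topspace_TG: "topspace TG = carrier G"
    and continuous_mult: "continuous_map (prod_topology TG TG) TG (\<lambda>(g, h). g \<otimes> h)"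
    and continuous_inv: "continuous_map TG TG (\<lambda>g. inv g)"
begin

lemma cont_mult:
  assumes "continuous_map Z TG a" "continuous_map Z TG b"
  shows "continuous_map Z TG (\<lambda>z. a z \<otimes> b z)"
  using cont_comp[OF continuous_map_pairedI[OF assms] continuous_mult] by simp

lemma cont_inv:
  assumes "continuous_map Z TG a"
  shows "continuous_map Z TG (\<lambda>z. inv (a z))"
  using cont_comp[OF assms continuous_inv] by simp

text \<open>
  A local trivialisation given by a section \<open>\<sigma>\<close> over \<open>U\<close> and the
  coordinate \<open>\<gamma>\<close> with \<open>e = \<gamma>(e) \<sigma>(\<pi> e)\<close>.
  Compared with a homeomorphism from \<open>G \<times> U\<close>, the two maps can be composed
  with other maps without handling products.
\<close>

definition chart :: "'b topology \<Rightarrow> 'e topology \<Rightarrow> ('g \<Rightarrow> 'e \<Rightarrow> 'e) \<Rightarrow> ('e \<Rightarrow> 'b)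
    \<Rightarrow> 'b set \<Rightarrow> ('b \<Rightarrow> 'e) \<Rightarrow> ('e \<Rightarrow> 'g) \<Rightarrow> bool"
  where "chart T E act \<pi> U \<sigma> \<gamma> \<longleftrightarrow> openin T U \<and>
    continuous_map (subtopology T U) E \<sigma> \<and>
    continuous_map (subtopology E {e \<in> topspace E. \<pi> e \<in> U}) TG \<gamma> \<and>
    (\<forall>u\<in>U. \<pi> (\<sigma> u) = u) \<and>
    (\<forall>e\<in>topspace E. \<pi> e \<in> U \<longrightarrow> act (\<gamma> e) (\<sigma> (\<pi> e)) = e) \<and>
    (\<forall>u\<in>U. \<forall>g\<in>carrier G. \<gamma> (act g (\<sigma> u)) = g)"

lemma action_cont:
  assumes "continuous_action G TG E act" "continuous_map Z TG a" "continuous_map Z E b"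
  shows "continuous_map Z E (\<lambda>z. act (a z) (b z))"
  using cont_comp[OF continuous_map_pairedI[OF assms(2,3)], of E "\<lambda>(g, e). act g e"]
    assms(1) by (simp add: continuous_action_def)

lemma action_closed:
  assumes "continuous_action G TG E act" "g \<in> carrier G" "e \<in> topspace E"
  shows "act g e \<in> topspace E"
proof -
  have "continuous_map (prod_topology TG E) E (\<lambda>(g, e). act g e)"
    using assms(1) by (simp add: continuous_action_def)
  from cont_closed[OF this, of "(g, e)"] show ?thesis
    using assms(2,3) topspace_TG by simp
qed

lemma principal_bundleI:
  assumes act: "continuous_action G TG E act" and \<pi>: "continuous_map E T \<pi>"
    and inv\<pi>: "\<And>g e. g \<in> carrier G \<Longrightarrow> e \<in> topspace E \<Longrightarrow> \<pi> (act g e) = \<pi> e"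
    and chart: "\<And>t. t \<in> topspace T \<Longrightarrow> \<exists>U \<sigma> \<gamma>. t \<in> U \<and> chart T E act \<pi> U \<sigma> \<gamma>"
  shows "principal_bundle G TG T E act \<pi>"
  unfolding principal_bundle_def
proof (intro conjI ballI act \<pi>)
  fix t assume "t \<in> topspace T"
  then obtain U \<sigma> \<gamma> where t: "t \<in> U" and c: "chart T E act \<pi> U \<sigma> \<gamma>" using chart by blast
  note c = c[unfolded chart_def]
  have U: "U \<subseteq> topspace T" using c openin_subset by blast
  let ?E = "subtopology E {e \<in> topspace E. \<pi> e \<in> U}"
  have \<sigma>E: "\<sigma> u \<in> topspace E" if "u \<in> U" for u
    using that c U cont_closed[of "subtopology T U" E \<sigma> u] by auto
  have 1: "continuous_map (prod_topology TG (subtopology T U)) E (\<lambda>x. act (fst x) (\<sigma> (snd x)))"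
    using c by (intro action_cont[OF act] continuous_map_fst
        cont_comp[OF continuous_map_snd]) auto
  have 2: "continuous_map (prod_topology TG (subtopology T U)) ?E (\<lambda>x. act (fst x) (\<sigma> (snd x)))"
    using \<sigma>E c U topspace_TG
    by (intro continuous_map_into_subtopology 1) (auto simp: inv\<pi> action_closed[OF act])
  have 3: "continuous_map ?E (prod_topology TG (subtopology T U)) (\<lambda>e. (\<gamma> e, \<pi> e))"
    by (intro continuous_map_pairedI continuous_map_into_subtopology)
      (use c \<pi> in \<open>auto intro: continuous_map_from_subtopology\<close>)
  have hm: "homeomorphic_maps (prod_topology TG (subtopology T U)) ?E
     (\<lambda>(g, u). act g (\<sigma> u)) (\<lambda>e. (\<gamma> e, \<pi> e))"
    unfolding homeomorphic_maps_def
    using 2 3 c U topspace_TG \<sigma>E by (auto simp: case_prod_unfold inv\<pi>)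
  have am: "act (h \<otimes> g) (\<sigma> u) = act h (act g (\<sigma> u))"
    if "h \<in> carrier G" "g \<in> carrier G" "u \<in> U" for h g u
    using act that \<sigma>E by (simp add: continuous_action_def)
  have "openin T U \<and> t \<in> U \<and>
      homeomorphic_map (prod_topology TG (subtopology T U)) ?E (\<lambda>(g, u). act g (\<sigma> u)) \<and>
      (\<forall>g\<in>carrier G. \<forall>u\<in>U. \<pi> ((\<lambda>(g, u). act g (\<sigma> u)) (g, u)) = u \<and>
        (\<forall>h\<in>carrier G. (\<lambda>(g, u). act g (\<sigma> u)) (h \<otimes> g, u) = act h ((\<lambda>(g, u). act g (\<sigma> u)) (g, u))))"
  proof (intro conjI ballI)
    show "homeomorphic_map (prod_topology TG (subtopology T U)) ?E (\<lambda>(g, u). act g (\<sigma> u))"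
      using homeomorphic_maps_imp_map[OF hm] .
    show "openin T U" using c by blast
  qed (use c t \<sigma>E inv\<pi> am in simp_all)
  then show "\<exists>U \<psi>. openin T U \<and> t \<in> U \<and>
      homeomorphic_map (prod_topology TG (subtopology T U))
        (subtopology E {e \<in> topspace E. \<pi> e \<in> U}) \<psi> \<and>
      (\<forall>g\<in>carrier G. \<forall>u\<in>U. \<pi> (\<psi> (g, u)) = u \<and>
        (\<forall>h\<in>carrier G. \<psi> (h \<otimes> g, u) = act h (\<psi> (g, u))))"
    by (intro exI[of _ U] exI[of _ "\<lambda>(g, u). act g (\<sigma> u)"])
qed

lemma bundle_action: "principal_bundle G TG T E act \<pi> \<Longrightarrow> continuous_action G TG E act"
  by (simp add: principal_bundle_def)

lemma bundle_proj: "principal_bundle G TG T E act \<pi> \<Longrightarrow> continuous_map E T \<pi>"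
  by (simp add: principal_bundle_def)

text \<open>
  The section is \<open>\<psi>(1, -)\<close> and the coordinate is the first component of the
  inverse of \<open>\<psi>\<close>. Equivariance of \<open>\<psi>\<close> also shows that the
  action preserves the fibres, which is not among the defining conditions of a principal bundle.
\<close>

lemma bundle_invariant_chart:
  assumes b: "principal_bundle G TG T E act \<pi>" and t: "t \<in> topspace T"
  obtains U \<sigma> \<gamma> where "t \<in> U" "chart T E act \<pi> U \<sigma> \<gamma>"
    "\<forall>g\<in>carrier G. \<forall>e\<in>topspace E. \<pi> e \<in> U \<longrightarrow> \<pi> (act g e) = \<pi> e"
proof -
  obtain U \<psi> where H: "openin T U \<and> t \<in> U \<and>
      homeomorphic_map (prod_topology TG (subtopology T U))
        (subtopology E {e \<in> topspace E. \<pi> e \<in> U}) \<psi> \<and>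
      (\<forall>g\<in>carrier G. \<forall>u\<in>U. \<pi> (\<psi> (g, u)) = u \<and>
        (\<forall>h\<in>carrier G. \<psi> (h \<otimes> g, u) = act h (\<psi> (g, u))))"
    using b t unfolding principal_bundle_def by blast
  then have U: "openin T U" "t \<in> U" and
    \<psi>: "homeomorphic_map (prod_topology TG (subtopology T U))
        (subtopology E {e \<in> topspace E. \<pi> e \<in> U}) \<psi>" and
    \<psi>\<pi>: "\<And>g u. g \<in> carrier G \<Longrightarrow> u \<in> U \<Longrightarrow> \<pi> (\<psi> (g, u)) = u" and
    \<psi>act: "\<And>g h u. g \<in> carrier G \<Longrightarrow> h \<in> carrier G \<Longrightarrow> u \<in> U \<Longrightarrow> \<psi> (h \<otimes> g, u) = act h (\<psi> (g, u))"
    by blast+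
  let ?E = "subtopology E {e \<in> topspace E. \<pi> e \<in> U}"
  let ?P = "prod_topology TG (subtopology T U)"
  obtain \<psi>' where \<psi>': "homeomorphic_maps ?P ?E \<psi> \<psi>'"
    using \<psi> homeomorphic_map_maps by blast
  have Us: "U \<subseteq> topspace T" using U openin_subset by blast
  have cp: "continuous_map ?P ?E \<psi>" and cp': "continuous_map ?E ?P \<psi>'"
    and i1: "\<And>g u. g \<in> carrier G \<Longrightarrow> u \<in> U \<Longrightarrow> \<psi>' (\<psi> (g, u)) = (g, u)"
    and i2: "\<And>e. e \<in> topspace E \<Longrightarrow> \<pi> e \<in> U \<Longrightarrow> \<psi> (\<psi>' e) = e"
    using \<psi>' Us topspace_TG by (auto simp: homeomorphic_maps_def)
  have \<psi>E: "\<psi> (g, u) \<in> topspace E" if "g \<in> carrier G" "u \<in> U" for g u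
    using cont_closed[OF cp, of "(g, u)"] that Us topspace_TG by auto
  have \<psi>'P: "fst (\<psi>' e) \<in> carrier G \<and> snd (\<psi>' e) = \<pi> e" if "e \<in> topspace E" "\<pi> e \<in> U" for e
  proof -
    have "\<psi>' e \<in> topspace ?P" using cont_closed[OF cp', of e] that by simp
    then show ?thesis using \<psi>\<pi>[of "fst (\<psi>' e)" "snd (\<psi>' e)"] i2 that topspace_TG by auto
  qed
  show ?thesis
  proof (rule that[of U "\<lambda>u. \<psi> (\<one>, u)" "\<lambda>e. fst (\<psi>' e)"])
    have "continuous_map (subtopology T U) ?P (\<lambda>u. (\<one>, u))"
      by (intro continuous_map_pairedI) (auto simp: topspace_TG)
    then have "continuous_map (subtopology T U) ?E (\<lambda>u. \<psi> (\<one>, u))"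
      using cp cont_comp by blast
    then have "continuous_map (subtopology T U) E (\<lambda>u. \<psi> (\<one>, u))"
      using continuous_map_into_fulltopology by blast
    moreover have "continuous_map ?E TG (\<lambda>e. fst (\<psi>' e))"
      using continuous_map_fst_of[OF cp'] by (simp add: o_def)
    moreover have "act (fst (\<psi>' e)) (\<psi> (\<one>, \<pi> e)) = e" if "e \<in> topspace E" "\<pi> e \<in> U" for e
      using \<psi>act[of \<one> "fst (\<psi>' e)" "\<pi> e"] \<psi>'P[OF that] i2[OF that] that
      by (metis one_closed prod.collapse r_one)
    moreover have "fst (\<psi>' (act g (\<psi> (\<one>, u)))) = g" if "u \<in> U" "g \<in> carrier G" for u g
      using \<psi>act[of \<one> g u] i1[of g u] that by simp
    ultimately show "chart T E act \<pi> U (\<lambda>u. \<psi> (\<one>, u)) (\<lambda>e. fst (\<psi>' e))"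
      unfolding chart_def using U \<psi>\<pi> by auto
    show "\<forall>g\<in>carrier G. \<forall>e\<in>topspace E. \<pi> e \<in> U \<longrightarrow> \<pi> (act g e) = \<pi> e"
    proof (intro ballI impI)
      fix g e assume that: "g \<in> carrier G" "e \<in> topspace E" "\<pi> e \<in> U"
      show "\<pi> (act g e) = \<pi> e"
        using \<psi>act[of "fst (\<psi>' e)" g "\<pi> e"] \<psi>'P[OF that(2,3)] i2[OF that(2,3)] that \<psi>\<pi>
        by (metis m_closed prod.collapse)
    qed
  qed (use U in auto)
qed

lemma bundle_invariant:
  assumes "principal_bundle G TG T E act \<pi>" "g \<in> carrier G" "e \<in> topspace E"
  shows "\<pi> (act g e) = \<pi> e"
proof -
  have "\<pi> e \<in> topspace T" using assms(1,3) bundle_proj cont_closed by metis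
  then obtain U \<sigma> \<gamma> where "\<pi> e \<in> U" "chart T E act \<pi> U \<sigma> \<gamma>"
    "\<forall>g\<in>carrier G. \<forall>e\<in>topspace E. \<pi> e \<in> U \<longrightarrow> \<pi> (act g e) = \<pi> e"
    by (rule bundle_invariant_chart[OF assms(1)])
  then show ?thesis using assms(2,3) by blast
qed

lemma bundle_chart:
  assumes "principal_bundle G TG T E act \<pi>" "t \<in> topspace T"
  obtains U \<sigma> \<gamma> where "t \<in> U" "chart T E act \<pi> U \<sigma> \<gamma>"
  by (rule bundle_invariant_chart[OF assms]) (rule that)

lemma bundle_act_closed:
  assumes "principal_bundle G TG T E act \<pi>" "g \<in> carrier G" "e \<in> topspace E"
  shows "act g e \<in> topspace E"
  using action_closed[OF bundle_action[OF assms(1)] assms(2,3)] .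

lemma bundle_act_one:
  assumes "principal_bundle G TG T E act \<pi>" "e \<in> topspace E"
  shows "act \<one> e = e"
  using bundle_action[OF assms(1)] assms(2) by (simp add: continuous_action_def)

lemma bundle_act_mult:
  assumes "principal_bundle G TG T E act \<pi>" "g \<in> carrier G" "h \<in> carrier G" "e \<in> topspace E"
  shows "act (g \<otimes> h) e = act g (act h e)"
  using bundle_action[OF assms(1)] assms by (simp add: continuous_action_def)

lemma bundle_proj_closed:
  "principal_bundle G TG T E act \<pi> \<Longrightarrow> e \<in> topspace E \<Longrightarrow> \<pi> e \<in> topspace T"
  using cont_closed[OF bundle_proj] .

lemma chartD:
  assumes b: "principal_bundle G TG T E act \<pi>" and c: "chart T E act \<pi> U \<sigma> \<gamma>"
  shows "openin T U" "U \<subseteq> topspace T"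
    "continuous_map (subtopology T U) E \<sigma>"
    "continuous_map (subtopology E {e \<in> topspace E. \<pi> e \<in> U}) TG \<gamma>"
    "\<And>u. u \<in> U \<Longrightarrow> \<pi> (\<sigma> u) = u"
    "\<And>u. u \<in> U \<Longrightarrow> \<sigma> u \<in> topspace E"
    "\<And>e. e \<in> topspace E \<Longrightarrow> \<pi> e \<in> U \<Longrightarrow> act (\<gamma> e) (\<sigma> (\<pi> e)) = e"
    "\<And>e. e \<in> topspace E \<Longrightarrow> \<pi> e \<in> U \<Longrightarrow> \<gamma> e \<in> carrier G"
    "\<And>u g. u \<in> U \<Longrightarrow> g \<in> carrier G \<Longrightarrow> \<gamma> (act g (\<sigma> u)) = g"
    "\<And>e g. e \<in> topspace E \<Longrightarrow> \<pi> e \<in> U \<Longrightarrow> g \<in> carrier G \<Longrightarrow> \<gamma> (act g e) = g \<otimes> \<gamma> e"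
proof -
  note c = c[unfolded chart_def]
  show 1: "openin T U" "U \<subseteq> topspace T" using c openin_subset by blast+
  show "continuous_map (subtopology T U) E \<sigma>" using c by blast
  show "continuous_map (subtopology E {e \<in> topspace E. \<pi> e \<in> U}) TG \<gamma>" using c by blast
  show "\<pi> (\<sigma> u) = u" if "u \<in> U" for u using c that by blast
  show \<sigma>: "\<sigma> u \<in> topspace E" if "u \<in> U" for u
    using cont_closed[of "subtopology T U" E \<sigma> u] c that 1 by auto
  show 2: "act (\<gamma> e) (\<sigma> (\<pi> e)) = e" if "e \<in> topspace E" "\<pi> e \<in> U" for e using c that by blast
  show 3: "\<gamma> e \<in> carrier G" if "e \<in> topspace E" "\<pi> e \<in> U" for e
    using cont_closed[of "subtopology E {e \<in> topspace E. \<pi> e \<in> U}" TG \<gamma> e] c that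
      topspace_TG by auto
  show 4: "\<gamma> (act g (\<sigma> u)) = g" if "u \<in> U" "g \<in> carrier G" for u g using c that by blast
  show "\<gamma> (act g e) = g \<otimes> \<gamma> e" if "e \<in> topspace E" "\<pi> e \<in> U" "g \<in> carrier G" for e g
    using 2[OF that(1,2)] 3[OF that(1,2)] 4[of "\<pi> e" "g \<otimes> \<gamma> e"] \<sigma>[OF that(2)] that
      bundle_act_mult[OF b, of g "\<gamma> e" "\<sigma> (\<pi> e)"] by simp
qed

lemma bundle_fibre:
  assumes b: "principal_bundle G TG T E act \<pi>" and e: "e \<in> topspace E" "e' \<in> topspace E" "\<pi> e = \<pi> e'"
  obtains g where "g \<in> carrier G" "act g e = e'"
proof -
  obtain U \<sigma> \<gamma> where U: "\<pi> e \<in> U" and c: "chart T E act \<pi> U \<sigma> \<gamma>"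
    by (rule bundle_chart[OF b bundle_proj_closed[OF b e(1)]])
  note c = chartD[OF b c]
  have g: "\<gamma> e \<in> carrier G" "\<gamma> e' \<in> carrier G" using c e U by auto
  have 1: "act (inv (\<gamma> e)) e = \<sigma> (\<pi> e)"
  proof -
    have "act (inv (\<gamma> e)) e = act (inv (\<gamma> e)) (act (\<gamma> e) (\<sigma> (\<pi> e)))"
      using c(7)[OF e(1) U] by simp
    also have "\<dots> = \<sigma> (\<pi> e)"
      using g c(6) U by (simp add: bundle_act_mult[OF b, symmetric] bundle_act_one[OF b])
    finally show ?thesis .
  qed
  have "act (\<gamma> e' \<otimes> inv (\<gamma> e)) e = act (\<gamma> e') (act (inv (\<gamma> e)) e)"
    using g e by (simp add: bundle_act_mult[OF b])
  also have "\<dots> = e'" using 1 c(7)[OF e(2)] e U by simp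
  finally show ?thesis using that[of "\<gamma> e' \<otimes> inv (\<gamma> e)"] g by simp
qed

lemma bundle_free:
  assumes b: "principal_bundle G TG T E act \<pi>" and e: "e \<in> topspace E"
    and g: "g \<in> carrier G" "h \<in> carrier G" and eq: "act g e = act h e"
  shows "g = h"
proof -
  obtain U \<sigma> \<gamma> where U: "\<pi> e \<in> U" and c: "chart T E act \<pi> U \<sigma> \<gamma>"
    by (rule bundle_chart[OF b bundle_proj_closed[OF b e]])
  note c = chartD[OF b c]
  have "g \<otimes> \<gamma> e = h \<otimes> \<gamma> e" using c(10)[OF e U] g eq by metis
  then show ?thesis using c(8)[OF e U] g by simp
qed

section \<open>Maps of principal bundles\<close>

definition bundle_map :: "'b topology \<Rightarrow> 'e topology \<Rightarrow> ('g \<Rightarrow> 'e \<Rightarrow> 'e) \<Rightarrow> ('e \<Rightarrow> 'b)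
    \<Rightarrow> 'c topology \<Rightarrow> 'f topology \<Rightarrow> ('g \<Rightarrow> 'f \<Rightarrow> 'f) \<Rightarrow> ('f \<Rightarrow> 'c)
    \<Rightarrow> ('b \<Rightarrow> 'c) \<Rightarrow> ('e \<Rightarrow> 'f) \<Rightarrow> bool"
  where "bundle_map T E act \<pi> T' E' act' \<pi>' h k \<longleftrightarrow>
    principal_bundle G TG T E act \<pi> \<and> principal_bundle G TG T' E' act' \<pi>' \<and>
    continuous_map T T' h \<and> continuous_map E E' k \<and> equivariant G E act act' k \<and>
    (\<forall>e\<in>topspace E. \<pi>' (k e) = h (\<pi> e))"

lemma bundle_mapD:
  assumes "bundle_map T E act \<pi> T' E' act' \<pi>' h k"
  shows "principal_bundle G TG T E act \<pi>" "principal_bundle G TG T' E' act' \<pi>'"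
    "continuous_map T T' h" "continuous_map E E' k"
    "\<And>g e. g \<in> carrier G \<Longrightarrow> e \<in> topspace E \<Longrightarrow> k (act g e) = act' g (k e)"
    "\<And>e. e \<in> topspace E \<Longrightarrow> \<pi>' (k e) = h (\<pi> e)"
proof -
  note a = assms[unfolded bundle_map_def equivariant_def]
  show "principal_bundle G TG T E act \<pi>" "principal_bundle G TG T' E' act' \<pi>'"
    "continuous_map T T' h" "continuous_map E E' k"
    using a by simp_all
  show "k (act g e) = act' g (k e)" if "g \<in> carrier G" "e \<in> topspace E" for g e
    using a that by simp
  show "\<pi>' (k e) = h (\<pi> e)" if "e \<in> topspace E" for e
    using a that by simp
qed

text \<open>
  A map of principal bundles is bijective on fibres, so a point of the target bundle lying over
  \<open>h t\<close> has a unique preimage over \<open>t\<close>. This replaces the identification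
  of the source with the pullback of the target.
\<close>

definition fibre_lift :: "'e topology \<Rightarrow> ('e \<Rightarrow> 'b) \<Rightarrow> ('e \<Rightarrow> 'f) \<Rightarrow> 'b \<Rightarrow> 'f \<Rightarrow> 'e"
  where "fibre_lift E \<pi> k t e' = (THE e. e \<in> topspace E \<and> \<pi> e = t \<and> k e = e')"

lemma fibre_lift_unique:
  assumes m: "bundle_map T E act \<pi> T' E' act' \<pi>' h k"
    and e: "e1 \<in> topspace E" "e2 \<in> topspace E" "\<pi> e1 = \<pi> e2" "k e1 = k e2"
  shows "e1 = e2"
proof -
  note m = m[unfolded bundle_map_def]
  have b: "principal_bundle G TG T E act \<pi>" and b': "principal_bundle G TG T' E' act' \<pi>'"
    using m by auto
  obtain g where g: "g \<in> carrier G" "act g e1 = e2" using bundle_fibre[OF b e(1-3)] .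
  have k1: "k e1 \<in> topspace E'" using m e cont_closed by metis
  have "act' g (k e1) = act' \<one> (k e1)"
    using m e g bundle_act_one[OF b' k1] by (auto simp: equivariant_def)
  then have "g = \<one>" using bundle_free[OF b' k1] g by auto
  then show ?thesis using g bundle_act_one[OF b e(1)] by simp
qed

lemma fibre_lift_exists:
  assumes m: "bundle_map T E act \<pi> T' E' act' \<pi>' h k"
    and t: "t \<in> topspace T" and e': "e' \<in> topspace E'" "\<pi>' e' = h t"
  shows "\<exists>e\<in>topspace E. \<pi> e = t \<and> k e = e'"
proof -
  note m = m[unfolded bundle_map_def]
  have b: "principal_bundle G TG T E act \<pi>" and b': "principal_bundle G TG T' E' act' \<pi>'"
    using m by auto
  obtain U \<sigma> \<gamma> where U: "t \<in> U" and c: "chart T E act \<pi> U \<sigma> \<gamma>" by (rule bundle_chart[OF b t])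
  note c = chartD[OF b c]
  have s: "\<sigma> t \<in> topspace E" "\<pi> (\<sigma> t) = t" using c U by auto
  have k1: "k (\<sigma> t) \<in> topspace E'" using m s cont_closed by metis
  obtain g where g: "g \<in> carrier G" "act' g (k (\<sigma> t)) = e'"
    using bundle_fibre[OF b' k1 e'(1)] m s e' by metis
  moreover have "k (act g (\<sigma> t)) = act' g (k (\<sigma> t))"
    using m g(1) s(1) by (auto simp: equivariant_def)
  ultimately show ?thesis
    using bundle_act_closed[OF b g(1) s(1)] bundle_invariant[OF b g(1) s(1)] s
    by (intro bexI[of _ "act g (\<sigma> t)"]) simp_all
qed

lemma fibre_lift_eq:
  assumes m: "bundle_map T E act \<pi> T' E' act' \<pi>' h k"
    and e: "e \<in> topspace E" "\<pi> e = t" "k e = e'"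
  shows "fibre_lift E \<pi> k t e' = e"
  unfolding fibre_lift_def
proof (rule the_equality)
  fix x assume "x \<in> topspace E \<and> \<pi> x = t \<and> k x = e'"
  then show "x = e" using fibre_lift_unique[OF m, of x e] e by simp
qed (use e in simp)

lemma fibre_lift:
  assumes m: "bundle_map T E act \<pi> T' E' act' \<pi>' h k"
    and t: "t \<in> topspace T" and e': "e' \<in> topspace E'" "\<pi>' e' = h t"
  shows "fibre_lift E \<pi> k t e' \<in> topspace E" "\<pi> (fibre_lift E \<pi> k t e') = t"
    "k (fibre_lift E \<pi> k t e') = e'"
proof -
  obtain e where e: "e \<in> topspace E" "\<pi> e = t" "k e = e'"
    using fibre_lift_exists[OF m t e'] by blast
  then have "fibre_lift E \<pi> k t e' = e" by (rule fibre_lift_eq[OF m])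
  then show "fibre_lift E \<pi> k t e' \<in> topspace E" "\<pi> (fibre_lift E \<pi> k t e') = t"
    "k (fibre_lift E \<pi> k t e') = e'"
    using e by simp_all
qed

text \<open>
  In charts around \<open>a z\<close> and \<open>h (a z)\<close> the lift is a translate of the
  section \<open>\<sigma>\<close>, by the group element that compares the coordinates of \<open>c
  z\<close> and of \<open>k (\<sigma> (a z))\<close>.
\<close>

lemma fibre_lift_continuous:
  assumes m: "bundle_map T E act \<pi> T' E' act' \<pi>' h k"
    and a: "continuous_map Z T a" and c: "continuous_map Z E' c"
    and ac: "\<And>z. z \<in> topspace Z \<Longrightarrow> \<pi>' (c z) = h (a z)"
  shows "continuous_map Z E (\<lambda>z. fibre_lift E \<pi> k (a z) (c z))"
proof (rule cont_locally)
  have b: "principal_bundle G TG T E act \<pi>" and b': "principal_bundle G TG T' E' act' \<pi>'"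
    and h: "continuous_map T T' h" and k: "continuous_map E E' k"
    and ke: "\<And>g e. g \<in> carrier G \<Longrightarrow> e \<in> topspace E \<Longrightarrow> k (act g e) = act' g (k e)"
    and k\<pi>: "\<And>e. e \<in> topspace E \<Longrightarrow> \<pi>' (k e) = h (\<pi> e)"
    by (fact bundle_mapD[OF m])+
  fix z0 assume z0: "z0 \<in> topspace Z"
  have ha: "continuous_map Z T' (\<lambda>z. h (a z))" using cont_comp[OF a h] .
  obtain U \<sigma> \<gamma> where U: "a z0 \<in> U" and ch: "chart T E act \<pi> U \<sigma> \<gamma>"
    by (rule bundle_chart[OF b cont_closed[OF a z0]])
  obtain U' \<sigma>' \<gamma>' where U': "h (a z0) \<in> U'" and ch': "chart T' E' act' \<pi>' U' \<sigma>' \<gamma>'"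
    by (rule bundle_chart[OF b' cont_closed[OF ha z0]])
  note ch = chartD[OF b ch] and ch' = chartD[OF b' ch']
  let ?Z = "{z \<in> topspace Z. a z \<in> U} \<inter> {z \<in> topspace Z. h (a z) \<in> U'}"
  have oZ: "openin Z ?Z"
    using a ha ch(1) ch'(1) by (intro openin_Int openin_continuous_map_preimage) auto
  let ?S = "subtopology Z ?Z"
  have 1: "continuous_map ?S E (\<lambda>z. \<sigma> (a z))"
    by (rule cont_comp[OF cont_subtopologies[OF a] ch(3)]) blast
  have 2: "continuous_map ?S TG (\<lambda>z. \<gamma>' (c z))"
  proof (rule cont_comp[OF cont_subtopologies[OF c] ch'(4)])
    show "c z \<in> {e \<in> topspace E'. \<pi>' e \<in> U'}" if "z \<in> topspace Z" "z \<in> ?Z" for z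
      using ac[OF that(1)] cont_closed[OF c that(1)] that(2) by simp
  qed
  have 3: "continuous_map ?S E' (\<lambda>z. k (\<sigma> (a z)))" using cont_comp[OF 1 k] .
  have 4: "continuous_map ?S TG (\<lambda>z. \<gamma>' (k (\<sigma> (a z))))"
  proof (rule cont_comp[OF _ ch'(4)])
    show "continuous_map ?S (subtopology E' {e \<in> topspace E'. \<pi>' e \<in> U'}) (\<lambda>z. k (\<sigma> (a z)))"
      using cont_closed[OF 3] k\<pi> ch(5,6)
      by (intro continuous_map_into_subtopology 3) (simp add: image_subset_iff Pi_iff)
  qed
  \<comment> \<open>this element carries the image of \<open>\<sigma> (a z)\<close> to \<open>c z\<close>\<close>
  have 5: "continuous_map ?S E (\<lambda>z. act (\<gamma>' (c z) \<otimes> inv (\<gamma>' (k (\<sigma> (a z))))) (\<sigma> (a z)))"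
    using 1 2 4 by (intro action_cont[OF bundle_action[OF b]] cont_mult cont_inv)
  have "continuous_map ?S E (\<lambda>z. fibre_lift E \<pi> k (a z) (c z))"
  proof (rule continuous_map_eq[OF 5])
    fix z assume "z \<in> topspace ?S"
    then have z: "z \<in> topspace Z" "a z \<in> U" "h (a z) \<in> U'" by auto
    let ?g = "\<gamma>' (k (\<sigma> (a z)))"
    have s: "\<sigma> (a z) \<in> topspace E" "\<pi> (\<sigma> (a z)) = a z" using ch z by auto
    have ks: "k (\<sigma> (a z)) \<in> topspace E'" using cont_closed[OF k] s by blast
    have cz: "c z \<in> topspace E'" "\<pi>' (c z) = h (a z)" using cont_closed[OF c] z ac by auto
    have gs: "?g \<in> carrier G" "\<gamma>' (c z) \<in> carrier G"
      using ch'(8)[OF ks] ch'(8)[OF cz(1)] s k\<pi> z cz by auto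
    have p: "\<pi>' (k (\<sigma> (a z))) = h (a z)" using k\<pi> s by simp
    have \<sigma>': "\<sigma>' (h (a z)) \<in> topspace E'" using ch' z by auto
    have q: "k (\<sigma> (a z)) = act' ?g (\<sigma>' (h (a z)))" using ch'(7)[OF ks] p z by simp
    have "act' (\<gamma>' (c z) \<otimes> inv ?g) (k (\<sigma> (a z))) = act' (\<gamma>' (c z) \<otimes> inv ?g) (act' ?g (\<sigma>' (h (a z))))"
      using q by simp
    also have "\<dots> = act' (\<gamma>' (c z)) (\<sigma>' (h (a z)))"
      using gs \<sigma>' by (simp add: bundle_act_mult[OF b', symmetric] m_assoc)
    also have "\<dots> = c z" using ch'(7)[OF cz(1)] cz z by simp
    finally have r: "k (act (\<gamma>' (c z) \<otimes> inv ?g) (\<sigma> (a z))) = c z"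
      using ke s gs by simp
    show "act (\<gamma>' (c z) \<otimes> inv ?g) (\<sigma> (a z)) = fibre_lift E \<pi> k (a z) (c z)"
      by (rule fibre_lift_eq[OF m, symmetric])
        (use r gs s bundle_act_closed[OF b] bundle_invariant[OF b] in auto)
  qed
  then show "\<exists>V. openin Z V \<and> z0 \<in> V \<and>
      continuous_map (subtopology Z V) E (\<lambda>z. fibre_lift E \<pi> k (a z) (c z))"
    using oZ z0 U U' by blast
qed

end

section \<open>Categories over the site\<close>

text \<open>Maps of spaces are extensional functions, so the identity has to be restricted.\<close>

abbreviation ident :: "'a topology \<Rightarrow> 'a \<Rightarrow> 'a" where "ident T \<equiv> \<lambda>t\<in>topspace T. t"

text \<open>The axioms of a category over the site, which the record leaves out.\<close>

definition stk_category :: "('u, 'o, 'm) stk \<Rightarrow> bool"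
  where "stk_category X \<longleftrightarrow>
    (\<forall>x\<in>Obj X. Idn X x \<in> Arr X \<and> Dom X (Idn X x) = x \<and> Cod X (Idn X x) = x) \<and>
    (\<forall>a\<in>Arr X. Dom X a \<in> Obj X \<and> Cod X a \<in> Obj X \<and>
      Cmp X a (Idn X (Dom X a)) = a \<and> Cmp X (Idn X (Cod X a)) a = a) \<and>
    (\<forall>a\<in>Arr X. \<forall>b\<in>Arr X. Dom X b = Cod X a \<longrightarrow>
      Cmp X b a \<in> Arr X \<and> Dom X (Cmp X b a) = Dom X a \<and> Cod X (Cmp X b a) = Cod X b) \<and>
    (\<forall>a\<in>Arr X. \<forall>b\<in>Arr X. \<forall>c\<in>Arr X. Dom X b = Cod X a \<longrightarrow> Dom X c = Cod X b \<longrightarrow>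
      Cmp X c (Cmp X b a) = Cmp X (Cmp X c b) a) \<and>
    (\<forall>x\<in>Obj X. BaseMap X (Idn X x) = ident (Base X x)) \<and>
    (\<forall>a\<in>Arr X. BaseMap X a \<in> ext_maps (Base X (Dom X a)) (Base X (Cod X a))) \<and>
    (\<forall>a\<in>Arr X. \<forall>b\<in>Arr X. Dom X b = Cod X a \<longrightarrow>
      BaseMap X (Cmp X b a) = compose (topspace (Base X (Dom X a))) (BaseMap X b) (BaseMap X a))"

lemma stk_categoryD:
  assumes "stk_category X"
  shows "\<And>x. x \<in> Obj X \<Longrightarrow> Idn X x \<in> Arr X"
    "\<And>x. x \<in> Obj X \<Longrightarrow> Dom X (Idn X x) = x" "\<And>x. x \<in> Obj X \<Longrightarrow> Cod X (Idn X x) = x"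
    "\<And>a. a \<in> Arr X \<Longrightarrow> Dom X a \<in> Obj X" "\<And>a. a \<in> Arr X \<Longrightarrow> Cod X a \<in> Obj X"
    "\<And>a. a \<in> Arr X \<Longrightarrow> Cmp X a (Idn X (Dom X a)) = a"
    "\<And>a. a \<in> Arr X \<Longrightarrow> Cmp X (Idn X (Cod X a)) a = a"
    "\<And>a b. a \<in> Arr X \<Longrightarrow> b \<in> Arr X \<Longrightarrow> Dom X b = Cod X a \<Longrightarrow> Cmp X b a \<in> Arr X"
    "\<And>a b. a \<in> Arr X \<Longrightarrow> b \<in> Arr X \<Longrightarrow> Dom X b = Cod X a \<Longrightarrow> Dom X (Cmp X b a) = Dom X a"
    "\<And>a b. a \<in> Arr X \<Longrightarrow> b \<in> Arr X \<Longrightarrow> Dom X b = Cod X a \<Longrightarrow> Cod X (Cmp X b a) = Cod X b"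
    "\<And>a b c. a \<in> Arr X \<Longrightarrow> b \<in> Arr X \<Longrightarrow> c \<in> Arr X \<Longrightarrow> Dom X b = Cod X a \<Longrightarrow> Dom X c = Cod X b \<Longrightarrow>
      Cmp X c (Cmp X b a) = Cmp X (Cmp X c b) a"
    "\<And>x. x \<in> Obj X \<Longrightarrow> BaseMap X (Idn X x) = ident (Base X x)"
    "\<And>a. a \<in> Arr X \<Longrightarrow> BaseMap X a \<in> ext_maps (Base X (Dom X a)) (Base X (Cod X a))"
    "\<And>a b. a \<in> Arr X \<Longrightarrow> b \<in> Arr X \<Longrightarrow> Dom X b = Cod X a \<Longrightarrow>
      BaseMap X (Cmp X b a) = compose (topspace (Base X (Dom X a))) (BaseMap X b) (BaseMap X a)"
  using assms unfolding stk_category_def by simp_all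

lemma stack_morphismD:
  assumes "stack_morphism X Y F"
  shows "\<And>x. x \<in> Obj X \<Longrightarrow> MapO F x \<in> Obj Y" "\<And>x. x \<in> Obj X \<Longrightarrow> Base Y (MapO F x) = Base X x"
    "\<And>x. x \<in> Obj X \<Longrightarrow> MapA F (Idn X x) = Idn Y (MapO F x)"
    "\<And>a. a \<in> Arr X \<Longrightarrow> MapA F a \<in> Arr Y"
    "\<And>a. a \<in> Arr X \<Longrightarrow> Dom Y (MapA F a) = MapO F (Dom X a)"
    "\<And>a. a \<in> Arr X \<Longrightarrow> Cod Y (MapA F a) = MapO F (Cod X a)"
    "\<And>a. a \<in> Arr X \<Longrightarrow> BaseMap Y (MapA F a) = BaseMap X a"
    "\<And>a b. a \<in> Arr X \<Longrightarrow> b \<in> Arr X \<Longrightarrow> Dom X b = Cod X a \<Longrightarrow>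
      MapA F (Cmp X b a) = Cmp Y (MapA F b) (MapA F a)"
  using assms unfolding stack_morphism_def by simp_all

lemma two_isoD:
  assumes "two_iso X Y F F' \<eta>"
  shows "\<And>x. x \<in> Obj X \<Longrightarrow> vertical_iso Y (MapO F x) (MapO F' x) (\<eta> x)"
    "\<And>a. a \<in> Arr X \<Longrightarrow> Cmp Y (\<eta> (Cod X a)) (MapA F a) = Cmp Y (MapA F' a) (\<eta> (Dom X a))"
  using assms unfolding two_iso_def by simp_all

lemma vertical_isoD:
  assumes "vertical_iso X x y a"
  shows "a \<in> Arr X" "Dom X a = x" "Cod X a = y" "Base X x = Base X y"
    "BaseMap X a = ident (Base X x)"
  using assms unfolding vertical_iso_def by simp_all

text \<open>
  The definition of a vertical isomorphism does not ask that the inverse be vertical; this follows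
  because the base map is a functor.
\<close>

lemma vertical_iso_inverse:
  assumes Y: "stk_category Y" and a: "vertical_iso Y x y a"
  obtains b where "vertical_iso Y y x b" "Cmp Y b a = Idn Y x" "Cmp Y a b = Idn Y y"
proof -
  note Y = stk_categoryD[OF Y] and a' = vertical_isoD[OF a]
  obtain b where b: "b \<in> Arr Y" "Dom Y b = y" "Cod Y b = x" "Cmp Y b a = Idn Y x" "Cmp Y a b = Idn Y y"
    using a unfolding vertical_iso_def by blast
  have x: "x \<in> Obj Y" using Y(4)[OF a'(1)] a'(2) by simp
  have "BaseMap Y b \<in> extensional (topspace (Base Y x))"
    using Y(13)[OF b(1)] b a'(4) by (simp add: ext_maps_def)
  moreover have "compose (topspace (Base Y x)) (BaseMap Y b) (BaseMap Y a) = ident (Base Y x)"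
    using Y(14)[OF a'(1) b(1)] a' b Y(12)[OF x] by simp
  then have "BaseMap Y b t = t" if "t \<in> topspace (Base Y x)" for t
    using that a'(5) by (auto simp: compose_def dest: fun_cong[where x = t])
  ultimately have "BaseMap Y b = ident (Base Y y)"
    using a'(4) by (intro extensionalityI[where A = "topspace (Base Y x)"]) auto
  then have "vertical_iso Y y x b"
    unfolding vertical_iso_def using a' b by metis
  then show ?thesis using b that by blast
qed

lemma vertical_iso_Idn:
  assumes Y: "stk_category Y" and x: "x \<in> Obj Y"
  shows "vertical_iso Y x x (Idn Y x)"
  unfolding vertical_iso_def
  using stk_categoryD(1-3,12)[OF Y x] stk_categoryD(6)[OF Y, of "Idn Y x"]
  by (auto intro!: bexI[of _ "Idn Y x"])

lemma two_iso_Idn: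
  assumes Y: "stk_category Y" and F: "stack_morphism X Y F"
    and eq: "\<And>x. x \<in> Obj X \<Longrightarrow> MapO F x = MapO F' x" "\<And>a. a \<in> Arr X \<Longrightarrow> MapA F a = MapA F' a"
  shows "two_iso X Y F F' (\<lambda>x. Idn Y (MapO F x))"
  unfolding two_iso_def
proof (intro conjI ballI)
  note F = stack_morphismD[OF F]
  show "vertical_iso Y (MapO F x) (MapO F' x) (Idn Y (MapO F x))" if "x \<in> Obj X" for x
    using vertical_iso_Idn[OF Y F(1)[OF that]] eq(1)[OF that] by simp
  fix a assume a: "a \<in> Arr X"
  show "Cmp Y (Idn Y (MapO F (Cod X a))) (MapA F a) = Cmp Y (MapA F' a) (Idn Y (MapO F (Dom X a)))"
    using stk_categoryD(6,7)[OF Y F(4)[OF a]] F(5,6)[OF a] eq(2)[OF a] by simp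
qed

lemma two_iso_sym:
  assumes Y: "stk_category Y" and F: "stack_morphism X Y F" and F': "stack_morphism X Y F'"
    and X: "\<And>a. a \<in> Arr X \<Longrightarrow> Dom X a \<in> Obj X \<and> Cod X a \<in> Obj X"
    and \<eta>: "two_iso X Y F F' \<eta>"
  obtains \<eta>' where "two_iso X Y F' F \<eta>'"
    "\<And>x. x \<in> Obj X \<Longrightarrow> Cmp Y (\<eta>' x) (\<eta> x) = Idn Y (MapO F x)"
    "\<And>x. x \<in> Obj X \<Longrightarrow> Cmp Y (\<eta> x) (\<eta>' x) = Idn Y (MapO F' x)"
proof -
  note C = stk_categoryD[OF Y]
  note F = stack_morphismD[OF F] and F' = stack_morphismD[OF F'] and \<eta> = two_isoD[OF \<eta>]
  have "\<forall>x\<in>Obj X. \<exists>b. vertical_iso Y (MapO F' x) (MapO F x) b \<and>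
      Cmp Y b (\<eta> x) = Idn Y (MapO F x) \<and> Cmp Y (\<eta> x) b = Idn Y (MapO F' x)"
    using vertical_iso_inverse[OF Y \<eta>(1)] by metis
  then obtain \<eta>' where \<eta>': "\<And>x. x \<in> Obj X \<Longrightarrow> vertical_iso Y (MapO F' x) (MapO F x) (\<eta>' x)"
      "\<And>x. x \<in> Obj X \<Longrightarrow> Cmp Y (\<eta>' x) (\<eta> x) = Idn Y (MapO F x)"
      "\<And>x. x \<in> Obj X \<Longrightarrow> Cmp Y (\<eta> x) (\<eta>' x) = Idn Y (MapO F' x)"
    by metis
  have "two_iso X Y F' F \<eta>'"
    unfolding two_iso_def
  proof (intro conjI ballI \<eta>'(1))
    fix a assume a: "a \<in> Arr X"
    let ?x = "Dom X a" and ?y = "Cod X a"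
    have xy: "?x \<in> Obj X" "?y \<in> Obj X" using X[OF a] by auto
    note v = vertical_isoD[OF \<eta>(1)[OF xy(1)]] vertical_isoD[OF \<eta>(1)[OF xy(2)]]
      vertical_isoD[OF \<eta>'(1)[OF xy(1)]] vertical_isoD[OF \<eta>'(1)[OF xy(2)]]
    note Fa = F(4-6)[OF a] and F'a = F'(4-6)[OF a]
    have "Cmp Y (\<eta>' ?y) (MapA F' a) = Cmp Y (\<eta>' ?y) (Cmp Y (MapA F' a) (Cmp Y (\<eta> ?x) (\<eta>' ?x)))"
      using \<eta>'(3)[OF xy(1)] C(6)[OF F'a(1)] F'a by simp
    also have "\<dots> = Cmp Y (\<eta>' ?y) (Cmp Y (Cmp Y (MapA F' a) (\<eta> ?x)) (\<eta>' ?x))"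
      using v F'a by (subst C(11)) simp_all
    also have "\<dots> = Cmp Y (\<eta>' ?y) (Cmp Y (Cmp Y (\<eta> ?y) (MapA F a)) (\<eta>' ?x))"
      using \<eta>(2)[OF a] by simp
    also have "\<dots> = Cmp Y (\<eta>' ?y) (Cmp Y (\<eta> ?y) (Cmp Y (MapA F a) (\<eta>' ?x)))"
      using v Fa by (subst (2) C(11)) simp_all
    also have "\<dots> = Cmp Y (Cmp Y (\<eta>' ?y) (\<eta> ?y)) (Cmp Y (MapA F a) (\<eta>' ?x))"
      using v Fa C(8-10) by (subst C(11)) simp_all
    also have "\<dots> = Cmp Y (MapA F a) (\<eta>' ?x)"
      using \<eta>'(2)[OF xy(2)] C(7)[of "Cmp Y (MapA F a) (\<eta>' ?x)"] C(8-10) v Fa by simp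
    finally show "Cmp Y (\<eta>' ?y) (MapA F' a) = Cmp Y (MapA F a) (\<eta>' ?x)" .
  qed
  then show ?thesis using that \<eta>' by blast
qed

lemma ext_mapsD:
  assumes "f \<in> ext_maps S T"
  shows "continuous_map S T f" "f \<in> extensional (topspace S)" "\<And>x. x \<in> topspace S \<Longrightarrow> f x \<in> topspace T"
proof -
  show f: "continuous_map S T f" "f \<in> extensional (topspace S)"
    using assms by (simp_all add: ext_maps_def)
  show "f x \<in> topspace T" if "x \<in> topspace S" for x
    using cont_closed[OF f(1) that] .
qed

lemma ext_maps_restrict: "continuous_map S T f \<Longrightarrow> restrict f (topspace S) \<in> ext_maps S T"
  by (auto simp: ext_maps_def intro: continuous_map_eq)

lemma ext_maps_compose:
  "f \<in> ext_maps S T \<Longrightarrow> g \<in> ext_maps T U \<Longrightarrow> compose (topspace S) g f \<in> ext_maps S U"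
  unfolding compose_def
  by (rule ext_maps_restrict[OF cont_comp[OF ext_mapsD(1) ext_mapsD(1)]])

lemma ext_maps_id: "ident S \<in> ext_maps S S"
  using ext_maps_restrict[OF continuous_map_id] by (simp add: id_def)

lemma ext_maps_id_right: "f \<in> ext_maps S T \<Longrightarrow> compose (topspace S) f (ident S) = f"
  by (rule extensionalityI[where A = "topspace S"]) (auto simp: ext_maps_def compose_def)

lemma ext_maps_id_left: "f \<in> ext_maps S T \<Longrightarrow> compose (topspace S) (ident T) f = f"
  by (rule extensionalityI[where A = "topspace S"]) (auto simp: ext_mapsD compose_def)

lemma compose_ext_maps_assoc:
  "f \<in> ext_maps S T \<Longrightarrow>
    compose (topspace S) h (compose (topspace S) g f) = compose (topspace S) (compose (topspace T) h g) f"
  by (rule ext) (auto simp: compose_def ext_mapsD)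

lemma space_stack_sel [simp]:
  "Obj (space_stack W) = {(T, f). f \<in> ext_maps T W}"
  "Dom (space_stack W) (x, y, h) = x" "Cod (space_stack W) (x, y, h) = y"
  "Base (space_stack W) = fst" "BaseMap (space_stack W) (x, y, h) = h"
  "Idn (space_stack W) (T, f) = ((T, f), (T, f), ident T)"
  "Cmp (space_stack W) (y, z, k) (x, y', h) = (x, z, compose (topspace (fst x)) k h)"
  by (simp_all add: space_stack_def)

lemma space_stack_Arr:
  "a \<in> Arr (space_stack W) \<longleftrightarrow> (\<exists>T f T' f' h. a = ((T, f), (T', f'), h) \<and> f \<in> ext_maps T W \<and>
    f' \<in> ext_maps T' W \<and> h \<in> ext_maps T T' \<and> compose (topspace T) f' h = f)"
  by (auto simp: space_stack_def)

lemma space_stack_ArrI: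
  "f' \<in> ext_maps T' W \<Longrightarrow> h \<in> ext_maps T T' \<Longrightarrow> f \<in> ext_maps T W \<Longrightarrow>
    (\<And>t. t \<in> topspace T \<Longrightarrow> f' (h t) = f t) \<Longrightarrow> ((T, f), (T', f'), h) \<in> Arr (space_stack W)"
proof -
  assume *: "f' \<in> ext_maps T' W" "h \<in> ext_maps T T'" "f \<in> ext_maps T W"
    "\<And>t. t \<in> topspace T \<Longrightarrow> f' (h t) = f t"
  have "compose (topspace T) f' h = f"
    by (rule extensionalityI[where A = "topspace T"])
      (use * ext_mapsD(2) in \<open>simp_all add: compose_def\<close>)
  then show ?thesis using * by (simp add: space_stack_Arr)
qed

lemma space_stack_ArrE:
  assumes "a \<in> Arr (space_stack W)"
  obtains T f T' f' h where "a = ((T, f), (T', f'), h)" "f \<in> ext_maps T W"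
    "f' \<in> ext_maps T' W" "h \<in> ext_maps T T'" "\<forall>t\<in>topspace T. f' (h t) = f t"
proof -
  obtain T f T' f' h where a: "a = ((T, f), (T', f'), h)" "f \<in> ext_maps T W"
    "f' \<in> ext_maps T' W" "h \<in> ext_maps T T'" and c: "compose (topspace T) f' h = f"
    using assms unfolding space_stack_Arr by blast
  have "f' (h t) = f t" if "t \<in> topspace T" for t
    using fun_cong[OF c, of t] that by (simp add: compose_def)
  then have "\<forall>t\<in>topspace T. f' (h t) = f t" by blast
  then show ?thesis by (rule that[OF a])
qed

lemma space_stack_category: "stk_category (space_stack W)"
  unfolding stk_category_def
proof (intro conjI ballI impI)
  fix a b assume a: "a \<in> Arr (space_stack W)" and b: "b \<in> Arr (space_stack W)"
    and ab: "Dom (space_stack W) b = Cod (space_stack W) a"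
  obtain T f T' f' h where a: "a = ((T, f), (T', f'), h)" "f \<in> ext_maps T W"
    "f' \<in> ext_maps T' W" "h \<in> ext_maps T T'" "\<forall>t\<in>topspace T. f' (h t) = f t"
    by (rule space_stack_ArrE[OF a])
  obtain S g T'' f'' k where b: "b = ((S, g), (T'', f''), k)"
    "g \<in> ext_maps S W" "f'' \<in> ext_maps T'' W" "k \<in> ext_maps S T''" "\<forall>t\<in>topspace S. f'' (k t) = g t"
    by (rule space_stack_ArrE[OF b])
  have S: "S = T'" "g = f'" using ab a b by simp_all
  have "compose (topspace T) k h \<in> ext_maps T T''" using ext_maps_compose a(4) b(4) S by blast
  then show "Cmp (space_stack W) b a \<in> Arr (space_stack W)"
    using a b S ext_mapsD(3)[OF a(4)]
    by (auto intro!: space_stack_ArrI simp: compose_def)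
  show "Dom (space_stack W) (Cmp (space_stack W) b a) = Dom (space_stack W) a"
    "Cod (space_stack W) (Cmp (space_stack W) b a) = Cod (space_stack W) b"
    "BaseMap (space_stack W) (Cmp (space_stack W) b a) = compose (topspace (Base (space_stack W) (Dom (space_stack W) a)))
       (BaseMap (space_stack W) b) (BaseMap (space_stack W) a)"
    using a b by simp_all
next
  fix a b c assume "a \<in> Arr (space_stack W)" "b \<in> Arr (space_stack W)" "c \<in> Arr (space_stack W)"
    "Dom (space_stack W) b = Cod (space_stack W) a" "Dom (space_stack W) c = Cod (space_stack W) b"
  then show "Cmp (space_stack W) c (Cmp (space_stack W) b a) = Cmp (space_stack W) (Cmp (space_stack W) c b) a"
    by (elim space_stack_ArrE) (simp add: compose_ext_maps_assoc)
qed (auto simp: ext_maps_id ext_maps_id_left ext_maps_id_right elim!: space_stack_ArrE intro!: space_stack_ArrI)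

section \<open>Quotient stacks\<close>

abbreviation points :: "('u, 'g, 'x) bundle_obj \<Rightarrow> 'u set" where "points P \<equiv> topspace (btotal P)"

locale qstack = topgroup G TG for G :: "'g monoid" (structure) and TG +
  fixes X :: "'x topology" and actX :: "'g \<Rightarrow> 'x \<Rightarrow> 'x" and U :: "'u itself"
  assumes action_X: "continuous_action G TG X actX"
begin

abbreviation qobj :: "('u, 'g, 'x) bundle_obj \<Rightarrow> bool" where "qobj \<equiv> quotient_obj G TG X actX"

abbreviation QS where "QS \<equiv> quotient_stack U G TG X actX"

lemma QS_sel [simp]:
  "Obj QS = {P. qobj P}"
  "Dom QS (P, P', h, k) = P" "Cod QS (P, P', h, k) = P'"
  "Base QS = btarget" "BaseMap QS (P, P', h, k) = h"
  "Idn QS P = (P, P, ident (btarget P), ident (btotal P))"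
  "Cmp QS (P', P'', h', k') (P, P1, h, k) =
     (P, P'', compose (topspace (btarget P)) h' h, compose (topspace (btotal P)) k' k)"
  by (simp_all add: quotient_stack_def)

abbreviation bundle_of where
  "bundle_of P \<equiv> principal_bundle G TG (btarget P) (btotal P) (bact P) (bproj P)"

abbreviation bundle_map_of where
  "bundle_map_of P P' \<equiv> bundle_map (btarget P) (btotal P) (bact P) (bproj P)
     (btarget P') (btotal P') (bact P') (bproj P')"

lemma quotient_objD:
  assumes "qobj P"
  shows "bundle_of P" "continuous_map (btotal P) X (bmap P)"
    "\<And>g e. g \<in> carrier G \<Longrightarrow> e \<in> points P \<Longrightarrow> bmap P (bact P g e) = actX g (bmap P e)"
    "\<And>e. e \<in> points P \<Longrightarrow> bmap P e \<in> topspace X"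
  using assms cont_closed[of "btotal P" X "bmap P"]
  unfolding quotient_obj_def equivariant_def by simp_all

lemma QS_ArrD:
  assumes "(P, P', h, k) \<in> Arr QS"
  shows "qobj P" "qobj P'"
    "h \<in> ext_maps (btarget P) (btarget P')" "k \<in> ext_maps (btotal P) (btotal P')"
    "bundle_map_of P P' h k"
    "\<And>e. e \<in> points P \<Longrightarrow> bmap P' (k e) = bmap P e"
    "\<And>e. e \<in> points P \<Longrightarrow> bproj P' (k e) = h (bproj P e)"
    "\<And>g e. g \<in> carrier G \<Longrightarrow> e \<in> points P \<Longrightarrow> k (bact P g e) = bact P' g (k e)"
proof -
  note a = assms[unfolded quotient_stack_def equivariant_def]
  show *: "qobj P" "qobj P'"
    "h \<in> ext_maps (btarget P) (btarget P')" "k \<in> ext_maps (btotal P) (btotal P')"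
    "\<And>e. e \<in> points P \<Longrightarrow> bmap P' (k e) = bmap P e"
    "\<And>e. e \<in> points P \<Longrightarrow> bproj P' (k e) = h (bproj P e)"
    "\<And>g e. g \<in> carrier G \<Longrightarrow> e \<in> points P \<Longrightarrow> k (bact P g e) = bact P' g (k e)"
    using a by simp_all
  show "bundle_map_of P P' h k"
    unfolding bundle_map_def equivariant_def
    using quotient_objD(1)[OF *(1)] quotient_objD(1)[OF *(2)] ext_mapsD(1)[OF *(3)] ext_mapsD(1)[OF *(4)] *(6,7)
    by simp
qed

lemma QS_ArrI:
  assumes "qobj P" "qobj P'"
    "h \<in> ext_maps (btarget P) (btarget P')" "k \<in> ext_maps (btotal P) (btotal P')"
    "\<And>e. e \<in> points P \<Longrightarrow> bmap P' (k e) = bmap P e"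
    "\<And>e. e \<in> points P \<Longrightarrow> bproj P' (k e) = h (bproj P e)"
    "\<And>g e. g \<in> carrier G \<Longrightarrow> e \<in> points P \<Longrightarrow> k (bact P g e) = bact P' g (k e)"
  shows "(P, P', h, k) \<in> Arr QS"
  using assms unfolding quotient_stack_def equivariant_def by simp

lemma QS_ArrE:
  assumes "a \<in> Arr QS"
  obtains P P' h k where "a = (P, P', h, k)" "(P, P', h, k) \<in> Arr QS"
  using assms by (cases a) auto

lemma QS_category: "stk_category QS"
  unfolding stk_category_def
proof (intro conjI ballI impI)
  fix a b assume a: "a \<in> Arr QS" and b: "b \<in> Arr QS" and ab: "Dom QS b = Cod QS a"
  obtain P P' h k where a': "a = (P, P', h, k)" and aA: "(P, P', h, k) \<in> Arr QS" using QS_ArrE[OF a] .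
  obtain P1 P'' h' k' where b': "b = (P1, P'', h', k')" and bA: "(P1, P'', h', k') \<in> Arr QS"
    using QS_ArrE[OF b] .
  have P1: "P1 = P'" using ab a' b' by simp
  note A = QS_ArrD[OF aA] and B = QS_ArrD[OF bA[unfolded P1]]
  show "Cmp QS b a \<in> Arr QS"
    unfolding a' b' QS_sel
  proof (rule QS_ArrI)
    show "compose (topspace (btarget P)) h' h \<in> ext_maps (btarget P) (btarget P'')"
      "compose (points P) k' k \<in> ext_maps (btotal P) (btotal P'')"
      using ext_maps_compose A(3,4) B(3,4) by blast+
    fix e assume e: "e \<in> points P"
    have ke: "k e \<in> points P'" using ext_mapsD(3)[OF A(4) e] .
    show "bmap P'' (compose (points P) k' k e) = bmap P e"
      using A(6)[OF e] B(6)[OF ke] e by (simp add: compose_def)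
    show "bproj P'' (compose (points P) k' k e) = compose (topspace (btarget P)) h' h (bproj P e)"
      using A(7)[OF e] B(7)[OF ke] e bundle_proj_closed[OF quotient_objD(1)[OF A(1)] e]
      by (simp add: compose_def)
    fix g assume g: "g \<in> carrier G"
    show "compose (points P) k' k (bact P g e) = bact P'' g (compose (points P) k' k e)"
      using A(8)[OF g e] B(8)[OF g ke] e bundle_act_closed[OF quotient_objD(1)[OF A(1)] g e]
      by (simp add: compose_def)
  qed (use A B in auto)
  show "Dom QS (Cmp QS b a) = Dom QS a" "Cod QS (Cmp QS b a) = Cod QS b"
    "BaseMap QS (Cmp QS b a) = compose (topspace (Base QS (Dom QS a))) (BaseMap QS b) (BaseMap QS a)"
    by (simp_all add: a' b')
next
  fix a b c assume a: "a \<in> Arr QS" and b: "b \<in> Arr QS" and c: "c \<in> Arr QS"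
    and ab: "Dom QS b = Cod QS a" and bc: "Dom QS c = Cod QS b"
  obtain P P' h k where a': "a = (P, P', h, k)" and A: "(P, P', h, k) \<in> Arr QS" using QS_ArrE[OF a] .
  obtain P1 P'' h' k' where b': "b = (P1, P'', h', k')" by (cases b)
  obtain P2 P3 h'' k'' where c': "c = (P2, P3, h'', k'')" by (cases c)
  have eq: "P1 = P'" "P2 = P''" using ab bc a' b' c' by simp_all
  show "Cmp QS c (Cmp QS b a) = Cmp QS (Cmp QS c b) a"
    unfolding a' b' c' QS_sel eq
      compose_ext_maps_assoc[OF QS_ArrD(3)[OF A]] compose_ext_maps_assoc[OF QS_ArrD(4)[OF A]] ..
next
  fix a assume a: "a \<in> Arr QS"
  obtain P P' h k where a': "a = (P, P', h, k)" and aA: "(P, P', h, k) \<in> Arr QS" using QS_ArrE[OF a] .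
  note A = QS_ArrD[OF aA]
  show "Dom QS a \<in> Obj QS" "Cod QS a \<in> Obj QS" using A a' by simp_all
  show "Cmp QS a (Idn QS (Dom QS a)) = a" "Cmp QS (Idn QS (Cod QS a)) a = a"
    using ext_maps_id_right[OF A(3)] ext_maps_id_right[OF A(4)]
      ext_maps_id_left[OF A(3)] ext_maps_id_left[OF A(4)] by (simp_all add: a')
  show "BaseMap QS a \<in> ext_maps (Base QS (Dom QS a)) (Base QS (Cod QS a))"
    using A(3) a' by simp
next
  fix P assume "P \<in> Obj QS"
  then have P: "qobj P" by simp
  show "Idn QS P \<in> Arr QS"
    unfolding QS_sel
    by (rule QS_ArrI) (use P ext_maps_id bundle_proj_closed[OF quotient_objD(1)[OF P]]
        bundle_act_closed[OF quotient_objD(1)[OF P]] in \<open>simp_all\<close>)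
qed simp_all

text \<open>
  A bundle map over the identity is an isomorphism: its inverse is the fibre lift.
\<close>

lemma QS_vertical_isoI:
  assumes A: "(P, R, ident (btarget P), k) \<in> Arr QS" and eq: "btarget P = btarget R"
  shows "vertical_iso QS P R (P, R, ident (btarget P), k)"
proof -
  note D = QS_ArrD[OF A]
  note m = D(5)
  let ?l = "\<lambda>e\<in>points R. fibre_lift (btotal P) (bproj P) k (bproj R e) e"
  note bP = quotient_objD(1)[OF D(1)] and bR = quotient_objD(1)[OF D(2)]
  have pr: "bproj R e \<in> topspace (btarget P)" "bproj R e = ident (btarget P) (bproj R e)"
    if "e \<in> points R" for e
    using bundle_proj_closed[OF bR that] eq by simp_all
  have L: "fibre_lift (btotal P) (bproj P) k (bproj R e) e \<in> points P"
    "bproj P (fibre_lift (btotal P) (bproj P) k (bproj R e) e) = bproj R e"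
    "k (fibre_lift (btotal P) (bproj P) k (bproj R e) e) = e" if "e \<in> points R" for e
    using fibre_lift[OF m pr(1)[OF that] that pr(2)[OF that]] .
  have cl: "continuous_map (btotal R) (btotal P) (\<lambda>e. fibre_lift (btotal P) (bproj P) k (bproj R e) e)"
    using pr bundle_proj[OF bR] eq
    by (intro fibre_lift_continuous[OF m, where c = "\<lambda>e. e"]) (simp_all add: continuous_map_id[unfolded id_def])
  have inv1: "?l (k e) = e" if e: "e \<in> points P" for e
    using ext_mapsD(3)[OF D(4) e] D(7)[OF e] bundle_proj_closed[OF bP e] fibre_lift_eq[OF m e] by simp
  have B: "(R, P, ident (btarget R), ?l) \<in> Arr QS"
  proof (rule QS_ArrI)
    show "?l \<in> ext_maps (btotal R) (btotal P)" using ext_maps_restrict[OF cl] .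
    show "(ident (btarget R)) \<in> ext_maps (btarget R) (btarget P)"
      using ext_maps_id eq by metis
    fix e assume e: "e \<in> points R"
    show "bmap P (?l e) = bmap R e" using D(6)[OF L(1)[OF e]] L(3)[OF e] e by simp
    show "bproj P (?l e) = ident (btarget R) (bproj R e)"
      using L(2)[OF e] e pr(1)[OF e] eq by simp
    fix g assume g: "g \<in> carrier G"
    have "fibre_lift (btotal P) (bproj P) k (bproj R (bact R g e)) (bact R g e)
        = bact P g (fibre_lift (btotal P) (bproj P) k (bproj R e) e)"
      using bundle_act_closed[OF bP g L(1)[OF e]] bundle_invariant[OF bP g L(1)[OF e]] L(2,3)[OF e]
        bundle_invariant[OF bR g e] D(8)[OF g L(1)[OF e]]
      by (intro fibre_lift_eq[OF m]) simp_all
    then show "?l (bact R g e) = bact P g (?l e)"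
      using e bundle_act_closed[OF bR g e] by simp
  qed (use D in auto)
  let ?a = "(P, R, ident (btarget P), k)"
  have "Cmp QS (R, P, ident (btarget R), ?l) ?a = Idn QS P"
    using inv1 eq by (auto simp: compose_def intro!: restrict_ext)
  moreover have "Cmp QS ?a (R, P, ident (btarget R), ?l) = Idn QS R"
    using L(3) eq by (auto simp: compose_def intro!: restrict_ext)
  ultimately show ?thesis
    unfolding vertical_iso_def using A B eq by (auto intro!: bexI[OF _ B])
qed

lemma QS_vertical_isoE:
  assumes "vertical_iso QS P R a"
  obtains k where "a = (P, R, ident (btarget P), k)"
    "(P, R, ident (btarget P), k) \<in> Arr QS" "btarget P = btarget R"
  using vertical_isoD[OF assms] by (cases a) simp

end

section \<open>Morphisms from a space to a quotient stack\<close>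

lemma id_map_sel [simp]: "MapO id_map x = x" "MapA id_map a = a"
  by (simp_all add: id_map_def)

lemma comp_map_sel [simp]:
  "MapO (comp_map K F) x = MapO K (MapO F x)" "MapA (comp_map K F) a = MapA K (MapA F a)"
  by (simp_all add: comp_map_def)

lemma space_map_sel [simp]:
  "MapO (space_map q) (T, f) = (T, compose (topspace T) q f)"
  "MapA (space_map q) ((T, f), (T', f'), h) =
     ((T, compose (topspace T) q f), (T', compose (topspace T') q f'), h)"
  by (simp_all add: space_map_def Let_def)

lemma arrow_cases:
  obtains T f T' f' h where "a = ((T, f), (T', f'), h)"
  using that[of "fst (fst a)" "snd (fst a)" "fst (fst (snd a))" "snd (fst (snd a))" "snd (snd a)"] by simp

lemma space_stack_ArrD:
  assumes "((T, f), (T', f'), h) \<in> Arr (space_stack S)"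
  shows "f \<in> ext_maps T S" "f' \<in> ext_maps T' S" "h \<in> ext_maps T T'"
    "\<And>t. t \<in> topspace T \<Longrightarrow> f' (h t) = f t"
proof -
  have *: "f \<in> ext_maps T S \<and> f' \<in> ext_maps T' S \<and> h \<in> ext_maps T T' \<and> compose (topspace T) f' h = f"
    using assms by (simp add: space_stack_def)
  then show "f \<in> ext_maps T S" "f' \<in> ext_maps T' S" "h \<in> ext_maps T T'" by simp_all
  show "f' (h t) = f t" if "t \<in> topspace T" for t
    using fun_cong[OF conjunct2[OF conjunct2[OF conjunct2[OF *]]], of t] that by (simp add: compose_def)
qed

lemma stack_morphism_comp:
  assumes F: "stack_morphism X Y F" and K: "stack_morphism Y Z K"
  shows "stack_morphism X Z (comp_map K F)"
  unfolding stack_morphism_def comp_map_sel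
proof (intro conjI ballI impI)
  note F = stack_morphismD[OF F] and K = stack_morphismD[OF K]
  fix x assume x: "x \<in> Obj X"
  show "MapO K (MapO F x) \<in> Obj Z" "Base Z (MapO K (MapO F x)) = Base X x"
    "MapA K (MapA F (Idn X x)) = Idn Z (MapO K (MapO F x))"
    using F(1-3)[OF x] K(1-3)[OF F(1)[OF x]] by simp_all
next
  note F = stack_morphismD[OF F] and K = stack_morphismD[OF K]
  fix a assume a: "a \<in> Arr X"
  show "MapA K (MapA F a) \<in> Arr Z" "Dom Z (MapA K (MapA F a)) = MapO K (MapO F (Dom X a))"
    "Cod Z (MapA K (MapA F a)) = MapO K (MapO F (Cod X a))" "BaseMap Z (MapA K (MapA F a)) = BaseMap X a"
    using F(4-7)[OF a] K(4-7)[OF F(4)[OF a]] by simp_all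
  fix b assume b: "b \<in> Arr X" "Dom X b = Cod X a"
  show "MapA K (MapA F (Cmp X b a)) = Cmp Z (MapA K (MapA F b)) (MapA K (MapA F a))"
    using F(8)[OF a b] K(8)[OF F(4)[OF a] F(4)[OF b(1)]] F(5)[OF b(1)] F(6)[OF a] b(2) by simp
qed

lemma ext_maps_compose_map:
  "f \<in> ext_maps T S \<Longrightarrow> continuous_map S S' l \<Longrightarrow> compose (topspace T) l f \<in> ext_maps T S'"
  unfolding compose_def
  by (rule ext_maps_restrict, rule cont_comp[OF ext_mapsD(1)])

lemma space_map_Arr:
  assumes l: "continuous_map S S' l" and a: "((T, f), (T', f'), h) \<in> Arr (space_stack S)"
  shows "((T, compose (topspace T) l f), (T', compose (topspace T') l f'), h) \<in> Arr (space_stack S')"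
proof -
  have *: "f \<in> ext_maps T S" "f' \<in> ext_maps T' S" "h \<in> ext_maps T T'" "\<And>t. t \<in> topspace T \<Longrightarrow> f' (h t) = f t"
    using space_stack_ArrD[OF a] .
  show ?thesis
    using *(4) ext_mapsD(3)[OF *(3)]
    by (intro space_stack_ArrI ext_maps_compose_map[OF _ l] *(1-3)) (simp add: compose_def)
qed

lemma space_map_morphism:
  assumes l: "continuous_map S S' l"
  shows "stack_morphism (space_stack S) (space_stack S') (space_map l)"
  unfolding stack_morphism_def
proof (intro conjI ballI impI)
  fix a assume a: "a \<in> Arr (space_stack S)"
  obtain T f T' f' h where a': "a = ((T, f), (T', f'), h)" by (rule arrow_cases)
  show "MapA (space_map l) a \<in> Arr (space_stack S')"
    using space_map_Arr[OF l a[unfolded a']] a' by simp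
  show "Dom (space_stack S') (MapA (space_map l) a) = MapO (space_map l) (Dom (space_stack S) a)"
    "Cod (space_stack S') (MapA (space_map l) a) = MapO (space_map l) (Cod (space_stack S) a)"
    "BaseMap (space_stack S') (MapA (space_map l) a) = BaseMap (space_stack S) a"
    by (simp_all add: a')
  fix b assume bd: "Dom (space_stack S) b = Cod (space_stack S) a"
  obtain S1 g S2 g' h' where b': "b = ((S1, g), (S2, g'), h')" by (rule arrow_cases)
  from bd show "MapA (space_map l) (Cmp (space_stack S) b a)
      = Cmp (space_stack S') (MapA (space_map l) b) (MapA (space_map l) a)"
    by (simp add: a' b')
next
  fix x assume "x \<in> Obj (space_stack S)"
  then obtain T f where x: "x = (T, f)" "f \<in> ext_maps T S" by auto
  show "MapO (space_map l) x \<in> Obj (space_stack S')"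
    using ext_maps_compose_map[OF x(2) l] by (simp add: x(1))
  show "Base (space_stack S') (MapO (space_map l) x) = Base (space_stack S) x"
    "MapA (space_map l) (Idn (space_stack S) x) = Idn (space_stack S') (MapO (space_map l) x)"
    by (simp_all add: x(1))
qed

lemma space_stack_Arr_Obj:
  "a \<in> Arr (space_stack S) \<Longrightarrow> Dom (space_stack S) a \<in> Obj (space_stack S) \<and> Cod (space_stack S) a \<in> Obj (space_stack S)"
  using stk_categoryD(4,5)[OF space_stack_category] by blast

definition total_map :: "'a \<times> 'b \<times> 'c \<times> 'd \<Rightarrow> 'd"
  where "total_map a = snd (snd (snd a))"

lemma total_map_simp [simp]: "total_map (P, P', h, k) = k"
  by (simp add: total_map_def)

context qstack begin

lemma morphism_object:
  assumes K: "stack_morphism (space_stack S) QS K" and f: "f \<in> ext_maps T S"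
  shows "qobj (MapO K (T, f))" "btarget (MapO K (T, f)) = T"
  using stack_morphismD(1,2)[OF K, of "(T, f)"] f by simp_all

lemma morphism_arrow:
  assumes K: "stack_morphism (space_stack S) QS K" and a: "((T, f), (T', f'), h) \<in> Arr (space_stack S)"
  obtains k where "MapA K ((T, f), (T', f'), h) = (MapO K (T, f), MapO K (T', f'), h, k)"
    and "(MapO K (T, f), MapO K (T', f'), h, k) \<in> Arr QS"
proof -
  let ?a = "((T, f), (T', f'), h)"
  obtain P P' h' k where e: "MapA K ?a = (P, P', h', k)" by (rule prod_cases4)
  have "P = MapO K (T, f)" "P' = MapO K (T', f')" "h' = h"
    using stack_morphismD(5-7)[OF K a] unfolding e by simp_all
  then show ?thesis using that e stack_morphismD(4)[OF K a] by simp
qed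

end

text \<open>
  A morphism \<open>K\<close> from a space \<open>S\<close> is determined, up to isomorphism, by
  its value on one object, the identity of \<open>S\<close>. As the points of \<open>S\<close>
  need not lie in the universe type, the identity is replaced by the homeomorphism
  \<open>j\<close> from a copy \<open>Su\<close> of \<open>S\<close>, with inverse
  \<open>ji\<close>.
\<close>

locale represented = qstack G TG X actX U
  for G :: "'g monoid" (structure) and TG and X :: "'x topology" and actX and U :: "'u itself" +
  fixes S :: "'s topology" and Su :: "'u topology" and j ji K
  assumes K: "stack_morphism (space_stack S) QS K" and j: "j \<in> ext_maps Su S"
    and ji: "continuous_map S Su ji"
    and j_ji: "\<And>s. s \<in> topspace S \<Longrightarrow> j (ji s) = s" and ji_j: "\<And>x. x \<in> topspace Su \<Longrightarrow> ji (j x) = x"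
begin

definition rep where "rep = MapO K (Su, j)"

definition class_map where "class_map T f = (\<lambda>t\<in>topspace T. ji (f t))"

text \<open>
  The bundle map from \<open>K (T, f)\<close> to the representing bundle that covers
  \<open>f\<close>.
\<close>

definition class_lift where "class_lift T f = total_map (MapA K ((T, f), (Su, j), class_map T f))"

lemma class_map_arrow:
  assumes f: "f \<in> ext_maps T S"
  shows "((T, f), (Su, j), class_map T f) \<in> Arr (space_stack S)"
  using ext_maps_restrict[OF cont_comp[OF ext_mapsD(1)[OF f] ji]] ext_mapsD(3)[OF f] j_ji
  by (intro space_stack_ArrI j f) (simp_all add: class_map_def)

lemma class_lift_arrow:
  assumes f: "f \<in> ext_maps T S"
  shows "(MapO K (T, f), rep, class_map T f, class_lift T f) \<in> Arr QS"
    and "MapA K ((T, f), (Su, j), class_map T f) = (MapO K (T, f), rep, class_map T f, class_lift T f)"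
proof -
  obtain k where k: "MapA K ((T, f), (Su, j), class_map T f) = (MapO K (T, f), MapO K (Su, j), class_map T f, k)"
    "(MapO K (T, f), MapO K (Su, j), class_map T f, k) \<in> Arr QS"
    by (rule morphism_arrow[OF K class_map_arrow[OF f]])
  then have "class_lift T f = k" by (simp add: class_lift_def)
  then show "(MapO K (T, f), rep, class_map T f, class_lift T f) \<in> Arr QS"
    "MapA K ((T, f), (Su, j), class_map T f) = (MapO K (T, f), rep, class_map T f, class_lift T f)"
    using k by (simp_all add: rep_def)
qed

lemma rep_obj: "qobj rep" "btarget rep = Su"
  using morphism_object[OF K j] by (simp_all add: rep_def)

lemma class_lift_natural:
  assumes a: "((T, f), (T', f'), h) \<in> Arr (space_stack S)"
    and e: "e \<in> points (MapO K (T, f))"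
  shows "class_lift T' f' (total_map (MapA K ((T, f), (T', f'), h)) e) = class_lift T f e"
proof -
  let ?a = "((T, f), (T', f'), h)"
  have *: "f \<in> ext_maps T S" "f' \<in> ext_maps T' S" "h \<in> ext_maps T T'" "\<And>t. t \<in> topspace T \<Longrightarrow> f' (h t) = f t"
    using space_stack_ArrD[OF a] .
  have "compose (topspace T) (class_map T' f') h = class_map T f"
    using *(4) ext_mapsD(3)[OF *(3)] by (auto simp: class_map_def compose_def)
  then have c: "Cmp (space_stack S) ((T', f'), (Su, j), class_map T' f') ?a = ((T, f), (Su, j), class_map T f)"
    by simp
  obtain k where k: "MapA K ?a = (MapO K (T, f), MapO K (T', f'), h, k)"
    by (rule morphism_arrow[OF K a])
  have "MapA K ((T, f), (Su, j), class_map T f)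
      = Cmp QS (MapA K ((T', f'), (Su, j), class_map T' f')) (MapA K ?a)"
    using stack_morphismD(8)[OF K a class_map_arrow[OF *(2)]] c by simp
  then have "class_lift T f = compose (points (MapO K (T, f))) (class_lift T' f') k"
    unfolding class_lift_arrow(2)[OF *(1)] class_lift_arrow(2)[OF *(2)] k by simp
  then show ?thesis using e k by (simp add: compose_def)
qed

text \<open>
  The pullback along \<open>f\<close> of a section \<open>s\<close> of the representing bundle.
\<close>

definition pullback_section where
  "pullback_section s T f t = fibre_lift (btotal (MapO K (T, f))) (bproj (MapO K (T, f))) (class_lift T f) t (s (ji (f t)))"

context
  fixes s assumes s: "continuous_map Su (btotal rep) s" "\<forall>x\<in>topspace Su. bproj rep (s x) = x"
begin

lemma pullback_section:
  assumes f: "f \<in> ext_maps T S"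
  shows "continuous_map T (btotal (MapO K (T, f))) (pullback_section s T f)"
    and "\<And>t. t \<in> topspace T \<Longrightarrow> pullback_section s T f t \<in> points (MapO K (T, f))"
    and "\<And>t. t \<in> topspace T \<Longrightarrow> bproj (MapO K (T, f)) (pullback_section s T f t) = t"
    and "\<And>t. t \<in> topspace T \<Longrightarrow> class_lift T f (pullback_section s T f t) = s (ji (f t))"
    and "\<And>t. t \<in> topspace T \<Longrightarrow> bmap (MapO K (T, f)) (pullback_section s T f t) = bmap rep (s (ji (f t)))"
    and "\<And>t e. t \<in> topspace T \<Longrightarrow> e \<in> points (MapO K (T, f)) \<Longrightarrow> bproj (MapO K (T, f)) e = t \<Longrightarrow>
      class_lift T f e = s (ji (f t)) \<Longrightarrow> e = pullback_section s T f t"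
proof -
  note A = QS_ArrD[OF class_lift_arrow(1)[OF f]] and T = morphism_object(2)[OF K f]
  note m = A(5)[unfolded T]
  have jf: "continuous_map T Su (\<lambda>t. ji (f t))" using cont_comp[OF ext_mapsD(1)[OF f] ji] .
  have sjf: "continuous_map T (btotal rep) (\<lambda>t. s (ji (f t)))" using cont_comp[OF jf s(1)] .
  have t1: "s (ji (f t)) \<in> points rep" "bproj rep (s (ji (f t))) = class_map T f t"
    if "t \<in> topspace T" for t
    using cont_closed[OF sjf that] cont_closed[OF jf that] s(2) that
    by (simp_all add: class_map_def)
  show "continuous_map T (btotal (MapO K (T, f))) (pullback_section s T f)"
    unfolding pullback_section_def
    using fibre_lift_continuous[OF m continuous_map_id sjf] t1(2) by simp
  show 1: "pullback_section s T f t \<in> points (MapO K (T, f))"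
    and 2: "bproj (MapO K (T, f)) (pullback_section s T f t) = t"
    and 3: "class_lift T f (pullback_section s T f t) = s (ji (f t))" if "t \<in> topspace T" for t
    unfolding pullback_section_def using fibre_lift[OF m that t1[OF that]] by simp_all
  show "bmap (MapO K (T, f)) (pullback_section s T f t) = bmap rep (s (ji (f t)))"
    if "t \<in> topspace T" for t
    using A(6)[OF 1[OF that]] 3[OF that] by simp
  show "e = pullback_section s T f t" if "t \<in> topspace T" "e \<in> points (MapO K (T, f))"
    "bproj (MapO K (T, f)) e = t" "class_lift T f e = s (ji (f t))" for t e
    unfolding pullback_section_def using fibre_lift_eq[OF m that(2-4)] by simp
qed

lemma pullback_section_natural:
  assumes a: "((T, f), (T', f'), h) \<in> Arr (space_stack S)" and t: "t \<in> topspace T"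
  shows "total_map (MapA K ((T, f), (T', f'), h)) (pullback_section s T f t) = pullback_section s T' f' (h t)"
proof -
  have *: "f \<in> ext_maps T S" "f' \<in> ext_maps T' S" "h \<in> ext_maps T T'" "\<And>t. t \<in> topspace T \<Longrightarrow> f' (h t) = f t"
    using space_stack_ArrD[OF a] .
  obtain k where k: "MapA K ((T, f), (T', f'), h) = (MapO K (T, f), MapO K (T', f'), h, k)"
    and kA: "(MapO K (T, f), MapO K (T', f'), h, k) \<in> Arr QS"
    by (rule morphism_arrow[OF K a])
  note A = QS_ArrD[OF kA]
  note p = pullback_section(2-4)[OF *(1) t]
  show ?thesis
    using ext_mapsD(3)[OF *(3) t] ext_mapsD(3)[OF A(4) p(1)] A(7)[OF p(1)] p class_lift_natural[OF a p(1)] *(4)[OF t]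
    unfolding k total_map_simp by (intro pullback_section(6)[OF *(2)]) simp_all
qed

end

end

section \<open>Trivial bundles\<close>

text \<open>
  The injection \<open>enc\<close> gives the trivial bundle \<open>T \<times> G\<close> a copy
  with points in the universe type.
\<close>

locale qstack_coded = qstack G TG X actX U
  for G :: "'g monoid" (structure) and TG and X :: "'x topology" and actX and U :: "'u itself" +
  fixes enc :: "'u \<times> 'g \<Rightarrow> 'u"
  assumes enc: "inj_on enc (UNIV \<times> carrier G)"
begin

definition dec where "dec = inv_into (UNIV \<times> carrier G) enc"

lemma dec_enc [simp]: "g \<in> carrier G \<Longrightarrow> dec (enc (t, g)) = (t, g)"
  unfolding dec_def by (rule inv_into_f_f[OF enc]) simp

definition triv_total :: "'u topology \<Rightarrow> 'u topology"
  where "triv_total T = push_top (prod_topology T TG) enc"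

definition triv_obj :: "'u topology \<Rightarrow> ('u \<Rightarrow> 'x) \<Rightarrow> ('u, 'g, 'x) bundle_obj"
  where "triv_obj T z = \<lparr>btarget = T, btotal = triv_total T,
    bact = (\<lambda>g x. enc (fst (dec x), g \<otimes> snd (dec x))), bproj = (\<lambda>x. fst (dec x)),
    bmap = (\<lambda>x. actX (snd (dec x)) (z (fst (dec x))))\<rparr>"

lemma triv_obj_sel [simp]:
  "btarget (triv_obj T z) = T" "btotal (triv_obj T z) = triv_total T"
  "g \<in> carrier G \<Longrightarrow> h \<in> carrier G \<Longrightarrow> bact (triv_obj T z) g (enc (t, h)) = enc (t, g \<otimes> h)"
  "h \<in> carrier G \<Longrightarrow> bproj (triv_obj T z) (enc (t, h)) = t"
  "h \<in> carrier G \<Longrightarrow> bmap (triv_obj T z) (enc (t, h)) = actX h (z t)"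
  by (simp_all add: triv_obj_def)

lemma triv_total_iff: "x \<in> topspace (triv_total T) \<longleftrightarrow> (\<exists>t g. t \<in> topspace T \<and> g \<in> carrier G \<and> x = enc (t, g))"
  by (auto simp: triv_total_def topspace_TG)

lemma triv_totalI: "t \<in> topspace T \<Longrightarrow> g \<in> carrier G \<Longrightarrow> enc (t, g) \<in> topspace (triv_total T)"
  using triv_total_iff by blast

lemma dec_continuous: "continuous_map (triv_total T) (prod_topology T TG) dec"
  unfolding triv_total_def
  by (rule continuous_map_from_push_top, rule continuous_map_eq[OF continuous_map_id])
    (auto simp: topspace_TG)

lemma dec_continuous_components:
  "continuous_map (triv_total T) T (\<lambda>x. fst (dec x))" "continuous_map (triv_total T) TG (\<lambda>x. snd (dec x))"
  using continuous_map_fst_of[OF dec_continuous] continuous_map_snd_of[OF dec_continuous]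
  by (simp_all add: o_def)

lemma enc_continuous:
  assumes "continuous_map Z T a" "continuous_map Z TG b"
  shows "continuous_map Z (triv_total T) (\<lambda>z. enc (a z, b z))"
  unfolding triv_total_def
  by (rule cont_comp[OF continuous_map_pairedI[OF assms] continuous_map_push_top])

lemma triv_obj_quotient_obj:
  assumes z: "continuous_map T X z"
  shows "qobj (triv_obj T z)"
  unfolding quotient_obj_def
proof (intro conjI)
  let ?E = "triv_total T"
  have act: "continuous_action G TG ?E (bact (triv_obj T z))"
    unfolding continuous_action_def
  proof (intro conjI ballI)
    have 1: "continuous_map (prod_topology TG ?E) T (\<lambda>p. fst (dec (snd p)))"
      "continuous_map (prod_topology TG ?E) TG (\<lambda>p. snd (dec (snd p)))"
      by (rule cont_comp[OF continuous_map_snd dec_continuous_components(1)])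
        (rule cont_comp[OF continuous_map_snd dec_continuous_components(2)])
    have "continuous_map (prod_topology TG ?E) ?E (\<lambda>p. enc (fst (dec (snd p)), fst p \<otimes> snd (dec (snd p))))"
      by (intro enc_continuous cont_mult 1 continuous_map_fst)
    then show "continuous_map (prod_topology TG ?E) ?E (\<lambda>(g, e). bact (triv_obj T z) g e)"
      by (simp add: triv_obj_def case_prod_unfold)
  qed (auto simp: triv_total_iff m_assoc)
  have "principal_bundle G TG T ?E (bact (triv_obj T z)) (bproj (triv_obj T z))"
  proof (rule principal_bundleI[OF act])
    show "continuous_map ?E T (bproj (triv_obj T z))"
      using dec_continuous_components(1) by (simp add: triv_obj_def)
    show "bproj (triv_obj T z) (bact (triv_obj T z) g e) = bproj (triv_obj T z) e"
      if "g \<in> carrier G" "e \<in> topspace ?E" for g e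
      using that by (auto simp: triv_total_iff)
    fix t assume t: "t \<in> topspace T"
    have "chart T ?E (bact (triv_obj T z)) (bproj (triv_obj T z)) (topspace T) (\<lambda>t. enc (t, \<one>)) (\<lambda>x. snd (dec x))"
      unfolding chart_def
      using enc_continuous[of "subtopology T (topspace T)" T "\<lambda>t. t" "\<lambda>_. \<one>"] dec_continuous_components(2)
      by (auto simp: triv_total_iff topspace_TG continuous_map_from_subtopology continuous_map_id[unfolded id_def])
    then show "\<exists>U \<sigma> \<gamma>. t \<in> U \<and> chart T ?E (bact (triv_obj T z)) (bproj (triv_obj T z)) U \<sigma> \<gamma>"
      using t by blast
  qed
  then show "principal_bundle G TG (btarget (triv_obj T z)) (btotal (triv_obj T z)) (bact (triv_obj T z)) (bproj (triv_obj T z))"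
    by simp
  show "continuous_map (btotal (triv_obj T z)) X (bmap (triv_obj T z))"
    using action_cont[OF action_X dec_continuous_components(2)
        cont_comp[OF dec_continuous_components(1) z]] by (simp add: triv_obj_def)
  have "actX (g \<otimes> h) (z t) = actX g (actX h (z t))"
    if "g \<in> carrier G" "h \<in> carrier G" "t \<in> topspace T" for g h t
    using action_X that cont_closed[OF z] by (simp add: continuous_action_def)
  then show "equivariant G (btotal (triv_obj T z)) (bact (triv_obj T z)) actX (bmap (triv_obj T z))"
    by (auto simp: equivariant_def triv_total_iff)
qed

definition triv_map :: "'u topology \<Rightarrow> ('u, 'g, 'x) bundle_obj \<Rightarrow> ('u \<Rightarrow> 'u) \<Rightarrow> 'u \<Rightarrow> 'u"
  where "triv_map T R s = (\<lambda>x\<in>topspace (triv_total T). bact R (snd (dec x)) (s (fst (dec x))))"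

lemma triv_map_enc:
  "t \<in> topspace T \<Longrightarrow> g \<in> carrier G \<Longrightarrow> triv_map T R s (enc (t, g)) = bact R g (s t)"
  by (simp add: triv_map_def triv_totalI)

lemma triv_map_arrow:
  assumes z: "continuous_map T X z" and R: "qobj R"
    and s: "continuous_map T (btotal R) s" and h: "h \<in> ext_maps T (btarget R)"
    and sh: "\<And>t. t \<in> topspace T \<Longrightarrow> bproj R (s t) = h t"
    and orbit_section: "\<And>t. t \<in> topspace T \<Longrightarrow> bmap R (s t) = z t"
  shows "(triv_obj T z, R, h, triv_map T R s) \<in> Arr QS"
proof (rule QS_ArrI[OF triv_obj_quotient_obj[OF z] R])
  note b = quotient_objD(1)[OF R]
  have sR: "s t \<in> points R" if "t \<in> topspace T" for t using cont_closed[OF s that] .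
  show "h \<in> ext_maps (btarget (triv_obj T z)) (btarget R)" using h by simp
  show "triv_map T R s \<in> ext_maps (btotal (triv_obj T z)) (btotal R)"
    unfolding triv_map_def triv_obj_sel(2)
    by (intro ext_maps_restrict action_cont[OF bundle_action[OF b]] dec_continuous_components(2)
        cont_comp[OF dec_continuous_components(1) s])
  fix e assume "e \<in> points (triv_obj T z)"
  then obtain t g where e: "t \<in> topspace T" "g \<in> carrier G" "e = enc (t, g)"
    using triv_total_iff by auto
  show "bmap R (triv_map T R s e) = bmap (triv_obj T z) e"
    using quotient_objD(3)[OF R e(2) sR[OF e(1)]] e orbit_section by (simp add: triv_map_enc)
  show "bproj R (triv_map T R s e) = h (bproj (triv_obj T z) e)"
    using bundle_invariant[OF b e(2) sR[OF e(1)]] e sh by (simp add: triv_map_enc)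
  fix g' assume g': "g' \<in> carrier G"
  show "triv_map T R s (bact (triv_obj T z) g' e) = bact R g' (triv_map T R s e)"
    using bundle_act_mult[OF b g' e(2) sR[OF e(1)]] e g' by (simp add: triv_map_enc)
qed

lemma triv_arrow_eqI:
  assumes k: "(triv_obj T z, R, h, k) \<in> Arr QS" and k': "(triv_obj T z', R, h', k') \<in> Arr QS"
    and eq: "\<And>t. t \<in> topspace T \<Longrightarrow> k (enc (t, \<one>)) = k' (enc (t, \<one>))"
  shows "k = k'"
proof (rule extensionalityI[where A = "topspace (triv_total T)"])
  note A = QS_ArrD[OF k] and B = QS_ArrD[OF k']
  show "k \<in> extensional (topspace (triv_total T))" "k' \<in> extensional (topspace (triv_total T))"
    using ext_mapsD(2)[OF A(4)] ext_mapsD(2)[OF B(4)] by simp_all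
  fix x assume "x \<in> topspace (triv_total T)"
  then obtain t g where e: "t \<in> topspace T" "g \<in> carrier G" "x = enc (t, g)" using triv_total_iff by auto
  have 1: "bact (triv_obj T z) g (enc (t, \<one>)) = x" "bact (triv_obj T z') g (enc (t, \<one>)) = x"
    using e by simp_all
  show "k x = k' x"
    using A(8)[of g "enc (t, \<one>)"] B(8)[of g "enc (t, \<one>)"] 1 e eq[OF e(1)] triv_totalI[OF e(1) one_closed]
    by simp
qed

text \<open>
  The composite of \<open>S \<rightarrow> X\<close> with the projection \<open>X \<rightarrow>
  [X/G]\<close>: all its bundles are trivial, with the map to \<open>X\<close> determined by its
  values on the unit section.
\<close>

definition triv where
  "triv h = \<lparr>MapO = (\<lambda>(T, f). triv_obj T (\<lambda>t. h (f t))),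
    MapA = (\<lambda>((T, f), (T', f'), k). (triv_obj T (\<lambda>t. h (f t)), triv_obj T' (\<lambda>t. h (f' t)), k,
      triv_map T (triv_obj T' (\<lambda>t. h (f' t))) (\<lambda>t. enc (k t, \<one>))))\<rparr>"

lemma triv_sel [simp]:
  "MapO (triv h) (T, f) = triv_obj T (\<lambda>t. h (f t))"
  "MapA (triv h) ((T, f), (T', f'), k) = (triv_obj T (\<lambda>t. h (f t)), triv_obj T' (\<lambda>t. h (f' t)), k,
      triv_map T (triv_obj T' (\<lambda>t. h (f' t))) (\<lambda>t. enc (k t, \<one>)))"
  by (simp_all add: triv_def)

lemma actX_one: "x \<in> topspace X \<Longrightarrow> actX \<one> x = x"
  using action_X by (simp add: continuous_action_def)

lemma triv_Arr:
  assumes h: "continuous_map S X h" and a: "((T, f), (T', f'), k) \<in> Arr (space_stack S)"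
  shows "MapA (triv h) ((T, f), (T', f'), k) \<in> Arr QS"
proof -
  have *: "f \<in> ext_maps T S" "f' \<in> ext_maps T' S" "k \<in> ext_maps T T'" "\<And>t. t \<in> topspace T \<Longrightarrow> f' (k t) = f t"
    using space_stack_ArrD[OF a] .
  have hf: "continuous_map T X (\<lambda>t. h (f t))" "continuous_map T' X (\<lambda>t. h (f' t))"
    using cont_comp[OF ext_mapsD(1) h] * by blast+
  have s: "continuous_map T (triv_total T') (\<lambda>t. enc (k t, \<one>))"
    by (intro enc_continuous ext_mapsD(1)[OF *(3)]) (simp add: topspace_TG)
  show ?thesis
    unfolding triv_sel
    by (rule triv_map_arrow[OF hf(1) triv_obj_quotient_obj[OF hf(2)]])
      (use s *(3,4) actX_one cont_closed[OF hf(1)] in simp_all)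
qed

lemma triv_morphism:
  assumes h: "continuous_map S X h"
  shows "stack_morphism (space_stack S) QS (triv h)"
  unfolding stack_morphism_def
proof (intro conjI ballI impI)
  fix x :: "'u topology \<times> ('u \<Rightarrow> _)" assume "x \<in> Obj (space_stack S)"
  then obtain T f where x: "x = (T, f)" "f \<in> ext_maps T S" by auto
  have hf: "continuous_map T X (\<lambda>t. h (f t))" using cont_comp[OF ext_mapsD(1)[OF x(2)] h] .
  show "MapO (triv h) x \<in> Obj QS" using triv_obj_quotient_obj[OF hf] x by simp
  show "Base QS (MapO (triv h) x) = Base (space_stack S) x" using x by simp
  have i: "Idn (space_stack S) x \<in> Arr (space_stack S)"
    using stk_categoryD(1)[OF space_stack_category, of x] x by simp
  have 1: "(triv_obj T (\<lambda>t. h (f t)), triv_obj T (\<lambda>t. h (f t)), ident T, triv_map T (triv_obj T (\<lambda>t. h (f t)))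
      (\<lambda>t. enc ((ident T) t, \<one>))) \<in> Arr QS"
    using triv_Arr[OF h i[unfolded x(1) space_stack_sel]] by simp
  have 2: "(triv_obj T (\<lambda>t. h (f t)), triv_obj T (\<lambda>t. h (f t)), ident T,
      ident (triv_total T)) \<in> Arr QS"
    using stk_categoryD(1)[OF QS_category, of "triv_obj T (\<lambda>t. h (f t))"] triv_obj_quotient_obj[OF hf] by simp
  show "MapA (triv h) (Idn (space_stack S) x) = Idn QS (MapO (triv h) x)"
    using triv_arrow_eqI[OF 1 2] by (simp add: x triv_map_enc triv_totalI)
next
  fix a :: "('u, _) space_arr" assume a: "a \<in> Arr (space_stack S)"
  obtain T f T' f' k where a': "a = ((T, f), (T', f'), k)" by (rule arrow_cases)
  note aA = a[unfolded a']
  show "MapA (triv h) a \<in> Arr QS" using triv_Arr[OF h aA] a' by simp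
  show "Dom QS (MapA (triv h) a) = MapO (triv h) (Dom (space_stack S) a)"
    "Cod QS (MapA (triv h) a) = MapO (triv h) (Cod (space_stack S) a)"
    "BaseMap QS (MapA (triv h) a) = BaseMap (space_stack S) a"
    by (simp_all add: a')
  fix b :: "('u, _) space_arr" assume b: "b \<in> Arr (space_stack S)" and ab: "Dom (space_stack S) b = Cod (space_stack S) a"
  obtain T1 f1 T'' f'' k' where b1: "b = ((T1, f1), (T'', f''), k')" by (rule arrow_cases)
  then have b': "b = ((T', f'), (T'', f''), k')" using ab a' by simp
  note k = space_stack_ArrD(3)[OF aA]
  have c: "Cmp (space_stack S) b a \<in> Arr (space_stack S)"
    using stk_categoryD(8)[OF space_stack_category a b ab] .
  note c1 = triv_Arr[OF h c[unfolded a' b' space_stack_sel fst_conv], unfolded triv_sel]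
  have d: "Cmp QS (MapA (triv h) b) (MapA (triv h) a) \<in> Arr QS"
    using stk_categoryD(8)[OF QS_category triv_Arr[OF h aA] triv_Arr[OF h b[unfolded b']]]
    by (simp add: a' b')
  note d1 = d[unfolded a' b' triv_sel QS_sel]
  show "MapA (triv h) (Cmp (space_stack S) b a) = Cmp QS (MapA (triv h) b) (MapA (triv h) a)"
    using triv_arrow_eqI[OF c1 d1] ext_mapsD(3)[OF k]
    by (simp add: a' b' triv_map_enc triv_totalI compose_def)
qed

text \<open>
  A trivial bundle maps to any bundle with a section. Sections of all the bundles \<open>F (T,
  f)\<close> that are natural in \<open>(T, f)\<close> and lie over \<open>h \<circ> l\<close>
  thus identify \<open>F\<close> with a map into \<open>X\<close>.
\<close>

lemma triv_two_iso:
  assumes h: "continuous_map S' X h" and l: "continuous_map S S' l"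
    and F: "stack_morphism (space_stack S) QS F"
    and s: "\<And>T f. f \<in> ext_maps T S \<Longrightarrow> continuous_map T (btotal (MapO F (T, f))) (s T f)"
    and sp: "\<And>T f t. f \<in> ext_maps T S \<Longrightarrow> t \<in> topspace T \<Longrightarrow> bproj (MapO F (T, f)) (s T f t) = t"
    and sm: "\<And>T f t. f \<in> ext_maps T S \<Longrightarrow> t \<in> topspace T \<Longrightarrow> bmap (MapO F (T, f)) (s T f t) = h (l (f t))"
    and sn: "\<And>T f T' f' k t. ((T, f), (T', f'), k) \<in> Arr (space_stack S) \<Longrightarrow> t \<in> topspace T \<Longrightarrow>
      total_map (MapA F ((T, f), (T', f'), k)) (s T f t) = s T' f' (k t)"
  shows "two_iso (space_stack S) QS (comp_map (triv h) (space_map l)) F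
    (\<lambda>(T, f). (triv_obj T (\<lambda>t. h (compose (topspace T) l f t)), MapO F (T, f), ident T,
       triv_map T (MapO F (T, f)) (s T f)))"
    (is "two_iso _ _ ?H _ ?\<eta>")
proof -
  have arr: "?\<eta> (T, f) \<in> Arr QS" if f: "f \<in> ext_maps T S" for T f
  proof -
    note O = morphism_object[OF F f]
    have z: "continuous_map T X (\<lambda>t. h (compose (topspace T) l f t))"
      using cont_comp[OF ext_mapsD(1)[OF ext_maps_compose_map[OF f l]] h] .
    have i: "ident T \<in> ext_maps T (btarget (MapO F (T, f)))" using ext_maps_id O(2) by simp
    show ?thesis
      unfolding case_prod_conv
      by (rule triv_map_arrow[OF z O(1) s[OF f] i]) (simp_all add: sp[OF f] sm[OF f] compose_def)
  qed
  have H: "stack_morphism (space_stack S) QS ?H"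
    using stack_morphism_comp[OF space_map_morphism[OF l] triv_morphism[OF h]] .
  show ?thesis
    unfolding two_iso_def
  proof (intro conjI ballI)
    fix x :: "('u, _) space_obj" assume "x \<in> Obj (space_stack S)"
    then obtain T f where x: "x = (T, f)" "f \<in> ext_maps T S" by auto
    show "vertical_iso QS (MapO ?H x) (MapO F x) (?\<eta> x)"
      using QS_vertical_isoI[of "triv_obj T (\<lambda>t. h (compose (topspace T) l f t))" "MapO F (T, f)"
          "triv_map T (MapO F (T, f)) (s T f)"] arr[OF x(2)] morphism_object(2)[OF F x(2)]
      by (simp add: x)
  next
    fix a :: "('u, _) space_arr" assume a: "a \<in> Arr (space_stack S)"
    obtain T f T' f' k where a': "a = ((T, f), (T', f'), k)" by (rule arrow_cases)
    note aA = a[unfolded a']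
    note * = space_stack_ArrD(1-3)[OF aA]
    obtain l' where MA: "MapA F a = (MapO F (T, f), MapO F (T', f'), k, l')"
      unfolding a' by (rule morphism_arrow[OF F aA])
    have sn': "l' (s T f t) = s T' f' (k t)" if "t \<in> topspace T" for t
      using sn[OF aA that] MA a' by simp
    have F1: "MapA F a \<in> Arr QS" using stack_morphismD(4)[OF F a] .
    have H1: "MapA ?H a \<in> Arr QS" using stack_morphismD(4)[OF H a] .
    have c1: "Cmp QS (?\<eta> (T', f')) (MapA ?H a) \<in> Arr QS"
      by (rule stk_categoryD(8)[OF QS_category H1 arr[OF *(2)]]) (simp add: a')
    have c2: "Cmp QS (MapA F a) (?\<eta> (T, f)) \<in> Arr QS"
      by (rule stk_categoryD(8)[OF QS_category arr[OF *(1)] F1]) (simp add: MA)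
    have kk: "compose (topspace T) (ident T') k = compose (topspace T) k (ident T)"
      using ext_maps_id_left[OF *(3)] ext_maps_id_right[OF *(3)] by simp
    have b1: "bact (MapO F (T', f')) \<one> (s T' f' (k t)) = s T' f' (k t)" if "t \<in> topspace T" for t
      using bundle_act_one[OF quotient_objD(1)[OF morphism_object(1)[OF F *(2)]]]
        cont_closed[OF s[OF *(2)] ext_mapsD(3)[OF *(3) that]] by blast
    have b2: "bact (MapO F (T, f)) \<one> (s T f t) = s T f t" if "t \<in> topspace T" for t
      using bundle_act_one[OF quotient_objD(1)[OF morphism_object(1)[OF F *(1)]]]
        cont_closed[OF s[OF *(1)] that] by blast
    note c1' = c1[unfolded a' comp_map_sel space_map_sel triv_sel case_prod_conv QS_sel]
    note c2' = c2[unfolded MA case_prod_conv QS_sel]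
    have "Cmp QS (?\<eta> (T', f')) (MapA ?H a) = Cmp QS (MapA F a) (?\<eta> (T, f))"
      unfolding MA
      unfolding a' comp_map_sel space_map_sel triv_sel case_prod_conv QS_sel triv_obj_sel(1) kk prod.inject
    proof (intro conjI refl triv_arrow_eqI[OF c1' c2'])
      fix t assume t: "t \<in> topspace T"
      show "compose (topspace (btotal (triv_obj T (\<lambda>t. h (compose (topspace T) l f t)))))
          (triv_map T' (MapO F (T', f')) (s T' f'))
          (triv_map T (triv_obj T' (\<lambda>t. h (compose (topspace T') l f' t))) (\<lambda>t. enc (k t, \<one>))) (enc (t, \<one>))
        = compose (topspace (btotal (triv_obj T (\<lambda>t. h (compose (topspace T) l f t)))))
          l' (triv_map T (MapO F (T, f)) (s T f)) (enc (t, \<one>))"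
        using b1[OF t] b2[OF t] sn'[OF t] ext_mapsD(3)[OF *(3) t] t
        by (simp add: compose_eq triv_map_enc triv_totalI)
    qed
    then show "Cmp QS (?\<eta> (Cod (space_stack S) a)) (MapA ?H a) = Cmp QS (MapA F a) (?\<eta> (Dom (space_stack S) a))"
      by (simp add: a')
  qed
qed

end

section \<open>Extension of the structure group along a split open inclusion\<close>

text \<open>
  The data amount to a decomposition \<open>G = A \<times> G'\<close> of topological groups in
  which \<open>A\<close> is discrete: \<open>p\<close> is the projection to \<open>G'\<close>, and
  \<open>g (\<iota> (p g))\<^sup>-\<^sup>1\<close> is the component of \<open>g\<close> in
  \<open>A\<close>, so that the last assumption says that \<open>A\<close> is discrete.
\<close>

locale induced = qstack_coded G TG X actX U enc + Q': qstack G' TG' X actX' U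
  for G :: "'g monoid" (structure) and TG and X :: "'x topology" and actX and U :: "'u itself" and enc
    and G' :: "'h monoid" and TG' and actX' +
  fixes \<iota> :: "'h \<Rightarrow> 'g" and p :: "'g \<Rightarrow> 'h"
  assumes comm_G: "comm_group G"
    and \<iota>: "\<iota> \<in> hom G' G" and \<iota>_cont: "continuous_map TG' TG \<iota>"
    and p: "p \<in> hom G G'" and p_cont: "continuous_map TG TG' p"
    and p_\<iota>: "\<And>g. g \<in> carrier G' \<Longrightarrow> p (\<iota> g) = g"
    and act_\<iota>: "\<And>g x. g \<in> carrier G' \<Longrightarrow> x \<in> topspace X \<Longrightarrow> actX' g x = actX (\<iota> g) x"
    and discrete_quotient: "\<And>a. openin TG {g \<in> carrier G. g \<otimes> inv (\<iota> (p g)) = a}"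
begin

sublocale comm_group G by (fact comm_G)

definition piA where "piA g = g \<otimes> inv (\<iota> (p g))"

definition A where "A = {g \<in> carrier G. p g = \<one>\<^bsub>G'\<^esub>}"

definition TA where "TA = subtopology TG A"

lemma hom_closed [simp]:
  "g \<in> carrier G' \<Longrightarrow> \<iota> g \<in> carrier G" "h \<in> carrier G \<Longrightarrow> p h \<in> carrier G'"
  using \<iota> p by (auto simp: hom_def)

lemma hom_mults:
  "g \<in> carrier G' \<Longrightarrow> g' \<in> carrier G' \<Longrightarrow> \<iota> (g \<otimes>\<^bsub>G'\<^esub> g') = \<iota> g \<otimes> \<iota> g'"
  "h \<in> carrier G \<Longrightarrow> h' \<in> carrier G \<Longrightarrow> p (h \<otimes> h') = p h \<otimes>\<^bsub>G'\<^esub> p h'"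
  using \<iota> p by (auto simp: hom_def)

lemma hom_ones: "\<iota> \<one>\<^bsub>G'\<^esub> = \<one>" "p \<one> = \<one>\<^bsub>G'\<^esub>"
  using hom_one[OF \<iota> Q'.is_group is_group] hom_one[OF p is_group Q'.is_group] by auto

lemma hom_invs: "h \<in> carrier G \<Longrightarrow> p (inv h) = inv\<^bsub>G'\<^esub> (p h)"
  using group_hom.hom_inv[of G G' p h] p Q'.is_group is_group
  by (simp add: group_hom_def group_hom_axioms_def)

lemma topspace_TA [simp]: "topspace TA = A"
  unfolding TA_def A_def using topspace_TG by auto

lemma A_carrier: "a \<in> A \<Longrightarrow> a \<in> carrier G" "a \<in> A \<Longrightarrow> p a = \<one>\<^bsub>G'\<^esub>"
  by (simp_all add: A_def)

lemma one_A: "\<one> \<in> A" by (simp add: A_def hom_ones)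

lemma mult_A: "a \<in> A \<Longrightarrow> b \<in> A \<Longrightarrow> a \<otimes> b \<in> A"
  using Q'.r_one[OF Q'.one_closed] by (simp add: A_def hom_mults)

lemma inv_A: "a \<in> A \<Longrightarrow> inv a \<in> A"
  by (simp add: A_def hom_invs)

lemma piA_closed: "g \<in> carrier G \<Longrightarrow> piA g \<in> A"
  by (simp add: A_def piA_def hom_mults hom_invs p_\<iota>)

lemma piA_carrier: "g \<in> carrier G \<Longrightarrow> piA g \<in> carrier G"
  using piA_closed A_carrier by blast

lemma piA_A: "a \<in> A \<Longrightarrow> piA a = a"
  by (simp add: piA_def A_def hom_ones)

lemma piA_\<iota>: "g \<in> carrier G' \<Longrightarrow> piA (\<iota> g) = \<one>"
  by (simp add: piA_def p_\<iota>)

lemma piA_mult: "g \<in> carrier G \<Longrightarrow> h \<in> carrier G \<Longrightarrow> piA (g \<otimes> h) = piA g \<otimes> piA h"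
  by (simp add: piA_def hom_mults inv_mult_group m_ac)

lemma piA_decomp: "g \<in> carrier G \<Longrightarrow> piA g \<otimes> \<iota> (p g) = g"
  by (simp add: piA_def m_assoc)

lemma piA_trivial: "g \<in> carrier G \<Longrightarrow> piA g = \<one> \<Longrightarrow> \<iota> (p g) = g"
  using piA_decomp[of g] by simp

lemma piA_cont: "continuous_map TG TG piA"
  unfolding piA_def
  by (intro cont_mult cont_inv cont_comp[OF p_cont \<iota>_cont])
    (simp add: continuous_map_id[unfolded id_def])

lemma TA_cont:
  assumes "continuous_map Z TG f" "\<And>z. z \<in> topspace Z \<Longrightarrow> f z \<in> A"
  shows "continuous_map Z TA f"
  using assms unfolding TA_def by (simp add: continuous_map_in_subtopology image_subset_iff Pi_iff)

lemma TA_TG: "continuous_map Z TA f \<Longrightarrow> continuous_map Z TG f"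
  unfolding TA_def using continuous_map_into_fulltopology by blast

definition ind_total :: "'u topology \<Rightarrow> 'u topology"
  where "ind_total E = push_top (prod_topology E TA) enc"

text \<open>
  The associated bundle \<open>G \<times>\<^sub>G\<^sub>' E\<close>. Because \<open>G = A \<times>
  G'\<close>, it is simply \<open>E \<times> A\<close>, on which \<open>G\<close> acts by its two
  components; no quotient has to be formed.
\<close>

definition ind_obj :: "('u, 'h, 'x) bundle_obj \<Rightarrow> ('u, 'g, 'x) bundle_obj"
  where "ind_obj y = \<lparr>btarget = btarget y, btotal = ind_total (btotal y),
    bact = (\<lambda>g x. enc (bact y (p g) (fst (dec x)), piA g \<otimes> snd (dec x))),
    bproj = (\<lambda>x. bproj y (fst (dec x))),
    bmap = (\<lambda>x. actX (snd (dec x)) (bmap y (fst (dec x))))\<rparr>"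

lemma dec_enc_A [simp]: "a \<in> A \<Longrightarrow> dec (enc (e, a)) = (e, a)"
  by (simp add: A_carrier)

lemma ind_obj_sel [simp]:
  "btarget (ind_obj y) = btarget y" "btotal (ind_obj y) = ind_total (btotal y)"
  "a \<in> A \<Longrightarrow> bact (ind_obj y) g (enc (e, a)) = enc (bact y (p g) e, piA g \<otimes> a)"
  "a \<in> A \<Longrightarrow> bproj (ind_obj y) (enc (e, a)) = bproj y e"
  "a \<in> A \<Longrightarrow> bmap (ind_obj y) (enc (e, a)) = actX a (bmap y e)"
  by (simp_all add: ind_obj_def)

lemma ind_totalE:
  assumes "x \<in> topspace (ind_total E)"
  obtains e a where "e \<in> topspace E" "a \<in> A" "x = enc (e, a)"
  using assms by (auto simp: ind_total_def)

lemma ind_totalI: "e \<in> topspace E \<Longrightarrow> a \<in> A \<Longrightarrow> enc (e, a) \<in> topspace (ind_total E)"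
  by (auto simp: ind_total_def)

lemma ind_dec_cont:
  "continuous_map (ind_total E) E (\<lambda>x. fst (dec x))" "continuous_map (ind_total E) TA (\<lambda>x. snd (dec x))"
proof -
  have "continuous_map (ind_total E) (prod_topology E TA) dec"
    unfolding ind_total_def
    by (rule continuous_map_from_push_top, rule continuous_map_eq[OF continuous_map_id]) auto
  from continuous_map_fst_of[OF this] continuous_map_snd_of[OF this]
  show "continuous_map (ind_total E) E (\<lambda>x. fst (dec x))" "continuous_map (ind_total E) TA (\<lambda>x. snd (dec x))"
    by (simp_all add: o_def)
qed

lemma ind_enc_cont:
  assumes "continuous_map Z E a" "continuous_map Z TA b"
  shows "continuous_map Z (ind_total E) (\<lambda>z. enc (a z, b z))"
  unfolding ind_total_def
  by (rule cont_comp[OF continuous_map_pairedI[OF assms] continuous_map_push_top])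

lemma X_act_mult:
  "g \<in> carrier G \<Longrightarrow> h \<in> carrier G \<Longrightarrow> x \<in> topspace X \<Longrightarrow> actX (g \<otimes> h) x = actX g (actX h x)"
  using action_X by (simp add: continuous_action_def)

text \<open>
  A chart \<open>(\<sigma>, \<gamma>)\<close> of \<open>E\<close> gives the chart of \<open>E
  \<times> A\<close> with section \<open>(\<sigma>, 1)\<close> and coordinate \<open>(e, a)
  \<mapsto> a \<iota>(\<gamma> e)\<close>.
\<close>

lemma ind_obj_quotient_obj:
  assumes y: "Q'.qobj y"
  shows "qobj (ind_obj y)"
  unfolding quotient_obj_def
proof (intro conjI)
  note Y = Q'.quotient_objD[OF y]
  note b = Y(1)
  let ?E = "ind_total (btotal y)" and ?act = "bact (ind_obj y)" and ?\<pi> = "bproj (ind_obj y)"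
  have act: "continuous_action G TG ?E ?act"
    unfolding continuous_action_def
  proof (intro conjI ballI)
    have 1: "continuous_map (prod_topology TG ?E) (btotal y) (\<lambda>x. fst (dec (snd x)))"
      "continuous_map (prod_topology TG ?E) TA (\<lambda>x. snd (dec (snd x)))"
      by (rule cont_comp[OF continuous_map_snd ind_dec_cont(1)])
        (rule cont_comp[OF continuous_map_snd ind_dec_cont(2)])
    have 2: "continuous_map (prod_topology TG ?E) (btotal y) (\<lambda>x. bact y (p (fst x)) (fst (dec (snd x))))"
      by (rule Q'.action_cont[OF Q'.bundle_action[OF b] cont_comp[OF continuous_map_fst p_cont] 1(1)])
    have 3: "continuous_map (prod_topology TG ?E) TA (\<lambda>x. piA (fst x) \<otimes> snd (dec (snd x)))"
    proof (rule TA_cont)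
      show "continuous_map (prod_topology TG ?E) TG (\<lambda>x. piA (fst x) \<otimes> snd (dec (snd x)))"
        by (intro cont_mult cont_comp[OF continuous_map_fst piA_cont] TA_TG 1(2))
      fix x assume "x \<in> topspace (prod_topology TG ?E)"
      then have "fst x \<in> carrier G" "snd (dec (snd x)) \<in> A"
        using cont_closed[OF 1(2)] topspace_TG by auto
      then show "piA (fst x) \<otimes> snd (dec (snd x)) \<in> A" by (intro mult_A piA_closed)
    qed
    show "continuous_map (prod_topology TG ?E) ?E (\<lambda>(g, e). ?act g e)"
      using ind_enc_cont[OF 2 3] by (simp add: ind_obj_def case_prod_unfold)
    fix x assume "x \<in> topspace ?E"
    then obtain e a where x: "e \<in> points y" "a \<in> A" "x = enc (e, a)" by (rule ind_totalE)
    show "?act \<one> x = x"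
      using Q'.bundle_act_one[OF b x(1)] x piA_A[OF one_A] A_carrier(1)[OF x(2)] by (simp add: hom_ones)
    fix g h assume gh: "g \<in> carrier G" "h \<in> carrier G"
    show "?act (g \<otimes> h) x = ?act g (?act h x)"
      using Q'.bundle_act_mult[OF b _ _ x(1), of "p g" "p h"] gh x(2,3) mult_A[OF piA_closed[OF gh(2)] x(2)]
      by (simp add: hom_mults piA_mult m_assoc piA_carrier A_carrier)
  qed
  have inv\<pi>: "?\<pi> (?act g x) = ?\<pi> x" if g: "g \<in> carrier G" and x: "x \<in> topspace ?E" for g x
  proof -
    obtain e a where x: "e \<in> points y" "a \<in> A" "x = enc (e, a)" using x by (rule ind_totalE)
    show ?thesis
      using Q'.bundle_invariant[OF b hom_closed(2)[OF g] x(1)] x mult_A[OF piA_closed[OF g] x(2)] by simp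
  qed
  have "principal_bundle G TG (btarget y) ?E ?act ?\<pi>"
  proof (rule principal_bundleI[OF act])
    show "?\<pi> (?act g x) = ?\<pi> x" if "g \<in> carrier G" "x \<in> topspace ?E" for g x
      using inv\<pi> that by simp
    show c\<pi>: "continuous_map ?E (btarget y) ?\<pi>"
      unfolding ind_obj_def using cont_comp[OF ind_dec_cont(1) Q'.bundle_proj[OF b]] by simp
    fix t assume "t \<in> topspace (btarget y)"
    then obtain V \<sigma> \<gamma> where t: "t \<in> V" and c: "Q'.chart (btarget y) (btotal y) (bact y) (bproj y) V \<sigma> \<gamma>"
      by (rule Q'.bundle_chart[OF b])
    note c = Q'.chartD[OF b c]
    let ?\<gamma> = "\<lambda>x. \<iota> (\<gamma> (fst (dec x))) \<otimes> snd (dec x)"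
    have "chart (btarget y) ?E ?act ?\<pi> V (\<lambda>u. enc (\<sigma> u, \<one>)) ?\<gamma>"
      unfolding chart_def
    proof (intro conjI ballI impI)
      show "openin (btarget y) V" by (fact c(1))
      show "continuous_map (subtopology (btarget y) V) ?E (\<lambda>u. enc (\<sigma> u, \<one>))"
        using one_A by (intro ind_enc_cont c(3)) simp
      let ?S = "{x \<in> topspace ?E. ?\<pi> x \<in> V}"
      have 1: "continuous_map (subtopology ?E ?S) (subtopology (btotal y) {e \<in> points y. bproj y e \<in> V})
          (\<lambda>x. fst (dec x))"
      proof (rule cont_subtopologies[OF ind_dec_cont(1)])
        fix x assume "x \<in> topspace ?E" "x \<in> ?S"
        then show "fst (dec x) \<in> {e \<in> points y. bproj y e \<in> V}"
          by (auto elim!: ind_totalE)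
      qed
      show "continuous_map (subtopology ?E ?S) TG ?\<gamma>"
        by (intro cont_mult cont_comp[OF cont_comp[OF 1 c(4)] \<iota>_cont]
            TA_TG continuous_map_from_subtopology ind_dec_cont(2))
      show "?\<pi> (enc (\<sigma> u, \<one>)) = u" if "u \<in> V" for u using c(5)[OF that] one_A by simp
      show "?act (?\<gamma> x) (enc (\<sigma> (?\<pi> x), \<one>)) = x" if x: "x \<in> topspace ?E" "?\<pi> x \<in> V" for x
      proof -
        obtain e a where x': "e \<in> points y" "a \<in> A" "x = enc (e, a)" using x(1) by (rule ind_totalE)
        have e: "bproj y e \<in> V" using x x' by simp
        have g: "\<gamma> e \<in> carrier G'" using c(8)[OF x'(1) e] .
        have "p (\<iota> (\<gamma> e) \<otimes> a) = \<gamma> e" "piA (\<iota> (\<gamma> e) \<otimes> a) = a"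
          using g x'(2) A_carrier[OF x'(2)] by (simp_all add: hom_mults p_\<iota> piA_mult piA_\<iota> piA_A)
        then show ?thesis using c(7)[OF x'(1) e] x' one_A A_carrier by simp
      qed
      show "?\<gamma> (?act g (enc (\<sigma> u, \<one>))) = g" if "u \<in> V" "g \<in> carrier G" for u g
        using c(9)[OF that(1) hom_closed(2)[OF that(2)]] that piA_closed[OF that(2)] one_A
          piA_decomp[OF that(2)] by (simp add: m_comm piA_carrier)
    qed
    then show "\<exists>V \<sigma> \<gamma>. t \<in> V \<and> chart (btarget y) ?E ?act ?\<pi> V \<sigma> \<gamma>" using t by blast
  qed
  then show "bundle_of (ind_obj y)" by simp
  show "continuous_map (btotal (ind_obj y)) X (bmap (ind_obj y))"
    unfolding ind_obj_def
    using action_cont[OF action_X TA_TG[OF ind_dec_cont(2)] cont_comp[OF ind_dec_cont(1) Y(2)]]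
    by simp
  show "equivariant G (btotal (ind_obj y)) (bact (ind_obj y)) actX (bmap (ind_obj y))"
    unfolding equivariant_def
  proof (intro ballI)
    fix g x assume g: "g \<in> carrier G" and "x \<in> points (ind_obj y)"
    then have "x \<in> topspace ?E" by simp
    then obtain e a where x: "e \<in> points y" "a \<in> A" "x = enc (e, a)" by (rule ind_totalE)
    have m: "bmap y e \<in> topspace X" using Y(4)[OF x(1)] .
    have a: "a \<in> carrier G" using A_carrier x by blast
    have "bmap (ind_obj y) (?act g x) = actX (piA g \<otimes> a) (actX (\<iota> (p g)) (bmap y e))"
      using x mult_A[OF piA_closed[OF g] x(2)] Y(3)[OF hom_closed(2)[OF g] x(1)]
        act_\<iota>[OF hom_closed(2)[OF g] m] by simp
    also have "\<dots> = actX (piA g \<otimes> a \<otimes> \<iota> (p g)) (bmap y e)"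
      using g a m by (intro X_act_mult[symmetric]) (simp_all add: piA_carrier)
    also have "piA g \<otimes> a \<otimes> \<iota> (p g) = g \<otimes> a"
      using piA_decomp[OF g] g a m_ac(1,2) by (metis hom_closed piA_carrier m_comm m_assoc)
    also have "actX (g \<otimes> a) (bmap y e) = actX g (bmap (ind_obj y) x)"
      using x g a m by (simp add: X_act_mult)
    finally show "bmap (ind_obj y) (?act g x) = actX g (bmap (ind_obj y) x)" .
  qed
qed

definition ind_arrow_map where
  "ind_arrow_map P k = (\<lambda>x\<in>topspace (ind_total (btotal P)). enc (k (fst (dec x)), snd (dec x)))"

lemma ind_arrow_map_enc:
  "e \<in> points P \<Longrightarrow> a \<in> A \<Longrightarrow> ind_arrow_map P k (enc (e, a)) = enc (k e, a)"
  by (simp add: ind_arrow_map_def ind_totalI)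

definition ind where
  "ind = \<lparr>MapO = ind_obj, MapA = (\<lambda>(P, P', h, k). (ind_obj P, ind_obj P', h, ind_arrow_map P k))\<rparr>"

lemma ind_sel [simp]:
  "MapO ind y = ind_obj y"
  "MapA ind (P, P', h, k) = (ind_obj P, ind_obj P', h, ind_arrow_map P k)"
  by (simp_all add: ind_def)

lemma ind_map_eqI:
  assumes "k \<in> extensional (topspace (ind_total E))" "k' \<in> extensional (topspace (ind_total E))"
    and "\<And>e a. e \<in> topspace E \<Longrightarrow> a \<in> A \<Longrightarrow> k (enc (e, a)) = k' (enc (e, a))"
  shows "k = k'"
  by (rule extensionalityI[OF assms(1,2)]) (use assms(3) in \<open>auto elim!: ind_totalE\<close>)

lemma ind_morphism: "stack_morphism Q'.QS QS ind"
  unfolding stack_morphism_def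
proof (intro conjI ballI impI)
  fix y assume "y \<in> Obj Q'.QS"
  then have y: "Q'.qobj y" by simp
  show "MapO ind y \<in> Obj QS" using ind_obj_quotient_obj[OF y] by simp
  show "Base QS (MapO ind y) = Base Q'.QS y" by simp
  have "ind_arrow_map y (ident (btotal y)) = ident (ind_total (btotal y))"
    by (rule ind_map_eqI[where E = "btotal y"]) (simp_all add: ind_arrow_map_def ind_totalI)
  then show "MapA ind (Idn Q'.QS y) = Idn QS (MapO ind y)" by simp
next
  fix a assume a: "a \<in> Arr Q'.QS"
  obtain P P' h k where a': "a = (P, P', h, k)" and aA: "(P, P', h, k) \<in> Arr Q'.QS" using Q'.QS_ArrE[OF a] .
  note D = Q'.QS_ArrD[OF aA]
  have "(ind_obj P, ind_obj P', h, ind_arrow_map P k) \<in> Arr QS"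
  proof (rule QS_ArrI[OF ind_obj_quotient_obj[OF D(1)] ind_obj_quotient_obj[OF D(2)]])
    show "h \<in> ext_maps (btarget (ind_obj P)) (btarget (ind_obj P'))" using D(3) by simp
    show "ind_arrow_map P k \<in> ext_maps (btotal (ind_obj P)) (btotal (ind_obj P'))"
      unfolding ind_arrow_map_def ind_obj_sel(2)
      by (rule ext_maps_restrict[OF ind_enc_cont[OF cont_comp[OF ind_dec_cont(1) ext_mapsD(1)[OF D(4)]] ind_dec_cont(2)]])
    fix x assume "x \<in> points (ind_obj P)"
    then have "x \<in> topspace (ind_total (btotal P))" by simp
    then obtain e b where x: "e \<in> points P" "b \<in> A" "x = enc (e, b)" by (rule ind_totalE)
    have ke: "ind_arrow_map P k x = enc (k e, b)" using x ind_arrow_map_enc by simp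
    show "bmap (ind_obj P') (ind_arrow_map P k x) = bmap (ind_obj P) x"
      unfolding ke using x D(6)[OF x(1)] by simp
    show "bproj (ind_obj P') (ind_arrow_map P k x) = h (bproj (ind_obj P) x)"
      unfolding ke using x D(7)[OF x(1)] by simp
    fix g assume g: "g \<in> carrier G"
    show "ind_arrow_map P k (bact (ind_obj P) g x) = bact (ind_obj P') g (ind_arrow_map P k x)"
      unfolding ke using x D(8)[OF hom_closed(2)[OF g] x(1)] mult_A[OF piA_closed[OF g] x(2)]
        Q'.bundle_act_closed[OF Q'.quotient_objD(1)[OF D(1)] hom_closed(2)[OF g] x(1)]
      by (simp add: ind_arrow_map_enc)
  qed
  then show "MapA ind a \<in> Arr QS" by (simp add: a')
  show "Dom QS (MapA ind a) = MapO ind (Dom Q'.QS a)" "Cod QS (MapA ind a) = MapO ind (Cod Q'.QS a)"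
    "BaseMap QS (MapA ind a) = BaseMap Q'.QS a"
    by (simp_all add: a')
  fix b assume "b \<in> Arr Q'.QS" "Dom Q'.QS b = Cod Q'.QS a"
  then obtain P'' h' k' where b': "b = (P', P'', h', k')" by (cases b) (simp add: a')
  have "ind_arrow_map P (compose (points P) k' k)
      = compose (topspace (ind_total (btotal P))) (ind_arrow_map P' k') (ind_arrow_map P k)"
    by (rule ind_map_eqI[where E = "btotal P"])
      (use ext_mapsD(3)[OF D(4)] in \<open>simp_all add: ind_arrow_map_enc compose_eq ind_totalI\<close>,
        simp add: ind_arrow_map_def)
  then show "MapA ind (Cmp Q'.QS b a) = Cmp QS (MapA ind b) (MapA ind a)"
    by (simp add: a' b')
qed

end

section \<open>Fibre products\<close>

lemma stack_morphism_cong: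
  assumes X: "stk_category X" and F': "stack_morphism X Y F'"
    and eq: "\<And>x. x \<in> Obj X \<Longrightarrow> MapO F x = MapO F' x" "\<And>a. a \<in> Arr X \<Longrightarrow> MapA F a = MapA F' a"
  shows "stack_morphism X Y F"
  unfolding stack_morphism_def
proof (intro conjI ballI impI)
  note X = stk_categoryD[OF X] and F' = stack_morphismD[OF F']
  fix x assume x: "x \<in> Obj X"
  show "MapO F x \<in> Obj Y" "Base Y (MapO F x) = Base X x" "MapA F (Idn X x) = Idn Y (MapO F x)"
    using F'(1-3)[OF x] eq(1)[OF x] eq(2)[OF X(1)[OF x]] by simp_all
next
  note X = stk_categoryD[OF X] and F' = stack_morphismD[OF F']
  fix a assume a: "a \<in> Arr X"
  show "MapA F a \<in> Arr Y" "Dom Y (MapA F a) = MapO F (Dom X a)" "Cod Y (MapA F a) = MapO F (Cod X a)"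
    "BaseMap Y (MapA F a) = BaseMap X a"
    using F'(4-7)[OF a] eq(2)[OF a] eq(1)[OF X(4)[OF a]] eq(1)[OF X(5)[OF a]] by simp_all
  fix b assume b: "b \<in> Arr X" "Dom X b = Cod X a"
  show "MapA F (Cmp X b a) = Cmp Y (MapA F b) (MapA F a)"
    using F'(8)[OF a b] eq(2)[OF a] eq(2)[OF b(1)] eq(2)[OF X(8)[OF a b]] by simp
qed

lemma fiber_product_sel [simp]:
  "Dom (fiber_product Y W X F K) (s, t, a, b) = s" "Cod (fiber_product Y W X F K) (s, t, a, b) = t"
  "Idn (fiber_product Y W X F K) (y, w, \<alpha>) = ((y, w, \<alpha>), (y, w, \<alpha>), Idn Y y, Idn W w)"
  "Cmp (fiber_product Y W X F K) (t, v, a', b') (s, t', a, b) = (s, v, Cmp Y a' a, Cmp W b' b)"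
  "Base (fiber_product Y W X F K) (y, w, \<alpha>) = Base Y y"
  "BaseMap (fiber_product Y W X F K) (s, t, a, b) = BaseMap Y a"
  by (simp_all add: fiber_product_def Let_def)

lemma fiber_product_Obj:
  "(y, w, \<alpha>) \<in> Obj (fiber_product Y W X F K) \<longleftrightarrow> y \<in> Obj Y \<and> w \<in> Obj W \<and> Base Y y = Base W w \<and>
     vertical_iso X (MapO F y) (MapO K w) \<alpha>"
  by (simp add: fiber_product_def Let_def)

lemma fiber_product_Arr:
  "((y, w, \<alpha>), (y', w', \<alpha>'), a, b) \<in> Arr (fiber_product Y W X F K) \<longleftrightarrow>
     (y, w, \<alpha>) \<in> Obj (fiber_product Y W X F K) \<and> (y', w', \<alpha>') \<in> Obj (fiber_product Y W X F K) \<and>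
     a \<in> Arr Y \<and> Dom Y a = y \<and> Cod Y a = y' \<and> b \<in> Arr W \<and> Dom W b = w \<and> Cod W b = w' \<and>
     BaseMap Y a = BaseMap W b \<and> Cmp X \<alpha>' (MapA F a) = Cmp X (MapA K b) \<alpha>"
  by (simp add: fiber_product_def Let_def)

lemma fibre_arrow_cases:
  obtains y w \<alpha> y' w' \<alpha>' a b where "c = ((y, w, \<alpha>), (y', w', \<alpha>'), a, b)"
  using that[of "fst (fst c)" "fst (snd (fst c))" "snd (snd (fst c))" "fst (fst (snd c))"
      "fst (snd (fst (snd c)))" "snd (snd (fst (snd c)))" "fst (snd (snd c))" "snd (snd (snd c))"] by simp

locale fibre_square =
  fixes Y :: "('u, 'o, 'm) stk" and W :: "('u, 'p, 'n) stk" and X :: "('u, 'q, 'l) stk" and F K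
  assumes Y: "stk_category Y" and W: "stk_category W" and X: "stk_category X"
    and F: "stack_morphism Y X F" and K: "stack_morphism W X K"
begin

abbreviation FP where "FP \<equiv> fiber_product Y W X F K"

lemma fp_composite:
  assumes c: "((y, w, \<alpha>), (y', w', \<alpha>'), a, b) \<in> Arr FP"
    and c': "((y', w', \<alpha>'), (y'', w'', \<alpha>''), a', b') \<in> Arr FP"
  shows "((y, w, \<alpha>), (y'', w'', \<alpha>''), Cmp Y a' a, Cmp W b' b) \<in> Arr FP"
proof -
  note Y = stk_categoryD[OF Y] and W = stk_categoryD[OF W] and X = stk_categoryD[OF X]
  note F = stack_morphismD[OF F] and K = stack_morphismD[OF K]
  note C = c[unfolded fiber_product_Arr fiber_product_Obj] and C' = c'[unfolded fiber_product_Arr fiber_product_Obj]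
  have a: "a \<in> Arr Y" "Dom Y a = y" "Cod Y a = y'" and b: "b \<in> Arr W" "Dom W b = w" "Cod W b = w'"
    and a': "a' \<in> Arr Y" "Dom Y a' = y'" "Cod Y a' = y''" and b': "b' \<in> Arr W" "Dom W b' = w'" "Cod W b' = w''"
    and m: "BaseMap Y a = BaseMap W b" "BaseMap Y a' = BaseMap W b'"
    and e: "Cmp X \<alpha>' (MapA F a) = Cmp X (MapA K b) \<alpha>" "Cmp X \<alpha>'' (MapA F a') = Cmp X (MapA K b') \<alpha>'"
    and B: "Base Y y = Base W w"
    and v: "vertical_iso X (MapO F y) (MapO K w) \<alpha>" "vertical_iso X (MapO F y') (MapO K w') \<alpha>'"
      "vertical_iso X (MapO F y'') (MapO K w'') \<alpha>''"
    using C C' by simp_all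
  note v1 = vertical_isoD(1-3)[OF v(1)] and v2 = vertical_isoD(1-3)[OF v(2)] and v3 = vertical_isoD(1-3)[OF v(3)]
  note Fa = F(4-6)[OF a(1)] and Fa' = F(4-6)[OF a'(1)] and Kb = K(4-6)[OF b(1)] and Kb' = K(4-6)[OF b'(1)]
  have "Cmp X \<alpha>'' (MapA F (Cmp Y a' a)) = Cmp X \<alpha>'' (Cmp X (MapA F a') (MapA F a))"
    using F(8)[OF a(1) a'(1)] a a' by simp
  also have "\<dots> = Cmp X (Cmp X (MapA K b') \<alpha>') (MapA F a)"
    using X(11)[OF Fa(1) Fa'(1) v3(1)] Fa Fa' v3 a a' e(2) by simp
  also have "\<dots> = Cmp X (MapA K b') (Cmp X (MapA K b) \<alpha>)"
    using X(11)[OF Fa(1) v2(1) Kb'(1)] Fa Kb' v2 a b' e(1) by simp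
  also have "\<dots> = Cmp X (MapA K (Cmp W b' b)) \<alpha>"
    using X(11)[OF v1(1) Kb(1) Kb'(1)] Kb Kb' v1 b b' K(8)[OF b(1) b'(1)] by simp
  finally have E: "Cmp X \<alpha>'' (MapA F (Cmp Y a' a)) = Cmp X (MapA K (Cmp W b' b)) \<alpha>" .
  have "BaseMap Y (Cmp Y a' a) = BaseMap W (Cmp W b' b)"
    using Y(14)[OF a(1) a'(1)] W(14)[OF b(1) b'(1)] a a' b b' m B by simp
  then show ?thesis
    unfolding fiber_product_Arr
    using c c' Y(8-10)[OF a(1) a'(1)] W(8-10)[OF b(1) b'(1)] a a' b b' E
    by (simp add: fiber_product_Arr)
qed

lemma fp_identity:
  assumes "(y, w, \<alpha>) \<in> Obj FP"
  shows "((y, w, \<alpha>), (y, w, \<alpha>), Idn Y y, Idn W w) \<in> Arr FP"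
proof -
  note Y = stk_categoryD[OF Y] and W = stk_categoryD[OF W] and X = stk_categoryD[OF X]
  have *: "y \<in> Obj Y" "w \<in> Obj W" "Base Y y = Base W w" "vertical_iso X (MapO F y) (MapO K w) \<alpha>"
    using assms by (simp_all add: fiber_product_Obj)
  note v = vertical_isoD(1-3)[OF *(4)]
  show ?thesis
    unfolding fiber_product_Arr
    using assms Y(1-3,12)[OF *(1)] W(1-3,12)[OF *(2)] *(3) X(6,7)[OF v(1)] v
      stack_morphismD(3)[OF F *(1)] stack_morphismD(3)[OF K *(2)] by simp
qed

lemma fp_category: "stk_category FP"
  unfolding stk_category_def
proof (intro conjI ballI impI)
  fix x assume x: "x \<in> Obj FP"
  obtain y w \<alpha> where x': "x = (y, w, \<alpha>)" by (rule prod_cases3)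
  have y: "y \<in> Obj Y" using x by (simp add: x' fiber_product_Obj)
  show "Idn FP x \<in> Arr FP" "Dom FP (Idn FP x) = x" "Cod FP (Idn FP x) = x"
    "BaseMap FP (Idn FP x) = ident (Base FP x)"
    using fp_identity x stk_categoryD(12)[OF Y y] by (simp_all add: x')
next
  fix c assume c: "c \<in> Arr FP"
  obtain y w \<alpha> y' w' \<alpha>' a b where c': "c = ((y, w, \<alpha>), (y', w', \<alpha>'), a, b)" by (rule fibre_arrow_cases)
  have *: "(y, w, \<alpha>) \<in> Obj FP" "(y', w', \<alpha>') \<in> Obj FP"
     "a \<in> Arr Y" "Dom Y a = y" "Cod Y a = y'" "b \<in> Arr W" "Dom W b = w" "Cod W b = w'"
    using c by (simp_all add: c' fiber_product_Arr)
  show "Dom FP c \<in> Obj FP" "Cod FP c \<in> Obj FP" using * by (simp_all add: c')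
  show "Cmp FP c (Idn FP (Dom FP c)) = c" "Cmp FP (Idn FP (Cod FP c)) c = c"
    using stk_categoryD(6,7)[OF Y *(3)] stk_categoryD(6,7)[OF W *(6)] * by (simp_all add: c')
  show "BaseMap FP c \<in> ext_maps (Base FP (Dom FP c)) (Base FP (Cod FP c))"
    using stk_categoryD(13)[OF Y *(3)] * by (simp add: c')
  fix d assume d: "d \<in> Arr FP" and cd: "Dom FP d = Cod FP c"
  obtain y1 w1 \<alpha>1 y'' w'' \<alpha>'' a' b' where d1: "d = ((y1, w1, \<alpha>1), (y'', w'', \<alpha>''), a', b')" by (rule fibre_arrow_cases)
  then have d': "d = ((y', w', \<alpha>'), (y'', w'', \<alpha>''), a', b')" using cd by (simp add: c')
  have **: "a' \<in> Arr Y" "Dom Y a' = y'" using d by (simp_all add: d' fiber_product_Arr)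
  show "Cmp FP d c \<in> Arr FP" using fp_composite[OF c[unfolded c'] d[unfolded d']] by (simp add: c' d')
  show "Dom FP (Cmp FP d c) = Dom FP c" "Cod FP (Cmp FP d c) = Cod FP d" by (simp_all add: c' d')
  show "BaseMap FP (Cmp FP d c) = compose (topspace (Base FP (Dom FP c))) (BaseMap FP d) (BaseMap FP c)"
    using stk_categoryD(14)[OF Y *(3) **(1)] * ** by (simp add: c' d')
next
  fix c d e assume c: "c \<in> Arr FP" and d: "d \<in> Arr FP" and e: "e \<in> Arr FP"
    and cd: "Dom FP d = Cod FP c" and de: "Dom FP e = Cod FP d"
  obtain y w \<alpha> y' w' \<alpha>' a b where c': "c = ((y, w, \<alpha>), (y', w', \<alpha>'), a, b)" by (rule fibre_arrow_cases)
  obtain y1 w1 \<alpha>1 y'' w'' \<alpha>'' a' b' where d1: "d = ((y1, w1, \<alpha>1), (y'', w'', \<alpha>''), a', b')" by (rule fibre_arrow_cases)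
  obtain y2 w2 \<alpha>2 y3 w3 \<alpha>3 a'' b'' where e1: "e = ((y2, w2, \<alpha>2), (y3, w3, \<alpha>3), a'', b'')" by (rule fibre_arrow_cases)
  have d': "d = ((y', w', \<alpha>'), (y'', w'', \<alpha>''), a', b')" using cd by (simp add: c' d1)
  have e': "e = ((y'', w'', \<alpha>''), (y3, w3, \<alpha>3), a'', b'')" using de by (simp add: d' e1)
  have "a \<in> Arr Y" "Cod Y a = y'" "b \<in> Arr W" "Cod W b = w'"
    "a' \<in> Arr Y" "Dom Y a' = y'" "Cod Y a' = y''" "b' \<in> Arr W" "Dom W b' = w'" "Cod W b' = w''"
    "a'' \<in> Arr Y" "Dom Y a'' = y''" "b'' \<in> Arr W" "Dom W b'' = w''"
    using c d e by (simp_all add: c' d' e' fiber_product_Arr)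
  then show "Cmp FP e (Cmp FP d c) = Cmp FP (Cmp FP e d) c"
    by (simp add: c' d' e' stk_categoryD(11)[OF Y] stk_categoryD(11)[OF W])
qed

text \<open>
  An arrow of a fibre product is invertible when both components are: the inverses of the
  components again satisfy the compatibility condition.
\<close>

lemma fp_vertical_iso:
  assumes c: "((y, w, \<alpha>), (y', w', \<alpha>'), a, b) \<in> Arr FP"
    and a: "vertical_iso Y y y' a" and b: "vertical_iso W w w' b"
  shows "vertical_iso FP (y, w, \<alpha>) (y', w', \<alpha>') ((y, w, \<alpha>), (y', w', \<alpha>'), a, b)"
proof -
  note Y' = stk_categoryD[OF Y] and W' = stk_categoryD[OF W] and X' = stk_categoryD[OF X]
  obtain a' where a': "vertical_iso Y y' y a'" "Cmp Y a' a = Idn Y y" "Cmp Y a a' = Idn Y y'"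
    by (rule vertical_iso_inverse[OF Y a])
  obtain b' where b': "vertical_iso W w' w b'" "Cmp W b' b = Idn W w" "Cmp W b b' = Idn W w'"
    by (rule vertical_iso_inverse[OF W b])
  have z: "(y, w, \<alpha>) \<in> Obj FP" "(y', w', \<alpha>') \<in> Obj FP" and e: "Cmp X \<alpha>' (MapA F a) = Cmp X (MapA K b) \<alpha>"
    using c by (simp_all add: fiber_product_Arr)
  have O: "y \<in> Obj Y" "w \<in> Obj W" "y' \<in> Obj Y" "w' \<in> Obj W" "Base Y y = Base W w" "Base Y y' = Base W w'"
    "vertical_iso X (MapO F y) (MapO K w) \<alpha>" "vertical_iso X (MapO F y') (MapO K w') \<alpha>'"
    using z by (simp_all add: fiber_product_Obj)
  note va = vertical_isoD[OF a] and vb = vertical_isoD[OF b] and va' = vertical_isoD[OF a'(1)] and vb' = vertical_isoD[OF b'(1)]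
  note v = vertical_isoD(1-3)[OF O(7)] and v' = vertical_isoD(1-3)[OF O(8)]
  note Fa = stack_morphismD(4-6)[OF F va(1)] and Fa' = stack_morphismD(4-6)[OF F va'(1)]
  note Kb = stack_morphismD(4-6)[OF K vb(1)] and Kb' = stack_morphismD(4-6)[OF K vb'(1)]
  have KK: "Cmp X (MapA K b') (MapA K b) = Idn X (MapO K w)"
    using stack_morphismD(8)[OF K vb(1) vb'(1)] stack_morphismD(3)[OF K O(2)] b'(2) vb vb' by simp
  have FF: "Cmp X (MapA F a) (MapA F a') = Idn X (MapO F y')"
    using stack_morphismD(8)[OF F va'(1) va(1)] stack_morphismD(3)[OF F O(3)] a'(3) va va' by simp
  have "Cmp X \<alpha> (MapA F a') = Cmp X (Cmp X (Cmp X (MapA K b') (MapA K b)) \<alpha>) (MapA F a')"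
    unfolding KK using X'(7)[OF v(1)] v by simp
  also have "\<dots> = Cmp X (Cmp X (MapA K b') (Cmp X (MapA K b) \<alpha>)) (MapA F a')"
    using X'(11)[OF v(1) Kb(1) Kb'(1)] v Kb Kb' vb vb' by simp
  also have "\<dots> = Cmp X (Cmp X (MapA K b') (Cmp X \<alpha>' (MapA F a))) (MapA F a')" using e by simp
  also have "\<dots> = Cmp X (Cmp X (Cmp X (MapA K b') \<alpha>') (MapA F a)) (MapA F a')"
    using X'(11)[OF Fa(1) v'(1) Kb'(1)] v' Fa Kb' va vb' by simp
  also have "\<dots> = Cmp X (Cmp X (MapA K b') \<alpha>') (Cmp X (MapA F a) (MapA F a'))"
    using X'(11)[OF Fa'(1) Fa(1) X'(8)[OF v'(1) Kb'(1)]] X'(9)[OF v'(1) Kb'(1)] v' Fa Fa' Kb' va va' vb' by simp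
  also have "\<dots> = Cmp X (MapA K b') \<alpha>'"
    unfolding FF using X'(6)[OF X'(8)[OF v'(1) Kb'(1)]] X'(9)[OF v'(1) Kb'(1)] v' Kb' vb' by simp
  finally have "((y', w', \<alpha>'), (y, w, \<alpha>), a', b') \<in> Arr FP"
    unfolding fiber_product_Arr using z va' vb' O by simp
  then show ?thesis
    unfolding vertical_iso_def
    using c va a' b' by (auto intro!: bexI[of _ "((y', w', \<alpha>'), (y, w, \<alpha>), a', b')"])
qed

end

section \<open>Orbit spaces and reductions of the structure group\<close>

text \<open>
  A morphism \<open>K\<close> from a space \<open>W\<close> of the site to \<open>[X/G]\<close>;
  here \<open>W\<close> can represent itself. Its representing bundle \<open>rep\<close> plays the
  role of \<open>P \<rightarrow> W\<close> in the argument.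
\<close>

locale induced_cover = induced G TG X actX U enc G' TG' actX' \<iota> p +
    represented G TG X actX U W W "ident W" "\<lambda>t. t" K
  for G :: "'g monoid" (structure) and TG and X :: "'x topology" and actX and U :: "'u itself" and enc
    and G' :: "'h monoid" and TG' and actX' \<iota> p and W :: "'u topology" and K
begin

lemma class_map_eq: "f \<in> ext_maps T W \<Longrightarrow> class_map T f = f"
  unfolding class_map_def by (rule extensionalityI[where A = "topspace T"]) (simp_all add: ext_mapsD(2))

lemma class_lift_arrow': "f \<in> ext_maps T W \<Longrightarrow> (MapO K (T, f), rep, f, class_lift T f) \<in> Arr QS"
  using class_lift_arrow(1)[of f T] by (simp add: class_map_eq)

lemmas repb = quotient_objD(1)[OF rep_obj(1)]

text \<open>
  A chosen point of each \<open>G'\<close>-orbit. Points of \<open>P/G'\<close> are represented by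
  these choices in order to remain in the universe type.
\<close>

definition orbit_rep where "orbit_rep e = (SOME e'. \<exists>g\<in>carrier G'. e' = bact rep (\<iota> g) e)"

lemma orbit_rep_ex:
  assumes "e \<in> points rep"
  obtains g where "g \<in> carrier G'" "orbit_rep e = bact rep (\<iota> g) e"
proof -
  have "\<exists>e'. \<exists>g\<in>carrier G'. e' = bact rep (\<iota> g) e" using Q'.one_closed by blast
  from someI_ex[OF this] that show ?thesis unfolding orbit_rep_def by blast
qed

lemma orbit_rep_closed: "e \<in> points rep \<Longrightarrow> orbit_rep e \<in> points rep"
  by (metis orbit_rep_ex bundle_act_closed[OF repb] hom_closed(1))

lemma orbit_rep_proj: "e \<in> points rep \<Longrightarrow> bproj rep (orbit_rep e) = bproj rep e"
  by (metis orbit_rep_ex bundle_invariant[OF repb] hom_closed(1))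

lemma orbit_rep_act:
  assumes e: "e \<in> points rep" and g: "g \<in> carrier G'"
  shows "orbit_rep (bact rep (\<iota> g) e) = orbit_rep e"
proof -
  have "(\<exists>h\<in>carrier G'. e' = bact rep (\<iota> h) (bact rep (\<iota> g) e)) = (\<exists>h\<in>carrier G'. e' = bact rep (\<iota> h) e)" for e'
  proof
    assume "\<exists>h\<in>carrier G'. e' = bact rep (\<iota> h) (bact rep (\<iota> g) e)"
    then obtain h where h: "h \<in> carrier G'" "e' = bact rep (\<iota> h) (bact rep (\<iota> g) e)" by blast
    then have "e' = bact rep (\<iota> (h \<otimes>\<^bsub>G'\<^esub> g)) e"
      using bundle_act_mult[OF repb _ _ e] g by (simp add: hom_mults)
    then show "\<exists>h\<in>carrier G'. e' = bact rep (\<iota> h) e" using h g by blast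
  next
    assume "\<exists>h\<in>carrier G'. e' = bact rep (\<iota> h) e"
    then obtain h where h: "h \<in> carrier G'" "e' = bact rep (\<iota> h) e" by blast
    have "bact rep (\<iota> (h \<otimes>\<^bsub>G'\<^esub> inv\<^bsub>G'\<^esub> g)) (bact rep (\<iota> g) e) = bact rep (\<iota> (h \<otimes>\<^bsub>G'\<^esub> inv\<^bsub>G'\<^esub> g \<otimes>\<^bsub>G'\<^esub> g)) e"
      using bundle_act_mult[OF repb _ _ e, of "\<iota> (h \<otimes>\<^bsub>G'\<^esub> inv\<^bsub>G'\<^esub> g)" "\<iota> g"] h g
      by (simp add: hom_mults(1)[of "h \<otimes>\<^bsub>G'\<^esub> inv\<^bsub>G'\<^esub> g" g])
    then have "e' = bact rep (\<iota> (h \<otimes>\<^bsub>G'\<^esub> inv\<^bsub>G'\<^esub> g)) (bact rep (\<iota> g) e)"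
      using h g by (simp add: Q'.m_assoc)
    then show "\<exists>h\<in>carrier G'. e' = bact rep (\<iota> h) (bact rep (\<iota> g) e)"
      using h g Q'.m_closed Q'.inv_closed by blast
  qed
  then show ?thesis unfolding orbit_rep_def by simp
qed

text \<open>
  Within a \<open>G\<close>-orbit, the \<open>G'\<close>-orbits are distinguished by the component
  in \<open>A\<close>.
\<close>

lemma orbit_rep_act_iff:
  assumes e: "e \<in> points rep" and g: "g \<in> carrier G"
  shows "orbit_rep (bact rep g e) = orbit_rep e \<longleftrightarrow> piA g = \<one>"
proof
  assume "piA g = \<one>"
  then have "g = \<iota> (p g)" using piA_trivial[OF g] by simp
  then show "orbit_rep (bact rep g e) = orbit_rep e" using orbit_rep_act[OF e hom_closed(2)[OF g]] by simp
next
  assume eq: "orbit_rep (bact rep g e) = orbit_rep e"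
  have ge: "bact rep g e \<in> points rep" using bundle_act_closed[OF repb g e] .
  obtain h where h: "h \<in> carrier G'" "orbit_rep e = bact rep (\<iota> h) e" using orbit_rep_ex[OF e] .
  obtain k where k: "k \<in> carrier G'" "orbit_rep (bact rep g e) = bact rep (\<iota> k) (bact rep g e)" using orbit_rep_ex[OF ge] .
  have "bact rep (\<iota> k \<otimes> g) e = bact rep (\<iota> h) e"
    using eq h k g bundle_act_mult[OF repb _ g e, of "\<iota> k"] by simp
  then have *: "\<iota> k \<otimes> g = \<iota> h" using bundle_free[OF repb e] h k g by simp
  have "piA (\<iota> k \<otimes> g) = piA g" using k g by (simp add: piA_mult piA_\<iota> piA_carrier)
  then show "piA g = \<one>" using * h piA_\<iota> by simp
qed

lemma orbit_rep_orep: "e \<in> points rep \<Longrightarrow> orbit_rep (orbit_rep e) = orbit_rep e"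
  by (metis orbit_rep_ex orbit_rep_act)

lemma orbit_rep_chart:
  assumes c: "chart (btarget rep) (btotal rep) (bact rep) (bproj rep) V \<sigma> \<gamma>"
    and e: "e \<in> points rep" "e' \<in> points rep" "bproj rep e = bproj rep e'" "bproj rep e \<in> V"
  shows "orbit_rep e = orbit_rep e' \<longleftrightarrow> piA (\<gamma> e) = piA (\<gamma> e')"
proof -
  note c = chartD[OF repb c]
  obtain g where g: "g \<in> carrier G" "bact rep g e = e'" by (rule bundle_fibre[OF repb e(1-3)])
  have ge: "\<gamma> e \<in> carrier G" using c(8)[OF e(1,4)] .
  have "\<gamma> e' = g \<otimes> \<gamma> e" using c(10)[OF e(1,4) g(1)] g by simp
  then have "piA (\<gamma> e') = piA g \<otimes> piA (\<gamma> e)" using piA_mult[OF g(1) ge] by simp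
  then have "piA (\<gamma> e) = piA (\<gamma> e') \<longleftrightarrow> piA g = \<one>"
    using piA_carrier[OF g(1)] piA_carrier[OF ge] by (metis l_one r_cancel_one')
  then show ?thesis using orbit_rep_act_iff[OF e(1) g(1)] g(2) by metis
qed

definition orbit_space where "orbit_space = push_top (btotal rep) orbit_rep"

lemma topspace_orbit_space [simp]: "topspace orbit_space = orbit_rep ` points rep"
  by (simp add: orbit_space_def)

lemma orbit_space_rep:
  assumes "x \<in> topspace orbit_space"
  shows "x \<in> points rep" "orbit_rep x = x"
  using assms orbit_rep_closed orbit_rep_orep by auto

lemma orbit_rep_cont: "continuous_map (btotal rep) orbit_space orbit_rep"
  unfolding orbit_space_def by (rule continuous_map_push_top)

lemma q_cont: "continuous_map orbit_space W (bproj rep)"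
  unfolding orbit_space_def
  by (rule continuous_map_from_push_top, rule continuous_map_eq[OF bundle_proj[OF repb, unfolded rep_obj(2)]])
    (simp add: orbit_rep_proj)

text \<open>
  In a chart, the fibre coordinate of an orbit is the component \<open>a\<close> of
  \<open>\<gamma>\<close> in \<open>A\<close>, so these sets are the sheets of \<open>P/G'\<close>
  over \<open>V\<close>.
\<close>

definition sheet where "sheet V \<gamma> a = {x \<in> topspace orbit_space. bproj rep x \<in> V \<and> piA (\<gamma> x) = a}"

lemma orbit_rep_gamma:
  assumes c: "chart (btarget rep) (btotal rep) (bact rep) (bproj rep) V \<sigma> \<gamma>"
    and e: "e \<in> points rep" "bproj rep e \<in> V"
  shows "piA (\<gamma> (orbit_rep e)) = piA (\<gamma> e)"
  using orbit_rep_chart[OF c orbit_rep_closed[OF e(1)] e(1)] orbit_rep_proj[OF e(1)] orbit_rep_orep[OF e(1)] e(2) by simp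

text \<open>
  The preimage of a sheet in \<open>P\<close> is cut out by the condition that the component of
  \<open>\<gamma>\<close> in \<open>A\<close> be \<open>a\<close>; this is open since
  \<open>A\<close> is discrete.
\<close>

lemma sheet_open:
  assumes c: "chart (btarget rep) (btotal rep) (bact rep) (bproj rep) V \<sigma> \<gamma>"
  shows "openin orbit_space (sheet V \<gamma> a)"
proof -
  note c' = chartD[OF repb c]
  let ?B = "{e \<in> points rep. bproj rep e \<in> V}"
  have oB: "openin (btotal rep) ?B"
    using openin_continuous_map_preimage[OF bundle_proj[OF repb] c'(1)] .
  have o: "openin (subtopology (btotal rep) ?B)
      {e \<in> topspace (subtopology (btotal rep) ?B). \<gamma> e \<in> {g \<in> carrier G. g \<otimes> inv (\<iota> (p g)) = a}}"
    by (rule openin_continuous_map_preimage[OF c'(4) discrete_quotient])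
  have iff: "orbit_rep e \<in> sheet V \<gamma> a \<longleftrightarrow> bproj rep e \<in> V \<and> piA (\<gamma> e) = a" if e: "e \<in> points rep" for e
    using e orbit_rep_proj[OF e] orbit_rep_gamma[OF c e] unfolding sheet_def by auto
  have eq: "{e \<in> topspace (subtopology (btotal rep) ?B). \<gamma> e \<in> {g \<in> carrier G. g \<otimes> inv (\<iota> (p g)) = a}}
      = {e \<in> points rep. orbit_rep e \<in> sheet V \<gamma> a}"
    using iff c'(8) unfolding piA_def by auto
  have "openin (btotal rep) {e \<in> points rep. orbit_rep e \<in> sheet V \<gamma> a}"
    using openin_trans_full[OF o oB] unfolding eq .
  moreover have "sheet V \<gamma> a \<subseteq> orbit_rep ` points rep"
    unfolding sheet_def topspace_orbit_space by blast
  ultimately show ?thesis unfolding orbit_space_def openin_push_top by blast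
qed

text \<open>
  Over the base \<open>V\<close> of a chart, \<open>P/G'\<close> is the disjoint union of the
  sheets, and \<open>u \<mapsto> [a \<sigma>(u)]\<close> is inverse to the projection of the sheet
  with index \<open>a\<close>.
\<close>

lemma orbit_space_covering: "covering_map orbit_space W (bproj rep)"
  unfolding covering_map_def
proof (intro conjI ballI)
  show "continuous_map orbit_space W (bproj rep)" by (fact q_cont)
  have W: "btarget rep = W" by (fact rep_obj(2))
  show "bproj rep ` topspace orbit_space = topspace W"
  proof
    show "bproj rep ` topspace orbit_space \<subseteq> topspace W" using cont_closed[OF q_cont] by blast
    show "topspace W \<subseteq> bproj rep ` topspace orbit_space"
    proof
      fix w assume w: "w \<in> topspace W"
      obtain V \<sigma> \<gamma> where t: "w \<in> V" and c: "chart (btarget rep) (btotal rep) (bact rep) (bproj rep) V \<sigma> \<gamma>"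
        using bundle_chart[OF repb] w W by metis
      note c = chartD[OF repb c]
      have "orbit_rep (\<sigma> w) \<in> topspace orbit_space" "bproj rep (orbit_rep (\<sigma> w)) = w"
        using c(5,6)[OF t] orbit_rep_proj by simp_all
      then show "w \<in> bproj rep ` topspace orbit_space" by (metis imageI)
    qed
  qed
  fix w assume w: "w \<in> topspace W"
  obtain V \<sigma> \<gamma> where t: "w \<in> V" and ch: "chart (btarget rep) (btotal rep) (bact rep) (bproj rep) V \<sigma> \<gamma>"
    using bundle_chart[OF repb] w W by metis
  note c = chartD[OF repb ch, unfolded W]
  have hom: "homeomorphic_map (subtopology orbit_space (sheet V \<gamma> a)) (subtopology W V) (bproj rep)" if a: "a \<in> A" for a
  proof -
    have ac: "a \<in> carrier G" using A_carrier a by blast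
    have as: "bact rep a (\<sigma> u) \<in> points rep" "bproj rep (bact rep a (\<sigma> u)) = u"
      "orbit_rep (bact rep a (\<sigma> u)) \<in> sheet V \<gamma> a" if u: "u \<in> V" for u
    proof -
      show 1: "bact rep a (\<sigma> u) \<in> points rep" "bproj rep (bact rep a (\<sigma> u)) = u"
        using bundle_act_closed[OF repb ac c(6)[OF u]] bundle_invariant[OF repb ac c(6)[OF u]] c(5)[OF u] by simp_all
      show "orbit_rep (bact rep a (\<sigma> u)) \<in> sheet V \<gamma> a"
        unfolding sheet_def
        using 1 orbit_rep_proj[OF 1(1)] orbit_rep_gamma[OF ch 1(1)] u c(9)[OF u ac] piA_A[OF a] by simp
    qed
    have "homeomorphic_maps (subtopology orbit_space (sheet V \<gamma> a)) (subtopology W V) (bproj rep) (\<lambda>u. orbit_rep (bact rep a (\<sigma> u)))"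
      unfolding homeomorphic_maps_def
    proof (intro conjI ballI)
      show "continuous_map (subtopology orbit_space (sheet V \<gamma> a)) (subtopology W V) (bproj rep)"
        by (rule cont_subtopologies[OF q_cont]) (simp add: sheet_def)
      have "continuous_map (subtopology W V) (btotal rep) (\<lambda>u. bact rep a (\<sigma> u))"
        by (rule action_cont[OF bundle_action[OF repb] _ c(3)]) (simp add: ac topspace_TG)
      from cont_comp[OF this orbit_rep_cont]
      show "continuous_map (subtopology W V) (subtopology orbit_space (sheet V \<gamma> a)) (\<lambda>u. orbit_rep (bact rep a (\<sigma> u)))"
        using as(3) by (simp add: continuous_map_in_subtopology image_subset_iff Pi_iff)
      show "orbit_rep (bact rep a (\<sigma> (bproj rep x))) = x" if "x \<in> topspace (subtopology orbit_space (sheet V \<gamma> a))" for x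
      proof -
        have x: "x \<in> topspace orbit_space" "bproj rep x \<in> V" "piA (\<gamma> x) = a" using that by (simp_all add: sheet_def)
        note xr = orbit_space_rep[OF x(1)] and s = as[OF x(2)]
        have "orbit_rep (bact rep a (\<sigma> (bproj rep x))) = orbit_rep x"
          using orbit_rep_chart[OF ch s(1) xr(1)] s x c(9)[OF x(2) ac] piA_A[OF a] by simp
        then show ?thesis using xr by simp
      qed
      show "bproj rep (orbit_rep (bact rep a (\<sigma> u))) = u" if "u \<in> topspace (subtopology W V)" for u
        using that as orbit_rep_proj by simp
    qed
    then show ?thesis by (rule homeomorphic_maps_imp_map)
  qed
  have "\<Union> (sheet V \<gamma> ` A) = {e \<in> topspace orbit_space. bproj rep e \<in> V}"
  proof
    show "{e \<in> topspace orbit_space. bproj rep e \<in> V} \<subseteq> \<Union> (sheet V \<gamma> ` A)"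
    proof
      fix e assume "e \<in> {e \<in> topspace orbit_space. bproj rep e \<in> V}"
      then have e: "e \<in> topspace orbit_space" "bproj rep e \<in> V" by simp_all
      then have "piA (\<gamma> e) \<in> A" using c(8)[OF orbit_space_rep(1)[OF e(1)] e(2)] piA_closed by blast
      then show "e \<in> \<Union> (sheet V \<gamma> ` A)" using e unfolding sheet_def by blast
    qed
  qed (auto simp: sheet_def)
  moreover have "disjoint (sheet V \<gamma> ` A)"
    unfolding pairwise_def disjnt_def by (auto simp: sheet_def)
  ultimately show "\<exists>V'. openin W V' \<and> w \<in> V' \<and> (\<exists>\<V>. \<Union>\<V> = {e \<in> topspace orbit_space. bproj rep e \<in> V'} \<and>
        (\<forall>V\<in>\<V>. openin orbit_space V) \<and> disjoint \<V> \<and>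
        (\<forall>V\<in>\<V>. homeomorphic_map (subtopology orbit_space V) (subtopology W V') (bproj rep)))"
    using c(1) t sheet_open[OF ch] hom
    by (intro exI[of _ V] exI[of _ "sheet V \<gamma> ` A"] conjI ballI) auto
qed

end

lemma continuous_map_id_subtopologies:
  assumes "S1 \<inter> S2 \<subseteq> S3"
  shows "continuous_map (subtopology (subtopology E S1) S2) (subtopology E S3) (\<lambda>x. x)"
  unfolding subtopology_subtopology
  by (rule continuous_map_into_subtopology)
    (use assms in \<open>auto intro: continuous_map_from_subtopology continuous_map_id[unfolded id_def]\<close>)

context induced_cover begin

text \<open>
  The reduction of \<open>R\<close> to \<open>G'\<close> that belongs to a section
  \<open>s\<close> of the orbit space: the points of \<open>R\<close> whose orbit is prescribed by
  \<open>s\<close>. The bundle map \<open>\<kappa>\<close> to the representing bundle transports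
  orbits.
\<close>

definition reduction where "reduction R \<kappa> s = \<lparr>btarget = btarget R,
  btotal = subtopology (btotal R) {e \<in> points R. orbit_rep (\<kappa> e) = s (bproj R e)},
  bact = (\<lambda>g. bact R (\<iota> g)), bproj = bproj R, bmap = bmap R\<rparr>"

lemma reduction_sel [simp]:
  "btarget (reduction R \<kappa> s) = btarget R" "bact (reduction R \<kappa> s) g e = bact R (\<iota> g) e" "bproj (reduction R \<kappa> s) = bproj R"
  "bmap (reduction R \<kappa> s) = bmap R"
  "btotal (reduction R \<kappa> s) = subtopology (btotal R) {e \<in> points R. orbit_rep (\<kappa> e) = s (bproj R e)}"
  by (simp_all add: reduction_def)

text \<open>
  The total space of \<open>reduction R \<kappa> s\<close>; this form is not unfolded by the
  simplifier.
\<close>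

definition reduction_total where "reduction_total R \<kappa> s = subtopology (btotal R) {e \<in> points R. orbit_rep (\<kappa> e) = s (bproj R e)}"

lemma reduction_total_iff:
  "e \<in> topspace (reduction_total R \<kappa> s) \<longleftrightarrow> e \<in> points R \<and> orbit_rep (\<kappa> e) = s (bproj R e)"
  by (simp add: reduction_total_def)

text \<open>
  The isomorphism \<open>(e, a) \<mapsto> a e\<close> from the extension of the reduction back to
  \<open>R\<close>.
\<close>

definition reduction_extension where
  "reduction_extension R \<kappa> s = (\<lambda>x\<in>topspace (ind_total (reduction_total R \<kappa> s)). bact R (snd (dec x)) (fst (dec x)))"

lemma reduction_extension_enc: "e \<in> topspace (reduction_total R \<kappa> s) \<Longrightarrow> a \<in> A \<Longrightarrow> reduction_extension R \<kappa> s (enc (e, a)) = bact R a e"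
  by (simp add: reduction_extension_def ind_totalI)

context
  fixes R f \<kappa> s
  assumes RA: "(R, rep, f, \<kappa>) \<in> Arr QS" and s: "s \<in> ext_maps (btarget R) orbit_space"
    and sf: "\<And>t. t \<in> topspace (btarget R) \<Longrightarrow> bproj rep (s t) = f t"
begin

lemmas RD = QS_ArrD[OF RA]
lemmas Rb = quotient_objD(1)[OF RD(1)]

lemma reduction_act_iff:
  assumes e: "e \<in> topspace (reduction_total R \<kappa> s)" and g: "g \<in> carrier G"
  shows "bact R g e \<in> topspace (reduction_total R \<kappa> s) \<longleftrightarrow> piA g = \<one>"
proof -
  have e': "e \<in> points R" "orbit_rep (\<kappa> e) = s (bproj R e)" using e by (simp_all add: reduction_total_iff)
  have "\<kappa> e \<in> points rep" using ext_mapsD(3)[OF RD(4) e'(1)] .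
  from orbit_rep_act_iff[OF this g] show ?thesis
    using bundle_act_closed[OF Rb g e'(1)] bundle_invariant[OF Rb g e'(1)] RD(8)[OF g e'(1)] e'(2)
    by (simp add: reduction_total_iff)
qed

text \<open>
  A section \<open>\<sigma>\<close> of \<open>R\<close> near \<open>t\<^sub>0\<close> meets the
  prescribed orbits after a translation by the constant \<open>\<delta> \<in> A\<close> that is
  right at \<open>t\<^sub>0\<close>: the component in \<open>A\<close> is locally constant, so
  \<open>\<delta>\<close> remains right nearby.
\<close>

lemma reduction_chart:
  assumes t0: "t0 \<in> topspace (btarget R)"
  shows "\<exists>N \<sigma>' \<gamma>'. t0 \<in> N \<and> Q'.chart (btarget R) (reduction_total R \<kappa> s) (\<lambda>g. bact R (\<iota> g)) (bproj R) N \<sigma>' \<gamma>'"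
proof -
  let ?T = "btarget R"
  obtain V \<sigma> \<gamma> where t0V: "t0 \<in> V" and ch: "chart ?T (btotal R) (bact R) (bproj R) V \<sigma> \<gamma>"
    by (rule bundle_chart[OF Rb t0])
  have ft0: "f t0 \<in> topspace (btarget rep)" using ext_mapsD(3)[OF RD(3) t0] .
  obtain VP \<sigma>P \<gamma>P where t0P: "f t0 \<in> VP"
    and chP: "chart (btarget rep) (btotal rep) (bact rep) (bproj rep) VP \<sigma>P \<gamma>P"
    by (rule bundle_chart[OF repb ft0])
  note c = chartD[OF Rb ch] and cP = chartD[OF repb chP]
  have \<kappa>\<sigma>: "\<kappa> (\<sigma> t) \<in> points rep" "bproj rep (\<kappa> (\<sigma> t)) = f t" if "t \<in> V" for t
    using ext_mapsD(3)[OF RD(4) c(6)[OF that]] RD(7)[OF c(6)[OF that]] c(5)[OF that] by simp_all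
  define a0 where "a0 = piA (\<gamma>P (s t0))"
  define b0 where "b0 = piA (\<gamma>P (\<kappa> (\<sigma> t0)))"
  define \<delta> where "\<delta> = a0 \<otimes> inv b0"
  have st0: "s t0 \<in> topspace orbit_space" "s t0 \<in> points rep" "bproj rep (s t0) \<in> VP"
    using ext_mapsD(3)[OF s t0] orbit_space_rep(1) sf[OF t0] t0P by simp_all
  have a0: "a0 \<in> A" unfolding a0_def using piA_closed cP(8)[OF st0(2,3)] by blast
  have b0: "b0 \<in> A" unfolding b0_def using piA_closed cP(8)[OF \<kappa>\<sigma>(1)[OF t0V]] \<kappa>\<sigma>(2)[OF t0V] t0P by simp
  have \<delta>: "\<delta> \<in> A" "\<delta> \<in> carrier G" "\<delta> \<otimes> b0 = a0"
    using a0 b0 mult_A inv_A A_carrier(1) by (simp_all add: \<delta>_def m_assoc)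
  \<comment> \<open>near \<open>t0\<close> both components in \<open>A\<close> keep their values at \<open>t0\<close>\<close>
  define N where "N = {t \<in> topspace ?T. s t \<in> sheet VP \<gamma>P a0} \<inter> {t \<in> V. orbit_rep (\<kappa> (\<sigma> t)) \<in> sheet VP \<gamma>P b0}"
  have oc: "continuous_map (subtopology ?T V) orbit_space (\<lambda>t. orbit_rep (\<kappa> (\<sigma> t)))"
    by (rule cont_comp[OF cont_comp[OF c(3) ext_mapsD(1)[OF RD(4)]] orbit_rep_cont])
  have oN: "openin ?T N"
  proof -
    have 1: "openin ?T {t \<in> topspace ?T. s t \<in> sheet VP \<gamma>P a0}"
      by (rule openin_continuous_map_preimage[OF ext_mapsD(1)[OF s] sheet_open[OF chP]])
    have "openin (subtopology ?T V) {t \<in> topspace (subtopology ?T V). orbit_rep (\<kappa> (\<sigma> t)) \<in> sheet VP \<gamma>P b0}"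
      by (rule openin_continuous_map_preimage[OF oc sheet_open[OF chP]])
    moreover have "{t \<in> topspace (subtopology ?T V). orbit_rep (\<kappa> (\<sigma> t)) \<in> sheet VP \<gamma>P b0}
        = {t \<in> V. orbit_rep (\<kappa> (\<sigma> t)) \<in> sheet VP \<gamma>P b0}"
      using c(2) by auto
    ultimately have "openin ?T {t \<in> V. orbit_rep (\<kappa> (\<sigma> t)) \<in> sheet VP \<gamma>P b0}"
      using openin_trans_full[OF _ c(1)] by simp
    then show ?thesis unfolding N_def using 1 by (rule openin_Int[rotated])
  qed
  have t0N: "t0 \<in> N"
    unfolding N_def sheet_def
    using t0 t0V t0P st0 \<kappa>\<sigma>[OF t0V] orbit_rep_proj[OF \<kappa>\<sigma>(1)[OF t0V]] orbit_rep_gamma[OF chP \<kappa>\<sigma>(1)[OF t0V]]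
    by (simp add: a0_def b0_def)
  have NV: "t \<in> V" "t \<in> topspace ?T" if "t \<in> N" for t using that c(2) unfolding N_def by blast+
  define \<sigma>' where "\<sigma>' t = bact R \<delta> (\<sigma> t)" for t
  have \<sigma>'1: "\<sigma>' t \<in> points R" "bproj R (\<sigma>' t) = t" if "t \<in> N" for t
    unfolding \<sigma>'_def using bundle_act_closed[OF Rb \<delta>(2) c(6)] bundle_invariant[OF Rb \<delta>(2) c(6)] c(5) NV(1)[OF that]
    by simp_all
  have \<sigma>'2: "\<sigma>' t \<in> topspace (reduction_total R \<kappa> s)" if t: "t \<in> N" for t
  proof -
    note tV = NV(1)[OF t]
    have st: "s t \<in> topspace orbit_space" "bproj rep (s t) \<in> VP" "piA (\<gamma>P (s t)) = a0" "bproj rep (s t) = f t"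
      using t sf[OF NV(2)[OF t]] unfolding N_def sheet_def by simp_all
    have "orbit_rep (\<kappa> (\<sigma> t)) \<in> sheet VP \<gamma>P b0" using t unfolding N_def by blast
    then have b: "piA (\<gamma>P (\<kappa> (\<sigma> t))) = b0" "f t \<in> VP"
      using orbit_rep_gamma[OF chP \<kappa>\<sigma>(1)[OF tV]] orbit_rep_proj[OF \<kappa>\<sigma>(1)[OF tV]] \<kappa>\<sigma>(2)[OF tV]
      unfolding sheet_def by simp_all
    have k: "\<kappa> (\<sigma>' t) = bact rep \<delta> (\<kappa> (\<sigma> t))" unfolding \<sigma>'_def using RD(8)[OF \<delta>(2) c(6)[OF tV]] .
    have k': "\<kappa> (\<sigma>' t) \<in> points rep" "bproj rep (\<kappa> (\<sigma>' t)) = f t"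
      using ext_mapsD(3)[OF RD(4) \<sigma>'1(1)[OF t]] RD(7)[OF \<sigma>'1(1)[OF t]] \<sigma>'1(2)[OF t] by simp_all
    have g: "\<gamma>P (\<kappa> (\<sigma> t)) \<in> carrier G" using cP(8)[OF \<kappa>\<sigma>(1)[OF tV]] \<kappa>\<sigma>(2)[OF tV] b(2) by simp
    have "\<gamma>P (\<kappa> (\<sigma>' t)) = \<delta> \<otimes> \<gamma>P (\<kappa> (\<sigma> t))"
      unfolding k using cP(10)[OF \<kappa>\<sigma>(1)[OF tV] _ \<delta>(2)] \<kappa>\<sigma>(2)[OF tV] b(2) by simp
    then have "piA (\<gamma>P (\<kappa> (\<sigma>' t))) = a0"
      using piA_mult[OF \<delta>(2) g] piA_A[OF \<delta>(1)] b(1) \<delta>(3) by simp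
    then have "orbit_rep (\<kappa> (\<sigma>' t)) = orbit_rep (s t)"
      using orbit_rep_chart[OF chP k'(1) orbit_space_rep(1)[OF st(1)]] k'(2) st b(2) by simp
    then show ?thesis using orbit_space_rep(2)[OF st(1)] \<sigma>'1[OF t] by (simp add: reduction_total_iff)
  qed
  define \<gamma>' where "\<gamma>' e = p (\<gamma> e \<otimes> inv \<delta>)" for e
  have "Q'.chart ?T (reduction_total R \<kappa> s) (\<lambda>g. bact R (\<iota> g)) (bproj R) N \<sigma>' \<gamma>'"
    unfolding Q'.chart_def
  proof (intro conjI ballI impI oN)
    have "continuous_map (subtopology ?T V) (btotal R) \<sigma>'"
      unfolding \<sigma>'_def by (rule action_cont[OF bundle_action[OF Rb] _ c(3)]) (simp add: \<delta>(2) topspace_TG)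
    then have "continuous_map (subtopology ?T N) (btotal R) \<sigma>'"
      by (rule continuous_map_from_subtopology_mono) (use NV(1) in blast)
    then show "continuous_map (subtopology ?T N) (reduction_total R \<kappa> s) \<sigma>'"
      using \<sigma>'2 unfolding reduction_total_def
      by (simp add: continuous_map_in_subtopology image_subset_iff Pi_iff)
    have "continuous_map (subtopology (reduction_total R \<kappa> s) {e \<in> topspace (reduction_total R \<kappa> s). bproj R e \<in> N})
        (subtopology (btotal R) {e \<in> points R. bproj R e \<in> V}) (\<lambda>x. x)"
      unfolding reduction_total_def by (rule continuous_map_id_subtopologies) (use NV(1) in auto)
    from cont_comp[OF this c(4)]
    show "continuous_map (subtopology (reduction_total R \<kappa> s) {e \<in> topspace (reduction_total R \<kappa> s). bproj R e \<in> N}) TG' \<gamma>'"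
      unfolding \<gamma>'_def
      by (intro cont_comp[OF _ p_cont] cont_mult) (simp_all add: \<delta>(2) topspace_TG)
    show "bproj R (\<sigma>' u) = u" if "u \<in> N" for u using \<sigma>'1[OF that] by simp
    show "bact R (\<iota> (\<gamma>' e)) (\<sigma>' (bproj R e)) = e"
      if e: "e \<in> topspace (reduction_total R \<kappa> s)" "bproj R e \<in> N" for e
    proof -
      have e': "e \<in> points R" using e by (simp add: reduction_total_iff)
      have eV: "bproj R e \<in> V" using NV e by blast
      note ge = c(8)[OF e' eV]
      have g: "\<gamma> e \<otimes> inv \<delta> \<in> carrier G" using ge \<delta> by simp
      have 1: "bact R (\<gamma> e \<otimes> inv \<delta>) (\<sigma>' (bproj R e)) = e"
        using bundle_act_mult[OF Rb g \<delta>(2) c(6)[OF eV]] ge \<delta>(2) c(7)[OF e' eV]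
        by (simp add: \<sigma>'_def m_assoc)
      then have "piA (\<gamma> e \<otimes> inv \<delta>) = \<one>" using reduction_act_iff[OF \<sigma>'2[OF e(2)] g] e by simp
      then show ?thesis using 1 piA_trivial[OF g] by (simp add: \<gamma>'_def)
    qed
    show "\<gamma>' (bact R (\<iota> g) (\<sigma>' u)) = g" if "u \<in> N" "g \<in> carrier G'" for u g
    proof -
      have "bact R (\<iota> g) (\<sigma>' u) = bact R (\<iota> g \<otimes> \<delta>) (\<sigma> u)"
        using bundle_act_mult[OF Rb _ \<delta>(2) c(6)[OF NV(1)[OF that(1)]]] that by (simp add: \<sigma>'_def)
      then have "\<gamma> (bact R (\<iota> g) (\<sigma>' u)) = \<iota> g \<otimes> \<delta>"
        using c(9)[OF NV(1)[OF that(1)], of "\<iota> g \<otimes> \<delta>"] that \<delta>(2) by simp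
      then show ?thesis using that \<delta>(2) by (simp add: \<gamma>'_def m_assoc p_\<iota>)
    qed
  qed
  then show ?thesis using t0N by blast
qed

lemma reduction_quotient_obj: "Q'.qobj (reduction R \<kappa> s)"
  unfolding quotient_obj_def
proof (intro conjI)
  have btot: "btotal (reduction R \<kappa> s) = reduction_total R \<kappa> s" by (simp add: reduction_total_def)
  have act: "continuous_action G' TG' (reduction_total R \<kappa> s) (\<lambda>g. bact R (\<iota> g))"
    unfolding continuous_action_def
  proof (intro conjI ballI)
    let ?P = "prod_topology TG' (reduction_total R \<kappa> s)"
    have "continuous_map (reduction_total R \<kappa> s) (btotal R) (\<lambda>x. x)"
      unfolding reduction_total_def by (simp add: continuous_map_from_subtopology continuous_map_id[unfolded id_def])
    from cont_comp[OF continuous_map_snd this]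
    have 1: "continuous_map ?P (btotal R) (\<lambda>x. bact R (\<iota> (fst x)) (snd x))"
      by (intro action_cont[OF bundle_action[OF Rb]] cont_comp[OF continuous_map_fst \<iota>_cont])
    have 2: "bact R (\<iota> g) e \<in> topspace (reduction_total R \<kappa> s)"
      if "g \<in> carrier G'" "e \<in> topspace (reduction_total R \<kappa> s)" for g e
      using reduction_act_iff[OF that(2)] that(1) piA_\<iota> by simp
    have "continuous_map ?P (reduction_total R \<kappa> s) (\<lambda>x. bact R (\<iota> (fst x)) (snd x))"
      by (subst (2) reduction_total_def, rule continuous_map_into_subtopology[OF 1])
        (use 2 Q'.topspace_TG in \<open>auto simp: reduction_total_iff\<close>)
    then show "continuous_map ?P (reduction_total R \<kappa> s) (\<lambda>(g, e). bact R (\<iota> g) e)"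
      by (simp add: case_prod_unfold)
  qed (use bundle_act_one[OF Rb] bundle_act_mult[OF Rb] in \<open>simp_all add: hom_ones hom_mults reduction_total_iff\<close>)
  have "principal_bundle G' TG' (btarget R) (reduction_total R \<kappa> s) (\<lambda>g. bact R (\<iota> g)) (bproj R)"
  proof (rule Q'.principal_bundleI[OF act])
    show "continuous_map (reduction_total R \<kappa> s) (btarget R) (bproj R)"
      unfolding reduction_total_def by (rule continuous_map_from_subtopology[OF bundle_proj[OF Rb]])
    show "bproj R (bact R (\<iota> g) e) = bproj R e" if "g \<in> carrier G'" "e \<in> topspace (reduction_total R \<kappa> s)" for g e
      using bundle_invariant[OF Rb] that by (simp add: reduction_total_iff)
    show "\<exists>U \<sigma> \<gamma>. t \<in> U \<and> Q'.chart (btarget R) (reduction_total R \<kappa> s) (\<lambda>g. bact R (\<iota> g)) (bproj R) U \<sigma> \<gamma>"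
      if "t \<in> topspace (btarget R)" for t using reduction_chart[OF that] .
  qed
  then show "principal_bundle G' TG' (btarget (reduction R \<kappa> s)) (btotal (reduction R \<kappa> s)) (bact (reduction R \<kappa> s)) (bproj (reduction R \<kappa> s))"
    unfolding btot by (simp add: reduction_def)
  show "continuous_map (btotal (reduction R \<kappa> s)) X (bmap (reduction R \<kappa> s))"
    by (simp add: continuous_map_from_subtopology[OF quotient_objD(2)[OF RD(1)]])
  show "equivariant G' (btotal (reduction R \<kappa> s)) (bact (reduction R \<kappa> s)) actX' (bmap (reduction R \<kappa> s))"
    unfolding equivariant_def btot
    using quotient_objD(3,4)[OF RD(1)] act_\<iota> by (simp add: reduction_total_iff)
qed

text \<open>
  Equivariance uses that \<open>G\<close> is commutative: \<open>(p g) e\<close> and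
  \<open>(\<pi>\<^sub>A g) a\<close> are sent to \<open>(\<pi>\<^sub>A g) a \<iota>(p g) e = g a
  e\<close>.
\<close>

lemma reduction_extension_arrow: "(ind_obj (reduction R \<kappa> s), R, ident (btarget R), reduction_extension R \<kappa> s) \<in> Arr QS"
proof (rule QS_ArrI[OF ind_obj_quotient_obj[OF reduction_quotient_obj] RD(1)])
  have btot: "btotal (reduction R \<kappa> s) = reduction_total R \<kappa> s" by (simp add: reduction_total_def)
  show "(ident (btarget R)) \<in> ext_maps (btarget (ind_obj (reduction R \<kappa> s))) (btarget R)"
    using ext_maps_id by simp
  have "continuous_map (reduction_total R \<kappa> s) (btotal R) (\<lambda>x. x)"
    unfolding reduction_total_def by (simp add: continuous_map_from_subtopology continuous_map_id[unfolded id_def])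
  from cont_comp[OF ind_dec_cont(1) this]
  have "continuous_map (ind_total (reduction_total R \<kappa> s)) (btotal R) (\<lambda>x. bact R (snd (dec x)) (fst (dec x)))"
    by (intro action_cont[OF bundle_action[OF Rb]] TA_TG ind_dec_cont(2))
  then show "reduction_extension R \<kappa> s \<in> ext_maps (btotal (ind_obj (reduction R \<kappa> s))) (btotal R)"
    unfolding reduction_extension_def ind_obj_sel(2) btot by (rule ext_maps_restrict)
  fix x assume "x \<in> points (ind_obj (reduction R \<kappa> s))"
  then have "x \<in> topspace (ind_total (reduction_total R \<kappa> s))" unfolding ind_obj_sel(2) btot .
  then obtain e a where x: "e \<in> topspace (reduction_total R \<kappa> s)" "a \<in> A" "x = enc (e, a)" by (rule ind_totalE)
  have e: "e \<in> points R" using x by (simp add: reduction_total_iff)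
  have a: "a \<in> carrier G" using A_carrier x by blast
  have al: "reduction_extension R \<kappa> s x = bact R a e" using reduction_extension_enc x by simp
  show "bmap R (reduction_extension R \<kappa> s x) = bmap (ind_obj (reduction R \<kappa> s)) x"
    unfolding al using quotient_objD(3)[OF RD(1) a e] x by simp
  show "bproj R (reduction_extension R \<kappa> s x) = ident (btarget R) (bproj (ind_obj (reduction R \<kappa> s)) x)"
    unfolding al using bundle_invariant[OF Rb a e] bundle_proj_closed[OF Rb e] x by simp
  fix g assume g: "g \<in> carrier G"
  have ig: "bact R (\<iota> (p g)) e \<in> topspace (reduction_total R \<kappa> s)"
    using reduction_act_iff[OF x(1)] g piA_\<iota> by simp
  have "reduction_extension R \<kappa> s (bact (ind_obj (reduction R \<kappa> s)) g x) = bact R (piA g \<otimes> a) (bact R (\<iota> (p g)) e)"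
    using reduction_extension_enc[OF ig mult_A[OF piA_closed[OF g] x(2)]] x by simp
  also have "\<dots> = bact R (piA g \<otimes> a \<otimes> \<iota> (p g)) e"
    using bundle_act_mult[OF Rb _ _ e] g a piA_carrier by simp
  also have "piA g \<otimes> a \<otimes> \<iota> (p g) = piA g \<otimes> \<iota> (p g) \<otimes> a"
    using g a piA_carrier[OF g] by (simp add: m_ac)
  also have "\<dots> = g \<otimes> a" using piA_decomp[OF g] by simp
  also have "bact R (g \<otimes> a) e = bact R g (reduction_extension R \<kappa> s x)"
    unfolding al using bundle_act_mult[OF Rb g a e] .
  finally show "reduction_extension R \<kappa> s (bact (ind_obj (reduction R \<kappa> s)) g x) = bact R g (reduction_extension R \<kappa> s x)" .
qed

lemma reduction_extension_iso: "vertical_iso QS (ind_obj (reduction R \<kappa> s)) R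
    (ind_obj (reduction R \<kappa> s), R, ident (btarget R), reduction_extension R \<kappa> s)"
  using QS_vertical_isoI[of "ind_obj (reduction R \<kappa> s)" R "reduction_extension R \<kappa> s"] reduction_extension_arrow by simp

end

end

section \<open>The equivalence of the fibre product with the orbit space\<close>

lemma id_map_morphism: "stack_morphism X X id_map"
  by (simp add: stack_morphism_def)

context induced_cover begin

sublocale sq: fibre_square Q'.QS "space_stack W" QS ind K
  by (unfold_locales) (fact Q'.QS_category space_stack_category QS_category ind_morphism K)+

definition qf where "qf T s = compose (topspace T) (bproj rep) s"

text \<open>
  The pullback of \<open>P\<close> along the composite of \<open>s\<close> with the projection of
  the orbit space.
\<close>

definition Rx where "Rx T s = MapO K (T, qf T s)"

definition kx where "kx T s = class_lift T (qf T s)"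

definition reduction_at where "reduction_at T s = reduction (Rx T s) (kx T s) s"

text \<open>
  The object of the fibre product given by a map \<open>s\<close> to the orbit space: the
  reduction defined by \<open>s\<close>, the underlying map to \<open>W\<close>, and the
  isomorphism from the extended reduction to the pulled back bundle.
\<close>

definition epsO where
  "epsO x = (let T = fst x; s = snd x in
    (reduction_at T s, (T, qf T s), (ind_obj (reduction_at T s), Rx T s, ident T, reduction_extension (Rx T s) (kx T s) s)))"

text \<open>
  Arrows between reductions are restrictions of the arrows between the ambient bundles.
\<close>

definition restricted_map where
  "restricted_map T s T' s' h = restrict (total_map (MapA K ((T, qf T s), (T', qf T' s'), h)))
     (topspace (reduction_total (Rx T s) (kx T s) s))"

definition eps where
  "eps = \<lparr>MapO = epsO, MapA = (\<lambda>((T, s), (T', s'), h). (epsO (T, s), epsO (T', s'),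
     (reduction_at T s, reduction_at T' s', h, restricted_map T s T' s' h), ((T, qf T s), (T', qf T' s'), h)))\<rparr>"

lemma eps_sel [simp]:
  "MapO eps (T, s) = (reduction_at T s, (T, qf T s), (ind_obj (reduction_at T s), Rx T s, ident T, reduction_extension (Rx T s) (kx T s) s))"
  "MapA eps ((T, s), (T', s'), h) = (MapO eps (T, s), MapO eps (T', s'),
     (reduction_at T s, reduction_at T' s', h, restricted_map T s T' s' h), ((T, qf T s), (T', qf T' s'), h))"
  by (simp_all add: eps_def epsO_def Let_def)

lemma reduction_at_sel [simp]:
  "btarget (reduction_at T s) = btarget (Rx T s)" "bact (reduction_at T s) g e = bact (Rx T s) (\<iota> g) e"
  "bproj (reduction_at T s) = bproj (Rx T s)" "bmap (reduction_at T s) = bmap (Rx T s)"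
  "btotal (reduction_at T s) = reduction_total (Rx T s) (kx T s) s"
  by (simp_all add: reduction_at_def reduction_total_def)

lemma qf_ext: "s \<in> ext_maps T orbit_space \<Longrightarrow> qf T s \<in> ext_maps T W"
  unfolding qf_def by (rule ext_maps_compose_map[OF _ q_cont])

lemma reduction_at_data:
  assumes s: "s \<in> ext_maps T orbit_space"
  shows "(Rx T s, rep, qf T s, kx T s) \<in> Arr QS" "btarget (Rx T s) = T" "s \<in> ext_maps (btarget (Rx T s)) orbit_space"
    "\<And>t. t \<in> topspace (btarget (Rx T s)) \<Longrightarrow> bproj rep (s t) = qf T s t"
    "qobj (Rx T s)"
proof -
  show 1: "btarget (Rx T s) = T" "qobj (Rx T s)"
    unfolding Rx_def using morphism_object[OF K qf_ext[OF s]] by simp_all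
  show "(Rx T s, rep, qf T s, kx T s) \<in> Arr QS" unfolding Rx_def kx_def using class_lift_arrow'[OF qf_ext[OF s]] .
  show "s \<in> ext_maps (btarget (Rx T s)) orbit_space" using 1 s by simp
  show "bproj rep (s t) = qf T s t" if "t \<in> topspace (btarget (Rx T s))" for t
    using that 1 by (simp add: qf_def compose_eq)
qed

lemma reduction_at_obj: "s \<in> ext_maps T orbit_space \<Longrightarrow> Q'.qobj (reduction_at T s)"
  unfolding reduction_at_def by (rule reduction_quotient_obj[OF reduction_at_data(1,3,4)])

lemma eps_alpha:
  assumes s: "s \<in> ext_maps T orbit_space"
  shows "vertical_iso QS (ind_obj (reduction_at T s)) (Rx T s)
     (ind_obj (reduction_at T s), Rx T s, ident T, reduction_extension (Rx T s) (kx T s) s)"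
  using reduction_extension_iso[OF reduction_at_data(1,3,4)[OF s]] reduction_at_data(2)[OF s] unfolding reduction_at_def by simp

lemma eps_obj:
  assumes s: "s \<in> ext_maps T orbit_space"
  shows "MapO eps (T, s) \<in> Obj sq.FP"
  using reduction_at_obj[OF s] qf_ext[OF s] reduction_at_data(2)[OF s] eps_alpha[OF s]
  by (simp add: fiber_product_Obj Rx_def)

lemma eps_arrow_data:
  assumes a: "((T, s), (T', s'), h) \<in> Arr (space_stack orbit_space)"
  obtains k where "MapA K ((T, qf T s), (T', qf T' s'), h) = (Rx T s, Rx T' s', h, k)"
    "(Rx T s, Rx T' s', h, k) \<in> Arr QS" "((T, qf T s), (T', qf T' s'), h) \<in> Arr (space_stack W)"
    "restricted_map T s T' s' h = restrict k (topspace (reduction_total (Rx T s) (kx T s) s))"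
    "\<And>e. e \<in> topspace (reduction_total (Rx T s) (kx T s) s) \<Longrightarrow> k e \<in> topspace (reduction_total (Rx T' s') (kx T' s') s')"
proof -
  note * = space_stack_ArrD[OF a]
  have b: "((T, qf T s), (T', qf T' s'), h) \<in> Arr (space_stack W)"
    unfolding qf_def by (rule space_map_Arr[OF q_cont a])
  obtain k where k: "MapA K ((T, qf T s), (T', qf T' s'), h) = (Rx T s, Rx T' s', h, k)"
    "(Rx T s, Rx T' s', h, k) \<in> Arr QS"
    unfolding Rx_def by (rule morphism_arrow[OF K b])
  note D = QS_ArrD[OF k(2)]
  have "k e \<in> topspace (reduction_total (Rx T' s') (kx T' s') s')"
    if e: "e \<in> topspace (reduction_total (Rx T s) (kx T s) s)" for e
  proof -
    have e': "e \<in> points (Rx T s)" "orbit_rep (kx T s e) = s (bproj (Rx T s) e)"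
      using e by (simp_all add: reduction_total_iff)
    have t: "bproj (Rx T s) e \<in> topspace T"
      using bundle_proj_closed[OF quotient_objD(1)[OF D(1)] e'(1)] reduction_at_data(2)[OF *(1)] by simp
    have "kx T' s' (k e) = kx T s e"
      using class_lift_natural[OF b] e'(1) k(1) unfolding kx_def Rx_def by simp
    then show ?thesis
      using ext_mapsD(3)[OF D(4) e'(1)] D(7)[OF e'(1)] e'(2) *(4)[OF t] by (simp add: reduction_total_iff)
  qed
  then show ?thesis using that[OF k b] k(1) by (simp add: restricted_map_def)
qed

lemma eps_red_arrow:
  assumes a: "((T, s), (T', s'), h) \<in> Arr (space_stack orbit_space)"
  shows "(reduction_at T s, reduction_at T' s', h, restricted_map T s T' s' h) \<in> Arr Q'.QS"
proof -
  note * = space_stack_ArrD[OF a]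
  obtain k where k: "MapA K ((T, qf T s), (T', qf T' s'), h) = (Rx T s, Rx T' s', h, k)"
    "(Rx T s, Rx T' s', h, k) \<in> Arr QS" "((T, qf T s), (T', qf T' s'), h) \<in> Arr (space_stack W)"
    "restricted_map T s T' s' h = restrict k (topspace (reduction_total (Rx T s) (kx T s) s))"
    and kr: "\<And>e. e \<in> topspace (reduction_total (Rx T s) (kx T s) s) \<Longrightarrow> k e \<in> topspace (reduction_total (Rx T' s') (kx T' s') s')"
    using eps_arrow_data[OF a] by blast
  note D = QS_ArrD[OF k(2)]
  have tot: "\<And>e. e \<in> topspace (reduction_total (Rx T s) (kx T s) s) \<Longrightarrow> e \<in> points (Rx T s)"
    by (simp add: reduction_total_iff)
  have ac: "bact (Rx T s) (\<iota> g) e \<in> topspace (reduction_total (Rx T s) (kx T s) s)"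
    if "g \<in> carrier G'" "e \<in> topspace (reduction_total (Rx T s) (kx T s) s)" for g e
    using reduction_act_iff[OF reduction_at_data(1,3,4)[OF *(1)] that(2)] that(1) piA_\<iota> by simp
  show ?thesis
  proof (rule Q'.QS_ArrI[OF reduction_at_obj[OF *(1)] reduction_at_obj[OF *(2)]])
    show "h \<in> ext_maps (btarget (reduction_at T s)) (btarget (reduction_at T' s'))"
      using *(3) reduction_at_data(2)[OF *(1)] reduction_at_data(2)[OF *(2)] by simp
    have "continuous_map (reduction_total (Rx T s) (kx T s) s) (btotal (Rx T' s')) k"
      by (subst reduction_total_def) (rule continuous_map_from_subtopology[OF ext_mapsD(1)[OF D(4)]])
    then have "continuous_map (reduction_total (Rx T s) (kx T s) s) (reduction_total (Rx T' s') (kx T' s') s') k"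
      using kr by (subst (2) reduction_total_def) (rule continuous_map_into_subtopology, auto simp: reduction_total_iff)
    then show "restricted_map T s T' s' h \<in> ext_maps (btotal (reduction_at T s)) (btotal (reduction_at T' s'))"
      unfolding k(4) reduction_at_sel by (rule ext_maps_restrict)
    fix e assume "e \<in> points (reduction_at T s)"
    then have e: "e \<in> topspace (reduction_total (Rx T s) (kx T s) s)" by simp
    show "bmap (reduction_at T' s') (restricted_map T s T' s' h e) = bmap (reduction_at T s) e"
      using D(6)[OF tot[OF e]] e by (simp add: k(4))
    show "bproj (reduction_at T' s') (restricted_map T s T' s' h e) = h (bproj (reduction_at T s) e)"
      using D(7)[OF tot[OF e]] e by (simp add: k(4))
    fix g assume g: "g \<in> carrier G'"
    show "restricted_map T s T' s' h (bact (reduction_at T s) g e) = bact (reduction_at T' s') g (restricted_map T s T' s' h e)"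
      using D(8)[OF hom_closed(1)[OF g] tot[OF e]] ac[OF g e] e by (simp add: k(4))
  qed
qed

lemma eps_arr:
  assumes a: "((T, s), (T', s'), h) \<in> Arr (space_stack orbit_space)"
  shows "MapA eps ((T, s), (T', s'), h) \<in> Arr sq.FP"
proof -
  note * = space_stack_ArrD[OF a]
  obtain k where k: "MapA K ((T, qf T s), (T', qf T' s'), h) = (Rx T s, Rx T' s', h, k)"
    "(Rx T s, Rx T' s', h, k) \<in> Arr QS" "((T, qf T s), (T', qf T' s'), h) \<in> Arr (space_stack W)"
    "restricted_map T s T' s' h = restrict k (topspace (reduction_total (Rx T s) (kx T s) s))"
    and kr: "\<And>e. e \<in> topspace (reduction_total (Rx T s) (kx T s) s) \<Longrightarrow> k e \<in> topspace (reduction_total (Rx T' s') (kx T' s') s')"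
    using eps_arrow_data[OF a] by blast
  note D = QS_ArrD[OF k(2)]
  let ?E = "reduction_total (Rx T s) (kx T s) s"
  have T: "btarget (Rx T s) = T" using reduction_at_data(2)[OF *(1)] .
  have hh: "compose (topspace T) (ident T') h = compose (topspace T) h (ident T)"
    using ext_maps_id_left[OF *(3)] ext_maps_id_right[OF *(3)] by simp
  have "compose (topspace (ind_total ?E)) (reduction_extension (Rx T' s') (kx T' s') s')
        (ind_arrow_map (reduction_at T s) (restricted_map T s T' s' h))
      = compose (topspace (ind_total ?E)) k (reduction_extension (Rx T s) (kx T s) s)"
  proof (rule ind_map_eqI[where E = ?E])
    fix e c assume e: "e \<in> topspace ?E" and c: "c \<in> A"
    have "ind_arrow_map (reduction_at T s) (restricted_map T s T' s' h) (enc (e, c)) = enc (k e, c)"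
      using e c by (simp add: ind_arrow_map_enc k(4))
    moreover have "k (bact (Rx T s) c e) = bact (Rx T' s') c (k e)"
      using D(8)[OF A_carrier(1)[OF c]] e by (simp add: reduction_total_iff)
    ultimately show "compose (topspace (ind_total ?E)) (reduction_extension (Rx T' s') (kx T' s') s')
        (ind_arrow_map (reduction_at T s) (restricted_map T s T' s' h)) (enc (e, c))
      = compose (topspace (ind_total ?E)) k (reduction_extension (Rx T s) (kx T s) s) (enc (e, c))"
      using reduction_extension_enc[OF e c] reduction_extension_enc[OF kr[OF e] c] e c by (simp add: compose_eq ind_totalI)
  qed (simp_all add: compose_def)
  then have "Cmp QS (ind_obj (reduction_at T' s'), Rx T' s', ident T', reduction_extension (Rx T' s') (kx T' s') s')
      (MapA ind (reduction_at T s, reduction_at T' s', h, restricted_map T s T' s' h))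
    = Cmp QS (MapA K ((T, qf T s), (T', qf T' s'), h))
      (ind_obj (reduction_at T s), Rx T s, ident T, reduction_extension (Rx T s) (kx T s) s)"
    unfolding k(1) using hh T by simp
  then show ?thesis
    unfolding eps_sel fiber_product_Arr
    using eps_obj[OF *(1)] eps_obj[OF *(2)] eps_red_arrow[OF a] k(3) by simp
qed

lemma eps_morphism: "stack_morphism (space_stack orbit_space) sq.FP eps"
  unfolding stack_morphism_def
proof (intro conjI ballI impI)
  fix x :: "('u, 'u) space_obj" assume "x \<in> Obj (space_stack orbit_space)"
  then obtain T s where x: "x = (T, s)" and s: "s \<in> ext_maps T orbit_space" by auto
  note d = reduction_at_data[OF s]
  show "MapO eps x \<in> Obj sq.FP" using eps_obj[OF s] x by simp
  show "Base sq.FP (MapO eps x) = Base (space_stack orbit_space) x" using d(2) by (simp add: x)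
  have "MapA K (Idn (space_stack W) (T, qf T s)) = Idn QS (MapO K (T, qf T s))"
    using stack_morphismD(3)[OF K, of "(T, qf T s)"] qf_ext[OF s] by simp
  then have "restricted_map T s T s (ident T) = ident (reduction_total (Rx T s) (kx T s) s)"
    unfolding restricted_map_def by (auto simp: Rx_def reduction_total_iff)
  then show "MapA eps (Idn (space_stack orbit_space) x) = Idn sq.FP (MapO eps x)"
    using d(2) by (simp add: x)
next
  fix a :: "('u, 'u) space_arr" assume a: "a \<in> Arr (space_stack orbit_space)"
  obtain T s T' s' h where a': "a = ((T, s), (T', s'), h)" by (rule arrow_cases)
  note aA = a[unfolded a']
  note * = space_stack_ArrD[OF aA]
  show "MapA eps a \<in> Arr sq.FP" using eps_arr[OF aA] a' by simp
  show "Dom sq.FP (MapA eps a) = MapO eps (Dom (space_stack orbit_space) a)"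
    "Cod sq.FP (MapA eps a) = MapO eps (Cod (space_stack orbit_space) a)"
    "BaseMap sq.FP (MapA eps a) = BaseMap (space_stack orbit_space) a"
    by (simp_all add: a')
  fix b :: "('u, 'u) space_arr" assume b: "b \<in> Arr (space_stack orbit_space)" and ab: "Dom (space_stack orbit_space) b = Cod (space_stack orbit_space) a"
  obtain T1 s1 T'' s'' h' where b1: "b = ((T1, s1), (T'', s''), h')" by (rule arrow_cases)
  then have b': "b = ((T', s'), (T'', s''), h')" using ab a' by simp
  note bA = b[unfolded b']
  obtain k where k: "MapA K ((T, qf T s), (T', qf T' s'), h) = (Rx T s, Rx T' s', h, k)"
    "((T, qf T s), (T', qf T' s'), h) \<in> Arr (space_stack W)"
    "restricted_map T s T' s' h = restrict k (topspace (reduction_total (Rx T s) (kx T s) s))"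
    and kr: "\<And>e. e \<in> topspace (reduction_total (Rx T s) (kx T s) s) \<Longrightarrow> k e \<in> topspace (reduction_total (Rx T' s') (kx T' s') s')"
    using eps_arrow_data[OF aA] by blast
  obtain k' where k': "MapA K ((T', qf T' s'), (T'', qf T'' s''), h') = (Rx T' s', Rx T'' s'', h', k')"
    "((T', qf T' s'), (T'', qf T'' s''), h') \<in> Arr (space_stack W)"
    "restricted_map T' s' T'' s'' h' = restrict k' (topspace (reduction_total (Rx T' s') (kx T' s') s'))"
    using eps_arrow_data[OF bA] by blast
  have "MapA K (Cmp (space_stack W) ((T', qf T' s'), (T'', qf T'' s''), h') ((T, qf T s), (T', qf T' s'), h))
      = Cmp QS (MapA K ((T', qf T' s'), (T'', qf T'' s''), h')) (MapA K ((T, qf T s), (T', qf T' s'), h))"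
    by (rule stack_morphismD(8)[OF K k(2) k'(2)]) simp
  then have "total_map (MapA K ((T, qf T s), (T'', qf T'' s''), compose (topspace T) h' h))
      = compose (points (Rx T s)) k' k"
    unfolding k(1) k'(1) by simp
  then have "restricted_map T s T'' s'' (compose (topspace T) h' h)
      = compose (topspace (reduction_total (Rx T s) (kx T s) s)) (restricted_map T' s' T'' s'' h') (restricted_map T s T' s' h)"
    unfolding restricted_map_def[of T s T''] k(3) k'(3)
    using kr by (auto simp: compose_def reduction_total_iff intro!: restrict_ext)
  then show "MapA eps (Cmp (space_stack orbit_space) b a) = Cmp sq.FP (MapA eps b) (MapA eps a)"
    using reduction_at_data(2)[OF *(1)] by (simp add: a' b')
qed

text \<open>
  An object \<open>(y, (T, f), \<alpha>)\<close> of the fibre product is a reduction of the pulled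
  back bundle to \<open>G'\<close>, and this is the section of orbits that it defines: the orbit
  of \<open>\<alpha>(e, 1)\<close> for any \<open>e\<close> over \<open>t\<close>.
\<close>

definition orbit_section where
  "orbit_section y T f \<alpha> = (\<lambda>t\<in>topspace T. orbit_rep (class_lift T f (total_map \<alpha> (enc (SOME e. e \<in> points y \<and> bproj y e = t, \<one>)))))"

lemma fp_objD:
  assumes z: "(y, (T, f), \<alpha>) \<in> Obj sq.FP"
  obtains ka where "Q'.qobj y" "f \<in> ext_maps T W" "btarget y = T"
    "\<alpha> = (ind_obj y, MapO K (T, f), ident T, ka)"
    "(ind_obj y, MapO K (T, f), ident T, ka) \<in> Arr QS"
proof -
  have *: "Q'.qobj y" "f \<in> ext_maps T W" "btarget y = T"
    "vertical_iso QS (ind_obj y) (MapO K (T, f)) \<alpha>"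
    using z by (simp_all add: fiber_product_Obj)
  from *(4) obtain ka where "\<alpha> = (ind_obj y, MapO K (T, f), ident (btarget (ind_obj y)), ka)"
    "(ind_obj y, MapO K (T, f), ident (btarget (ind_obj y)), ka) \<in> Arr QS"
    by (rule QS_vertical_isoE)
  then show ?thesis using that * by simp
qed

lemma fp_obj_map:
  assumes y: "Q'.qobj y" and f: "f \<in> ext_maps T W" and T: "btarget y = T"
    and ka: "(ind_obj y, MapO K (T, f), ident T, ka) \<in> Arr QS"
    and e: "e \<in> points y"
  shows "ka (enc (e, \<one>)) \<in> points (MapO K (T, f))"
    "bproj (MapO K (T, f)) (ka (enc (e, \<one>))) = bproj y e"
    "bmap (MapO K (T, f)) (ka (enc (e, \<one>))) = bmap y e"
    "\<And>g. g \<in> carrier G' \<Longrightarrow> ka (enc (bact y g e, \<one>)) = bact (MapO K (T, f)) (\<iota> g) (ka (enc (e, \<one>)))"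
    "\<And>c. c \<in> A \<Longrightarrow> bact (MapO K (T, f)) c (ka (enc (e, \<one>))) = ka (enc (e, c))"
    "orbit_rep (class_lift T f (ka (enc (e, \<one>)))) \<in> topspace orbit_space"
    "bproj rep (orbit_rep (class_lift T f (ka (enc (e, \<one>))))) = f (bproj y e)"
proof -
  note D = QS_ArrD[OF ka] and Y = Q'.quotient_objD[OF y]
  have e1: "enc (e, \<one>) \<in> points (ind_obj y)" using ind_totalI[OF e one_A] by simp
  have t: "bproj y e \<in> topspace T" using Q'.bundle_proj_closed[OF Y(1) e] T by simp
  show 1: "ka (enc (e, \<one>)) \<in> points (MapO K (T, f))" using ext_mapsD(3)[OF D(4) e1] .
  show 2: "bproj (MapO K (T, f)) (ka (enc (e, \<one>))) = bproj y e" using D(7)[OF e1] one_A t by simp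
  show "bmap (MapO K (T, f)) (ka (enc (e, \<one>))) = bmap y e"
    using D(6)[OF e1] one_A Y(4)[OF e] actX_one by simp
  show "ka (enc (bact y g e, \<one>)) = bact (MapO K (T, f)) (\<iota> g) (ka (enc (e, \<one>)))" if g: "g \<in> carrier G'" for g
    using D(8)[OF hom_closed(1)[OF g] e1] one_A p_\<iota>[OF g] piA_\<iota>[OF g] by simp
  show "bact (MapO K (T, f)) c (ka (enc (e, \<one>))) = ka (enc (e, c))" if c: "c \<in> A" for c
    using D(8)[OF A_carrier(1)[OF c] e1] one_A piA_A[OF c] A_carrier[OF c] Q'.bundle_act_one[OF Y(1) e] by simp
  note kD = QS_ArrD[OF class_lift_arrow'[OF f]]
  have 3: "class_lift T f (ka (enc (e, \<one>))) \<in> points rep" using ext_mapsD(3)[OF kD(4) 1] .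
  show "orbit_rep (class_lift T f (ka (enc (e, \<one>)))) \<in> topspace orbit_space" using 3 by simp
  show "bproj rep (orbit_rep (class_lift T f (ka (enc (e, \<one>))))) = f (bproj y e)"
    using orbit_rep_proj[OF 3] kD(7)[OF 1] 2 by simp
qed

text \<open>
  Another point \<open>e\<close> of the fibre differs by an element of \<open>G'\<close>, which
  does not change the orbit.
\<close>

lemma orbit_section_eq:
  assumes z: "(y, (T, f), \<alpha>) \<in> Obj sq.FP" and e: "e \<in> points y"
  shows "orbit_section y T f \<alpha> (bproj y e) = orbit_rep (class_lift T f (total_map \<alpha> (enc (e, \<one>))))"
proof -
  obtain ka where ka: "Q'.qobj y" "f \<in> ext_maps T W" "btarget y = T"
    "\<alpha> = (ind_obj y, MapO K (T, f), ident T, ka)"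
    "(ind_obj y, MapO K (T, f), ident T, ka) \<in> Arr QS"
    by (rule fp_objD[OF z])
  note Y = Q'.quotient_objD[OF ka(1)]
  note m = fp_obj_map[OF ka(1,2,3,5)]
  note kD = QS_ArrD[OF class_lift_arrow'[OF ka(2)]]
  define e' where "e' = (SOME e'. e' \<in> points y \<and> bproj y e' = bproj y e)"
  have e': "e' \<in> points y" "bproj y e' = bproj y e"
    using someI[of "\<lambda>e'. e' \<in> points y \<and> bproj y e' = bproj y e" e] e unfolding e'_def by simp_all
  obtain g where g: "g \<in> carrier G'" "bact y g e = e'" by (rule Q'.bundle_fibre[OF Y(1) e e'(1) e'(2)[symmetric]])
  have "class_lift T f (ka (enc (e', \<one>))) = bact rep (\<iota> g) (class_lift T f (ka (enc (e, \<one>))))"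
    using m(4)[OF e g(1)] g(2) kD(8)[OF hom_closed(1)[OF g(1)] m(1)[OF e]] by simp
  then have "orbit_rep (class_lift T f (ka (enc (e', \<one>)))) = orbit_rep (class_lift T f (ka (enc (e, \<one>))))"
    using orbit_rep_act[OF ext_mapsD(3)[OF kD(4) m(1)[OF e]] g(1)] by simp
  then show ?thesis
    using Q'.bundle_proj_closed[OF Y(1) e] ka(3) unfolding orbit_section_def e'_def ka(4) by simp
qed

lemma orbit_section_ext:
  assumes z: "(y, (T, f), \<alpha>) \<in> Obj sq.FP"
  shows "orbit_section y T f \<alpha> \<in> ext_maps T orbit_space" "\<And>t. t \<in> topspace T \<Longrightarrow> bproj rep (orbit_section y T f \<alpha> t) = f t"
    "qf T (orbit_section y T f \<alpha>) = f"
proof -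
  obtain ka where ka: "Q'.qobj y" "f \<in> ext_maps T W" "btarget y = T"
    "\<alpha> = (ind_obj y, MapO K (T, f), ident T, ka)"
    "(ind_obj y, MapO K (T, f), ident T, ka) \<in> Arr QS"
    by (rule fp_objD[OF z])
  note Y = Q'.quotient_objD[OF ka(1)]
  note m = fp_obj_map[OF ka(1,2,3,5)]
  note kD = QS_ArrD[OF class_lift_arrow'[OF ka(2)]] and D = QS_ArrD[OF ka(5)]
  have i: "continuous_map (btotal y) (ind_total (btotal y)) (\<lambda>e. enc (e, \<one>))"
    by (rule ind_enc_cont) (simp_all add: one_A continuous_map_id[unfolded id_def])
  have w: "continuous_map (btotal y) orbit_space (\<lambda>e. orbit_rep (class_lift T f (ka (enc (e, \<one>)))))"
    using cont_comp[OF cont_comp[OF cont_comp[OF i ext_mapsD(1)[OF D(4)[unfolded ind_obj_sel]]]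
          ext_mapsD(1)[OF kD(4)]] orbit_rep_cont] .
  have sec: "\<exists>V \<sigma>. t \<in> V \<and> openin T V \<and> continuous_map (subtopology T V) (btotal y) \<sigma> \<and>
      (\<forall>u\<in>V. \<sigma> u \<in> points y \<and> bproj y (\<sigma> u) = u)" if t: "t \<in> topspace T" for t
  proof -
    have "t \<in> topspace (btarget y)" using t ka(3) by simp
    then obtain V \<sigma> \<gamma> where V: "t \<in> V" and c: "Q'.chart (btarget y) (btotal y) (bact y) (bproj y) V \<sigma> \<gamma>"
      by (rule Q'.bundle_chart[OF Y(1)])
    note c = Q'.chartD[OF Y(1) c, unfolded ka(3)]
    show ?thesis using V c(1,3,5,6) by blast
  qed
  show q: "bproj rep (orbit_section y T f \<alpha> t) = f t" if t: "t \<in> topspace T" for t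
  proof -
    obtain e where e: "e \<in> points y" "bproj y e = t" using sec[OF t] by blast
    show ?thesis using orbit_section_eq[OF z e(1)] m(7)[OF e(1)] e(2) ka(4) by simp
  qed
  have "continuous_map T orbit_space (orbit_section y T f \<alpha>)"
  proof (rule cont_locally)
    fix t assume "t \<in> topspace T"
    then obtain V \<sigma> where V: "t \<in> V" "openin T V" "continuous_map (subtopology T V) (btotal y) \<sigma>"
      "\<forall>u\<in>V. \<sigma> u \<in> points y \<and> bproj y (\<sigma> u) = u" using sec by blast
    have "continuous_map (subtopology T V) orbit_space (orbit_section y T f \<alpha>)"
    proof (rule continuous_map_eq[OF cont_comp[OF V(3) w]])
      fix u assume "u \<in> topspace (subtopology T V)"
      then have "\<sigma> u \<in> points y" "bproj y (\<sigma> u) = u" using V(4) by simp_all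
      then show "orbit_rep (class_lift T f (ka (enc (\<sigma> u, \<one>)))) = orbit_section y T f \<alpha> u"
        using orbit_section_eq[OF z, of "\<sigma> u"] ka(4) by simp
    qed
    then show "\<exists>V. openin T V \<and> t \<in> V \<and> continuous_map (subtopology T V) orbit_space (orbit_section y T f \<alpha>)" using V by blast
  qed
  then show "orbit_section y T f \<alpha> \<in> ext_maps T orbit_space" by (simp add: ext_maps_def orbit_section_def)
  show "qf T (orbit_section y T f \<alpha>) = f"
    unfolding qf_def
    by (rule extensionalityI[where A = "topspace T"])
      (use q ext_mapsD(2)[OF ka(2)] in \<open>simp_all add: compose_def\<close>)
qed

text \<open>
  The compatibility condition of a fibre product arrow, read off at the points \<open>(e,
  1)\<close>.
\<close>

lemma fp_arrD:
  assumes c: "((y, (T, f), \<alpha>), (y', (T', f'), \<alpha>'), a, b) \<in> Arr sq.FP"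
  obtains h l k where "a = (y, y', h, l)" "(y, y', h, l) \<in> Arr Q'.QS"
    "b = ((T, f), (T', f'), h)" "((T, f), (T', f'), h) \<in> Arr (space_stack W)"
    "MapA K b = (MapO K (T, f), MapO K (T', f'), h, k)"
    "\<forall>e\<in>points y. total_map \<alpha>' (enc (l e, \<one>)) = k (total_map \<alpha> (enc (e, \<one>)))"
proof -
  have *: "(y, (T, f), \<alpha>) \<in> Obj sq.FP" "(y', (T', f'), \<alpha>') \<in> Obj sq.FP"
     "a \<in> Arr Q'.QS" "Dom Q'.QS a = y" "Cod Q'.QS a = y'" "b \<in> Arr (space_stack W)"
     "Dom (space_stack W) b = (T, f)" "Cod (space_stack W) b = (T', f')"
     "BaseMap Q'.QS a = BaseMap (space_stack W) b" "Cmp QS \<alpha>' (MapA ind a) = Cmp QS (MapA K b) \<alpha>"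
    using c by (simp_all add: fiber_product_Arr)
  obtain P P' h l where a1: "a = (P, P', h, l)" and aA: "(P, P', h, l) \<in> Arr Q'.QS" by (rule Q'.QS_ArrE[OF *(3)])
  have a: "a = (y, y', h, l)" using a1 *(4,5) by simp
  obtain T1 f1 T2 f2 h2 where b1: "b = ((T1, f1), (T2, f2), h2)" by (rule arrow_cases)
  have b: "b = ((T, f), (T', f'), h)" using b1 *(7,8,9) a by simp
  obtain k where k: "MapA K ((T, f), (T', f'), h) = (MapO K (T, f), MapO K (T', f'), h, k)"
    by (rule morphism_arrow[OF K *(6)[unfolded b]])
  obtain ka where ka: "\<alpha> = (ind_obj y, MapO K (T, f), ident T, ka)" by (rule fp_objD[OF *(1)])
  obtain ka' where ka': "\<alpha>' = (ind_obj y', MapO K (T', f'), ident T', ka')" by (rule fp_objD[OF *(2)])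
  have eq: "compose (topspace (ind_total (btotal y))) ka' (ind_arrow_map y l) = compose (topspace (ind_total (btotal y))) k ka"
    using *(10) unfolding a b k ka ka' by simp
  have "total_map \<alpha>' (enc (l e, \<one>)) = k (total_map \<alpha> (enc (e, \<one>)))" if e: "e \<in> points y" for e
    using fun_cong[OF eq, of "enc (e, \<one>)"] e one_A
    by (simp add: compose_eq ind_totalI ind_arrow_map_enc ka ka')
  then show ?thesis using that[of h l k] a aA a1 b *(6) k by simp
qed

definition inv_eps where
  "inv_eps = \<lparr>MapO = (\<lambda>(y, (T, f), \<alpha>). (T, orbit_section y T f \<alpha>)),
    MapA = (\<lambda>((y, (T, f), \<alpha>), (y', (T', f'), \<alpha>'), a, b). ((T, orbit_section y T f \<alpha>), (T', orbit_section y' T' f' \<alpha>'), snd (snd b)))\<rparr>"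

lemma inv_eps_sel [simp]:
  "MapO inv_eps (y, (T, f), \<alpha>) = (T, orbit_section y T f \<alpha>)"
  "MapA inv_eps ((y, (T, f), \<alpha>), (y', (T', f'), \<alpha>'), a, b) = ((T, orbit_section y T f \<alpha>), (T', orbit_section y' T' f' \<alpha>'), snd (snd b))"
  by (simp_all add: inv_eps_def)

lemma fp_cases:
  obtains y T f \<alpha> y' T' f' \<alpha>' a b where "c = ((y, (T, f), \<alpha>), (y', (T', f'), \<alpha>'), a, b)"
proof -
  obtain y w \<alpha> y' w' \<alpha>' a b where "c = ((y, w, \<alpha>), (y', w', \<alpha>'), a, b)" by (rule fibre_arrow_cases)
  then show ?thesis using that[of y "fst w" "snd w" \<alpha> y' "fst w'" "snd w'"] by simp
qed

lemma inv_eps_arr: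
  assumes c: "((y, (T, f), \<alpha>), (y', (T', f'), \<alpha>'), a, b) \<in> Arr sq.FP"
  shows "((T, orbit_section y T f \<alpha>), (T', orbit_section y' T' f' \<alpha>'), snd (snd b)) \<in> Arr (space_stack orbit_space)"
proof -
  have z: "(y, (T, f), \<alpha>) \<in> Obj sq.FP" and z': "(y', (T', f'), \<alpha>') \<in> Obj sq.FP"
    using c by (simp_all add: fiber_product_Arr)
  obtain h l k where hlk: "a = (y, y', h, l)" "(y, y', h, l) \<in> Arr Q'.QS"
    "b = ((T, f), (T', f'), h)" "((T, f), (T', f'), h) \<in> Arr (space_stack W)"
    "MapA K b = (MapO K (T, f), MapO K (T', f'), h, k)"
    "\<forall>e\<in>points y. total_map \<alpha>' (enc (l e, \<one>)) = k (total_map \<alpha> (enc (e, \<one>)))"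
    by (rule fp_arrD[OF c])
  obtain ka where ka: "Q'.qobj y" "f \<in> ext_maps T W" "btarget y = T"
    "\<alpha> = (ind_obj y, MapO K (T, f), ident T, ka)"
    "(ind_obj y, MapO K (T, f), ident T, ka) \<in> Arr QS"
    by (rule fp_objD[OF z])
  note D = Q'.QS_ArrD[OF hlk(2)]
  have "orbit_section y' T' f' \<alpha>' (h t) = orbit_section y T f \<alpha> t" if t: "t \<in> topspace T" for t
  proof -
    obtain e where e: "e \<in> points y" "bproj y e = t"
      using Q'.bundle_chart[OF Q'.quotient_objD(1)[OF ka(1)], of t] Q'.chartD(5,6)[OF Q'.quotient_objD(1)[OF ka(1)]]
        t ka(3) by metis
    have le: "l e \<in> points y'" "bproj y' (l e) = h t" using ext_mapsD(3)[OF D(4) e(1)] D(7)[OF e(1)] e(2) by simp_all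
    have m: "total_map \<alpha> (enc (e, \<one>)) \<in> points (MapO K (T, f))"
      using fp_obj_map(1)[OF ka(1,2,3,5) e(1)] ka(4) by simp
    have "orbit_section y' T' f' \<alpha>' (h t) = orbit_rep (class_lift T' f' (k (total_map \<alpha> (enc (e, \<one>)))))"
      using orbit_section_eq[OF z' le(1)] le(2) hlk(6) e(1) by simp
    also have "\<dots> = orbit_rep (class_lift T f (total_map \<alpha> (enc (e, \<one>))))"
      using class_lift_natural[OF hlk(4) m] hlk(5) hlk(3) by simp
    finally show ?thesis using orbit_section_eq[OF z e(1)] e(2) by simp
  qed
  then show ?thesis
    using space_stack_ArrI[OF orbit_section_ext(1)[OF z'] space_stack_ArrD(3)[OF hlk(4)] orbit_section_ext(1)[OF z]] hlk(3) by simp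
qed

lemma inv_eps_morphism: "stack_morphism sq.FP (space_stack orbit_space) inv_eps"
  unfolding stack_morphism_def
proof (intro conjI ballI impI)
  fix x assume x: "x \<in> Obj sq.FP"
  obtain y w \<alpha> where x1: "x = (y, w, \<alpha>)" by (rule prod_cases3)
  obtain T f where w: "w = (T, f)" by (cases w)
  note x' = x1[unfolded w]
  note z = x[unfolded x']
  have T: "btarget y = T" using z by (simp add: fiber_product_Obj)
  show "MapO inv_eps x \<in> Obj (space_stack orbit_space)" using orbit_section_ext(1)[OF z] by (simp add: x')
  show "Base (space_stack orbit_space) (MapO inv_eps x) = Base sq.FP x" by (simp add: x' T)
  show "MapA inv_eps (Idn sq.FP x) = Idn (space_stack orbit_space) (MapO inv_eps x)" by (simp add: x')
next
  fix c assume c: "c \<in> Arr sq.FP"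
  obtain y T f \<alpha> y' T' f' \<alpha>' a b where c': "c = ((y, (T, f), \<alpha>), (y', (T', f'), \<alpha>'), a, b)" by (rule fp_cases)
  note cA = c[unfolded c']
  show "MapA inv_eps c \<in> Arr (space_stack orbit_space)" using inv_eps_arr[OF cA] by (simp add: c')
  show "Dom (space_stack orbit_space) (MapA inv_eps c) = MapO inv_eps (Dom sq.FP c)"
    "Cod (space_stack orbit_space) (MapA inv_eps c) = MapO inv_eps (Cod sq.FP c)" by (simp_all add: c')
  obtain h l where hl: "a = (y, y', h, l)" "b = ((T, f), (T', f'), h)" by (rule fp_arrD[OF cA])
  show "BaseMap (space_stack orbit_space) (MapA inv_eps c) = BaseMap sq.FP c" using hl by (simp add: c')
  fix d assume d: "d \<in> Arr sq.FP" and cd: "Dom sq.FP d = Cod sq.FP c"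
  obtain y1 T1 f1 \<alpha>1 y'' T'' f'' \<alpha>'' a' b' where d1: "d = ((y1, (T1, f1), \<alpha>1), (y'', (T'', f''), \<alpha>''), a', b')" by (rule fp_cases)
  have d': "d = ((y', (T', f'), \<alpha>'), (y'', (T'', f''), \<alpha>''), a', b')" using cd d1 by (simp add: c')
  obtain h' l' where hl': "a' = (y', y'', h', l')" "b' = ((T', f'), (T'', f''), h')" by (rule fp_arrD[OF d[unfolded d']])
  show "MapA inv_eps (Cmp sq.FP d c) = Cmp (space_stack orbit_space) (MapA inv_eps d) (MapA inv_eps c)"
    using hl hl' by (simp add: c' d')
qed

text \<open>
  The reduction defined by \<open>s\<close> prescribes \<open>s\<close>; one composite is the
  identity on the nose.
\<close>

lemma inv_eps_eps:
  assumes s: "s \<in> ext_maps T orbit_space"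
  shows "MapO inv_eps (MapO eps (T, s)) = (T, s)"
proof -
  note z = eps_obj[OF s, unfolded eps_sel]
  note d = reduction_at_data[OF s]
  let ?\<alpha> = "(ind_obj (reduction_at T s), Rx T s, ident T, reduction_extension (Rx T s) (kx T s) s)"
  have "orbit_section (reduction_at T s) T (qf T s) ?\<alpha> t = s t" if t: "t \<in> topspace T" for t
  proof -
    note b = Q'.quotient_objD(1)[OF reduction_at_obj[OF s]]
    have "t \<in> topspace (btarget (reduction_at T s))" using t d(2) by simp
    then obtain V \<sigma> \<gamma> where V: "t \<in> V" and c: "Q'.chart (btarget (reduction_at T s)) (btotal (reduction_at T s)) (bact (reduction_at T s)) (bproj (reduction_at T s)) V \<sigma> \<gamma>"
      by (rule Q'.bundle_chart[OF b])
    have e: "\<sigma> t \<in> points (reduction_at T s)" "bproj (reduction_at T s) (\<sigma> t) = t"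
      using Q'.chartD(5,6)[OF b c V] by simp_all
    then have e': "\<sigma> t \<in> topspace (reduction_total (Rx T s) (kx T s) s)" by simp
    have "reduction_extension (Rx T s) (kx T s) s (enc (\<sigma> t, \<one>)) = \<sigma> t"
      using reduction_extension_enc[OF e' one_A] bundle_act_one[OF quotient_objD(1)[OF d(5)]] e' by (simp add: reduction_total_iff)
    then show ?thesis
      using orbit_section_eq[OF z e(1)] e e' by (simp add: reduction_total_iff kx_def)
  qed
  then have "orbit_section (reduction_at T s) T (qf T s) ?\<alpha> = s"
    by (intro extensionalityI[where A = "topspace T"]) (use ext_mapsD(2)[OF s] in \<open>simp_all add: orbit_section_def\<close>)
  then show ?thesis by simp
qed

text \<open>
  The inclusion \<open>e \<mapsto> \<alpha>(e, 1)\<close> identifies \<open>y\<close> with the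
  reduction that belongs to its own section of orbits.
\<close>

definition unit_map where
  "unit_map y \<alpha> = (\<lambda>e\<in>points y. total_map \<alpha> (enc (e, \<one>)))"

definition unit_iso :: "('u, 'h, 'x) bundle_obj \<times> ('u, 'u) space_obj \<times> ('u, 'g, 'x) bundle_arr \<Rightarrow> _" where
  "unit_iso z = (case z of (y, (T, f), \<alpha>) \<Rightarrow> (z, epsO (T, orbit_section y T f \<alpha>),
     (y, reduction_at T (orbit_section y T f \<alpha>), ident T, unit_map y \<alpha>), Idn (space_stack W) (T, f)))"

lemma unit_iso_arrow:
  assumes z: "(y, (T, f), \<alpha>) \<in> Obj sq.FP"
  shows "(y, reduction_at T (orbit_section y T f \<alpha>), ident T, unit_map y \<alpha>) \<in> Arr Q'.QS"
    and "vertical_iso sq.FP (y, (T, f), \<alpha>) (MapO eps (MapO inv_eps (y, (T, f), \<alpha>))) (unit_iso (y, (T, f), \<alpha>))"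
proof -
  let ?s = "orbit_section y T f \<alpha>"
  obtain ka where ka: "Q'.qobj y" "f \<in> ext_maps T W" "btarget y = T"
    "\<alpha> = (ind_obj y, MapO K (T, f), ident T, ka)"
    "(ind_obj y, MapO K (T, f), ident T, ka) \<in> Arr QS"
    by (rule fp_objD[OF z])
  note s = orbit_section_ext[OF z]
  note Y = Q'.quotient_objD[OF ka(1)]
  note m = fp_obj_map[OF ka(1,2,3,5)]
  note D = QS_ArrD[OF ka(5)]
  have R: "Rx T ?s = MapO K (T, f)" "kx T ?s = class_lift T f" unfolding Rx_def kx_def s(3) by simp_all
  let ?E = "reduction_total (MapO K (T, f)) (class_lift T f) ?s"
  have l: "unit_map y \<alpha> e = ka (enc (e, \<one>))" if "e \<in> points y" for e
    using that ka(4) by (simp add: unit_map_def)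
  have lE: "ka (enc (e, \<one>)) \<in> topspace ?E" if e: "e \<in> points y" for e
    using m(1,2)[OF e] orbit_section_eq[OF z e] ka(4) by (simp add: reduction_total_iff)
  have i: "continuous_map (btotal y) (ind_total (btotal y)) (\<lambda>e. enc (e, \<one>))"
    by (rule ind_enc_cont) (simp_all add: one_A continuous_map_id[unfolded id_def])
  have "continuous_map (btotal y) (btotal (MapO K (T, f))) (\<lambda>e. ka (enc (e, \<one>)))"
    using cont_comp[OF i ext_mapsD(1)[OF D(4)[unfolded ind_obj_sel]]] .
  then have lc: "continuous_map (btotal y) ?E (\<lambda>e. ka (enc (e, \<one>)))"
    using lE by (subst reduction_total_def) (rule continuous_map_into_subtopology, auto simp: reduction_total_iff)
  show A: "(y, reduction_at T ?s, ident T, unit_map y \<alpha>) \<in> Arr Q'.QS"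
  proof (rule Q'.QS_ArrI[OF ka(1) reduction_at_obj[OF s(1)]])
    show "(ident T) \<in> ext_maps (btarget y) (btarget (reduction_at T ?s))"
      using ext_maps_id reduction_at_data(2)[OF s(1)] ka(3) by simp
    have "unit_map y \<alpha> = (\<lambda>e\<in>points y. ka (enc (e, \<one>)))" using ka(4) by (simp add: unit_map_def)
    then show "unit_map y \<alpha> \<in> ext_maps (btotal y) (btotal (reduction_at T ?s))"
      using ext_maps_restrict[OF lc] R by simp
    fix e assume e: "e \<in> points y"
    show "bmap (reduction_at T ?s) (unit_map y \<alpha> e) = bmap y e" using l[OF e] m(3)[OF e] R by simp
    show "bproj (reduction_at T ?s) (unit_map y \<alpha> e) = ident T (bproj y e)"
      using l[OF e] m(2)[OF e] R Q'.bundle_proj_closed[OF Y(1) e] ka(3) by simp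
    fix g assume g: "g \<in> carrier G'"
    show "unit_map y \<alpha> (bact y g e) = bact (reduction_at T ?s) g (unit_map y \<alpha> e)"
      using l[OF e] l[OF Q'.bundle_act_closed[OF Y(1) g e]] m(4)[OF e g] R by simp
  qed
  have v: "vertical_iso Q'.QS y (reduction_at T ?s) (y, reduction_at T ?s, ident T, unit_map y \<alpha>)"
    using Q'.QS_vertical_isoI[of y "reduction_at T ?s" "unit_map y \<alpha>"] A ka(3) reduction_at_data(2)[OF s(1)] by simp
  have TfO: "(T, f) \<in> Obj (space_stack W)" using ka(2) by simp
  have aw: "vertical_iso (space_stack W) (T, f) (T, f) (Idn (space_stack W) (T, f))"
    by (rule vertical_iso_Idn[OF space_stack_category TfO])
  have a_eq: "compose (topspace (ind_total (btotal y))) (reduction_extension (Rx T ?s) (kx T ?s) ?s) (ind_arrow_map y (unit_map y \<alpha>)) = ka"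
  proof (rule ind_map_eqI[where E = "btotal y"])
    show "ka \<in> extensional (topspace (ind_total (btotal y)))" using ext_mapsD(2)[OF D(4)] by simp
    fix e c assume e: "e \<in> points y" and c: "c \<in> A"
    show "compose (topspace (ind_total (btotal y))) (reduction_extension (Rx T ?s) (kx T ?s) ?s)
        (ind_arrow_map y (unit_map y \<alpha>)) (enc (e, c)) = ka (enc (e, c))"
      unfolding R using reduction_extension_enc[OF lE[OF e] c] m(5)[OF e c] l[OF e] e c
      by (simp add: compose_eq ind_totalI ind_arrow_map_enc)
  qed (simp add: compose_def)
  have KI: "MapA K (Idn (space_stack W) (T, f)) = Idn QS (MapO K (T, f))"
    by (rule stack_morphismD(3)[OF K TfO])
  have "Cmp QS (MapA K (Idn (space_stack W) (T, f))) \<alpha> = \<alpha>"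
    unfolding KI using stk_categoryD(7)[OF QS_category ka(5)] ka(4) by simp
  moreover have "Cmp QS (ind_obj (reduction_at T ?s), Rx T ?s, ident T, reduction_extension (Rx T ?s) (kx T ?s) ?s)
      (MapA ind (y, reduction_at T ?s, ident T, unit_map y \<alpha>)) = \<alpha>"
    using a_eq ext_maps_id_left[OF ext_maps_id[of T]] ka(3,4) R(1) by simp
  moreover have es: "MapO eps (T, ?s) = (reduction_at T ?s, (T, f),
      (ind_obj (reduction_at T ?s), Rx T ?s, ident T, reduction_extension (Rx T ?s) (kx T ?s) ?s))"
    by (simp add: s(3))
  ultimately have "((y, (T, f), \<alpha>), MapO eps (T, ?s), (y, reduction_at T ?s, ident T, unit_map y \<alpha>),
      Idn (space_stack W) (T, f)) \<in> Arr sq.FP"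
    unfolding es fiber_product_Arr
    using z eps_obj[OF s(1), unfolded es] A stk_categoryD(1)[OF space_stack_category TfO] by simp
  from sq.fp_vertical_iso[OF this[unfolded es] v aw]
  show "vertical_iso sq.FP (y, (T, f), \<alpha>) (MapO eps (MapO inv_eps (y, (T, f), \<alpha>))) (unit_iso (y, (T, f), \<alpha>))"
    unfolding unit_iso_def inv_eps_sel es by (simp add: s(3) epsO_def Let_def)
qed

lemma unit_two_iso: "two_iso sq.FP sq.FP id_map (comp_map eps inv_eps) unit_iso"
  unfolding two_iso_def
proof (intro conjI ballI)
  fix x assume x: "x \<in> Obj sq.FP"
  obtain y w \<alpha> where x1: "x = (y, w, \<alpha>)" by (rule prod_cases3)
  obtain T f where w: "w = (T, f)" by (cases w)
  show "vertical_iso sq.FP (MapO id_map x) (MapO (comp_map eps inv_eps) x) (unit_iso x)"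
    using unit_iso_arrow(2)[OF x[unfolded x1 w]] unfolding x1 w comp_map_sel id_map_sel .
next
  fix c assume c: "c \<in> Arr sq.FP"
  obtain y T f \<alpha> y' T' f' \<alpha>' a b where c': "c = ((y, (T, f), \<alpha>), (y', (T', f'), \<alpha>'), a, b)" by (rule fp_cases)
  note cA = c[unfolded c']
  have z: "(y, (T, f), \<alpha>) \<in> Obj sq.FP" and z': "(y', (T', f'), \<alpha>') \<in> Obj sq.FP"
    using cA by (simp_all add: fiber_product_Arr)
  obtain h l k where hlk: "a = (y, y', h, l)" "(y, y', h, l) \<in> Arr Q'.QS"
    "b = ((T, f), (T', f'), h)" "((T, f), (T', f'), h) \<in> Arr (space_stack W)"
    "MapA K b = (MapO K (T, f), MapO K (T', f'), h, k)"
    "\<forall>e\<in>points y. total_map \<alpha>' (enc (l e, \<one>)) = k (total_map \<alpha> (enc (e, \<one>)))"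
    by (rule fp_arrD[OF cA])
  obtain ka where ka: "Q'.qobj y" "f \<in> ext_maps T W" "btarget y = T"
    "\<alpha> = (ind_obj y, MapO K (T, f), ident T, ka)"
    "(ind_obj y, MapO K (T, f), ident T, ka) \<in> Arr QS"
    by (rule fp_objD[OF z])
  let ?s = "orbit_section y T f \<alpha>" and ?s' = "orbit_section y' T' f' \<alpha>'"
  note s = orbit_section_ext[OF z] and s' = orbit_section_ext[OF z']
  have R: "Rx T ?s = MapO K (T, f)" "kx T ?s = class_lift T f" unfolding Rx_def kx_def s(3) by simp_all
  have aE: "((T, ?s), (T', ?s'), h) \<in> Arr (space_stack orbit_space)" using inv_eps_arr[OF cA] hlk(3) by simp
  note D = Q'.QS_ArrD[OF hlk(2)] and B = Q'.QS_ArrD[OF unit_iso_arrow(1)[OF z]]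
  have rm: "restricted_map T ?s T' ?s' h = restrict k (topspace (reduction_total (MapO K (T, f)) (class_lift T f) ?s))"
    unfolding restricted_map_def s(3) s'(3) R using hlk(3,5) by simp
  have u: "unit_map y \<alpha> e \<in> topspace (reduction_total (MapO K (T, f)) (class_lift T f) ?s)" if "e \<in> points y" for e
    using ext_mapsD(3)[OF B(4) that] R by simp
  have "compose (points y) (unit_map y' \<alpha>') l
      = compose (points y) (restricted_map T ?s T' ?s' h) (unit_map y \<alpha>)"
    unfolding rm compose_def
  proof (rule restrict_ext)
    fix e assume e: "e \<in> points y"
    show "unit_map y' \<alpha>' (l e) = restrict k (topspace (reduction_total (MapO K (T, f)) (class_lift T f) ?s)) (unit_map y \<alpha> e)"
      using u[OF e] ext_mapsD(3)[OF D(4) e] hlk(6) e by (simp add: unit_map_def)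
  qed
  moreover have "compose (topspace T) (ident T') h = compose (topspace T) h (ident T)"
    using ext_maps_id_left[OF space_stack_ArrD(3)[OF hlk(4)]] ext_maps_id_right[OF space_stack_ArrD(3)[OF hlk(4)]] by simp
  ultimately show "Cmp sq.FP (unit_iso (Cod sq.FP c)) (MapA id_map c)
      = Cmp sq.FP (MapA (comp_map eps inv_eps) c) (unit_iso (Dom sq.FP c))"
    using s(3) s'(3) ka(3) by (simp add: c' unit_iso_def hlk(1,3) epsO_def Let_def)
qed

lemma eps_equivalence: "stack_equivalence (space_stack orbit_space) sq.FP eps"
proof -
  have c1: "stack_morphism (space_stack orbit_space) (space_stack orbit_space) (comp_map inv_eps eps)"
    by (rule stack_morphism_comp[OF eps_morphism inv_eps_morphism])
  have c2: "stack_morphism sq.FP sq.FP (comp_map eps inv_eps)"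
    by (rule stack_morphism_comp[OF inv_eps_morphism eps_morphism])
  have "\<exists>\<eta>. two_iso (space_stack orbit_space) (space_stack orbit_space) id_map (comp_map inv_eps eps) \<eta>"
  proof (rule exI, rule two_iso_Idn[OF space_stack_category id_map_morphism])
    fix x :: "('u, 'u) space_obj" assume "x \<in> Obj (space_stack orbit_space)"
    then obtain T s where x: "x = (T, s)" and s: "s \<in> ext_maps T orbit_space" by auto
    show "MapO id_map x = MapO (comp_map inv_eps eps) x" using inv_eps_eps[OF s] by (simp add: x)
  next
    fix a :: "('u, 'u) space_arr" assume a: "a \<in> Arr (space_stack orbit_space)"
    obtain T s T' s' h where a': "a = ((T, s), (T', s'), h)" by (rule arrow_cases)
    note * = space_stack_ArrD[OF a[unfolded a']]
    show "MapA id_map a = MapA (comp_map inv_eps eps) a"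
      using inv_eps_eps[OF *(1)] inv_eps_eps[OF *(2)] by (simp add: a')
  qed
  moreover have "\<exists>\<eta>. two_iso sq.FP sq.FP (comp_map eps inv_eps) id_map \<eta>"
  proof -
    have "Dom sq.FP a \<in> Obj sq.FP \<and> Cod sq.FP a \<in> Obj sq.FP" if "a \<in> Arr sq.FP" for a
      using stk_categoryD(4,5)[OF sq.fp_category that] by simp
    then obtain \<eta> where "two_iso sq.FP sq.FP (comp_map eps inv_eps) id_map \<eta>"
      by (rule two_iso_sym[OF sq.fp_category id_map_morphism c2 _ unit_two_iso])
    then show ?thesis by (rule exI[of "two_iso sq.FP sq.FP (comp_map eps inv_eps) id_map"])
  qed
  ultimately show ?thesis
    unfolding stack_equivalence_def using eps_morphism inv_eps_morphism by blast
qed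

text \<open>
  The equivalence is compatible with the projections to \<open>W\<close> strictly, so identities
  serve as the 2-isomorphism.
\<close>

lemma eps_over_base:
  "\<exists>\<eta>. two_iso (space_stack orbit_space) (space_stack W) (comp_map fiber_proj eps) (space_map (bproj rep)) \<eta>"
proof -
  have eq: "MapO (comp_map fiber_proj eps) x = MapO (space_map (bproj rep)) x"
    "MapA (comp_map fiber_proj eps) a = MapA (space_map (bproj rep)) a" for x :: "('u, 'u) space_obj" and a
  proof -
    show "MapO (comp_map fiber_proj eps) x = MapO (space_map (bproj rep)) x"
      by (cases x) (simp add: fiber_proj_def qf_def)
    obtain T s T' s' h where a': "a = ((T, s), (T', s'), h)" by (rule arrow_cases)
    show "MapA (comp_map fiber_proj eps) a = MapA (space_map (bproj rep)) a"
      by (simp add: a' fiber_proj_def qf_def)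
  qed
  have "stack_morphism (space_stack orbit_space) (space_stack W) (comp_map fiber_proj eps)"
    by (rule stack_morphism_cong[OF space_stack_category space_map_morphism[OF q_cont]]) (rule eq)+
  from two_iso_Idn[OF space_stack_category this eq] show ?thesis by blast
qed

end

context induced begin

theorem induced_covering_projection: "covering_projection Q'.QS QS ind"
proof -
  have *: "\<exists>(E :: 'u topology) \<epsilon> q \<eta>.
        stack_equivalence (space_stack E) (fiber_product Q'.QS (space_stack W) QS ind K) \<epsilon> \<and>
        covering_map E W q \<and>
        two_iso (space_stack E) (space_stack W) (comp_map fiber_proj \<epsilon>) (space_map q) \<eta>"
    if K: "stack_morphism (space_stack W) QS K" for W :: "'u topology" and K
  proof -
    interpret c: induced_cover G TG X actX U enc G' TG' actX' \<iota> p W K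
    proof unfold_locales
      show "stack_morphism (space_stack W) QS K" by (fact K)
      show "(ident W) \<in> ext_maps W W" by (rule ext_maps_id)
    qed (simp_all add: continuous_map_id[unfolded id_def])
    show ?thesis using c.eps_equivalence c.orbit_space_covering c.eps_over_base by blast
  qed
  then show ?thesis
    unfolding covering_projection_def representable_def using ind_morphism by blast
qed

end

section \<open>Bundles over the circle\<close>

context topgroup begin

text \<open>
  Bolzano's subdivision principle: lifts over adjacent intervals can be glued, and over a short
  interval, which lies in a chart, a lift is a translate of the section.
\<close>

lemma path_lift:
  fixes w :: "real \<Rightarrow> 'b"
  assumes b: "principal_bundle G TG T E act \<pi>" and w: "continuous_map euclideanreal T w" and ab: "a \<le> b"
    and e: "e \<in> topspace E" "\<pi> e = w a"
  obtains \<theta> where "continuous_map (top_of_set {a..b}) E \<theta>" "\<theta> a = e" "\<And>t. t \<in> {a..b} \<Longrightarrow> \<pi> (\<theta> t) = w t"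
proof -
  define L where "L a b \<longleftrightarrow> (\<forall>e. e \<in> topspace E \<and> \<pi> e = w a \<longrightarrow> (\<exists>\<theta>. continuous_map (top_of_set {a..b}) E \<theta> \<and>
      \<theta> a = e \<and> (\<forall>t\<in>{a..b}. \<pi> (\<theta> t) = w t)))" for a b
  have "L a b"
    using ab
  proof (rule Bolzano)
    fix a b c assume L: "L a b" "L b c" and abc: "a \<le> b" "b \<le> c"
    show "L a c"
      unfolding L_def
    proof (intro allI impI)
      fix e assume e: "e \<in> topspace E \<and> \<pi> e = w a"
      obtain \<theta> where th: "continuous_map (top_of_set {a..b}) E \<theta>" "\<theta> a = e" "\<forall>t\<in>{a..b}. \<pi> (\<theta> t) = w t"
        using L(1) e unfolding L_def by blast
      have "\<theta> b \<in> topspace E" "\<pi> (\<theta> b) = w b" using cont_closed[OF th(1)] th(3) abc by simp_all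
      then obtain \<theta>' where th': "continuous_map (top_of_set {b..c}) E \<theta>'" "\<theta>' b = \<theta> b" "\<forall>t\<in>{b..c}. \<pi> (\<theta>' t) = w t"
        using L(2) unfolding L_def by blast
      have "continuous_map (top_of_set {a..c}) E (\<lambda>t. if t \<le> b then \<theta> t else \<theta>' t)"
      proof (rule continuous_map_cases_le)
        have "{a..c} \<inter> {x \<in> topspace (top_of_set {a..c}). x \<le> b} = {a..b}"
          "{a..c} \<inter> {x \<in> topspace (top_of_set {a..c}). b \<le> x} = {b..c}" using abc by auto
        then show "continuous_map (subtopology (top_of_set {a..c}) {x \<in> topspace (top_of_set {a..c}). x \<le> b}) E \<theta>"
          "continuous_map (subtopology (top_of_set {a..c}) {x \<in> topspace (top_of_set {a..c}). b \<le> x}) E \<theta>'"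
          using th(1) th'(1) by (simp_all only: subtopology_subtopology)
        show "continuous_map (top_of_set {a..c}) euclideanreal (\<lambda>t. t)" by simp
      qed (use th' in auto)
      then show "\<exists>\<theta>. continuous_map (top_of_set {a..c}) E \<theta> \<and> \<theta> a = e \<and> (\<forall>t\<in>{a..c}. \<pi> (\<theta> t) = w t)"
        using th th' abc by (intro exI[of _ "\<lambda>t. if t \<le> b then \<theta> t else \<theta>' t"]) auto
    qed
  next
    fix x :: real
    have wx: "w x \<in> topspace T" using cont_closed[OF w] by simp
    obtain V \<sigma> \<gamma> where V: "w x \<in> V" and c: "chart T E act \<pi> V \<sigma> \<gamma>" by (rule bundle_chart[OF b wx])
    note c = chartD[OF b c]
    have "open {t. w t \<in> V}" using openin_continuous_map_preimage[OF w c(1)] by simp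
    then obtain d where d: "d > 0" "ball x d \<subseteq> {t. w t \<in> V}" using V open_contains_ball by (metis mem_Collect_eq)
    have "L a b" if "a \<le> x" "x \<le> b" "b - a < d" for a b
      unfolding L_def
    proof (intro allI impI)
      fix e assume e: "e \<in> topspace E \<and> \<pi> e = w a"
      have wV: "w t \<in> V" if "t \<in> {a..b}" for t
      proof -
        have "t \<in> ball x d" using that \<open>a \<le> x\<close> \<open>x \<le> b\<close> \<open>b - a < d\<close> by (auto simp: dist_real_def)
        then show ?thesis using d(2) by blast
      qed
      have aV: "\<pi> e \<in> V" using wV[of a] e that by simp
      have "continuous_map (top_of_set {a..b}) (subtopology T V) w"
        by (intro continuous_map_into_subtopology continuous_map_from_subtopology w) (use wV in auto)
      from cont_comp[OF this c(3)]
      have "continuous_map (top_of_set {a..b}) E (\<lambda>t. act (\<gamma> e) (\<sigma> (w t)))"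
        using c(8)[of e] aV e by (intro action_cont[OF bundle_action[OF b]]) (simp_all add: topspace_TG)
      moreover have "act (\<gamma> e) (\<sigma> (w a)) = e" using c(7)[of e] aV e by simp
      moreover have "\<pi> (act (\<gamma> e) (\<sigma> (w t))) = w t" if "t \<in> {a..b}" for t
        using bundle_invariant[OF b c(8) c(6)] c(5) wV[OF that] aV e by simp
      ultimately show "\<exists>\<theta>. continuous_map (top_of_set {a..b}) E \<theta> \<and> \<theta> a = e \<and> (\<forall>t\<in>{a..b}. \<pi> (\<theta> t) = w t)"
        by (intro exI[of _ "\<lambda>t. act (\<gamma> e) (\<sigma> (w t))"]) simp
    qed
    then show "\<exists>d>0. \<forall>a b. a \<le> x \<and> x \<le> b \<and> b - a < d \<longrightarrow> L a b" using d(1) by blast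
  qed
  then show ?thesis using e that unfolding L_def by blast
qed

end

definition circle_path :: "real \<Rightarrow> complex" where "circle_path t = cis (2 * pi * t)"

lemma circle_path_eq:
  assumes "t \<in> {0..1}" "t' \<in> {0..1}" "circle_path t = circle_path t'"
  shows "t = t' \<or> (t = 0 \<and> t' = 1) \<or> (t = 1 \<and> t' = 0)"
proof -
  have "cos (2 * pi * t) = cos (2 * pi * t')" "sin (2 * pi * t) = sin (2 * pi * t')"
    using arg_cong[OF assms(3), of Re] arg_cong[OF assms(3), of Im] by (simp_all add: circle_path_def)
  then obtain n :: int where "2 * pi * t = 2 * pi * t' + 2 * pi * n"
    using sin_cos_eq_iff[of "2 * pi * t" "2 * pi * t'"] by blast
  then have "2 * pi * t = 2 * pi * (t' + of_int n)" by (simp add: algebra_simps)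
  then have n: "t = t' + real_of_int n" by simp
  then have "\<bar>real_of_int n\<bar> \<le> 1" using assms(1,2) by auto
  then have "\<bar>n\<bar> \<le> 1" by linarith
  then have "n = 0 \<or> n = 1 \<or> n = -1" by linarith
  then show ?thesis using n assms(1,2) by auto
qed

lemma circle_path_quotient: "quotient_map (top_of_set {0..1}) circle_space circle_path"
proof -
  have c: "continuous_map (top_of_set {0..1}) circle_space circle_path"
    unfolding circle_space_def circle_path_def
    by (auto simp: continuous_map_in_subtopology intro!: continuous_intros)
  have im: "circle_path ` {0..1} = sphere 0 1"
  proof
    show "sphere 0 1 \<subseteq> circle_path ` {0..1}"
    proof
      fix z :: complex assume "z \<in> sphere 0 1"
      then have z: "norm z = 1" by simp
      have "z = circle_path (Arg2pi z / (2 * pi))"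
        using z complex_norm_eq_1_exp[of z] by (simp add: circle_path_def cis_conv_exp)
      moreover have "Arg2pi z / (2 * pi) \<in> {0..1}" using Arg2pi[of z] by (simp add: field_simps)
      ultimately show "z \<in> circle_path ` {0..1}" by blast
    qed
  qed (auto simp: circle_path_def)
  show ?thesis
    by (rule T1_Spaces.continuous_imp_quotient_map[OF c])
      (use im in \<open>simp_all add: circle_space_def Hausdorff_space_subtopology compact_space_subtopology\<close>)
qed

context topgroup begin

text \<open>
  A lift of the standard loop through \<open>e\<^sub>0\<close> ends at a point of the same fibre.
  Multiplying it by a path in \<open>G\<close> from \<open>1\<close> to the element that moves
  this point back to \<open>e\<^sub>0\<close> closes it up.
\<close>

lemma circle_bundle_section:
  assumes b: "principal_bundle G TG Su E act \<pi>"
    and ji: "homeomorphic_map circle_space Su ji"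
    and path: "\<And>g. g \<in> carrier G \<Longrightarrow>
      \<exists>c. continuous_map (top_of_set {0..1::real}) TG c \<and> c 0 = \<one> \<and> c 1 = g"
    and e0: "e0 \<in> topspace E" "\<pi> e0 = ji 1"
  obtains s where "continuous_map Su E s" "\<forall>x\<in>topspace Su. \<pi> (s x) = x" "s (ji 1) = e0"
proof -
  have jc: "continuous_map circle_space Su ji" using homeomorphic_imp_continuous_map[OF ji] .
  have "continuous_map euclideanreal circle_space circle_path"
    unfolding circle_space_def circle_path_def
    by (auto simp: continuous_map_in_subtopology intro!: continuous_intros)
  then have w: "continuous_map euclideanreal Su (\<lambda>t. ji (circle_path t))" using jc by (rule cont_comp)
  have c01: "circle_path 0 = 1" "circle_path 1 = 1" by (simp_all add: circle_path_def)
  obtain \<theta> where \<theta>: "continuous_map (top_of_set {0..1}) E \<theta>" "\<theta> 0 = e0"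
      "\<And>t. t \<in> {0..1} \<Longrightarrow> \<pi> (\<theta> t) = ji (circle_path t)"
    using path_lift[OF b w, of 0 1 e0] e0 c01 by auto
  have \<theta>E: "\<theta> t \<in> topspace E" if "t \<in> {0..1}" for t using cont_closed[OF \<theta>(1)] that by simp
  have "\<pi> (\<theta> 1) = \<pi> (\<theta> 0)" using \<theta>(3)[of 0] \<theta>(3)[of 1] c01 by simp
  then obtain g where g: "g \<in> carrier G" "act g (\<theta> 1) = \<theta> 0"
    using bundle_fibre[OF b \<theta>E[of 1] \<theta>E[of 0]] by auto
  obtain c where c: "continuous_map (top_of_set {0..1::real}) TG c" "c 0 = \<one>" "c 1 = g" using path[OF g(1)] by blast
  have cG: "c t \<in> carrier G" if "t \<in> {0..1}" for t
    using cont_closed[OF c(1)] that topspace_TG by simp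
  let ?s = "\<lambda>t. act (c t) (\<theta> t)"
  have s: "continuous_map (top_of_set {0..1}) E ?s" using action_cont[OF bundle_action[OF b] c(1) \<theta>(1)] .
  have s01: "?s 0 = e0" "?s 1 = e0" using c g \<theta>(2) bundle_act_one[OF b e0(1)] by simp_all
  have quo: "quotient_map (top_of_set {0..1}) Su (ji \<circ> circle_path)"
    using quotient_map_compose[OF circle_path_quotient conjunct1[OF ji[unfolded homeomorphic_map_def]]] .
  have inj: "inj_on ji (topspace circle_space)" using homeomorphic_imp_injective_map[OF ji] .
  have well: "?s t = ?s t'" if t: "t \<in> topspace (top_of_set {0..1})" "t' \<in> topspace (top_of_set {0..1})"
    "(ji \<circ> circle_path) t = (ji \<circ> circle_path) t'" for t t'
  proof -
    have "circle_path t \<in> topspace circle_space" "circle_path t' \<in> topspace circle_space"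
      by (simp_all add: circle_space_def circle_path_def)
    then have "circle_path t = circle_path t'" using t(3) inj by (simp add: inj_on_eq_iff)
    then show ?thesis using circle_path_eq[of t t'] t s01 by auto
  qed
  have "\<exists>f. continuous_map Su E f \<and> (\<forall>t\<in>{0..1}. f (ji (circle_path t)) = ?s t)"
  proof (rule quotient_map_lift_exists[OF quo s])
    fix g assume g: "continuous_map Su E g"
      "\<And>x. x \<in> topspace (top_of_set {0..1}) \<Longrightarrow> g ((ji \<circ> circle_path) x) = ?s x"
    then have "\<forall>t\<in>{0..1}. g (ji (circle_path t)) = ?s t" by simp
    then show ?thesis using g(1) by blast
  qed (rule well)
  then obtain f where fc: "continuous_map Su E f" and fv: "\<And>t. t \<in> {0..1} \<Longrightarrow> f (ji (circle_path t)) = ?s t"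
    by blast
  show ?thesis
  proof (rule that[OF fc])
    show "f (ji 1) = e0" using fv[of 0] s01 c01 by simp
    show "\<forall>x\<in>topspace Su. \<pi> (f x) = x"
    proof
    fix x assume "x \<in> topspace Su"
    then have "x \<in> (ji \<circ> circle_path) ` topspace (top_of_set {0..1})"
      using quotient_imp_surjective_map[OF quo] by simp
    then obtain t where t: "t \<in> {0..1}" "x = ji (circle_path t)" by auto
    then show "\<pi> (f x) = x" using fv[of t] \<theta>(3)[OF t(1)] bundle_invariant[OF b cG[OF t(1)] \<theta>E[OF t(1)]] by simp
    qed
  qed
qed

end

section \<open>The fundamental group of a quotient stack\<close>

context qstack_coded begin

text \<open>Any space whose points can be injected into the universe can be represented.\<close>

lemma represented_by_copy:
  assumes K: "stack_morphism (space_stack S) QS K" and c: "inj_on c (topspace S)"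
  shows "represented G TG X actX U S (push_top S c) (restrict (inv_into (topspace S) c) (c ` topspace S)) c K"
proof unfold_locales
  show "restrict (inv_into (topspace S) c) (c ` topspace S) \<in> ext_maps (push_top S c) S"
    using ext_maps_restrict[OF continuous_map_inv_push_top[OF c]] by simp
  show "continuous_map S (push_top S c) c" by (rule continuous_map_push_top)
  show "stack_morphism (space_stack S) QS K" by (fact K)
  show "restrict (inv_into (topspace S) c) (c ` topspace S) (c s) = s" if "s \<in> topspace S" for s
    using that c by simp
  show "c (restrict (inv_into (topspace S) c) (c ` topspace S) x) = x" if "x \<in> topspace (push_top S c)" for x
    using that f_inv_into_f[of x c "topspace S"] by simp
qed

context
  fixes u :: "real \<Rightarrow> 'u" and x
  assumes u: "inj u" and x: "point_of_stack QS x"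
    and path: "\<And>g. g \<in> carrier G \<Longrightarrow>
      \<exists>c. continuous_map (top_of_set {0..1::real}) TG c \<and> c 0 = \<one> \<and> c 1 = g"
begin

lemmas x_morphism = x[unfolded point_of_stack_def]

interpretation pt: represented G TG X actX U pt_space "push_top pt_space (\<lambda>_. u 0)"
  "restrict (inv_into (topspace pt_space) (\<lambda>_. u 0)) ((\<lambda>_. u 0) ` topspace pt_space)" "\<lambda>_. u 0" x
  by (rule represented_by_copy[OF x_morphism]) (simp add: pt_space_def)

abbreviation ptu where "ptu \<equiv> push_top pt_space (\<lambda>_. u 0)"

lemma topspace_ptu: "topspace ptu = {u 0}" by (simp add: pt_space_def)

definition base_lift where "base_lift = (SOME e. e \<in> points pt.rep)"

lemma base_lift: "base_lift \<in> points pt.rep" "bproj pt.rep base_lift = u 0"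
proof -
  note b = quotient_objD(1)[OF pt.rep_obj(1)]
  have "u 0 \<in> topspace (btarget pt.rep)" using pt.rep_obj(2) topspace_ptu by simp
  then obtain V \<sigma> \<gamma> where "u 0 \<in> V" "chart (btarget pt.rep) (btotal pt.rep) (bact pt.rep) (bproj pt.rep) V \<sigma> \<gamma>"
    by (rule bundle_chart[OF b])
  then have "\<sigma> (u 0) \<in> points pt.rep" using chartD(6)[OF b] by blast
  then show 1: "base_lift \<in> points pt.rep" unfolding base_lift_def by (rule someI)
  show "bproj pt.rep base_lift = u 0"
    using bundle_proj_closed[OF b 1] pt.rep_obj(2) topspace_ptu by simp
qed

abbreviation base_section where "base_section \<equiv> pt.pullback_section (\<lambda>_. base_lift)"

definition base_value where "base_value = bmap pt.rep base_lift"

lemma base_data: "continuous_map ptu (btotal pt.rep) (\<lambda>_. base_lift)"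
    "\<forall>y\<in>topspace ptu. bproj pt.rep base_lift = y"
  using base_lift topspace_ptu by simp_all

lemmas base_section = pt.pullback_section[OF base_data]
lemmas base_section_natural = pt.pullback_section_natural[OF base_data]

lemma unit_ext: "(f :: 'u \<Rightarrow> unit) = g" by (rule ext) simp

lemma pt_ext: "(f :: 'u \<Rightarrow> unit) \<in> ext_maps T pt_space"
proof -
  have 1: "restrict (\<lambda>_. ()) (topspace T) \<in> ext_maps T pt_space"
    by (rule ext_maps_restrict) (simp add: pt_space_def)
  show ?thesis by (subst unit_ext[of f "restrict (\<lambda>_. ()) (topspace T)"]) (rule 1)
qed

text \<open>The argument embeds the circle into the reals and hence into the universe.\<close>

definition code where "code z = u (Arg z)"

lemma code_inj: "inj_on code (topspace circle_space)"
proof (rule inj_onI)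
  fix z z' assume z: "z \<in> topspace circle_space" "z' \<in> topspace circle_space" and "code z = code z'"
  then have "Arg z = Arg z'" using u by (simp add: code_def inj_eq)
  moreover have "norm z = 1" "norm z' = 1" using z by (simp_all add: circle_space_def)
  ultimately show "z = z'" using rcis_cmod_Arg[of z] rcis_cmod_Arg[of z'] by simp
qed

abbreviation circle_u where "circle_u \<equiv> push_top circle_space code"

lemma one_circle: "1 \<in> topspace circle_space" by (simp add: circle_space_def)

text \<open>
  A natural family of sections of the bundles of a loop \<open>f0\<close>, lying over a loop
  \<open>z\<close> in \<open>X\<close>, and equal at the base point to the section fixed in the
  base point \<open>x\<close> itself, via \<open>\<phi>\<close>.
\<close>

definition normalised_section where
  "normalised_section f0 \<phi> s z \<longleftrightarrow> continuous_map circle_space X z \<and> z 1 = base_value \<and>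
    (\<forall>T f. f \<in> ext_maps T circle_space \<longrightarrow> continuous_map T (btotal (MapO f0 (T, f))) (s T f)) \<and>
    (\<forall>T f. f \<in> ext_maps T circle_space \<longrightarrow> (\<forall>t\<in>topspace T. bproj (MapO f0 (T, f)) (s T f t) = t)) \<and>
    (\<forall>T f. f \<in> ext_maps T circle_space \<longrightarrow> (\<forall>t\<in>topspace T. bmap (MapO f0 (T, f)) (s T f t) = z (f t))) \<and>
    (\<forall>T f T' f' k. ((T, f), (T', f'), k) \<in> Arr (space_stack circle_space) \<longrightarrow>
      (\<forall>t\<in>topspace T. total_map (MapA f0 ((T, f), (T', f'), k)) (s T f t) = s T' f' (k t))) \<and>
    (\<forall>T f. \<forall>t\<in>topspace T. total_map (\<phi> (T, f)) (base_section T f t) = s T (compose (topspace T) (\<lambda>_. 1) f) t)"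

lemma normalised_sectionD:
  assumes "normalised_section f0 \<phi> s z"
  shows "continuous_map circle_space X z" "z 1 = base_value"
    "\<And>T f. f \<in> ext_maps T circle_space \<Longrightarrow> continuous_map T (btotal (MapO f0 (T, f))) (s T f)"
    "\<And>T f t. f \<in> ext_maps T circle_space \<Longrightarrow> t \<in> topspace T \<Longrightarrow> bproj (MapO f0 (T, f)) (s T f t) = t"
    "\<And>T f t. f \<in> ext_maps T circle_space \<Longrightarrow> t \<in> topspace T \<Longrightarrow> bmap (MapO f0 (T, f)) (s T f t) = z (f t)"
    "\<And>T f T' f' k t. ((T, f), (T', f'), k) \<in> Arr (space_stack circle_space) \<Longrightarrow> t \<in> topspace T \<Longrightarrow>
      total_map (MapA f0 ((T, f), (T', f'), k)) (s T f t) = s T' f' (k t)"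
    "\<And>T f t. t \<in> topspace T \<Longrightarrow> total_map (\<phi> (T, f)) (base_section T f t)
       = s T (compose (topspace T) (\<lambda>_. 1) f) t"
  using assms unfolding normalised_section_def by simp_all

text \<open>
  The representing bundle of a loop is a bundle over the circle, and its section exists by
  \<open>circle_bundle_section\<close>; the prescribed value at \<open>1\<close> makes the section
  compatible with \<open>\<phi>\<close>.
\<close>

lemma loop_section:
  assumes L: "(f0, \<phi>) \<in> pointed_loops QS x"
  shows "\<exists>s z. normalised_section f0 \<phi> s z"
proof -
  have f0: "stack_morphism (space_stack circle_space) QS f0"
    and \<phi>: "two_iso (space_stack pt_space) QS x (comp_map f0 (space_map (\<lambda>_. 1))) \<phi>"
    using L by (simp_all add: pointed_loops_def)
  interpret c: represented G TG X actX U circle_space circle_u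
    "restrict (inv_into (topspace circle_space) code) (code ` topspace circle_space)" code f0
    by (rule represented_by_copy[OF f0 code_inj])
  have one_map: "continuous_map pt_space circle_space (\<lambda>_. 1)" using one_circle by simp
  let ?c = "\<lambda>T (f :: 'u \<Rightarrow> unit). compose (topspace T) (\<lambda>_. 1 :: complex) f"
  have c1: "?c T f \<in> ext_maps T circle_space" for T f
    by (rule ext_maps_compose_map[OF pt_ext one_map])
  define p where "p = (restrict (inv_into (topspace pt_space) (\<lambda>_. u 0)) ((\<lambda>_. u 0) ` topspace pt_space))"
  have \<phi>v: "\<exists>k. \<phi> (T, f) = (MapO x (T, f), MapO f0 (T, ?c T f), ident T, k) \<and>
      (MapO x (T, f), MapO f0 (T, ?c T f), ident T, k) \<in> Arr QS" for T f
  proof -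
    have "vertical_iso QS (MapO x (T, f)) (MapO f0 (T, ?c T f)) (\<phi> (T, f))"
      using two_isoD(1)[OF \<phi>, of "(T, f)"] pt_ext by simp
    then show ?thesis
      using morphism_object(2)[OF x_morphism pt_ext, of T f] QS_vertical_isoE by metis
  qed
  \<comment> \<open>the point over \<open>1\<close> that \<open>\<phi>\<close> assigns to the chosen lift of the base point; it does not depend on the test object\<close>
  define e1 where "e1 = c.class_lift ptu (?c ptu p) (total_map (\<phi> (ptu, p)) base_lift)"
  have key: "c.class_lift T (?c T f) (total_map (\<phi> (T, f)) (base_section T f t)) = e1" if t: "t \<in> topspace T" for T f t
  proof -
    let ?a = "((T, f), (ptu, p), pt.class_map T f)"
    let ?b = "((T, ?c T f), (ptu, ?c ptu p), pt.class_map T f)"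
    have a: "?a \<in> Arr (space_stack pt_space)"
      unfolding p_def by (rule pt.class_map_arrow[OF pt_ext])
    have b: "?b \<in> Arr (space_stack circle_space)"
      by (rule space_map_Arr[OF one_map a])
    obtain k where k: "\<phi> (T, f) = (MapO x (T, f), MapO f0 (T, ?c T f), ident T, k)"
      "(MapO x (T, f), MapO f0 (T, ?c T f), ident T, k) \<in> Arr QS" using \<phi>v by blast
    obtain k1 where k1: "\<phi> (ptu, p) = (MapO x (ptu, p), MapO f0 (ptu, ?c ptu p), ident ptu, k1)"
      using \<phi>v by blast
    obtain l where l: "MapA f0 ?b = (MapO f0 (T, ?c T f), MapO f0 (ptu, ?c ptu p), pt.class_map T f, l)"
      by (rule morphism_arrow[OF f0 b])
    have xa: "MapA x ?a = (MapO x (T, f), pt.rep, pt.class_map T f, pt.class_lift T f)"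
      unfolding p_def by (rule pt.class_lift_arrow(2)[OF pt_ext])
    have "Cmp QS (\<phi> (ptu, p)) (MapA x ?a) = Cmp QS (MapA f0 ?b) (\<phi> (T, f))"
      using two_isoD(2)[OF \<phi> a] by simp
    then have eq: "compose (points (MapO x (T, f))) k1 (pt.class_lift T f) = compose (points (MapO x (T, f))) l k"
      unfolding xa k(1) k1 l by simp
    note bs = base_section(2-4)[OF pt_ext t]
    have "k1 base_lift = l (k (base_section T f t))"
      using fun_cong[OF eq, of "base_section T f t"] bs by (simp add: compose_eq)
    moreover have "c.class_lift ptu (?c ptu p) (l (k (base_section T f t))) = c.class_lift T (?c T f) (k (base_section T f t))"
      using c.class_lift_natural[OF b ext_mapsD(3)[OF QS_ArrD(4)[OF k(2)] bs(1)]] l by simp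
    ultimately show ?thesis unfolding e1_def k(1) k1 by simp
  qed
  have e1: "e1 \<in> points c.rep" "bproj c.rep e1 = code 1" "bmap c.rep e1 = base_value"
  proof -
    have t: "u 0 \<in> topspace ptu" using topspace_ptu by simp
    obtain k where k: "\<phi> (ptu, p) = (MapO x (ptu, p), MapO f0 (ptu, ?c ptu p), ident ptu, k)"
      "(MapO x (ptu, p), MapO f0 (ptu, ?c ptu p), ident ptu, k) \<in> Arr QS" using \<phi>v by blast
    note bs = base_section(2,3,5)[OF pt_ext[of p] t]
    note D = QS_ArrD[OF k(2)] and D' = QS_ArrD[OF c.class_lift_arrow(1)[OF c1[of ptu p]]]
    have e: "e1 = c.class_lift ptu (?c ptu p) (k (base_section ptu p (u 0)))" using key[OF t, of p] k(1) by simp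
    note kb = ext_mapsD(3)[OF D(4) bs(1)]
    show "e1 \<in> points c.rep" unfolding e using ext_mapsD(3)[OF D'(4) kb] .
    show "bproj c.rep e1 = code 1"
      unfolding e using D'(7)[OF kb] D(7)[OF bs(1)] bs(2) t by (simp add: c.class_map_def compose_eq)
    show "bmap c.rep e1 = base_value"
      unfolding e using D'(6)[OF kb] D(6)[OF bs(1)] bs(3) by (simp add: base_value_def)
  qed
  note cb = quotient_objD(1)[OF c.rep_obj(1), unfolded c.rep_obj(2)]
  obtain s0 where s0: "continuous_map circle_u (btotal c.rep) s0" "\<forall>y\<in>topspace circle_u. bproj c.rep (s0 y) = y"
      "s0 (code 1) = e1"
    by (rule circle_bundle_section[OF cb homeomorphic_map_push_top[OF code_inj] path e1(1,2)])
  note S = c.pullback_section[OF s0(1,2)]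
  show ?thesis
    unfolding normalised_section_def
  proof (intro exI[of _ "c.pullback_section s0"] exI[of _ "\<lambda>y. bmap c.rep (s0 (code y))"] conjI allI impI ballI)
    show "continuous_map circle_space X (\<lambda>y. bmap c.rep (s0 (code y)))"
      by (rule cont_comp[OF cont_comp[OF continuous_map_push_top s0(1)] quotient_objD(2)[OF c.rep_obj(1)]])
    show "bmap c.rep (s0 (code 1)) = base_value" using s0(3) e1(3) by simp
    show "total_map (MapA f0 ((T, f), (T', f'), k)) (c.pullback_section s0 T f t) = c.pullback_section s0 T' f' (k t)"
      if "((T, f), (T', f'), k) \<in> Arr (space_stack circle_space)" "t \<in> topspace T" for T f T' f' k t
      by (rule c.pullback_section_natural[OF s0(1,2) that])
    show "total_map (\<phi> (T, f)) (base_section T f t) = c.pullback_section s0 T (?c T f) t"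
      if t: "t \<in> topspace T" for T f t
    proof (rule S(6)[OF c1 t])
      obtain k where k: "\<phi> (T, f) = (MapO x (T, f), MapO f0 (T, ?c T f), ident T, k)"
        "(MapO x (T, f), MapO f0 (T, ?c T f), ident T, k) \<in> Arr QS" using \<phi>v by blast
      note bs = base_section(2,3)[OF pt_ext[of f] t] and D = QS_ArrD[OF k(2)]
      show "total_map (\<phi> (T, f)) (base_section T f t) \<in> points (MapO f0 (T, ?c T f))"
        using ext_mapsD(3)[OF D(4) bs(1)] k(1) by simp
      show "bproj (MapO f0 (T, ?c T f)) (total_map (\<phi> (T, f)) (base_section T f t)) = t"
        unfolding k(1) total_map_simp by (rule trans[OF D(7)[OF bs(1)]]) (simp add: bs(2) t)
      show "c.class_lift T (?c T f) (total_map (\<phi> (T, f)) (base_section T f t)) = s0 (code (?c T f t))"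
        unfolding key[OF t] compose_eq[OF t] by (rule s0(3)[symmetric])
    qed
    show "continuous_map T (btotal (MapO f0 (T, f))) (c.pullback_section s0 T f)"
      if "f \<in> ext_maps T circle_space" for T f using S(1)[OF that] .
    show "bproj (MapO f0 (T, f)) (c.pullback_section s0 T f t) = t"
      "bmap (MapO f0 (T, f)) (c.pullback_section s0 T f t) = bmap c.rep (s0 (code (f t)))"
      if "f \<in> ext_maps T circle_space" "t \<in> topspace T" for T f t using S(3,5)[OF that] .
  qed
qed

text \<open>The constant loop.\<close>

lemma pointed_loops_nonempty: "pointed_loops QS x \<noteq> {}"
proof -
  have c: "continuous_map circle_space pt_space (\<lambda>_. ())" by (simp add: pt_space_def)
  have one_map: "continuous_map pt_space circle_space (\<lambda>_. 1)" using one_circle by simp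
  let ?f = "comp_map x (space_map (\<lambda>_. ()))"
  have f: "stack_morphism (space_stack circle_space) QS ?f"
    by (rule stack_morphism_comp[OF space_map_morphism[OF c] x_morphism])
  have "two_iso (space_stack pt_space) QS x (comp_map ?f (space_map (\<lambda>_. 1))) (\<lambda>p. Idn QS (MapO x p))"
  proof (rule two_iso_Idn[OF QS_category x_morphism])
    fix p :: "('u, unit) space_obj"
    obtain T f where p: "p = (T, f)" by (cases p)
    show "MapO x p = MapO (comp_map ?f (space_map (\<lambda>_. 1))) p"
      unfolding p comp_map_sel space_map_sel by (subst unit_ext) (rule refl)
  next
    fix a :: "('u, unit) space_arr"
    obtain T f T' f' h where a: "a = ((T, f), (T', f'), h)" by (rule arrow_cases)
    have e: "compose (topspace T) (\<lambda>_. ()) (compose (topspace T) (\<lambda>_. 1 :: complex) f) = f"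
       "compose (topspace T') (\<lambda>_. ()) (compose (topspace T') (\<lambda>_. 1 :: complex) f') = f'"
      by (rule unit_ext)+
    show "MapA x a = MapA (comp_map ?f (space_map (\<lambda>_. 1))) a"
      unfolding a comp_map_sel space_map_sel by (rule arg_cong[of _ _ "MapA x"]) (auto intro: unit_ext)
  qed
  then have "(?f, \<lambda>p. Idn QS (MapO x p)) \<in> pointed_loops QS x" using f by (simp add: pointed_loops_def)
  then show ?thesis by blast
qed

text \<open>
  The normalised sections replace both loops by loops \<open>z\<^sub>0\<close>,
  \<open>z\<^sub>1\<close> in \<open>X\<close> with the same base point. A based homotopy between
  these gives a morphism with trivial bundles from the cylinder; the 2-isomorphisms with the two
  loops and with the base point come from the sections, and they agree at the base point because
  the sections do.
\<close>

lemma loops_homotopic: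
  assumes SC: "\<And>z0 z1. continuous_map circle_space X z0 \<Longrightarrow> continuous_map circle_space X z1 \<Longrightarrow> z0 1 = z1 1 \<Longrightarrow>
      \<exists>h. continuous_map cylinder_space X h \<and> (\<forall>y\<in>topspace circle_space. h (0, y) = z0 y \<and> h (1, y) = z1 y) \<and>
        (\<forall>t\<in>{0..1}. h (t, 1) = z0 1)"
    and L0: "(f0, \<phi>0) \<in> pointed_loops QS x" and L1: "(f1, \<phi>1) \<in> pointed_loops QS x"
  shows "loop_homotopic QS x (f0, \<phi>0) (f1, \<phi>1)"
proof -
  obtain s0 z0 where "normalised_section f0 \<phi>0 s0 z0" using loop_section[OF L0] by blast
  note N0 = normalised_sectionD[OF this]
  note z0 = N0(1,2) and s0 = N0(3-7)
  obtain s1 z1 where "normalised_section f1 \<phi>1 s1 z1" using loop_section[OF L1] by blast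
  note N1 = normalised_sectionD[OF this]
  note z1 = N1(1,2) and s1 = N1(3-7)
  have f01: "stack_morphism (space_stack circle_space) QS f0" "stack_morphism (space_stack circle_space) QS f1"
    and \<phi>: "two_iso (space_stack pt_space) QS x (comp_map f0 (space_map (\<lambda>_. 1))) \<phi>0"
      "two_iso (space_stack pt_space) QS x (comp_map f1 (space_map (\<lambda>_. 1))) \<phi>1"
    using L0 L1 by (simp_all add: pointed_loops_def)
  obtain h where h: "continuous_map cylinder_space X h"
    "\<And>y. y \<in> topspace circle_space \<Longrightarrow> h (0, y) = z0 y" "\<And>y. y \<in> topspace circle_space \<Longrightarrow> h (1, y) = z1 y"
    "\<And>t. t \<in> {0..1} \<Longrightarrow> h (t, 1) = base_value"
    using SC[OF z0(1) z1(1)] z0(2) z1(2) by auto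
  let ?H = "triv h"
  let ?I = "top_of_set {0..1::real}"
  have H: "stack_morphism (space_stack cylinder_space) QS ?H" by (rule triv_morphism[OF h(1)])
  have l: "continuous_map circle_space cylinder_space (\<lambda>y. (0, y))" "continuous_map circle_space cylinder_space (\<lambda>y. (1, y))"
    "continuous_map ?I cylinder_space (\<lambda>t. (t, 1))"
    unfolding cylinder_space_def using one_circle
    by (auto intro!: continuous_map_pairedI simp: continuous_map_id[unfolded id_def])
  define \<theta>0 where "\<theta>0 = (\<lambda>(T, f). (triv_obj T (\<lambda>t. h (compose (topspace T) (\<lambda>y. (0, y)) f t)), MapO f0 (T, f),
      ident T, triv_map T (MapO f0 (T, f)) (s0 T f)))"
  define \<theta>1 where "\<theta>1 = (\<lambda>(T, f). (triv_obj T (\<lambda>t. h (compose (topspace T) (\<lambda>y. (1, y)) f t)), MapO f1 (T, f),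
      ident T, triv_map T (MapO f1 (T, f)) (s1 T f)))"
  have t0: "two_iso (space_stack circle_space) QS (comp_map ?H (space_map (\<lambda>y. (0, y)))) f0 \<theta>0"
    unfolding \<theta>0_def
  proof (rule triv_two_iso[OF h(1) l(1) f01(1) s0(1,2)])
    show "bmap (MapO f0 (T, f)) (s0 T f t) = h (0, f t)"
      if "f \<in> ext_maps T circle_space" "t \<in> topspace T" for T f t
      using s0(3)[OF that] h(2)[OF ext_mapsD(3)[OF that]] by simp
  qed (simp_all add: s0(4))
  have t1: "two_iso (space_stack circle_space) QS (comp_map ?H (space_map (\<lambda>y. (1, y)))) f1 \<theta>1"
    unfolding \<theta>1_def
  proof (rule triv_two_iso[OF h(1) l(2) f01(2) s1(1,2)])
    show "bmap (MapO f1 (T, f)) (s1 T f t) = h (1, f t)"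
      if "f \<in> ext_maps T circle_space" "t \<in> topspace T" for T f t
      using s1(3)[OF that] h(3)[OF ext_mapsD(3)[OF that]] by simp
  qed (simp_all add: s1(4))
  let ?xI = "comp_map x (space_map (\<lambda>_ :: real. ()))"
  let ?u = "\<lambda>T (f :: 'u \<Rightarrow> real). compose (topspace T) (\<lambda>_. ()) f"
  have pI: "continuous_map ?I pt_space (\<lambda>_. ())" by (simp add: pt_space_def)
  have xI: "stack_morphism (space_stack ?I) QS ?xI"
    by (rule stack_morphism_comp[OF space_map_morphism[OF pI] x_morphism])
  \<comment> \<open>trivial bundles can only be the source of \<open>triv_two_iso\<close>, so the 2-isomorphism at the base point is constructed backwards and then inverted\<close>
  define \<epsilon>' where "\<epsilon>' = (\<lambda>(T, f). (triv_obj T (\<lambda>t. h (compose (topspace T) (\<lambda>t. (t, 1)) f t)), MapO ?xI (T, f),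
      ident T, triv_map T (MapO ?xI (T, f)) (base_section T (?u T f))))"
  have e': "two_iso (space_stack ?I) QS (comp_map ?H (space_map (\<lambda>t. (t, 1)))) ?xI \<epsilon>'"
    unfolding \<epsilon>'_def
  proof (rule triv_two_iso[OF h(1) l(3) xI])
    fix T and f :: "'u \<Rightarrow> real" assume f: "f \<in> ext_maps T ?I"
    show "continuous_map T (btotal (MapO ?xI (T, f))) (base_section T (?u T f))"
      using base_section(1)[OF pt_ext] by simp
    fix t assume t: "t \<in> topspace T"
    show "bproj (MapO ?xI (T, f)) (base_section T (?u T f) t) = t" using base_section(3)[OF pt_ext t] by simp
    show "bmap (MapO ?xI (T, f)) (base_section T (?u T f) t) = h (f t, 1)"
      using base_section(5)[OF pt_ext t] h(4)[of "f t"] ext_mapsD(3)[OF f t] by (simp add: base_value_def)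
  next
    fix T T' k t and f f' :: "'u \<Rightarrow> real" assume a: "((T, f), (T', f'), k) \<in> Arr (space_stack ?I)" and t: "t \<in> topspace T"
    show "total_map (MapA ?xI ((T, f), (T', f'), k)) (base_section T (?u T f) t) = base_section T' (?u T' f') (k t)"
      using base_section_natural[OF space_map_Arr[OF pI a] t] by simp
  qed
  have HI: "stack_morphism (space_stack ?I) QS (comp_map ?H (space_map (\<lambda>t. (t, 1))))"
    by (rule stack_morphism_comp[OF space_map_morphism[OF l(3)] H])
  have "\<exists>\<epsilon>. two_iso (space_stack ?I) QS ?xI (comp_map ?H (space_map (\<lambda>t. (t, 1)))) \<epsilon> \<and>
    (\<forall>p\<in>Obj (space_stack ?I). Cmp QS (\<epsilon>' p) (\<epsilon> p) = Idn QS (MapO ?xI p))"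
  proof (rule two_iso_sym[OF QS_category HI xI space_stack_Arr_Obj e'])
    fix \<eta> assume "two_iso (space_stack ?I) QS ?xI (comp_map ?H (space_map (\<lambda>t. (t, 1)))) \<eta>"
      "\<And>p. p \<in> Obj (space_stack ?I) \<Longrightarrow> Cmp QS (\<epsilon>' p) (\<eta> p) = Idn QS (MapO ?xI p)"
    then show ?thesis by (intro exI[of _ \<eta>] conjI ballI)
  qed
  then obtain \<epsilon> where e: "two_iso (space_stack ?I) QS ?xI (comp_map ?H (space_map (\<lambda>t. (t, 1)))) \<epsilon>"
    "\<forall>p\<in>Obj (space_stack ?I). Cmp QS (\<epsilon>' p) (\<epsilon> p) = Idn QS (MapO ?xI p)"
    by blast
  have compat: "Cmp QS (\<theta> (MapO (space_map (\<lambda>_. 1)) p)) (\<epsilon> (MapO (space_map (\<lambda>_. i)) p)) = \<phi> p"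
    if p: "p \<in> Obj (space_stack pt_space)" and i: "i \<in> {0..1}"
      and \<theta>: "\<theta> = (\<lambda>(T, f). (triv_obj T (\<lambda>t. h (compose (topspace T) (\<lambda>y. (i, y)) f t)), MapO g (T, f),
        ident T, triv_map T (MapO g (T, f)) (s T f)))"
      and \<theta>2: "two_iso (space_stack circle_space) QS (comp_map ?H (space_map (\<lambda>y. (i, y)))) g \<theta>"
      and \<phi>: "two_iso (space_stack pt_space) QS x (comp_map g (space_map (\<lambda>_. 1))) \<phi>"
      and g: "stack_morphism (space_stack circle_space) QS g"
      and sc: "\<And>T f. f \<in> ext_maps T circle_space \<Longrightarrow> continuous_map T (btotal (MapO g (T, f))) (s T f)"
      and s\<phi>: "\<And>T f t. t \<in> topspace T \<Longrightarrow> total_map (\<phi> (T, f)) (base_section T f t) = s T (compose (topspace T) (\<lambda>_. 1) f) t"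
    for p i g s \<theta> \<phi>
  proof -
    obtain T f where pT: "p = (T, f)" by (cases p)
    define c where "c = compose (topspace T) (\<lambda>_ :: unit. 1 :: complex) f"
    define r where "r = compose (topspace T) (\<lambda>_ :: unit. i) f"
    have cE: "c \<in> ext_maps T circle_space" unfolding c_def
      by (rule ext_maps_compose_map[OF pt_ext]) (use one_circle in simp)
    have rE: "r \<in> ext_maps T ?I" unfolding r_def
      by (rule ext_maps_compose_map[OF pt_ext]) (use i in simp)
    have ur: "?u T r = f" by (rule unit_ext)
    have hc: "(\<lambda>t. h (compose (topspace T) (\<lambda>y. (i, y)) c t)) = (\<lambda>t. h (compose (topspace T) (\<lambda>t. (t, 1)) r t))"
      by (auto simp: c_def r_def compose_def)
    let ?Z = "triv_obj T (\<lambda>t. h (compose (topspace T) (\<lambda>t. (t, 1)) r t))"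
    have \<theta>c: "\<theta> (T, c) = (?Z, MapO g (T, c), ident T, triv_map T (MapO g (T, c)) (s T c))"
      unfolding \<theta> by (simp add: hc)
    have \<epsilon>r: "\<epsilon>' (T, r) = (?Z, MapO x (T, f), ident T, triv_map T (MapO x (T, f)) (base_section T f))"
      unfolding \<epsilon>'_def by (simp add: ur)
    have xT: "btarget (MapO x (T, f)) = T" by (rule morphism_object(2)[OF x_morphism pt_ext])
    have \<phi>v: "vertical_iso QS (MapO x (T, f)) (MapO g (T, c)) (\<phi> (T, f))"
      using two_isoD(1)[OF \<phi>, of "(T, f)"] pt_ext by (simp add: c_def)
    then obtain k where k: "\<phi> (T, f) = (MapO x (T, f), MapO g (T, c), ident T, k)"
      "(MapO x (T, f), MapO g (T, c), ident T, k) \<in> Arr QS"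
      using xT QS_vertical_isoE by metis
    have A1: "\<theta> (T, c) \<in> Arr QS" using vertical_isoD(1)[OF two_isoD(1)[OF \<theta>2, of "(T, c)"]] cE by simp
    have A2: "\<epsilon>' (T, r) \<in> Arr QS" using vertical_isoD(1)[OF two_isoD(1)[OF e', of "(T, r)"]] rE by simp
    have v3: "vertical_iso QS (MapO ?xI (T, r)) (MapO (comp_map ?H (space_map (\<lambda>t. (t, 1)))) (T, r)) (\<epsilon> (T, r))"
      using two_isoD(1)[OF e(1), of "(T, r)"] rE by simp
    have A3: "\<epsilon> (T, r) \<in> Arr QS" "Dom QS (\<epsilon> (T, r)) = MapO x (T, f)" "Cod QS (\<epsilon> (T, r)) = ?Z"
      using vertical_isoD(1-3)[OF v3] by (simp_all add: ur)
    have kA: "\<phi> (T, f) \<in> Arr QS" using k by simp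
    have C: "Cmp QS (\<phi> (T, f)) (\<epsilon>' (T, r)) \<in> Arr QS"
      by (rule stk_categoryD(8)[OF QS_category A2 kA]) (simp add: k(1) \<epsilon>r)
    have "Cmp QS (\<phi> (T, f)) (\<epsilon>' (T, r)) = \<theta> (T, c)"
    proof -
      have ii: "compose (topspace T) (ident T) (ident T) = ident T"
        by (rule ext_maps_id_left[OF ext_maps_id])
      have b1: "bact (MapO x (T, f)) \<one> (base_section T f t) = base_section T f t" if "t \<in> topspace T" for t
        using bundle_act_one[OF quotient_objD(1)[OF morphism_object(1)[OF x_morphism pt_ext]] base_section(2)[OF pt_ext that]] .
      have b2: "bact (MapO g (T, c)) \<one> (s T c t) = s T c t" if "t \<in> topspace T" for t
        using bundle_act_one[OF quotient_objD(1)[OF morphism_object(1)[OF g cE]] cont_closed[OF sc[OF cE] that]] .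
      have "compose (topspace (triv_total T)) k (triv_map T (MapO x (T, f)) (base_section T f)) = triv_map T (MapO g (T, c)) (s T c)"
      proof (rule triv_arrow_eqI)
        show "(?Z, MapO g (T, c), ident T, compose (topspace (triv_total T)) k (triv_map T (MapO x (T, f)) (base_section T f))) \<in> Arr QS"
          using C unfolding k(1) \<epsilon>r by (simp add: ii)
        show "(?Z, MapO g (T, c), ident T, triv_map T (MapO g (T, c)) (s T c)) \<in> Arr QS" using A1 unfolding \<theta>c .
        fix t assume t: "t \<in> topspace T"
        show "compose (topspace (triv_total T)) k (triv_map T (MapO x (T, f)) (base_section T f)) (enc (t, \<one>))
           = triv_map T (MapO g (T, c)) (s T c) (enc (t, \<one>))"
          using b1[OF t] b2[OF t] s\<phi>[OF t, of f] k(1) t by (simp add: compose_eq triv_totalI triv_map_enc c_def)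
      qed
      then show ?thesis unfolding k(1) \<epsilon>r \<theta>c by (simp add: ii)
    qed
    then have "Cmp QS (\<theta> (T, c)) (\<epsilon> (T, r)) = Cmp QS (Cmp QS (\<phi> (T, f)) (\<epsilon>' (T, r))) (\<epsilon> (T, r))" by simp
    also have "\<dots> = Cmp QS (\<phi> (T, f)) (Cmp QS (\<epsilon>' (T, r)) (\<epsilon> (T, r)))"
      by (rule stk_categoryD(11)[OF QS_category A3(1) A2 kA, symmetric]) (simp_all add: A3 k(1) \<epsilon>r)
    also have "Cmp QS (\<epsilon>' (T, r)) (\<epsilon> (T, r)) = Idn QS (MapO x (T, f))"
      using e(2) rE by (auto simp: ur)
    also have "Cmp QS (\<phi> (T, f)) (Idn QS (MapO x (T, f))) = \<phi> (T, f)"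
      using stk_categoryD(6)[OF QS_category kA] by (simp add: k(1))
    finally show ?thesis by (simp add: pT c_def r_def)
  qed
  have "\<forall>p\<in>Obj (space_stack pt_space).
      Cmp QS (\<theta>0 (MapO (space_map (\<lambda>_. 1)) p)) (\<epsilon> (MapO (space_map (\<lambda>_. 0)) p)) = \<phi>0 p \<and>
      Cmp QS (\<theta>1 (MapO (space_map (\<lambda>_. 1)) p)) (\<epsilon> (MapO (space_map (\<lambda>_. 1)) p)) = \<phi>1 p"
    using compat[OF _ _ \<theta>0_def t0 \<phi>(1) f01(1) s0(1) s0(5)] compat[OF _ _ \<theta>1_def t1 \<phi>(2) f01(2) s1(1) s1(5)]
    by simp
  then show ?thesis
    unfolding loop_homotopic_def case_prod_conv using H e(1) t0 t1 by blast
qed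

lemma pi1_singleton:
  assumes SC: "\<And>z0 z1. continuous_map circle_space X z0 \<Longrightarrow> continuous_map circle_space X z1 \<Longrightarrow> z0 1 = z1 1 \<Longrightarrow>
      \<exists>h. continuous_map cylinder_space X h \<and> (\<forall>y\<in>topspace circle_space. h (0, y) = z0 y \<and> h (1, y) = z1 y) \<and>
        (\<forall>t\<in>{0..1}. h (t, 1) = z0 1)"
  shows "is_singleton (pi1 QS x)"
proof -
  let ?L = "pointed_loops QS x"
  have hom: "loop_homotopic QS x a b" if ab: "a \<in> ?L" "b \<in> ?L" for a b
  proof -
    obtain f0 \<phi>0 where a: "a = (f0, \<phi>0)" by (cases a)
    obtain f1 \<phi>1 where b: "b = (f1, \<phi>1)" by (cases b)
    show ?thesis unfolding a b by (rule loops_homotopic[OF _ ab[unfolded a b]]) (rule SC)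
  qed
  have "{(a, b). a \<in> ?L \<and> b \<in> ?L \<and> loop_homotopic QS x a b} = ?L \<times> ?L" using hom by auto
  then have "pi1 QS x = ?L // (?L \<times> ?L)" unfolding pi1_def by simp
  also have "\<dots> = {?L}" using pointed_loops_nonempty by (auto simp: quotient_def)
  finally show ?thesis by (simp add: is_singleton_def)
qed

end

lemma point_exists:
  assumes "z \<in> topspace X"
  shows "point_of_stack QS (triv (\<lambda>_. z))"
  unfolding point_of_stack_def by (rule triv_morphism) (use assms in simp)

end

section \<open>Complements of coordinate subspaces of codimension at least two\<close>

text \<open>
  A normed space containing \<open>\<complex>\<^sup>n\<close> for every \<open>n\<close>. The
  number of rays is not a type, while the theory of homotopic paths needs a real normed vector
  space; the coordinates beyond \<open>n\<close> do no harm.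
\<close>

type_synonym cseq = "nat \<Rightarrow>\<^sub>C complex"

definition coord_vec :: "nat \<Rightarrow> complex \<Rightarrow> cseq"
  where "coord_vec i w = Bcontfun (\<lambda>k. if k = i then w else 0)"

lemma coord_vec_apply: "apply_bcontfun (coord_vec i w) k = (if k = i then w else 0)"
proof -
  have "range (\<lambda>k. if k = i then w else 0) \<subseteq> {w, 0}" by auto
  then have "bounded (range (\<lambda>k. if k = i then w else 0))"
    using finite_imp_bounded[of "{w, 0}"] bounded_subset by blast
  then have "(\<lambda>k. if k = i then w else 0) \<in> bcontfun" by (simp add: bcontfun_def)
  then show ?thesis by (simp add: coord_vec_def Bcontfun_inverse)
qed

lemma coord_sum: "finite I \<Longrightarrow> apply_bcontfun (\<Sum>i\<in>I. coord_vec i (c i)) k = (if k \<in> I then c k else 0)"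
  by (induction I rule: finite_induct) (auto simp: plus_bcontfun.rep_eq zero_bcontfun.rep_eq coord_vec_apply)

lemma coord_vec_continuous: "continuous_on S (\<lambda>x. coord_vec i x)"
  unfolding continuous_on_iff
proof (intro ballI allI impI)
  fix x and e :: real assume "e > 0"
  have "dist (coord_vec i x') (coord_vec i x) \<le> dist x' x" for x'
    by (rule dist_bound) (simp add: coord_vec_apply)
  then show "\<exists>d>0. \<forall>x'\<in>S. dist x' x < d \<longrightarrow> dist (coord_vec i x') (coord_vec i x) < e"
    using \<open>e > 0\<close> le_less_trans by blast
qed

lemma coord_continuous: "continuous_on S (\<lambda>v. apply_bcontfun v k)"
  unfolding continuous_on_iff
proof (intro ballI allI impI)
  fix v :: "('a, 'b) bcontfun" and e :: real assume "e > 0"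
  then show "\<exists>d>0. \<forall>w\<in>S. dist w v < d \<longrightarrow> dist (apply_bcontfun w k) (apply_bcontfun v k) < e"
    using dist_bounded le_less_trans by blast
qed

lemma coord_vec_path: "continuous_on T f \<Longrightarrow> continuous_on T (\<lambda>t. coord_vec i (f t))"
  by (rule continuous_on_compose2[OF coord_vec_continuous[of UNIV]]) simp_all

lemma coord_path: "continuous_on T p \<Longrightarrow> continuous_on T (\<lambda>t. apply_bcontfun (p t) k)"
  by (rule continuous_on_compose2[OF coord_continuous[of UNIV]]) simp_all

text \<open>
  A polynomial approximation of the loop has an image of measure zero, so a small translate of it
  avoids the origin.
\<close>

lemma approx_nonvanishing_loop:
  fixes c :: "real \<Rightarrow> complex"
  assumes c: "path c" "pathfinish c = pathstart c" and e: "\<epsilon> > 0"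
  shows "\<exists>g. path g \<and> pathfinish g = pathstart g \<and> (\<forall>t\<in>{0..1}. norm (g t - c t) < \<epsilon> \<and> g t \<noteq> 0)"
proof -
  obtain p where p: "polynomial_function p" "pathstart p = pathstart c" "pathfinish p = pathfinish c"
    "\<And>t. t \<in> {0..1} \<Longrightarrow> norm (p t - c t) < \<epsilon> / 2"
    using path_approx_polynomial_function[OF c(1), of "\<epsilon> / 2"] e by auto
  have "p differentiable_on {0..1}"
    using differentiable_on_polynomial_function[OF p(1)] .
  then have "negligible (p ` {0..1})" by (rule negligible_differentiable_image_lowdim[rotated]) simp
  moreover have "\<not> negligible (ball (0 :: complex) (\<epsilon> / 2))"
    using e open_not_negligible[of "ball (0 :: complex) (\<epsilon> / 2)"] by simp
  ultimately have "\<not> ball 0 (\<epsilon> / 2) \<subseteq> p ` {0..1}" using negligible_subset by blast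
  then obtain w where "w \<in> ball 0 (\<epsilon> / 2)" and wp: "w \<notin> p ` {0..1}" by blast
  then have w: "norm w < \<epsilon> / 2" "w \<notin> p ` {0..1}" by simp_all
  have "path (\<lambda>t. p t - w)"
    unfolding path_def using continuous_on_polymonial_function[OF p(1)] by (intro continuous_intros) auto
  moreover have "norm (p t - w - c t) < \<epsilon>" if "t \<in> {0..1}" for t
  proof -
    have "norm (p t - w - c t) \<le> norm (p t - c t) + norm w"
      using norm_triangle_ineq4[of "p t - c t" w] by (simp add: algebra_simps)
    then show ?thesis using p(4)[OF that] w(1) by linarith
  qed
  moreover have "p t - w \<noteq> 0" if "t \<in> {0..1}" for t using w(2) that by auto
  ultimately show ?thesis
    using p(2,3) c(2) by (intro exI[of _ "\<lambda>t. p t - w"]) (auto simp: pathstart_def pathfinish_def)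
qed

text \<open>
  The open subset of \<open>\<complex>\<^sup>n\<close> of the points at which the set of vanishing
  coordinates is admissible. That every single coordinate may vanish means that the complement has
  complex codimension at least two.
\<close>

locale zero_patterns =
  fixes n :: nat and P :: "nat set \<Rightarrow> bool"
  assumes P_mono: "\<And>I J. P I \<Longrightarrow> J \<subseteq> I \<Longrightarrow> P J"
    and P_small: "P {}" "\<And>i. i < n \<Longrightarrow> P {i}"
begin

definition zeros :: "(nat \<Rightarrow> complex) \<Rightarrow> nat set" where "zeros v = {i. i < n \<and> v i = 0}"

definition S :: "cseq set" where "S = {v. P (zeros (apply_bcontfun v))}"

lemma S_open: "open S"
proof (subst open_subopen, intro ballI)
  fix v assume v: "v \<in> S"
  let ?T = "\<Inter>i\<in>{..<n} - zeros v. {w :: cseq. apply_bcontfun w i \<noteq> 0}"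
  have "open {w :: cseq. apply_bcontfun w i \<noteq> 0}" for i
    using open_Collect_neq[OF coord_continuous[of UNIV i] continuous_on_const[of UNIV "0 :: complex"]] .
  then have "open ?T" by (intro open_INT) auto
  moreover have "v \<in> ?T" by (auto simp: zeros_def)
  moreover have "?T \<subseteq> S"
  proof
    fix w assume "w \<in> ?T"
    then have "zeros w \<subseteq> zeros v" by (auto simp: zeros_def)
    then show "w \<in> S" using v P_mono unfolding S_def by blast
  qed
  ultimately show "\<exists>T. open T \<and> v \<in> T \<and> T \<subseteq> S" by blast
qed

text \<open>
  Replaces the coordinates with index in \<open>I\<close> of the path \<open>p\<close> by those of
  \<open>g\<close>.
\<close>

definition change :: "nat set \<Rightarrow> (real \<Rightarrow> nat \<Rightarrow> complex) \<Rightarrow> (real \<Rightarrow> cseq) \<Rightarrow> real \<Rightarrow> cseq"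
  where "change I g p t = p t + (\<Sum>i\<in>I. coord_vec i (g t i - p t i))"

lemma change_apply: "finite I \<Longrightarrow> apply_bcontfun (change I g p t) k = (if k \<in> I then g t k else p t k)"
  by (simp add: change_def plus_bcontfun.rep_eq coord_sum)

lemma change_path:
  assumes "path p" "finite I" "\<And>i. i \<in> I \<Longrightarrow> path (\<lambda>t. g t i)"
  shows "path (change I g p)"
  using assms unfolding path_def change_def
  by (intro continuous_on_add continuous_on_sum coord_vec_path continuous_on_diff coord_path) auto

lemma change_loop:
  assumes "pathfinish p = pathstart p" "\<And>i. i \<in> I \<Longrightarrow> g 1 i = g 0 i"
  shows "pathfinish (change I g p) = pathstart (change I g p)"
  using assms by (simp add: change_def pathfinish_def pathstart_def)

lemma segment_apply:
  assumes "x \<in> closed_segment a (b :: cseq)"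
  shows "\<exists>u. apply_bcontfun x k = (1 - u) *\<^sub>R apply_bcontfun a k + u *\<^sub>R apply_bcontfun b k"
proof -
  obtain u where "x = (1 - u) *\<^sub>R a + u *\<^sub>R b" using assms by (auto simp: closed_segment_def)
  then show ?thesis by (auto simp: plus_bcontfun.rep_eq scaleR_bcontfun.rep_eq)
qed

text \<open>
  The set is open, so the straight homotopy to a loop that is uniformly close stays inside.
\<close>

lemma loop_nonvanishing:
  assumes p: "path p" "path_image p \<subseteq> S" "pathfinish p = pathstart p"
  shows "\<exists>p'. path p' \<and> pathfinish p' = pathstart p' \<and> (\<forall>t\<in>{0..1}. \<forall>i<n. apply_bcontfun (p' t) i \<noteq> 0) \<and> homotopic_loops S p p'"
proof -
  obtain \<epsilon> where e: "\<epsilon> > 0" "(\<Union>x\<in>path_image p. cball x \<epsilon>) \<subseteq> S"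
    using compact_subset_open_imp_cball_epsilon_subset[OF compact_path_image[OF p(1)] S_open p(2)] by blast
  have "\<forall>i. \<exists>g. path g \<and> pathfinish g = pathstart g \<and> (\<forall>t\<in>{0..1}. norm (g t - apply_bcontfun (p t) i) < \<epsilon> \<and> g t \<noteq> 0)"
  proof
    fix i
    have "path (\<lambda>t. apply_bcontfun (p t) i)" using p(1) coord_path unfolding path_def by blast
    moreover have "pathfinish (\<lambda>t. apply_bcontfun (p t) i) = pathstart (\<lambda>t. apply_bcontfun (p t) i)"
      using p(3) by (simp add: pathfinish_def pathstart_def)
    ultimately show "\<exists>g. path g \<and> pathfinish g = pathstart g \<and> (\<forall>t\<in>{0..1}. norm (g t - apply_bcontfun (p t) i) < \<epsilon> \<and> g t \<noteq> 0)"
      using approx_nonvanishing_loop e(1) by blast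
  qed
  then obtain g where g: "\<And>i. path (g i)" "\<And>i. pathfinish (g i) = pathstart (g i)"
    "\<And>i t. t \<in> {0..1} \<Longrightarrow> norm (g i t - apply_bcontfun (p t) i) < \<epsilon> \<and> g i t \<noteq> 0" by metis
  let ?p = "change {..<n} (\<lambda>t i. g i t) p"
  have pp: "path ?p" using change_path[OF p(1), of "{..<n}" "\<lambda>t i. g i t"] g(1) by simp
  have pl: "pathfinish ?p = pathstart ?p"
    using g(2) by (intro change_loop p(3)) (simp add: pathfinish_def pathstart_def)
  have "closed_segment (p t) (?p t) \<subseteq> S" if t: "t \<in> {0..1}" for t
  proof -
    have "dist (p t) (?p t) \<le> \<epsilon>"
    proof (rule dist_bound)
      fix k show "dist (p t k) (?p t k) \<le> \<epsilon>"
        using g(3)[OF t, of k] e(1) by (auto simp: change_apply dist_norm norm_minus_commute)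
    qed
    then have "closed_segment (p t) (?p t) \<subseteq> cball (p t) \<epsilon>"
      using e(1) by (intro closed_segment_subset convex_cball) auto
    moreover have "cball (p t) \<epsilon> \<subseteq> S" using e(2) t unfolding path_image_def by blast
    ultimately show ?thesis by blast
  qed
  then have "homotopic_loops S p ?p" by (intro homotopic_loops_linear p(1,3) pp pl)
  moreover have "apply_bcontfun (?p t) i \<noteq> 0" if "t \<in> {0..1}" "i < n" for t i using g(3)[OF that(1)] that(2) by (simp add: change_apply)
  ultimately show ?thesis using pp pl by blast
qed

text \<open>
  Along the straight homotopy that changes the coordinate \<open>k\<close> to the constant
  \<open>1\<close>, only this coordinate can vanish.
\<close>

lemma nonvanishing_loop_contract:
  assumes p: "path p" "pathfinish p = pathstart p" and nz: "\<And>t i. t \<in> {0..1} \<Longrightarrow> i < n \<Longrightarrow> apply_bcontfun (p t) i \<noteq> 0"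
  shows "k \<le> n \<Longrightarrow> homotopic_loops S p (change {..<k} (\<lambda>_ _. 1) p)"
proof (induction k)
  case 0
  have "change {..<0} (\<lambda>_ _. 1) p = p" by (auto simp: change_def)
  moreover have "path_image p \<subseteq> S"
  proof -
    have "zeros (p t) = {}" if "t \<in> {0..1}" for t using nz[OF that] by (auto simp: zeros_def)
    then show ?thesis using P_small(1) by (auto simp: path_image_def S_def)
  qed
  ultimately show ?case using p by (simp add: homotopic_loops_refl)
next
  case (Suc k)
  let ?q = "\<lambda>k. change {..<k} (\<lambda>_ _. 1) p"
  have path: "path (?q k)" "pathfinish (?q k) = pathstart (?q k)" for k
    using change_path[OF p(1), of "{..<k}" "\<lambda>_ _. 1"] change_loop[OF p(2), of "{..<k}" "\<lambda>_ _. 1"]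
    by (simp_all add: path_def)
  have "closed_segment (?q k t) (?q (Suc k) t) \<subseteq> S" if t: "t \<in> {0..1}" for t
  proof
    fix x assume x: "x \<in> closed_segment (?q k t) (?q (Suc k) t)"
    have "apply_bcontfun x i \<noteq> 0" if i: "i < n" "i \<noteq> k" for i
    proof -
      obtain u where u: "apply_bcontfun x i = (1 - u) *\<^sub>R apply_bcontfun (?q k t) i + u *\<^sub>R apply_bcontfun (?q (Suc k) t) i"
        using segment_apply[OF x] by blast
      have "apply_bcontfun (?q (Suc k) t) i = apply_bcontfun (?q k t) i"
        using i(2) by (auto simp: change_apply less_Suc_eq)
      then have "apply_bcontfun x i = apply_bcontfun (?q k t) i"
        using u by (simp add: scaleR_left_distrib[symmetric])
      then show ?thesis using nz[OF t i(1)] by (simp add: change_apply)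
    qed
    then have "zeros x \<subseteq> {k}" by (auto simp: zeros_def)
    then show "x \<in> S" using P_mono[OF P_small(2)[of k]] Suc.prems unfolding S_def by simp
  qed
  then have "homotopic_loops S (?q k) (?q (Suc k))" by (intro homotopic_loops_linear path)
  then show ?case using Suc homotopic_loops_trans by (metis Suc_leD)
qed

lemma S_simply_connected: "simply_connected S"
proof -
  define a :: cseq where "a = (\<Sum>i<n. coord_vec i 1)"
  have to_const: "homotopic_loops S p (\<lambda>_. a)"
    if p: "path p" "path_image p \<subseteq> S" "pathfinish p = pathstart p" for p
  proof -
    obtain p' where p': "path p'" "pathfinish p' = pathstart p'" "\<forall>t\<in>{0..1}. \<forall>i<n. apply_bcontfun (p' t) i \<noteq> 0"
      "homotopic_loops S p p'" using loop_nonvanishing[OF p] by blast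
    let ?q = "change {..<n} (\<lambda>_ _. 1) p'"
    have 1: "homotopic_loops S p' ?q" using nonvanishing_loop_contract[OF p'(1,2), of n] p'(3) by blast
    have path: "path ?q" "pathfinish ?q = pathstart ?q"
      using change_path[OF p'(1), of "{..<n}" "\<lambda>_ _. 1"] change_loop[OF p'(2), of "{..<n}" "\<lambda>_ _. 1"]
      by (simp_all add: path_def)
    have "closed_segment (?q t) a \<subseteq> S" for t
    proof
      fix x assume x: "x \<in> closed_segment (?q t) a"
      have "apply_bcontfun x i \<noteq> 0" if i: "i < n" for i
      proof -
        obtain u where u: "apply_bcontfun x i = (1 - u) *\<^sub>R apply_bcontfun (?q t) i + u *\<^sub>R apply_bcontfun a i"
          using segment_apply[OF x] by blast
        then have "apply_bcontfun x i = (1 - u) *\<^sub>R 1 + u *\<^sub>R 1"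
          using i by (simp add: change_apply a_def coord_sum)
        then show ?thesis by (simp add: scaleR_left_distrib[symmetric])
      qed
      then have "zeros x = {}" by (auto simp: zeros_def)
      then show "x \<in> S" using P_small(1) by (simp add: S_def)
    qed
    then have "homotopic_loops S ?q (\<lambda>_. a)"
      by (intro homotopic_loops_linear path) (auto simp: path_def pathstart_def pathfinish_def)
    then show ?thesis using 1 p'(4) homotopic_loops_trans by blast
  qed
  show ?thesis
    unfolding simply_connected_def using to_const homotopic_loops_sym homotopic_loops_trans by blast
qed

definition Zp :: "(nat \<Rightarrow> complex) topology"
  where "Zp = subtopology (product_topology (\<lambda>_. euclidean) {..<n}) {z. P (zeros z)}"

lemma topspace_Zp: "topspace Zp = {z \<in> {..<n} \<rightarrow>\<^sub>E UNIV. P (zeros z)}"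
  by (auto simp: Zp_def)

lemma Zp_continuous_iff:
  "continuous_map T Zp f \<longleftrightarrow> (\<forall>i<n. continuous_map T euclidean (\<lambda>t. f t i)) \<and> (\<forall>t\<in>topspace T. f t \<in> topspace Zp)"
  unfolding Zp_def continuous_map_in_subtopology continuous_map_componentwise
  by (auto simp: PiE_def extensional_def image_subset_iff)

definition emb :: "(nat \<Rightarrow> complex) \<Rightarrow> cseq" where "emb z = (\<Sum>i<n. coord_vec i (z i))"

lemma emb_apply: "apply_bcontfun (emb z) k = (if k < n then z k else 0)"
  by (simp add: emb_def coord_sum)

lemma zeros_emb: "zeros (emb z) = zeros z"
  by (auto simp: zeros_def emb_apply)

text \<open>
  Simple connectedness gives a homotopy of paths on the square; it is constant on the two sides
  and so descends to the cylinder.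
\<close>

lemma Zp_based_homotopy:
  assumes z0: "continuous_map circle_space Zp z0" and z1: "continuous_map circle_space Zp z1"
    and z01: "z0 1 = z1 1"
  shows "\<exists>h. continuous_map cylinder_space Zp h \<and>
    (\<forall>y\<in>topspace circle_space. h (0, y) = z0 y \<and> h (1, y) = z1 y) \<and> (\<forall>t\<in>{0..1}. h (t, 1) = z0 1)"
proof -
  have path: "path (\<lambda>t. emb (z (circle_path t)))" "path_image (\<lambda>t. emb (z (circle_path t))) \<subseteq> S"
    if z: "continuous_map circle_space Zp z" for z
  proof -
    have c: "continuous_map (top_of_set {0..1}) Zp (\<lambda>t. z (circle_path t))"
      by (rule cont_comp[OF quotient_imp_continuous_map[OF circle_path_quotient] z])
    then have "continuous_on {0..1} (\<lambda>t. z (circle_path t) i)" if "i < n" for i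
      using that by (simp add: Zp_continuous_iff)
    then show "path (\<lambda>t. emb (z (circle_path t)))"
      unfolding path_def emb_def by (intro continuous_on_sum coord_vec_path) auto
    have "P (zeros (z (circle_path t)))" if "t \<in> {0..1}" for t
      using cont_closed[OF c, of t] that by (simp add: topspace_Zp)
    then show "path_image (\<lambda>t. emb (z (circle_path t))) \<subseteq> S"
      by (auto simp: path_image_def S_def zeros_emb)
  qed
  let ?p = "\<lambda>t. emb (z0 (circle_path t))" and ?q = "\<lambda>t. emb (z1 (circle_path t))"
  have c01: "circle_path 0 = 1" "circle_path 1 = 1" by (simp_all add: circle_path_def)
  have "homotopic_paths S ?p ?q"
    using S_simply_connected path[OF z0] path[OF z1] z01 c01
    unfolding simply_connected_eq_homotopic_paths by (simp add: pathstart_def pathfinish_def)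
  then obtain h where h: "continuous_on ({0..1} \<times> {0..1}) h" "h \<in> ({0..1} \<times> {0..1}) \<rightarrow> S"
    "\<forall>x\<in>{0..1}. h (0, x) = ?p x" "\<forall>x\<in>{0..1}. h (1, x) = ?q x"
    "\<forall>t\<in>{0..1::real}. pathstart (h \<circ> Pair t) = pathstart ?p \<and> pathfinish (h \<circ> Pair t) = pathfinish ?p"
    unfolding homotopic_paths by blast
  define H where "H x = (\<lambda>i\<in>{..<n}. apply_bcontfun (h x) i)" for x
  let ?I = "top_of_set {0..1::real}"
  have ends: "h (t, 0) = emb (z0 1)" "h (t, 1) = emb (z0 1)" if "t \<in> {0..1}" for t
    using h(5) that c01 by (auto simp: pathstart_def pathfinish_def)
  have z_emb: "(\<lambda>i\<in>{..<n}. apply_bcontfun (emb z) i) = z" if "z \<in> topspace Zp" for z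
    using that by (intro extensionalityI[where A = "{..<n}"]) (auto simp: topspace_Zp emb_apply PiE_def)
  have II: "prod_topology ?I ?I = top_of_set ({0..1} \<times> {0..1})"
    by (simp add: prod_topology_subtopology_eu)
  have Hc: "continuous_map (prod_topology ?I ?I) Zp H"
    unfolding Zp_continuous_iff II
  proof (intro conjI allI impI ballI)
    fix i assume "i < n"
    then show "continuous_map (top_of_set ({0..1} \<times> {0..1})) euclidean (\<lambda>t. H t i)"
      using coord_path[OF h(1), of i] by (simp add: H_def)
  next
    fix x :: "real \<times> real" assume "x \<in> topspace (top_of_set ({0..1} \<times> {0..1}))"
    then have "h x \<in> S" using h(2) by auto
    moreover have "zeros (H x) = zeros (h x)" by (auto simp: zeros_def H_def)
    ultimately show "H x \<in> topspace Zp" by (simp add: topspace_Zp S_def) (simp add: H_def)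
  qed
  let ?c = "\<lambda>x :: real \<times> real. (fst x, circle_path (snd x))"
  have cc: "continuous_map (prod_topology ?I ?I) cylinder_space ?c"
    unfolding cylinder_space_def
    by (intro continuous_map_pairedI continuous_map_fst cont_comp[OF continuous_map_snd]
        quotient_imp_continuous_map[OF circle_path_quotient])
  have surj: "circle_path ` {0..1} = topspace circle_space"
    using quotient_imp_surjective_map[OF circle_path_quotient] by simp
  have "?c ` topspace (prod_topology ?I ?I) = topspace cylinder_space"
  proof -
    have "?c ` ({0..1} \<times> {0..1}) = {0..1} \<times> circle_path ` {0..1}"
    proof
      show "{0..1} \<times> circle_path ` {0..1} \<subseteq> ?c ` ({0..1} \<times> {0..1})"
      proof
        fix x assume "x \<in> {0..1 :: real} \<times> circle_path ` {0..1}"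
        then obtain s where "fst x \<in> {0..1}" "s \<in> {0..1}" "snd x = circle_path s" by auto
        then show "x \<in> ?c ` ({0..1} \<times> {0..1})"
          by (intro image_eqI[of _ _ "(fst x, s)"]) (simp_all add: prod_eq_iff)
      qed
    qed auto
    then show ?thesis by (simp add: cylinder_space_def surj)
  qed
  moreover have "compact_space (prod_topology ?I ?I)" "Hausdorff_space cylinder_space"
    unfolding II using compact_Times[of "{0..1 :: real}" "{0..1 :: real}"]
    by (simp_all add: cylinder_space_def circle_space_def Hausdorff_space_subtopology compact_space_subtopology)
  ultimately have quo: "quotient_map (prod_topology ?I ?I) cylinder_space ?c"
    by (intro T1_Spaces.continuous_imp_quotient_map[OF cc])
  have well: "H x = H y" if x: "x \<in> topspace (prod_topology ?I ?I)" and y: "y \<in> topspace (prod_topology ?I ?I)"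
    and xy: "?c x = ?c y" for x y
  proof -
    obtain t s where ts: "x = (t, s)" "t \<in> {0..1}" "s \<in> {0..1}" using x by auto
    obtain t' s' where ts': "y = (t', s')" "t' \<in> {0..1}" "s' \<in> {0..1}" using y by auto
    have "t = t'" "circle_path s = circle_path s'" using xy ts ts' by simp_all
    then show ?thesis
    proof -
      have "h (t, s) = h (t, s')"
        using circle_path_eq[OF ts(3) ts'(3) \<open>circle_path s = circle_path s'\<close>] ends[OF ts(2)] by (elim disjE conjE) simp_all
      then show ?thesis using \<open>t = t'\<close> by (simp add: H_def ts(1) ts'(1))
    qed
  qed
  have "\<exists>k. continuous_map cylinder_space Zp k \<and> (\<forall>x\<in>{0..1} \<times> {0..1}. k (?c x) = H x)"
  proof (rule quotient_map_lift_exists[OF quo Hc])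
    fix k assume k: "continuous_map cylinder_space Zp k"
      "\<And>x. x \<in> topspace (prod_topology ?I ?I) \<Longrightarrow> k (?c x) = H x"
    then have "\<forall>x\<in>{0..1} \<times> {0..1}. k (?c x) = H x" by simp
    then show ?thesis using k(1) by blast
  qed (rule well)
  then obtain k where k: "continuous_map cylinder_space Zp k" "\<And>t s. t \<in> {0..1} \<Longrightarrow> s \<in> {0..1} \<Longrightarrow> k (t, circle_path s) = H (t, s)"
    by auto
  show ?thesis
  proof (intro exI[of _ k] conjI ballI)
    show "continuous_map cylinder_space Zp k" by (fact k(1))
    fix y assume y: "y \<in> topspace circle_space"
    then obtain s where s: "s \<in> {0..1}" "y = circle_path s" using surj by blast
    show "k (0, y) = z0 y" "k (1, y) = z1 y"
      using k(2)[of 0 s] k(2)[of 1 s] s h(3,4) z_emb[OF cont_closed[OF z0 y]]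
        z_emb[OF cont_closed[OF z1 y]] by (simp_all add: H_def)
  next
    fix t :: real assume t: "t \<in> {0..1}"
    have "1 \<in> topspace circle_space" by (simp add: circle_space_def)
    then show "k (t, 1) = z0 1"
      using k(2)[OF t, of 0] c01 ends[OF t] z_emb[OF cont_closed[OF z0]] by (simp add: H_def)
  qed
qed

end

section \<open>The space of a fan\<close>

lemma poly_value_superset:
  assumes "finite S" "Poly_Mapping.keys p \<subseteq> S"
  shows "poly_value p z = (\<Sum>e\<in>S. Poly_Mapping.lookup p e * (\<Prod>i\<in>Poly_Mapping.keys e. z i ^ Poly_Mapping.lookup e i))"
  unfolding poly_value_def
  by (rule sum.mono_neutral_left) (use assms in \<open>auto simp: in_keys_iff\<close>)

lemma poly_value_add: "poly_value (p + q) z = poly_value p z + poly_value q z"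
proof -
  let ?S = "Poly_Mapping.keys p \<union> Poly_Mapping.keys q"
  have "finite ?S" "Poly_Mapping.keys (p + q) \<subseteq> ?S" by (simp_all add: keys_add)
  then show ?thesis
    using poly_value_superset[of ?S "p + q" z] poly_value_superset[of ?S p z] poly_value_superset[of ?S q z]
    by (simp add: lookup_add algebra_simps sum.distrib)
qed

lemma poly_value_sum: "poly_value (\<Sum>s\<in>T. f s) z = (\<Sum>s\<in>T. poly_value (f s) z)"
proof (induction T rule: infinite_finite_induct)
  case (insert x F)
  then show ?case by (simp add: poly_value_add)
qed (simp_all add: poly_value_def)

lemma poly_value_single: "poly_value (Poly_Mapping.single e c) z = c * (\<Prod>i\<in>Poly_Mapping.keys e. z i ^ Poly_Mapping.lookup e i)"
  by (simp add: poly_value_def)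

lemma monomial_mult_var:
  fixes e :: "nat \<Rightarrow>\<^sub>0 nat" and z :: "nat \<Rightarrow> complex"
  shows "(\<Prod>i\<in>Poly_Mapping.keys (e + Poly_Mapping.single j 1). z i ^ Poly_Mapping.lookup (e + Poly_Mapping.single j 1) i)
    = (\<Prod>i\<in>Poly_Mapping.keys e. z i ^ Poly_Mapping.lookup e i) * z j"
proof -
  let ?S = "insert j (Poly_Mapping.keys e)"
  have 1: "(\<Prod>i\<in>Poly_Mapping.keys e'. z i ^ Poly_Mapping.lookup e' i) = (\<Prod>i\<in>?S. z i ^ Poly_Mapping.lookup e' i)"
    if "Poly_Mapping.keys e' \<subseteq> ?S" for e'
    by (rule prod.mono_neutral_left) (use that in \<open>auto simp: in_keys_iff\<close>)
  have "Poly_Mapping.keys (e + Poly_Mapping.single j 1) \<subseteq> ?S"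
    using keys_add[of e "Poly_Mapping.single j (1 :: nat)"] by auto
  then have "(\<Prod>i\<in>Poly_Mapping.keys (e + Poly_Mapping.single j 1). z i ^ Poly_Mapping.lookup (e + Poly_Mapping.single j 1) i)
     = (\<Prod>i\<in>?S. z i ^ Poly_Mapping.lookup e i * z i ^ (if i = j then 1 else 0))"
    unfolding 1[OF \<open>_ \<subseteq> ?S\<close>] by (intro prod.cong refl) (auto simp: lookup_add lookup_single power_add when_def)
  also have "\<dots> = (\<Prod>i\<in>?S. z i ^ Poly_Mapping.lookup e i) * (\<Prod>i\<in>?S. z i ^ (if i = j then 1 else 0))"
    by (rule prod.distrib)
  also have "(\<Prod>i\<in>?S. z i ^ (if i = j then 1 else 0)) = (\<Prod>i\<in>{j}. z i ^ (if i = j then 1 else 0))"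
    by (rule prod.mono_neutral_right) auto
  also have "(\<Prod>i\<in>?S. z i ^ Poly_Mapping.lookup e i) = (\<Prod>i\<in>Poly_Mapping.keys e. z i ^ Poly_Mapping.lookup e i)"
    by (rule sym, rule 1) blast
  finally show ?thesis by simp
qed

lemma poly_value_mult_var: "poly_value (p * poly_var j) z = poly_value p z * z j"
proof (induction p rule: update_induct)
  case const
  then show ?case by (simp add: poly_value_def)
next
  case (update f a b)
  have "Poly_Mapping.update a b f = f + Poly_Mapping.single a b"
    using update(1) by (intro poly_mapping_eqI) (auto simp: lookup_update lookup_add lookup_single in_keys_iff when_def)
  then show ?case
    using update monomial_mult_var[where e = a and z = z and j = j]
    by (simp add: distrib_right poly_value_add poly_value_single poly_var_def mult_single)
qed

lemma poly_value_prod_var: "finite I \<Longrightarrow> poly_value (p * (\<Prod>i\<in>I. poly_var i)) z = poly_value p z * (\<Prod>i\<in>I. z i)"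
proof (induction I rule: finite_induct)
  case (insert j I)
  have "poly_value (p * (\<Prod>i\<in>insert j I. poly_var i)) z = poly_value (p * (\<Prod>i\<in>I. poly_var i) * poly_var j) z"
    using insert by (simp add: ac_simps)
  also have "\<dots> = poly_value p z * (\<Prod>i\<in>I. z i) * z j" using insert by (simp add: poly_value_mult_var)
  finally show ?case using insert by (simp add: ac_simps)
qed simp

text \<open>
  A point lies outside the vanishing locus iff one of the generating monomials does not vanish at
  it, that is, iff for some \<open>\<sigma>\<close> all the rays with vanishing coordinate lie in
  \<open>\<sigma>\<close>.
\<close>

lemma topspace_Z_space_iff:
  "z \<in> topspace (Z_space n \<rho> \<Sigma>) \<longleftrightarrow> z \<in> {..<n} \<rightarrow>\<^sub>E UNIV \<and> (\<exists>\<sigma>\<in>\<Sigma>. \<forall>i<n. z i = 0 \<longrightarrow> \<rho> i \<subseteq> \<sigma>)"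
proof -
  let ?m = "\<lambda>\<sigma>. \<Prod>i | i < n \<and> \<not> \<rho> i \<subseteq> \<sigma>. poly_var i"
  have one: "poly_value 1 z = 1" using poly_value_single[of 0 1 z] by simp
  have m: "poly_value (c * ?m \<sigma>) z = poly_value c z * (\<Prod>i | i < n \<and> \<not> \<rho> i \<subseteq> \<sigma>. z i)" for c \<sigma>
    by (rule poly_value_prod_var) simp
  have e1: "(\<forall>p\<in>irrelevant_ideal n \<rho> \<Sigma>. poly_value p z = 0) \<longleftrightarrow> (\<forall>\<sigma>\<in>\<Sigma>. (\<Prod>i | i < n \<and> \<not> \<rho> i \<subseteq> \<sigma>. z i) = 0)"
  proof
    assume a: "\<forall>p\<in>irrelevant_ideal n \<rho> \<Sigma>. poly_value p z = 0"
    show "\<forall>\<sigma>\<in>\<Sigma>. (\<Prod>i | i < n \<and> \<not> \<rho> i \<subseteq> \<sigma>. z i) = 0"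
    proof
      fix \<sigma> assume s: "\<sigma> \<in> \<Sigma>"
      have "1 * ?m \<sigma> \<in> irrelevant_ideal n \<rho> \<Sigma>"
        unfolding irrelevant_ideal_def poly_ideal_def
        using s by (intro CollectI exI[of _ "\<lambda>_. 1"] exI[of _ "{?m \<sigma>}"]) (auto simp: poly_ring_def)
      then show "(\<Prod>i | i < n \<and> \<not> \<rho> i \<subseteq> \<sigma>. z i) = 0" using a m[of 1 \<sigma>] one by simp
    qed
  next
    assume a: "\<forall>\<sigma>\<in>\<Sigma>. (\<Prod>i | i < n \<and> \<not> \<rho> i \<subseteq> \<sigma>. z i) = 0"
    show "\<forall>p\<in>irrelevant_ideal n \<rho> \<Sigma>. poly_value p z = 0"
    proof
      fix p assume "p \<in> irrelevant_ideal n \<rho> \<Sigma>"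
      then obtain c T where p: "p = (\<Sum>s\<in>T. c s * s)" and T: "T \<subseteq> ?m ` \<Sigma>"
        unfolding irrelevant_ideal_def poly_ideal_def by blast
      have "poly_value (c s * s) z = 0" if s: "s \<in> T" for s
      proof -
        obtain \<sigma> where "\<sigma> \<in> \<Sigma>" "s = ?m \<sigma>" using T s by blast
        then show ?thesis using m[of "c s" \<sigma>] a by simp
      qed
      then show "poly_value p z = 0" by (simp add: p poly_value_sum)
    qed
  qed
  have e2: "(\<Prod>i | i < n \<and> \<not> \<rho> i \<subseteq> \<sigma>. z i) = 0 \<longleftrightarrow> \<not> (\<forall>i<n. z i = 0 \<longrightarrow> \<rho> i \<subseteq> \<sigma>)" for \<sigma>
    by (subst prod_zero_iff) auto
  have "(\<forall>p\<in>irrelevant_ideal n \<rho> \<Sigma>. poly_value p z = 0)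
      \<longleftrightarrow> \<not> (\<exists>\<sigma>\<in>\<Sigma>. \<forall>i<n. z i = 0 \<longrightarrow> \<rho> i \<subseteq> \<sigma>)"
    unfolding e1 e2 by (simp only: bex_simps ball_simps not_not)
  then show ?thesis
    unfolding Z_space_def vanishing_locus_def topspace_subtopology topspace_product_topology
    by (simp only: Int_iff Diff_iff mem_Collect_eq topspace_euclidean) argo
qed

section \<open>Integer-valued homomorphisms\<close>

lemma int_power_carrier: "carrier (int_power n) = {..<n} \<rightarrow>\<^sub>E UNIV"
  by (simp add: int_power_def)

lemma int_power_mult: "x \<otimes>\<^bsub>int_power n\<^esub> y = (\<lambda>i\<in>{..<n}. x i + y i)"
  by (simp add: int_power_def)

lemma int_power_one: "\<one>\<^bsub>int_power n\<^esub> = (\<lambda>i\<in>{..<n}. 0)"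
  by (simp add: int_power_def)

lemma int_power_group: "comm_group (int_power n)"
proof -
  have "group (int_power n)" unfolding int_power_def by (rule product_group) simp
  then show ?thesis by (rule group.group_comm_groupI) (auto simp: int_power_mult add.commute)
qed

lemma int_power_inv: "x \<in> carrier (int_power n) \<Longrightarrow> inv\<^bsub>int_power n\<^esub> x = (\<lambda>i\<in>{..<n}. - x i)"
  unfolding int_power_def by simp

lemma hom_int:
  assumes "\<mu> \<in> hom A integer_group" "group A"
  shows "x \<in> carrier A \<Longrightarrow> y \<in> carrier A \<Longrightarrow> \<mu> (x \<otimes>\<^bsub>A\<^esub> y) = \<mu> x + \<mu> y"
    and "x \<in> carrier A \<Longrightarrow> \<mu> (inv\<^bsub>A\<^esub> x) = - \<mu> x"
    and "\<mu> \<one>\<^bsub>A\<^esub> = 0"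
    and "x \<in> carrier A \<Longrightarrow> \<mu> (x [^]\<^bsub>A\<^esub> (k :: int)) = k * \<mu> x"
proof -
  interpret group_hom A integer_group \<mu>
    using assms by (simp add: group_hom_def group_hom_axioms_def)
  show "x \<in> carrier A \<Longrightarrow> y \<in> carrier A \<Longrightarrow> \<mu> (x \<otimes>\<^bsub>A\<^esub> y) = \<mu> x + \<mu> y"
    "x \<in> carrier A \<Longrightarrow> \<mu> (inv\<^bsub>A\<^esub> x) = - \<mu> x" "\<mu> \<one>\<^bsub>A\<^esub> = 0"
    "x \<in> carrier A \<Longrightarrow> \<mu> (x [^]\<^bsub>A\<^esub> (k :: int)) = k * \<mu> x"
    using hom_int_pow[of x k] by simp_all
qed

lemma int_homI:
  assumes "\<And>x y. x \<in> carrier A \<Longrightarrow> y \<in> carrier A \<Longrightarrow> \<mu> (x \<otimes>\<^bsub>A\<^esub> y) = \<mu> x + (\<mu> y :: int)"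
  shows "\<mu> \<in> hom A integer_group"
  using assms by (simp add: hom_def)

text \<open>
  The common kernel is a direct summand. When one more \<open>\<mu>\<close> is added, its values
  on the previous summand form some \<open>d\<int>\<close>; if \<open>v\<close> in the summand has
  value \<open>d\<close>, then \<open>x - (\<mu>(x) / d) v\<close> is, in additive notation, the
  new projection.
\<close>

lemma common_kernel_retraction:
  fixes m :: nat
  assumes A: "comm_group A" and \<mu>: "\<forall>i<m. \<mu> i \<in> hom A integer_group"
  shows "\<exists>e\<in>hom A A. \<forall>x\<in>carrier A. (\<forall>i<m. \<mu> i (e x) = 0) \<and> ((\<forall>i<m. \<mu> i x = 0) \<longrightarrow> e x = x)"
  using \<mu>
proof (induction m)
  case 0
  show ?case by (rule bexI[of _ "\<lambda>x. x"]) (simp_all add: hom_def)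
next
  case (Suc m)
  interpret comm_group A by fact
  obtain e where e: "e \<in> hom A A"
    and e0: "\<And>x i. x \<in> carrier A \<Longrightarrow> i < m \<Longrightarrow> \<mu> i (e x) = 0"
    and ex: "\<And>x. x \<in> carrier A \<Longrightarrow> (\<And>i. i < m \<Longrightarrow> \<mu> i x = 0) \<Longrightarrow> e x = x"
    using Suc.IH Suc.prems by (metis less_SucI)
  have ec: "e x \<in> carrier A" if "x \<in> carrier A" for x using e that by (auto simp: hom_def)
  have em: "e (x \<otimes>\<^bsub>A\<^esub> y) = e x \<otimes>\<^bsub>A\<^esub> e y" if "x \<in> carrier A" "y \<in> carrier A" for x y
    using e that by (auto simp: hom_def)
  note h = hom_int[OF Suc.prems[rule_format] is_group]
  show ?case
  proof (cases "\<forall>x\<in>carrier A. \<mu> m (e x) = 0")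
    case True
    then show ?thesis using e e0 ex by (intro bexI[of _ e]) (auto simp: less_Suc_eq)
  next
    case False
    define D where "D = (\<lambda>d :: nat. d > 0 \<and> (\<exists>v\<in>carrier A. \<mu> m (e v) = int d))"
    obtain v0 where v0: "v0 \<in> carrier A" "\<mu> m (e v0) \<noteq> 0" using False by blast
    have em_hom: "(\<lambda>x. \<mu> m (e x)) \<in> hom A integer_group"
      using h(1)[of m] em ec by (intro int_homI) simp
    note hm = hom_int[OF em_hom is_group]
    have "D (nat \<bar>\<mu> m (e v0)\<bar>)"
    proof (cases "\<mu> m (e v0) > 0")
      case True
      then show ?thesis unfolding D_def using v0(1) by (intro conjI bexI[of _ v0]) auto
    next
      case False
      then show ?thesis unfolding D_def using v0 hm(2)[of v0]
        by (intro conjI bexI[of _ "inv\<^bsub>A\<^esub> v0"]) auto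
    qed
    define d where "d = (LEAST d. D d)"
    have "D d" unfolding d_def by (rule LeastI) fact
    then obtain v where d: "d > 0" and v: "v \<in> carrier A" "\<mu> m (e v) = int d" unfolding D_def by blast
    have dvd: "int d dvd \<mu> m (e x)" if x: "x \<in> carrier A" for x
    proof (rule ccontr)
      let ?a = "\<mu> m (e x)"
      assume "\<not> int d dvd ?a"
      then have r: "?a mod int d > 0"
        using pos_mod_sign[of "int d" ?a] d unfolding dvd_eq_mod_eq_0 by linarith
      let ?y = "x \<otimes>\<^bsub>A\<^esub> inv\<^bsub>A\<^esub> (v [^]\<^bsub>A\<^esub> (?a div int d))"
      have "\<mu> m (e ?y) = ?a - (?a div int d) * int d"
        using hm(1)[of x "inv\<^bsub>A\<^esub> (v [^]\<^bsub>A\<^esub> (?a div int d))"] hm(2)[of "v [^]\<^bsub>A\<^esub> (?a div int d)"]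
          hm(4)[of v] x v by simp
      then have "\<mu> m (e ?y) = ?a mod int d" by (simp add: minus_div_mult_eq_mod)
      then have "D (nat (?a mod int d))" unfolding D_def using r x v(1) by (intro conjI bexI[of _ ?y]) auto
      then have "d \<le> nat (?a mod int d)" unfolding d_def by (rule Least_le)
      moreover have "?a mod int d < int d" using d by simp
      ultimately show False using r by linarith
    qed
    define q where "q x = \<mu> m (e x) div int d" for x
    have q: "\<mu> m (e x) = q x * int d" if "x \<in> carrier A" for x using dvd[OF that] unfolding q_def by simp
    have qm: "q (x \<otimes>\<^bsub>A\<^esub> y) = q x + q y" if "x \<in> carrier A" "y \<in> carrier A" for x y
    proof -
      have "q (x \<otimes>\<^bsub>A\<^esub> y) * int d = (q x + q y) * int d"
        using q[of "x \<otimes>\<^bsub>A\<^esub> y"] q[of x] q[of y] hm(1)[of x y] that by (simp add: algebra_simps)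
      then show ?thesis using d by simp
    qed
    define e' where "e' x = e x \<otimes>\<^bsub>A\<^esub> inv\<^bsub>A\<^esub> (e v [^]\<^bsub>A\<^esub> q x)" for x
    have "e' \<in> hom A A"
    proof (rule homI)
      fix x y assume xy: "x \<in> carrier A" "y \<in> carrier A"
      show "e' x \<in> carrier A" unfolding e'_def using xy v ec by simp
      show "e' (x \<otimes>\<^bsub>A\<^esub> y) = e' x \<otimes>\<^bsub>A\<^esub> e' y"
        unfolding e'_def using xy v ec em qm by (simp add: int_pow_mult inv_mult_group m_ac)
    qed
    moreover have "\<mu> i (e' x) = 0" if "x \<in> carrier A" "i < Suc m" for x i
    proof -
      have *: "\<mu> i (e' x) = \<mu> i (e x) - q x * \<mu> i (e v)"
        unfolding e'_def using h(1,2,4)[OF that(2)] that v ec by simp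
      show ?thesis using that(2) e0[OF that(1)] e0[OF v(1)] q[OF that(1)] v(2) unfolding less_Suc_eq
        by (auto simp: *)
    qed
    moreover have "e' x = x" if "x \<in> carrier A" "\<forall>i<Suc m. \<mu> i x = 0" for x
    proof -
      have "e x = x" using ex that by simp
      then have "q x = 0" using q[OF that(1)] that(2) d by simp
      then show ?thesis using \<open>e x = x\<close> that(1) v ec unfolding e'_def by simp
    qed
    ultimately show ?thesis by (intro bexI[of _ e']) auto
  qed
qed

text \<open>
  A homomorphism that vanishes on the common kernel is a rational combination of the
  \<open>\<mu>\<^sub>i\<close>. By induction this holds on the kernel of the last one; on all of
  \<open>H\<close> a multiple of that one is added, found from its value at a single
  \<open>v\<close> outside the kernel.
\<close>

lemma rational_combination:
  fixes m :: nat
  assumes A: "comm_group A" and f: "f \<in> hom A integer_group"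
    and H: "subgroup H A" and \<mu>: "\<forall>i<m. \<mu> i \<in> hom A integer_group"
    and k: "\<And>x. x \<in> H \<Longrightarrow> (\<forall>i<m. \<mu> i x = 0) \<Longrightarrow> f x = 0"
  shows "\<exists>k c. k \<noteq> 0 \<and> (\<forall>x\<in>H. k * f x = (\<Sum>i<m. c i * \<mu> i x))"
  using H \<mu> k
proof (induction m arbitrary: H)
  case 0
  then show ?case by (intro exI[of _ 1]) auto
next
  case (Suc m)
  interpret comm_group A by fact
  interpret H: subgroup H A by fact
  note hf = hom_int[OF f is_group]
  note h = hom_int[OF Suc.prems(2)[rule_format] is_group]
  define H' where "H' = {x \<in> H. \<mu> m x = 0}"
  have sub: "subgroup H' A"
  proof (rule subgroupI)
    show "H' \<noteq> {}" using H.one_closed h(3)[of m] by (auto simp: H'_def intro: exI[of _ "\<one>\<^bsub>A\<^esub>"])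
  qed (use h(1-2)[of m] in \<open>auto simp: H'_def\<close>)
  have "\<exists>k c. k \<noteq> 0 \<and> (\<forall>x\<in>H'. k * f x = (\<Sum>i<m. c i * \<mu> i x))"
    by (rule Suc.IH[OF sub]) (use Suc.prems in \<open>auto simp: H'_def less_Suc_eq\<close>)
  then obtain k c where k: "k \<noteq> 0" and c: "\<And>x. x \<in> H' \<Longrightarrow> k * f x = (\<Sum>i<m. c i * \<mu> i x)" by blast
  show ?case
  proof (cases "\<forall>x\<in>H. \<mu> m x = 0")
    case True
    then have "H' = H" by (auto simp: H'_def)
    then have "\<forall>x\<in>H. k * f x = (\<Sum>i<Suc m. c i * \<mu> i x)" using c True by simp
    then show ?thesis using k by blast
  next
    case False
    then obtain v where v: "v \<in> H" "\<mu> m v \<noteq> 0" by blast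
    let ?d = "\<mu> m v"
    define g where "g x = k * f x - (\<Sum>i<m. c i * \<mu> i x)" for x
    have g_hom: "g \<in> hom A integer_group"
    proof (rule int_homI)
      fix x y assume "x \<in> carrier A" "y \<in> carrier A"
      then have "(\<Sum>i<m. c i * \<mu> i (x \<otimes>\<^bsub>A\<^esub> y)) = (\<Sum>i<m. c i * \<mu> i x) + (\<Sum>i<m. c i * \<mu> i y)"
        unfolding sum.distrib[symmetric] using h(1) by (intro sum.cong) (auto simp: distrib_left)
      then show "g (x \<otimes>\<^bsub>A\<^esub> y) = g x + g y"
        unfolding g_def using hf(1) \<open>x \<in> carrier A\<close> \<open>y \<in> carrier A\<close> by (simp add: algebra_simps)
    qed
    note hg = hom_int[OF g_hom is_group]
    have dg: "?d * g x = g v * \<mu> m x" if x: "x \<in> H" for x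
    proof -
      \<comment> \<open>the combination \<open>\<mu>(v) x - \<mu>(x) v\<close> lies in the kernel of \<open>\<mu>\<close>\<close>
      let ?y = "x [^]\<^bsub>A\<^esub> ?d \<otimes>\<^bsub>A\<^esub> inv\<^bsub>A\<^esub> (v [^]\<^bsub>A\<^esub> \<mu> m x)"
      have pw: "x [^]\<^bsub>A\<^esub> ?d \<in> H" "v [^]\<^bsub>A\<^esub> \<mu> m x \<in> H"
        using subgroup_int_pow_closed[OF Suc.prems(1)] x v by auto
      have cx: "x \<in> carrier A" "v \<in> carrier A" using x v by auto
      have "\<mu> m ?y = 0" using cx h(1,2,4)[of m] by simp
      then have "?y \<in> H'" unfolding H'_def using pw by simp
      then have "g ?y = 0" using c by (simp add: g_def)
      moreover have "g ?y = ?d * g x - \<mu> m x * g v" using cx hg(1,2,4) by simp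
      ultimately show ?thesis by (simp add: algebra_simps)
    qed
    let ?c = "\<lambda>i. if i < m then ?d * c i else g v"
    have "\<forall>x\<in>H. (?d * k) * f x = (\<Sum>i<Suc m. ?c i * \<mu> i x)"
    proof
      fix x assume x: "x \<in> H"
      have "(\<Sum>i<Suc m. ?c i * \<mu> i x) = ?d * (\<Sum>i<m. c i * \<mu> i x) + g v * \<mu> m x"
        by (simp add: sum_distrib_left mult.assoc)
      also have "\<dots> = ?d * (k * f x)" using dg[OF x] unfolding g_def by (simp add: algebra_simps)
      finally show "(?d * k) * f x = (\<Sum>i<Suc m. ?c i * \<mu> i x)" by simp
    qed
    then show ?thesis using k v(2) by (intro exI[of _ "?d * k"] exI[of _ ?c]) simp
  qed
qed

text \<open>The standard basis generates.\<close>

lemma int_power_hom_eq: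
  assumes C: "group C" and f: "f \<in> hom (int_power n) C" "g \<in> hom (int_power n) C"
    and eq: "\<And>i. i < n \<Longrightarrow> f (std_basis n i) = g (std_basis n i)"
    and x: "x \<in> carrier (int_power n)"
  shows "f x = g x"
proof -
  interpret Z: comm_group "int_power n" by (rule int_power_group)
  interpret C: group C by fact
  interpret f: group_hom "int_power n" C f
    using f by (simp add: group_hom_def group_hom_axioms_def C Z.is_group)
  interpret g: group_hom "int_power n" C g
    using f by (simp add: group_hom_def group_hom_axioms_def C Z.is_group)
  define S where "S = {x \<in> carrier (int_power n). f x = g x}"
  have S: "subgroup S (int_power n)"
    by (rule Z.subgroupI) (auto simp: S_def)
  have basis: "std_basis n i \<in> carrier (int_power n)" for i
    by (auto simp: std_basis_def int_power_carrier)
  have single: "(\<lambda>i\<in>{..<n}. if i = j then c else 0) \<in> S" if j: "j < n" for j c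
  proof (induction c rule: int_induct[of _ 0])
    case base
    have "(\<lambda>i\<in>{..<n}. if i = j then 0 else 0) = \<one>\<^bsub>int_power n\<^esub>" by (auto simp: int_power_one)
    then show ?case using subgroup.one_closed[OF S] by simp
  next
    case (step1 c)
    have eq: "(\<lambda>i\<in>{..<n}. if i = j then c + 1 else 0)
      = (\<lambda>i\<in>{..<n}. if i = j then c else 0) \<otimes>\<^bsub>int_power n\<^esub> std_basis n j"
      by (auto simp: int_power_mult std_basis_def)
    have "std_basis n j \<in> S" using assms(4)[OF j] basis by (simp add: S_def)
    then show ?case unfolding eq by (intro subgroup.m_closed[OF S] step1(2))
  next
    case (step2 c)
    have eq: "(\<lambda>i\<in>{..<n}. if i = j then c - 1 else 0)
      = (\<lambda>i\<in>{..<n}. if i = j then c else 0) \<otimes>\<^bsub>int_power n\<^esub> inv\<^bsub>int_power n\<^esub> std_basis n j"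
      using int_power_inv[OF basis] by (auto simp: int_power_mult std_basis_def)
    have "std_basis n j \<in> S" using assms(4)[OF j] basis by (simp add: S_def)
    then show ?case unfolding eq by (intro subgroup.m_closed[OF S] subgroup.m_inv_closed[OF S] step2(2))
  qed
  have "(\<lambda>i\<in>{..<n}. if i < k then x i else 0) \<in> S" for k
  proof (induction k)
    case 0
    have "(\<lambda>i\<in>{..<n}. if i < 0 then x i else 0) = \<one>\<^bsub>int_power n\<^esub>" by (auto simp: int_power_one)
    then show ?case using subgroup.one_closed[OF S] by simp
  next
    case (Suc k)
    show ?case
    proof (cases "k < n")
      case True
      have eq: "(\<lambda>i\<in>{..<n}. if i < Suc k then x i else 0) = (\<lambda>i\<in>{..<n}. if i < k then x i else 0)
        \<otimes>\<^bsub>int_power n\<^esub> (\<lambda>i\<in>{..<n}. if i = k then x k else 0)"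
        by (auto simp: int_power_mult)
      show ?thesis unfolding eq by (rule subgroup.m_closed[OF S Suc single[OF True]])
    next
      case False
      then have "(\<lambda>i\<in>{..<n}. if i < Suc k then x i else 0) = (\<lambda>i\<in>{..<n}. if i < k then x i else 0)"
        by (auto simp: restrict_def)
      then show ?thesis using Suc by simp
    qed
  qed
  from this[of n] have "(\<lambda>i\<in>{..<n}. if i < n then x i else 0) \<in> S" .
  moreover have "(\<lambda>i\<in>{..<n}. if i < n then x i else 0) = x"
    using x by (auto simp: int_power_carrier restrict_def PiE_def extensional_def)
  ultimately show ?thesis by (simp add: S_def)
qed

section \<open>Groups of homomorphisms\<close>

lemma hom_group_simps:
  "carrier (hom_group A C) = hom A C \<inter> extensional (carrier A)"
  "f \<otimes>\<^bsub>hom_group A C\<^esub> g = (\<lambda>x\<in>carrier A. f x \<otimes>\<^bsub>C\<^esub> g x)"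
  "\<one>\<^bsub>hom_group A C\<^esub> = (\<lambda>x\<in>carrier A. \<one>\<^bsub>C\<^esub>)"
  by (simp_all add: hom_group_def)

lemma hom_restrict: "group A \<Longrightarrow> f \<in> hom A C \<Longrightarrow> restrict f (carrier A) \<in> hom A C"
  unfolding hom_def by (auto simp: group.is_monoid monoid.m_closed)

lemma hom_group_inverse:
  assumes A: "group A" and C: "comm_group C" and f: "f \<in> carrier (hom_group A C)"
  shows "(\<lambda>x\<in>carrier A. inv\<^bsub>C\<^esub> f x) \<in> carrier (hom_group A C)"
proof -
  interpret A: group A by fact
  interpret C: comm_group C by fact
  have "(\<lambda>x. inv\<^bsub>C\<^esub> f x) \<in> hom A C"
    using f by (auto simp: hom_group_simps hom_def Pi_iff C.inv_mult)
  then show ?thesis using hom_restrict[OF A] by (simp add: hom_group_simps)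
qed

lemma hom_group_comm_group:
  assumes A: "group A" and C: "comm_group C"
  shows "comm_group (hom_group A C)"
proof -
  interpret A: group A by fact
  interpret C: comm_group C by fact
  have m: "f \<otimes>\<^bsub>hom_group A C\<^esub> g \<in> carrier (hom_group A C)"
    if "f \<in> carrier (hom_group A C)" "g \<in> carrier (hom_group A C)" for f g
  proof -
    have "(\<lambda>x. f x \<otimes>\<^bsub>C\<^esub> g x) \<in> hom A C"
      using that by (auto simp: hom_group_simps hom_def Pi_iff C.m_ac)
    then show ?thesis using hom_restrict[OF A] by (simp add: hom_group_simps)
  qed
  have one: "\<one>\<^bsub>hom_group A C\<^esub> \<in> carrier (hom_group A C)"
    by (auto simp: hom_group_simps hom_def)
  show ?thesis
  proof (rule comm_groupI[OF m one])
    fix f g h assume f: "f \<in> carrier (hom_group A C)" and g: "g \<in> carrier (hom_group A C)"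
      and h: "h \<in> carrier (hom_group A C)"
    have c: "x \<in> carrier A \<Longrightarrow> f x \<in> carrier C" "x \<in> carrier A \<Longrightarrow> g x \<in> carrier C"
      "x \<in> carrier A \<Longrightarrow> h x \<in> carrier C" for x
      using f g h by (auto simp: hom_group_simps hom_def)
    show "f \<otimes>\<^bsub>hom_group A C\<^esub> g \<otimes>\<^bsub>hom_group A C\<^esub> h = f \<otimes>\<^bsub>hom_group A C\<^esub> (g \<otimes>\<^bsub>hom_group A C\<^esub> h)"
      using c by (auto simp: hom_group_simps C.m_assoc intro!: restrict_ext)
    show "f \<otimes>\<^bsub>hom_group A C\<^esub> g = g \<otimes>\<^bsub>hom_group A C\<^esub> f"
      using c by (auto simp: hom_group_simps C.m_comm intro!: restrict_ext)
    show "\<one>\<^bsub>hom_group A C\<^esub> \<otimes>\<^bsub>hom_group A C\<^esub> f = f"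
      using f c by (auto simp: hom_group_simps extensional_def restrict_def)
    show "\<exists>y\<in>carrier (hom_group A C). y \<otimes>\<^bsub>hom_group A C\<^esub> f = \<one>\<^bsub>hom_group A C\<^esub>"
      by (rule bexI[OF _ hom_group_inverse[OF A C f]])
        (use c in \<open>auto simp: hom_group_simps intro!: restrict_ext\<close>)
  qed
qed

lemma hom_group_inv:
  assumes "group A" "comm_group C" "f \<in> carrier (hom_group A C)"
  shows "inv\<^bsub>hom_group A C\<^esub> f = (\<lambda>x\<in>carrier A. inv\<^bsub>C\<^esub> f x)"
proof -
  interpret C: comm_group C by fact
  interpret H: comm_group "hom_group A C" by (rule hom_group_comm_group) fact+
  have "f x \<in> carrier C" if "x \<in> carrier A" for x using assms(3) that by (auto simp: hom_group_simps hom_def)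
  then have "(\<lambda>x\<in>carrier A. inv\<^bsub>C\<^esub> f x) \<otimes>\<^bsub>hom_group A C\<^esub> f = \<one>\<^bsub>hom_group A C\<^esub>"
    by (auto simp: hom_group_simps intro!: restrict_ext)
  then show ?thesis by (rule H.inv_equality[OF _ assms(3) hom_group_inverse[OF assms]])
qed

lemma hom_map_hom:
  assumes "group A" "group A'" "h \<in> hom A A'"
  shows "hom_map A h \<in> hom (hom_group A' C) (hom_group A C)"
proof (rule homI)
  interpret A: group A by fact
  have hc: "h x \<in> carrier A'" if "x \<in> carrier A" for x using assms(3) that by (auto simp: hom_def)
  fix f assume f: "f \<in> carrier (hom_group A' C)"
  then have "(\<lambda>x. f (h x)) \<in> hom A C"
    using assms(3) by (auto simp: hom_group_simps hom_def Pi_iff)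
  then show "hom_map A h f \<in> carrier (hom_group A C)"
    unfolding hom_map_def using hom_restrict[OF assms(1)] by (simp add: hom_group_simps)
  fix g assume "g \<in> carrier (hom_group A' C)"
  show "hom_map A h (f \<otimes>\<^bsub>hom_group A' C\<^esub> g) = hom_map A h f \<otimes>\<^bsub>hom_group A C\<^esub> hom_map A h g"
    unfolding hom_map_def hom_group_simps using hc by (auto intro!: restrict_ext)
qed

lemma complex_units_simps:
  "carrier complex_units = UNIV - {0}" "x \<otimes>\<^bsub>complex_units\<^esub> y = x * y" "\<one>\<^bsub>complex_units\<^esub> = 1"
  by (simp_all add: complex_units_def)

lemma complex_units_group: "comm_group complex_units"
proof (rule comm_groupI)
  fix x assume "x \<in> carrier complex_units"
  then show "\<exists>y\<in>carrier complex_units. y \<otimes>\<^bsub>complex_units\<^esub> x = \<one>\<^bsub>complex_units\<^esub>"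
    by (intro bexI[of _ "inverse x"]) (simp_all add: complex_units_simps)
qed (simp_all add: complex_units_simps)

lemma complex_units_inv: "x \<noteq> 0 \<Longrightarrow> inv\<^bsub>complex_units\<^esub> x = inverse x"
proof -
  interpret comm_group complex_units by (rule complex_units_group)
  assume "x \<noteq> 0"
  then show ?thesis by (intro inv_equality) (simp_all add: complex_units_simps)
qed

abbreviation char_group :: "'a monoid \<Rightarrow> ('a \<Rightarrow> complex) monoid"
  where "char_group D \<equiv> hom_group D complex_units"

definition char_topology :: "'a monoid \<Rightarrow> ('a \<Rightarrow> complex) topology"
  where "char_topology D = subtopology (product_topology (\<lambda>_. euclidean) (carrier D)) (carrier (char_group D))"

lemma topspace_char_topology: "topspace (char_topology D) = carrier (char_group D)"
  by (auto simp: char_topology_def hom_group_simps PiE_def)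

lemma char_nonzero: "g \<in> carrier (char_group D) \<Longrightarrow> x \<in> carrier D \<Longrightarrow> g x \<noteq> 0"
  by (auto simp: hom_group_simps hom_def complex_units_simps)

lemma continuous_map_eval:
  "x \<in> carrier D \<Longrightarrow> continuous_map (char_topology D) euclidean (\<lambda>g. g x)"
  unfolding char_topology_def
  by (intro continuous_map_from_subtopology continuous_map_product_projection) simp

lemma continuous_map_into_char_topology:
  assumes "\<And>z. z \<in> topspace Z \<Longrightarrow> f z \<in> carrier (char_group D)"
    and "\<And>x. x \<in> carrier D \<Longrightarrow> continuous_map Z euclidean (\<lambda>z. f z x)"
  shows "continuous_map Z (char_topology D) f"
  unfolding char_topology_def continuous_map_in_subtopology continuous_map_componentwise
  using assms by (auto simp: hom_group_simps)

lemma continuous_map_complex_mult: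
  fixes f g :: "'a \<Rightarrow> complex"
  assumes "continuous_map Z euclidean f" "continuous_map Z euclidean g"
  shows "continuous_map Z euclidean (\<lambda>z. f z * g z)"
  using assms unfolding continuous_map_atin limitin_canonical_iff by (blast intro: tendsto_mult)

lemma char_topgroup:
  assumes "group D"
  shows "topgroup (char_group D) (char_topology D)"
proof -
  interpret G: comm_group "char_group D" by (rule hom_group_comm_group[OF assms complex_units_group])
  show ?thesis
  proof unfold_locales
    show "topspace (char_topology D) = carrier (char_group D)" by (rule topspace_char_topology)
    let ?P = "prod_topology (char_topology D) (char_topology D)"
    have ev: "continuous_map ?P euclidean (\<lambda>z. fst z x)" "continuous_map ?P euclidean (\<lambda>z. snd z x)"
      if "x \<in> carrier D" for x
      using continuous_map_compose[OF continuous_map_fst continuous_map_eval[OF that]]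
        continuous_map_compose[OF continuous_map_snd continuous_map_eval[OF that]]
      by (simp_all add: comp_def)
    show "continuous_map ?P (char_topology D) (\<lambda>(g, h). g \<otimes>\<^bsub>char_group D\<^esub> h)"
    proof (rule continuous_map_into_char_topology)
      fix z assume "z \<in> topspace ?P"
      then show "(case z of (g, h) \<Rightarrow> g \<otimes>\<^bsub>char_group D\<^esub> h) \<in> carrier (char_group D)"
        by (auto simp: topspace_char_topology)
    next
      fix x assume x: "x \<in> carrier D"
      have "continuous_map ?P euclidean (\<lambda>z. fst z x * snd z x)"
        by (intro continuous_map_complex_mult ev x)
      then show "continuous_map ?P euclidean (\<lambda>z. (case z of (g, h) \<Rightarrow> g \<otimes>\<^bsub>char_group D\<^esub> h) x)"
        using x by (simp add: hom_group_simps complex_units_simps case_prod_unfold)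
    qed
    show "continuous_map (char_topology D) (char_topology D) (\<lambda>g. inv\<^bsub>char_group D\<^esub> g)"
    proof (rule continuous_map_into_char_topology)
      fix z assume "z \<in> topspace (char_topology D)"
      then show "inv\<^bsub>char_group D\<^esub> z \<in> carrier (char_group D)"
        by (simp add: topspace_char_topology)
    next
      fix x assume x: "x \<in> carrier D"
      have "continuous_map (char_topology D) euclidean (\<lambda>g. inverse (g x))"
        unfolding continuous_map_atin
      proof (intro ballI)
        fix g assume g: "g \<in> topspace (char_topology D)"
        have "limitin euclidean (\<lambda>g. g x) (g x) (atin (char_topology D) g)"
          using continuous_map_eval[OF x] g unfolding continuous_map_atin by blast
        then show "limitin euclidean (\<lambda>g. inverse (g x)) (inverse (g x)) (atin (char_topology D) g)"
          using char_nonzero[OF _ x] g by (simp add: topspace_char_topology tendsto_inverse)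
      qed
      then show "continuous_map (char_topology D) euclidean (\<lambda>z. (inv\<^bsub>char_group D\<^esub> z) x)"
      proof (rule continuous_map_eq)
        fix g assume "g \<in> topspace (char_topology D)"
        then have g: "g \<in> carrier (char_group D)" by (simp add: topspace_char_topology)
        show "inverse (g x) = (inv\<^bsub>char_group D\<^esub> g) x"
          using hom_group_inv[OF assms complex_units_group g] complex_units_inv[OF char_nonzero[OF g x]] x by simp
      qed
    qed
  qed
qed

lemma hom_map_continuous:
  assumes "group D" "group D'" "h \<in> hom D D'"
  shows "continuous_map (char_topology D') (char_topology D) (hom_map D h)"
proof (rule continuous_map_into_char_topology)
  fix z assume "z \<in> topspace (char_topology D')"
  then show "hom_map D h z \<in> carrier (char_group D)"
    using hom_map_hom[OF assms] by (auto simp: topspace_char_topology hom_def)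
next
  fix x assume x: "x \<in> carrier D"
  then have "h x \<in> carrier D'" using assms(3) by (auto simp: hom_def)
  then show "continuous_map (char_topology D') euclidean (\<lambda>z. hom_map D h z x)"
    using continuous_map_eval[of "h x" D'] x by (simp add: hom_map_def)
qed

section \<open>The cokernel of a dual map and its characters\<close>

text \<open>
  For \<open>M = [B Q]\<close> the cokernel \<open>D\<close> of \<open>M\<^sup>*\<close> is
  \<open>DG(\<beta>)\<close>, and \<open>cls\<close> is the quotient map.
\<close>

locale dual_cokernel =
  fixes k m :: nat and M :: "(nat \<Rightarrow> int) \<Rightarrow> nat \<Rightarrow> int"
  assumes M: "M \<in> hom (int_power k) (int_power m)"
begin

abbreviation F where "F \<equiv> int_power k"
abbreviation E where "E \<equiv> int_power m"

definition im where "im = hom_map F M ` carrier (dual_group E)"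

definition D where "D = dual_group F Mod im"

definition cls where "cls f = im #>\<^bsub>dual_group F\<^esub> f"

definition coord :: "nat \<Rightarrow> (nat \<Rightarrow> int) \<Rightarrow> int" where "coord i = (\<lambda>v\<in>carrier F. v i)"

definition lin :: "(nat \<Rightarrow> int) \<Rightarrow> (nat \<Rightarrow> int) \<Rightarrow> int"
  where "lin c = (\<lambda>v\<in>carrier F. \<Sum>i<k. c i * v i)"

sublocale F: comm_group F by (rule int_power_group)
sublocale E: comm_group E by (rule int_power_group)
sublocale dF: comm_group "dual_group F"
  by (rule hom_group_comm_group[OF F.is_group abelian_integer_group])
sublocale dE: comm_group "dual_group E"
  by (rule hom_group_comm_group[OF E.is_group abelian_integer_group])
sublocale M: group_hom F E M
  using M by (simp add: group_hom_def group_hom_axioms_def F.is_group E.is_group)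

lemma dual_simps:
  "f \<in> carrier (dual_group F) \<longleftrightarrow> f \<in> hom F integer_group \<and> f \<in> extensional (carrier F)"
  "f \<otimes>\<^bsub>dual_group F\<^esub> g = (\<lambda>v\<in>carrier F. f v + g v)"
  by (simp_all add: hom_group_simps)

lemma dual_inv: "f \<in> carrier (dual_group F) \<Longrightarrow> inv\<^bsub>dual_group F\<^esub> f = (\<lambda>v\<in>carrier F. - f v)"
  using hom_group_inv[OF F.is_group abelian_integer_group] by simp

lemma im_subgroup: "subgroup im (dual_group F)"
proof -
  interpret group_hom "dual_group E" "dual_group F" "hom_map F M"
    using hom_map_hom[OF F.is_group E.is_group M]
    by (simp add: group_hom_def group_hom_axioms_def dF.is_group dE.is_group)
  show ?thesis unfolding im_def by (rule img_is_subgroup)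
qed

lemma im_normal: "im \<lhd> dual_group F"
  using im_subgroup by (simp add: dF.normal_iff_subgroup)

sublocale D: comm_group D unfolding D_def by (rule dF.abelian_FactGroup[OF im_subgroup])

lemma carrier_D: "carrier D = cls ` carrier (dual_group F)"
  unfolding D_def cls_def carrier_FactGroup by simp

lemma cls_closed [simp]: "f \<in> carrier (dual_group F) \<Longrightarrow> cls f \<in> carrier D"
  by (simp add: carrier_D)

lemma cls_hom: "cls \<in> hom (dual_group F) D"
  unfolding cls_def D_def using normal.r_coset_hom_Mod[OF im_normal] by simp

sublocale cls: group_hom "dual_group F" D cls
  using cls_hom by (simp add: group_hom_def group_hom_axioms_def dF.is_group D.is_group)

lemma cls_im: "f \<in> im \<Longrightarrow> cls f = \<one>\<^bsub>D\<^esub>"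
  unfolding cls_def D_def one_FactGroup
  using dF.coset_join2[OF _ im_subgroup] subgroup.subset[OF im_subgroup] by auto

lemma cls_eqI:
  assumes f: "f \<in> carrier (dual_group F)" "g \<in> carrier (dual_group F)"
    and h: "h \<in> hom E integer_group" and eq: "\<And>v. v \<in> carrier F \<Longrightarrow> f v = g v + h (M v)"
  shows "cls f = cls g"
proof -
  have h': "restrict h (carrier E) \<in> carrier (dual_group E)"
    using hom_restrict[OF E.is_group h] by (simp add: hom_group_simps)
  let ?d = "hom_map F M (restrict h (carrier E))"
  have d: "?d \<in> im" unfolding im_def using h' by (rule imageI)
  then have dc: "?d \<in> carrier (dual_group F)" using subgroup.subset[OF im_subgroup] by blast
  have "f = g \<otimes>\<^bsub>dual_group F\<^esub> ?d"
  proof (rule extensionalityI[of _ "carrier F"])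
    fix v assume v: "v \<in> carrier F"
    then show "f v = (g \<otimes>\<^bsub>dual_group F\<^esub> ?d) v" by (simp add: dual_simps hom_map_def eq)
  qed (use f in \<open>simp_all add: dual_simps\<close>)
  then have "cls f = cls g \<otimes>\<^bsub>D\<^esub> cls ?d" using f dc by simp
  then show ?thesis using cls_im[OF d] f by simp
qed

lemma hom_on_D:
  assumes C: "group C" and \<psi>: "\<psi> \<in> hom (dual_group F) C"
    and one: "\<And>h. h \<in> carrier (dual_group E) \<Longrightarrow> \<psi> (hom_map F M h) = \<one>\<^bsub>C\<^esub>"
  shows "\<exists>g\<in>hom D C. \<forall>f\<in>carrier (dual_group F). g (cls f) = \<psi> f"
proof -
  interpret \<psi>: group_hom "dual_group F" C \<psi>
    using \<psi> C by (simp add: group_hom_def group_hom_axioms_def dF.is_group)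
  have "im \<subseteq> kernel (dual_group F) C \<psi>"
    using one subgroup.subset[OF im_subgroup] by (auto simp: kernel_def im_def)
  from \<psi>.FactGroup_universal_kernel[OF im_normal this] obtain g
    where "g \<in> hom D C" "\<And>f. f \<in> carrier (dual_group F) \<Longrightarrow> g (cls f) = \<psi> f"
    unfolding D_def cls_def by blast
  then show ?thesis by blast
qed

lemma basis_closed [simp]: "std_basis k i \<in> carrier F"
  by (auto simp: std_basis_def int_power_carrier)

lemma lin_closed [simp]: "lin c \<in> carrier (dual_group F)"
proof -
  have "(\<lambda>v. \<Sum>i<k. c i * v i) \<in> hom F integer_group"
    by (rule int_homI) (simp add: int_power_mult distrib_left sum.distrib)
  then show ?thesis unfolding lin_def using hom_restrict[OF F.is_group] by (simp add: dual_simps)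
qed

lemma lin_hom: "lin \<in> hom F (dual_group F)"
proof (rule homI)
  fix c d :: "nat \<Rightarrow> int"
  have "lin (c \<otimes>\<^bsub>F\<^esub> d) v = (lin c \<otimes>\<^bsub>dual_group F\<^esub> lin d) v" for v
    unfolding lin_def dual_simps
    by (cases "v \<in> carrier F") (simp_all add: int_power_mult distrib_right sum.distrib)
  then show "lin (c \<otimes>\<^bsub>F\<^esub> d) = lin c \<otimes>\<^bsub>dual_group F\<^esub> lin d" by (rule ext)
qed simp

lemma lin_basis: "i < k \<Longrightarrow> lin (std_basis k i) = coord i"
  unfolding lin_def coord_def
proof (rule restrict_ext)
  fix v :: "nat \<Rightarrow> int" assume "i < k"
  have "(\<Sum>j<k. std_basis k i j * v j) = (\<Sum>j<k. if j = i then v j else 0)"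
    by (rule sum.cong) (auto simp: std_basis_def)
  then show "(\<Sum>j<k. std_basis k i j * v j) = v i" using \<open>i < k\<close> by simp
qed

lemma coord_closed: "i < k \<Longrightarrow> coord i \<in> carrier (dual_group F)"
  using lin_closed[of "std_basis k i"] lin_basis by simp

lemma dual_eq_lin:
  assumes "f \<in> carrier (dual_group F)"
  shows "f = lin (\<lambda>i\<in>{..<k}. f (std_basis k i))"
proof (rule extensionalityI[of _ "carrier F"])
  fix v assume v: "v \<in> carrier F"
  let ?c = "\<lambda>i\<in>{..<k}. f (std_basis k i)"
  have "f \<in> hom F integer_group" "lin ?c \<in> hom F integer_group"
    using assms lin_closed[of ?c] unfolding dual_simps by blast+
  then show "f v = lin ?c v"
  proof (rule int_power_hom_eq[OF group_integer_group _ _ _ v])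
    fix i assume i: "i < k"
    have "std_basis k i j = (if j = i then 1 else 0)" if "j < k" for j
      using that by (simp add: std_basis_def)
    then have "(\<Sum>j<k. ?c j * std_basis k i j) = (\<Sum>j<k. if j = i then f (std_basis k j) else 0)"
      by (intro sum.cong) simp_all
    then have "lin ?c (std_basis k i) = (\<Sum>j<k. if j = i then f (std_basis k j) else 0)"
      by (simp add: lin_def)
    then show "f (std_basis k i) = lin ?c (std_basis k i)" using i by simp
  qed
qed (use assms lin_closed in \<open>simp_all add: dual_simps\<close>)

lemma hom_D_eq:
  assumes C: "group C" and g: "g \<in> hom D C" "g' \<in> hom D C"
    and eq: "\<And>i. i < k \<Longrightarrow> g (cls (coord i)) = g' (cls (coord i))" and x: "x \<in> carrier D"
  shows "g x = g' x"
proof -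
  obtain f where f: "f \<in> carrier (dual_group F)" "x = cls f" using x by (auto simp: carrier_D)
  let ?c = "\<lambda>i\<in>{..<k}. f (std_basis k i)"
  have h: "(\<lambda>c. cls (lin c)) \<in> hom F D"
    using hom_compose[OF lin_hom cls_hom] by (simp add: comp_def)
  have "(\<lambda>c. g (cls (lin c))) \<in> hom F C" "(\<lambda>c. g' (cls (lin c))) \<in> hom F C"
    using hom_compose[OF h g(1)] hom_compose[OF h g(2)] by (simp_all add: comp_def)
  then have "g (cls (lin ?c)) = g' (cls (lin ?c))"
    by (rule int_power_hom_eq[OF C]) (auto simp: lin_basis eq int_power_carrier)
  then show ?thesis using dual_eq_lin[OF f(1)] f(2) by simp
qed

lemma char_eqI:
  assumes "g \<in> carrier (char_group D)" "g' \<in> carrier (char_group D)"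
    and eq: "\<And>i. i < k \<Longrightarrow> g (cls (coord i)) = g' (cls (coord i))"
  shows "g = g'"
proof (rule extensionalityI[of _ "carrier D"])
  interpret C: comm_group complex_units by (rule complex_units_group)
  fix x assume "x \<in> carrier D"
  then show "g x = g' x"
    using hom_D_eq[OF C.is_group, of g g' x] assms by (simp add: hom_group_simps)
qed (use assms in \<open>simp_all add: hom_group_simps\<close>)

lemma char_cls_mult:
  assumes "g \<in> carrier (char_group D)" "f \<in> carrier (dual_group F)" "f' \<in> carrier (dual_group F)"
  shows "g (cls (\<lambda>v\<in>carrier F. f v + f' v)) = g (cls f) * g (cls f')"
proof -
  have "cls (\<lambda>v\<in>carrier F. f v + f' v) = cls f \<otimes>\<^bsub>D\<^esub> cls f'"
    using cls.hom_mult[OF assms(2,3)] by (simp add: dual_simps)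
  then show ?thesis using assms by (auto simp: hom_group_simps hom_def complex_units_simps)
qed

lemma char_cls_multiple:
  assumes g: "g \<in> carrier (char_group D)" and f: "f \<in> carrier (dual_group F)"
  shows "(\<lambda>v\<in>carrier F. int j * f v) \<in> carrier (dual_group F) \<and>
    g (cls (\<lambda>v\<in>carrier F. int j * f v)) = g (cls f) ^ j"
proof (induction j)
  case 0
  have "(\<lambda>v\<in>carrier F. 0) = \<one>\<^bsub>dual_group F\<^esub>" by (simp add: hom_group_simps)
  moreover have "g \<one>\<^bsub>D\<^esub> = 1"
    using hom_one[of g D complex_units] g complex_units_group D.is_group
    by (simp add: hom_group_simps complex_units_simps comm_group.axioms)
  ultimately show ?case by simp
next
  case (Suc j)
  have eq: "(\<lambda>v\<in>carrier F. int (Suc j) * f v) = (\<lambda>v\<in>carrier F. (\<lambda>v\<in>carrier F. int j * f v) v + f v)"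
    by (auto simp: algebra_simps intro!: restrict_ext)
  have c: "(\<lambda>v\<in>carrier F. (\<lambda>v\<in>carrier F. int j * f v) v + f v) \<in> carrier (dual_group F)"
    using dF.m_closed[OF conjunct1[OF Suc] f] unfolding dual_simps .
  show ?case unfolding eq
    by (intro conjI c) (simp only: char_cls_mult[OF g conjunct1[OF Suc] f] conjunct2[OF Suc] power_Suc2)
qed

lemma factor_through_M:
  assumes surj: "M ` carrier F = carrier E" and f: "f \<in> hom F integer_group"
    and 0: "\<And>v. v \<in> carrier F \<Longrightarrow> M v = \<one>\<^bsub>E\<^esub> \<Longrightarrow> f v = 0"
  shows "\<exists>h\<in>hom E integer_group. \<forall>v\<in>carrier F. f v = h (M v)"
proof -
  note hf = hom_int[OF f F.is_group]
  have eq: "f v = f w" if "v \<in> carrier F" "w \<in> carrier F" "M v = M w" for v w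
  proof -
    have "f (v \<otimes>\<^bsub>F\<^esub> inv\<^bsub>F\<^esub> w) = 0" using that by (intro 0) simp_all
    then show ?thesis using that hf(1,2) by simp
  qed
  define h where "h y = f (SOME v. v \<in> carrier F \<and> M v = y)" for y
  have h: "h (M v) = f v" if v: "v \<in> carrier F" for v
  proof -
    have "(SOME w. w \<in> carrier F \<and> M w = M v) \<in> carrier F \<and> M (SOME w. w \<in> carrier F \<and> M w = M v) = M v"
      by (rule someI[of _ v]) (simp add: v)
    then show ?thesis unfolding h_def using eq[OF _ v] by blast
  qed
  have "h \<in> hom E integer_group"
  proof (rule int_homI)
    fix x y assume "x \<in> carrier E" "y \<in> carrier E"
    then obtain v w where v: "v \<in> carrier F" "x = M v" and w: "w \<in> carrier F" "y = M w"
      unfolding surj[symmetric] by blast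
    have "h (M (v \<otimes>\<^bsub>F\<^esub> w)) = f (v \<otimes>\<^bsub>F\<^esub> w)" by (rule h) (simp add: v(1) w(1))
    then have "h (M (v \<otimes>\<^bsub>F\<^esub> w)) = h (M v) + h (M w)" using h v(1) w(1) hf(1)[OF v(1) w(1)] by simp
    then show "h (x \<otimes>\<^bsub>E\<^esub> y) = h x + h y" using v w by simp
  qed
  then show ?thesis using h by (intro bexI[of _ h]) simp_all
qed

text \<open>
  The kernel of \<open>M\<close> is the common kernel of its components, so \<open>f\<close> is a
  rational combination of these. Hence the elements of \<open>D\<close> that vanish on the kernel
  of \<open>M\<close> have finite order.
\<close>

lemma multiple_through_M:
  assumes f: "f \<in> hom F integer_group"
    and 0: "\<And>v. v \<in> carrier F \<Longrightarrow> M v = \<one>\<^bsub>E\<^esub> \<Longrightarrow> f v = 0"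
  shows "\<exists>j>0. \<exists>h\<in>hom E integer_group. \<forall>v\<in>carrier F. int j * f v = h (M v)"
proof -
  have \<mu>: "(\<lambda>v. M v i) \<in> hom F integer_group" if "i < m" for i
  proof (rule int_homI)
    fix x y assume "x \<in> carrier F" "y \<in> carrier F"
    then have "M (x \<otimes>\<^bsub>F\<^esub> y) i = (M x \<otimes>\<^bsub>E\<^esub> M y) i" by simp
    then show "M (x \<otimes>\<^bsub>F\<^esub> y) i = M x i + M y i" using that int_power_mult[where x = "M x" and y = "M y" and n = m] by simp
  qed
  have "f v = 0" if v: "v \<in> carrier F" "\<forall>i<m. M v i = 0" for v
  proof (rule 0[OF v(1)])
    show "M v = \<one>\<^bsub>E\<^esub>"
      by (rule extensionalityI[of _ "{..<m}"])
        (use M.hom_closed[OF v(1)] v(2) in \<open>auto simp: int_power_one int_power_carrier PiE_def\<close>)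
  qed
  then obtain j c where j: "j \<noteq> 0" and c: "\<And>v. v \<in> carrier F \<Longrightarrow> j * f v = (\<Sum>i<m. c i * M v i)"
    using rational_combination[OF F.comm_group_axioms f F.subgroup_self, of m "\<lambda>i v. M v i"] \<mu> by blast
  have h: "(\<lambda>y. \<Sum>i<m. (sgn j * c i) * y i) \<in> hom E integer_group"
    by (rule int_homI) (simp add: int_power_mult distrib_left sum.distrib)
  have "int (nat \<bar>j\<bar>) * f v = (\<Sum>i<m. (sgn j * c i) * M v i)" if "v \<in> carrier F" for v
  proof -
    have "int (nat \<bar>j\<bar>) * f v = sgn j * (j * f v)"
      using abs_sgn[of j] by (simp add: mult.assoc[symmetric] mult.commute[of "sgn j" j])
    also have "\<dots> = (\<Sum>i<m. (sgn j * c i) * M v i)" unfolding c[OF that] by (simp add: sum_distrib_left mult.assoc)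
    finally show ?thesis .
  qed
  then show ?thesis using j h by (intro exI[of _ "nat \<bar>j\<bar>"] conjI bexI[OF _ h]) simp_all
qed

end

lemma openin_finite_conj:
  fixes k :: nat
  assumes "\<And>i. i < k \<Longrightarrow> openin T {g \<in> topspace T. P i g}"
  shows "openin T {g \<in> topspace T. \<forall>i<k. P i g}"
  using assms
proof (induction k)
  case (Suc k)
  have "{g \<in> topspace T. \<forall>i<Suc k. P i g} = {g \<in> topspace T. \<forall>i<k. P i g} \<inter> {g \<in> topspace T. P k g}"
    by (auto simp: less_Suc_eq)
  then show ?case using Suc by (metis (no_types, lifting) less_SucI lessI openin_Int)
qed simp

text \<open>
  The maps \<open>a\<close> and \<open>a'\<close> are projections onto the kernels of
  \<open>M'\<close> and \<open>M\<close>, followed by mutually inverse isomorphisms between these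
  kernels.
\<close>

locale dual_cokernel_pair = N: dual_cokernel k m M + N': dual_cokernel k' m' M'
  for k m M k' m' M' +
  fixes a a' :: "(nat \<Rightarrow> int) \<Rightarrow> nat \<Rightarrow> int"
  assumes a: "a \<in> hom N'.F N.F" and a': "a' \<in> hom N.F N'.F"
    and Ma: "\<And>v. v \<in> carrier N'.F \<Longrightarrow> M (a v) = \<one>\<^bsub>N.E\<^esub>"
    and Ma': "\<And>v. v \<in> carrier N.F \<Longrightarrow> M' (a' v) = \<one>\<^bsub>N'.E\<^esub>"
    and aa': "\<And>v. v \<in> carrier N.F \<Longrightarrow> M v = \<one>\<^bsub>N.E\<^esub> \<Longrightarrow> a (a' v) = v"
    and a'a: "\<And>v. v \<in> carrier N'.F \<Longrightarrow> M' v = \<one>\<^bsub>N'.E\<^esub> \<Longrightarrow> a' (a v) = v"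
    and surj: "M' ` carrier N'.F = carrier N'.E"
begin

lemma a_closed [simp]: "v \<in> carrier N'.F \<Longrightarrow> a v \<in> carrier N.F" "w \<in> carrier N.F \<Longrightarrow> a' w \<in> carrier N'.F"
  using a a' by (auto simp: hom_def)

text \<open>
  Since \<open>M'\<close> is onto, the class of a functional is determined by its restriction to
  the kernel.
\<close>

lemma cls'_eqI:
  assumes f: "f \<in> carrier (dual_group N'.F)" "g \<in> carrier (dual_group N'.F)"
    and eq: "\<And>v. v \<in> carrier N'.F \<Longrightarrow> M' v = \<one>\<^bsub>N'.E\<^esub> \<Longrightarrow> f v = g v"
  shows "N'.cls f = N'.cls g"
proof -
  have h: "(\<lambda>v. f v - g v) \<in> hom N'.F integer_group"
    using hom_int(1)[OF _ N'.F.is_group, of f] hom_int(1)[OF _ N'.F.is_group, of g] f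
    by (intro int_homI) (simp add: hom_group_simps(1))
  obtain h where h: "h \<in> hom N'.E integer_group" "\<And>v. v \<in> carrier N'.F \<Longrightarrow> f v - g v = h (M' v)"
    using N'.factor_through_M[OF surj h] eq by auto
  show ?thesis by (rule N'.cls_eqI[OF f h(1)]) (use h(2) in \<open>simp add: algebra_simps\<close>)
qed

lemma dual_a: "hom_map N'.F a \<in> hom (dual_group N.F) (dual_group N'.F)"
  by (rule hom_map_hom[OF N'.F.is_group N.F.is_group a])

lemma dual_a': "hom_map N.F a' \<in> hom (dual_group N'.F) (dual_group N.F)"
  by (rule hom_map_hom[OF N.F.is_group N'.F.is_group a'])

lemma dual_a_closed [simp]:
  "f \<in> carrier (dual_group N.F) \<Longrightarrow> hom_map N'.F a f \<in> carrier (dual_group N'.F)"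
  "f' \<in> carrier (dual_group N'.F) \<Longrightarrow> hom_map N.F a' f' \<in> carrier (dual_group N.F)"
  using dual_a dual_a' by (auto simp: hom_def)

lemma theta_exists:
  "\<exists>\<theta>\<in>hom N.D N'.D. \<forall>f\<in>carrier (dual_group N.F). \<theta> (N.cls f) = N'.cls (hom_map N'.F a f)"
proof (rule N.hom_on_D[OF N'.D.is_group])
  show "(\<lambda>f. N'.cls (hom_map N'.F a f)) \<in> hom (dual_group N.F) N'.D"
    using hom_compose[OF dual_a N'.cls_hom] by (simp add: comp_def)
  fix h assume h: "h \<in> carrier (dual_group N.E)"
  then have h1: "h \<one>\<^bsub>N.E\<^esub> = 0" using hom_int(3)[OF _ N.E.is_group] by (simp add: hom_group_simps)
  have "hom_map N'.F a (hom_map N.F M h) = \<one>\<^bsub>dual_group N'.F\<^esub>"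
    unfolding hom_map_def hom_group_simps by (rule restrict_ext) (simp add: Ma h1)
  then show "N'.cls (hom_map N'.F a (hom_map N.F M h)) = \<one>\<^bsub>N'.D\<^esub>" by simp
qed

lemma section_exists:
  "\<exists>s\<in>hom N'.D N.D. \<forall>f\<in>carrier (dual_group N'.F). s (N'.cls f) = N.cls (hom_map N.F a' f)"
proof (rule N'.hom_on_D[OF N.D.is_group])
  show "(\<lambda>f. N.cls (hom_map N.F a' f)) \<in> hom (dual_group N'.F) N.D"
    using hom_compose[OF dual_a' N.cls_hom] by (simp add: comp_def)
  fix h assume h: "h \<in> carrier (dual_group N'.E)"
  then have h1: "h \<one>\<^bsub>N'.E\<^esub> = 0" using hom_int(3)[OF _ N'.E.is_group] by (simp add: hom_group_simps)
  have "hom_map N.F a' (hom_map N'.F M' h) = \<one>\<^bsub>dual_group N.F\<^esub>"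
    unfolding hom_map_def hom_group_simps by (rule restrict_ext) (simp add: Ma' h1)
  then show "N.cls (hom_map N.F a' (hom_map N'.F M' h)) = \<one>\<^bsub>N.D\<^esub>" by simp
qed

definition \<theta> where "\<theta> = (SOME \<theta>. \<theta> \<in> hom N.D N'.D \<and>
  (\<forall>f\<in>carrier (dual_group N.F). \<theta> (N.cls f) = N'.cls (hom_map N'.F a f)))"

definition s where "s = (SOME s. s \<in> hom N'.D N.D \<and>
  (\<forall>f\<in>carrier (dual_group N'.F). s (N'.cls f) = N.cls (hom_map N.F a' f)))"

lemma \<theta>: "\<theta> \<in> hom N.D N'.D" "f \<in> carrier (dual_group N.F) \<Longrightarrow> \<theta> (N.cls f) = N'.cls (hom_map N'.F a f)"
  using someI_ex[OF theta_exists[unfolded Bex_def]] unfolding \<theta>_def by blast+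

lemma s: "s \<in> hom N'.D N.D" "f \<in> carrier (dual_group N'.F) \<Longrightarrow> s (N'.cls f) = N.cls (hom_map N.F a' f)"
  using someI_ex[OF section_exists[unfolded Bex_def]] unfolding s_def by blast+

text \<open>
  The functionals \<open>f\<close> and \<open>f \<circ> a' \<circ> a\<close> agree on the kernel
  of \<open>M'\<close>.
\<close>

lemma \<theta>_s:
  assumes "x \<in> carrier N'.D" shows "\<theta> (s x) = x"
proof -
  obtain f where f: "f \<in> carrier (dual_group N'.F)" "x = N'.cls f" using assms by (auto simp: N'.carrier_D)
  have "\<theta> (s x) = N'.cls (hom_map N'.F a (hom_map N.F a' f))" using f by (simp add: s(2) \<theta>(2))
  also have "\<dots> = N'.cls f"
  proof (rule cls'_eqI)
    show "hom_map N'.F a (hom_map N.F a' f) \<in> carrier (dual_group N'.F)" using f(1) by simp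
  qed (use f(1) in \<open>simp_all add: hom_map_def a'a\<close>)
  finally show ?thesis using f by simp
qed

lemma \<theta>_s_closed [simp]: "x \<in> carrier N.D \<Longrightarrow> \<theta> x \<in> carrier N'.D" "y \<in> carrier N'.D \<Longrightarrow> s y \<in> carrier N.D"
  using \<theta>(1) s(1) by (auto simp: hom_def)

definition \<iota> where "\<iota> = hom_map N.D \<theta>"

definition p where "p = hom_map N'.D s"

lemma \<iota>_hom: "\<iota> \<in> hom (char_group N'.D) (char_group N.D)"
  unfolding \<iota>_def by (rule hom_map_hom[OF N.D.is_group N'.D.is_group \<theta>(1)])

lemma p_hom: "p \<in> hom (char_group N.D) (char_group N'.D)"
  unfolding p_def by (rule hom_map_hom[OF N'.D.is_group N.D.is_group s(1)])

lemma \<iota>_continuous: "continuous_map (char_topology N'.D) (char_topology N.D) \<iota>"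
  unfolding \<iota>_def by (rule hom_map_continuous[OF N.D.is_group N'.D.is_group \<theta>(1)])

lemma p_continuous: "continuous_map (char_topology N.D) (char_topology N'.D) p"
  unfolding p_def by (rule hom_map_continuous[OF N'.D.is_group N.D.is_group s(1)])

lemma p_\<iota>: "g \<in> carrier (char_group N'.D) \<Longrightarrow> p (\<iota> g) = g"
  unfolding p_def \<iota>_def hom_map_def
  by (rule extensionalityI[of _ "carrier N'.D"]) (auto simp: \<theta>_s hom_group_simps)

text \<open>
  The component of a character \<open>g\<close> in the complement of \<open>\<iota>\<close>,
  evaluated at a coordinate class, is the value of \<open>g\<close> at the class of a functional
  \<open>f - f \<circ> a \<circ> a'\<close>, which vanishes on the kernel of \<open>M\<close> and
  so has finite order.
\<close>

lemma complement_coordinate: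
  assumes "i < k"
  shows "\<exists>y\<in>carrier N.D. \<exists>j>0. \<forall>g\<in>carrier (char_group N.D).
    g (N.cls (N.coord i)) * inverse (g (s (\<theta> (N.cls (N.coord i))))) = g y \<and> g y ^ j = 1"
proof -
  let ?c = "N.coord i"
  let ?c' = "hom_map N.F a' (hom_map N'.F a ?c)"
  have c: "?c \<in> carrier (dual_group N.F)" by (rule N.coord_closed[OF assms])
  then have c': "?c' \<in> carrier (dual_group N.F)" by simp
  let ?y = "?c \<otimes>\<^bsub>dual_group N.F\<^esub> inv\<^bsub>dual_group N.F\<^esub> ?c'"
  have y: "?y \<in> carrier (dual_group N.F)" using c c' by simp
  have yv: "?y v = ?c v - ?c (a (a' v))" if "v \<in> carrier N.F" for v
    using that c' by (simp add: N.dual_simps N.dual_inv hom_map_def)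
  have "?y \<in> hom N.F integer_group" using y by (simp add: N.dual_simps)
  then obtain j h where j: "j > 0" and h: "h \<in> hom N.E integer_group"
      and eq: "\<And>v. v \<in> carrier N.F \<Longrightarrow> int j * ?y v = h (M v)"
    using N.multiple_through_M[of ?y] yv aa' by auto
  have "g (N.cls ?c) * inverse (g (s (\<theta> (N.cls ?c)))) = g (N.cls ?y) \<and> g (N.cls ?y) ^ j = 1"
    if g: "g \<in> carrier (char_group N.D)" for g
  proof
    have "(\<lambda>v\<in>carrier N.F. ?y v + ?c' v) = ?c"
      by (rule extensionalityI[of _ "carrier N.F"]) (use c yv in \<open>auto simp: N.dual_simps hom_map_def\<close>)
    then have "g (N.cls ?c) = g (N.cls ?y) * g (N.cls ?c')" using N.char_cls_mult[OF g y c'] by simp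
    moreover have "g (N.cls ?c') \<noteq> 0" by (rule char_nonzero[OF g]) (simp add: c')
    ultimately show "g (N.cls ?c) * inverse (g (s (\<theta> (N.cls ?c)))) = g (N.cls ?y)"
      using c by (simp add: \<theta>(2) s(2) field_simps)
    let ?z = "\<lambda>v\<in>carrier N.F. int j * ?y v"
    have z: "?z \<in> carrier (dual_group N.F)" "g (N.cls ?z) = g (N.cls ?y) ^ j"
      using N.char_cls_multiple[OF g y, of j] by blast+
    have "N.cls ?z = N.cls \<one>\<^bsub>dual_group N.F\<^esub>"
      by (rule N.cls_eqI[OF z(1) N.dF.one_closed h]) (simp add: eq hom_group_simps(3)[of N.F])
    moreover have "g \<one>\<^bsub>N.D\<^esub> = 1"
      using hom_one[of g N.D complex_units] g complex_units_group N.D.is_group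
      by (simp add: hom_group_simps complex_units_simps comm_group.axioms)
    ultimately show "g (N.cls ?y) ^ j = 1" using z(2) by simp
  qed
  then show ?thesis using y j by (intro bexI[of _ "N.cls ?y"] exI[of _ j]) simp_all
qed

text \<open>
  By \<open>complement_coordinate\<close> the component is determined by finitely many values of
  \<open>g\<close>, each of them a root of unity of bounded order. Such values are isolated.
\<close>

lemma fibres_open:
  "openin (char_topology N.D) {g \<in> carrier (char_group N.D).
    g \<otimes>\<^bsub>char_group N.D\<^esub> inv\<^bsub>char_group N.D\<^esub> (\<iota> (p g)) = b}"
proof (cases "\<exists>g0\<in>carrier (char_group N.D). g0 \<otimes>\<^bsub>char_group N.D\<^esub> inv\<^bsub>char_group N.D\<^esub> (\<iota> (p g0)) = b")
  case False
  then have "{g \<in> carrier (char_group N.D). g \<otimes>\<^bsub>char_group N.D\<^esub> inv\<^bsub>char_group N.D\<^esub> (\<iota> (p g)) = b} = {}"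
    by blast
  then show ?thesis by (simp only: openin_empty)
next
  case True
  interpret G: comm_group "char_group N.D"
    by (rule hom_group_comm_group[OF N.D.is_group complex_units_group])
  let ?\<pi> = "\<lambda>g. g \<otimes>\<^bsub>char_group N.D\<^esub> inv\<^bsub>char_group N.D\<^esub> (\<iota> (p g))"
  obtain g0 where g0: "g0 \<in> carrier (char_group N.D)" "?\<pi> g0 = b" using True by blast
  have ip: "\<iota> (p g) \<in> carrier (char_group N.D)" if "g \<in> carrier (char_group N.D)" for g
    using \<iota>_hom p_hom that by (auto simp: hom_def)
  have val: "?\<pi> g x = g x * inverse (g (s (\<theta> x)))" if g: "g \<in> carrier (char_group N.D)" and x: "x \<in> carrier N.D" for g x
  proof -
    have "\<iota> (p g) x = g (s (\<theta> x))" using x by (simp add: \<iota>_def p_def hom_map_def)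
    moreover have "g (s (\<theta> x)) \<noteq> 0" using char_nonzero[OF g] x by simp
    ultimately show ?thesis
      using hom_group_inv[OF N.D.is_group complex_units_group ip[OF g]] x
      by (simp add: hom_group_simps complex_units_simps complex_units_inv)
  qed
  have "\<exists>y j. \<forall>i<k. y i \<in> carrier N.D \<and> j i > 0 \<and> (\<forall>g\<in>carrier (char_group N.D).
    g (N.cls (N.coord i)) * inverse (g (s (\<theta> (N.cls (N.coord i))))) = g (y i) \<and> g (y i) ^ (j i) = 1)"
    using complement_coordinate by metis
  then obtain y and j :: "nat \<Rightarrow> nat" where y: "\<And>i. i < k \<Longrightarrow> y i \<in> carrier N.D" and j: "\<And>i. i < k \<Longrightarrow> j i > 0"
    and gy: "\<And>i g. i < k \<Longrightarrow> g \<in> carrier (char_group N.D) \<Longrightarrow>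
      g (N.cls (N.coord i)) * inverse (g (s (\<theta> (N.cls (N.coord i))))) = g (y i)"
    and root: "\<And>i g. i < k \<Longrightarrow> g \<in> carrier (char_group N.D) \<Longrightarrow> g (y i) ^ (j i) = 1" by blast
  have coords: "?\<pi> g (N.cls (N.coord i)) = g (y i)" if "i < k" "g \<in> carrier (char_group N.D)" for i g
    using val[OF that(2)] gy[OF that] N.coord_closed[OF that(1)] by simp
  have iff: "?\<pi> g = b \<longleftrightarrow> (\<forall>i<k. g (y i) = g0 (y i))" if g: "g \<in> carrier (char_group N.D)" for g
  proof
    assume "?\<pi> g = b"
    then show "\<forall>i<k. g (y i) = g0 (y i)" using coords g g0 by metis
  next
    assume eq: "\<forall>i<k. g (y i) = g0 (y i)"
    have "?\<pi> g = ?\<pi> g0"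
    proof (rule N.char_eqI)
      show "?\<pi> g \<in> carrier (char_group N.D)" "?\<pi> g0 \<in> carrier (char_group N.D)"
        using g g0(1) ip by (blast intro: G.m_closed G.inv_closed)+
      show "?\<pi> g (N.cls (N.coord i)) = ?\<pi> g0 (N.cls (N.coord i))" if "i < k" for i
        using coords[OF that g] coords[OF that g0(1)] eq that by metis
    qed
    then show "?\<pi> g = b" using g0 by simp
  qed
  have set_eq: "{g \<in> carrier (char_group N.D). ?\<pi> g = b}
    = {g \<in> topspace (char_topology N.D). \<forall>i<k. g (y i) = g0 (y i)}"
    using iff by (auto simp: topspace_char_topology)
  show ?thesis unfolding set_eq
  proof (rule openin_finite_conj)
    fix i assume i: "i < k"
    \<comment> \<open>the roots of unity to be kept away from\<close>
    define R where "R = {w :: complex. w ^ (j i) = 1} - {g0 (y i)}"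
    have "finite R" unfolding R_def using finite_roots_unity[of "j i"] j[OF i] by simp
    then have "open (- R)" by (simp add: finite_imp_closed open_Compl)
    then have "openin (char_topology N.D) {g \<in> topspace (char_topology N.D). g (y i) \<in> - R}"
      by (intro openin_continuous_map_preimage[OF continuous_map_eval[OF y[OF i]]]) simp
    moreover have "{g \<in> topspace (char_topology N.D). g (y i) \<in> - R}
      = {g \<in> topspace (char_topology N.D). g (y i) = g0 (y i)}"
      using root[OF i] by (auto simp: R_def topspace_char_topology)
    ultimately show "openin (char_topology N.D) {g \<in> topspace (char_topology N.D). g (y i) = g0 (y i)}"
      by simp
  qed
qed

text \<open>
  As \<open>D'\<close> is the dual of a free group, a character can be divided continuously:
  choose logarithms \<open>w\<^sub>i\<close> of its values at the coordinates and multiply them by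
  \<open>t\<close>. Composing functionals with the projection \<open>a' \<circ> a\<close> onto the
  kernel makes this well defined on classes.
\<close>

lemma char_path:
  assumes g: "g \<in> carrier (char_group N'.D)"
  shows "\<exists>c. continuous_map (top_of_set {0..1::real}) (char_topology N'.D) c \<and>
    c 0 = \<one>\<^bsub>char_group N'.D\<^esub> \<and> c 1 = g"
proof -
  have "\<exists>w. \<forall>i<k'. exp (w i) = g (N'.cls (N'.coord i))"
  proof -
    have "\<exists>w. exp w = g (N'.cls (N'.coord i))" if "i < k'" for i
      using exp_Ln[OF char_nonzero[OF g N'.cls_closed[OF N'.coord_closed[OF that]]]] by blast
    then show ?thesis by metis
  qed
  \<comment> \<open>logarithms of the values at the coordinate classes\<close>
  then obtain w where w: "\<And>i. i < k' \<Longrightarrow> exp (w i) = g (N'.cls (N'.coord i))" by blast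
  define e where "e v = a' (a v)" for v
  have e: "e \<in> hom N'.F N'.F" unfolding e_def using hom_compose[OF a a'] by (simp add: comp_def)
  have ec [simp]: "e v \<in> carrier N'.F" if "v \<in> carrier N'.F" for v unfolding e_def using that by simp
  define \<psi> where "\<psi> t f = exp (of_real t * (\<Sum>i<k'. of_int (f (e (std_basis k' i))) * w i))" for t :: real and f
  have "\<exists>h\<in>hom N'.D complex_units. \<forall>f\<in>carrier (dual_group N'.F). h (N'.cls f) = \<psi> t f" for t
  proof (rule N'.hom_on_D[OF comm_group.axioms(2)[OF complex_units_group]])
    show "\<psi> t \<in> hom (dual_group N'.F) complex_units"
    proof (rule homI)
      fix f f' :: "(nat \<Rightarrow> int) \<Rightarrow> int"
      show "\<psi> t f \<in> carrier complex_units" by (simp add: \<psi>_def complex_units_simps)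
      show "\<psi> t (f \<otimes>\<^bsub>dual_group N'.F\<^esub> f') = \<psi> t f \<otimes>\<^bsub>complex_units\<^esub> \<psi> t f'"
        by (simp add: \<psi>_def complex_units_simps N'.dual_simps exp_add[symmetric] algebra_simps sum.distrib)
    qed
    fix h assume h: "h \<in> carrier (dual_group N'.E)"
    then have h1: "h \<one>\<^bsub>N'.E\<^esub> = 0" using hom_int(3)[OF _ N'.E.is_group] by (simp add: hom_group_simps)
    have "hom_map N'.F M' h (e (std_basis k' i)) = 0" for i
      using Ma'[of "a (std_basis k' i)"] h1 by (simp add: hom_map_def e_def)
    then show "\<psi> t (hom_map N'.F M' h) = \<one>\<^bsub>complex_units\<^esub>" by (simp add: \<psi>_def complex_units_simps)
  qed
  then obtain \<gamma>' where \<gamma>': "\<And>t. \<gamma>' t \<in> hom N'.D complex_units"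
    "\<And>t f. f \<in> carrier (dual_group N'.F) \<Longrightarrow> \<gamma>' t (N'.cls f) = \<psi> t f" by metis
  define \<gamma> where "\<gamma> t = restrict (\<gamma>' t) (carrier N'.D)" for t
  have \<gamma>: "\<gamma> t \<in> carrier (char_group N'.D)" for t
    unfolding \<gamma>_def using hom_restrict[OF N'.D.is_group \<gamma>'(1)] by (simp add: hom_group_simps)
  have \<gamma>v: "\<gamma> t (N'.cls f) = \<psi> t f" if "f \<in> carrier (dual_group N'.F)" for t f
    unfolding \<gamma>_def using \<gamma>'(2)[OF that] that by simp
  have "continuous_map (top_of_set {0..1}) (char_topology N'.D) \<gamma>"
  proof (rule continuous_map_into_char_topology)
    fix x assume "x \<in> carrier N'.D"
    then obtain f where f: "f \<in> carrier (dual_group N'.F)" "x = N'.cls f" by (auto simp: N'.carrier_D)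
    have "continuous_on {0..1} (\<lambda>t. \<psi> t f)" unfolding \<psi>_def by (intro continuous_intros)
    then show "continuous_map (top_of_set {0..1}) euclidean (\<lambda>t. \<gamma> t x)" using f by (simp add: \<gamma>v)
  qed (rule \<gamma>)
  moreover have "\<gamma> 0 = \<one>\<^bsub>char_group N'.D\<^esub>"
  proof (rule extensionalityI[of _ "carrier N'.D"])
    fix x assume "x \<in> carrier N'.D"
    then obtain f where f: "f \<in> carrier (dual_group N'.F)" "x = N'.cls f" by (auto simp: N'.carrier_D)
    then show "\<gamma> 0 x = \<one>\<^bsub>char_group N'.D\<^esub> x" by (simp add: \<gamma>v \<psi>_def hom_group_simps complex_units_simps)
  qed (simp_all add: \<gamma>_def hom_group_simps)
  moreover have "\<gamma> 1 = g"
  proof (rule extensionalityI[of _ "carrier N'.D"])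
    fix x assume "x \<in> carrier N'.D"
    then obtain f where f: "f \<in> carrier (dual_group N'.F)" "x = N'.cls f" by (auto simp: N'.carrier_D)
    let ?f = "hom_map N'.F e f"
    let ?c = "\<lambda>i\<in>{..<k'}. ?f (std_basis k' i)"
    have fe: "?f \<in> carrier (dual_group N'.F)"
      using hom_map_hom[OF N'.F.is_group N'.F.is_group e] f(1) by (auto simp: hom_def)
    have C: "group complex_units" using complex_units_group by (simp add: comm_group.axioms)
    have h: "(\<lambda>c. N'.cls (N'.lin c)) \<in> hom N'.F N'.D"
      using hom_compose[OF N'.lin_hom N'.cls_hom] by (simp add: comp_def)
    have gl: "(\<lambda>c. g (N'.cls (N'.lin c))) \<in> hom N'.F complex_units"
      using hom_compose[OF h, of g complex_units] g by (simp add: comp_def hom_group_simps)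
    have el: "(\<lambda>c. exp (\<Sum>i<k'. of_int (c i) * w i)) \<in> hom N'.F complex_units"
      by (rule homI) (simp_all add: complex_units_simps int_power_mult exp_add[symmetric] algebra_simps sum.distrib)
    have "exp (\<Sum>i<k'. of_int (?c i) * w i) = g (N'.cls (N'.lin ?c))"
    proof (rule int_power_hom_eq[OF C el gl])
      fix i assume i: "i < k'"
      have "(\<Sum>j<k'. of_int (std_basis k' i j) * w j) = (\<Sum>j<k'. if j = i then w j else 0)"
        by (rule sum.cong) (auto simp: std_basis_def)
      then show "exp (\<Sum>j<k'. of_int (std_basis k' i j) * w j) = g (N'.cls (N'.lin (std_basis k' i)))"
        using i by (simp add: N'.lin_basis w)
    qed (simp only: int_power_carrier restrict_PiE_iff UNIV_I ball_triv simp_thms)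
    also have "N'.lin ?c = ?f" using N'.dual_eq_lin[OF fe] by simp
    also have "N'.cls ?f = N'.cls f"
      by (rule cls'_eqI[OF fe f(1)]) (simp add: hom_map_def e_def a'a)
    finally have "g x = exp (\<Sum>i<k'. of_int (f (e (std_basis k' i))) * w i)"
      by (simp add: f(2) hom_map_def)
    then show "\<gamma> 1 x = g x" using f by (simp add: \<gamma>v \<psi>_def)
  qed (use g in \<open>simp_all add: \<gamma>_def hom_group_simps\<close>)
  ultimately show ?thesis by blast
qed

end

section \<open>Resolutions and the kernel of \<open>\<beta>\<close>\<close>

locale lifted_resolution =
  fixes N :: "'a monoid" and \<beta> :: "(nat \<Rightarrow> int) \<Rightarrow> 'a" and n r m :: nat
    and B Q :: "(nat \<Rightarrow> int) \<Rightarrow> nat \<Rightarrow> int" and q :: "(nat \<Rightarrow> int) \<Rightarrow> 'a"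
  assumes N: "comm_group N" and \<beta>: "\<beta> \<in> hom (int_power n) N"
    and Q: "Q \<in> hom (int_power r) (int_power m)" and Q_inj: "inj_on Q (carrier (int_power r))"
    and q: "q \<in> hom (int_power m) N" and q_onto: "q ` carrier (int_power m) = carrier N"
    and exact: "Q ` carrier (int_power r) = kernel (int_power m) N q"
    and B: "B \<in> hom (int_power n) (int_power m)"
    and lift: "\<And>x. x \<in> carrier (int_power n) \<Longrightarrow> q (B x) = \<beta> x"
begin

abbreviation M where "M \<equiv> block_map n r m B Q"

definition head :: "(nat \<Rightarrow> int) \<Rightarrow> nat \<Rightarrow> int" where "head v = restrict v {..<n}"

definition tail :: "(nat \<Rightarrow> int) \<Rightarrow> nat \<Rightarrow> int" where "tail v = (\<lambda>i\<in>{..<r}. v (n + i))"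

definition join :: "(nat \<Rightarrow> int) \<Rightarrow> (nat \<Rightarrow> int) \<Rightarrow> nat \<Rightarrow> int"
  where "join x y = (\<lambda>i\<in>{..<n + r}. if i < n then x i else y (i - n))"

lemma M_eq: "M v = B (head v) \<otimes>\<^bsub>int_power m\<^esub> Q (tail v)"
  by (simp add: block_map_def head_def tail_def)

lemma head_closed [simp]: "head v \<in> carrier (int_power n)"
  and tail_closed [simp]: "tail v \<in> carrier (int_power r)"
  and join_closed [simp]: "join x y \<in> carrier (int_power (n + r))"
  by (simp_all only: head_def tail_def join_def int_power_carrier restrict_PiE_iff UNIV_I ball_triv simp_thms)

lemma head_join: "x \<in> carrier (int_power n) \<Longrightarrow> head (join x y) = x"
  by (rule extensionalityI[of _ "{..<n}"]) (auto simp: head_def join_def int_power_carrier PiE_def)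

lemma tail_join: "y \<in> carrier (int_power r) \<Longrightarrow> tail (join x y) = y"
  by (rule extensionalityI[of _ "{..<r}"]) (auto simp: tail_def join_def int_power_carrier PiE_def)

lemma head_tail_eqI:
  assumes "v \<in> carrier (int_power (n + r))" "w \<in> carrier (int_power (n + r))" "head v = head w" "tail v = tail w"
  shows "v = w"
proof (rule extensionalityI[of _ "{..<n + r}"])
  fix i assume "i \<in> {..<n + r}"
  then consider "i < n" | j where "j < r" "i = n + j" by (metis lessThan_iff less_diff_conv2 linorder_not_le le_add_diff_inverse nat_add_left_cancel_less)
  then show "v i = w i"
  proof cases
    case 1
    then have "v i = head v i" "w i = head w i" by (simp_all add: head_def)
    then show ?thesis using assms(3) by simp
  next
    case 2
    then have "v i = tail v j" "w i = tail w j" by (simp_all add: tail_def)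
    then show ?thesis using assms(4) by simp
  qed
qed (use assms in \<open>auto simp: int_power_carrier PiE_def\<close>)

lemma head_hom: "head \<in> hom (int_power (n + r)) (int_power n)"
  by (rule homI) (simp, auto simp: head_def int_power_mult)

lemma tail_hom: "tail \<in> hom (int_power (n + r)) (int_power r)"
  by (rule homI) (simp, auto simp: tail_def int_power_mult)

lemma block_map_hom: "M \<in> hom (int_power (n + r)) (int_power m)"
proof -
  interpret E: comm_group "int_power m" by (rule int_power_group)
  have 1: "(\<lambda>v. B (head v)) \<in> hom (int_power (n + r)) (int_power m)"
    and 2: "(\<lambda>v. Q (tail v)) \<in> hom (int_power (n + r)) (int_power m)"
    using hom_compose[OF head_hom B] hom_compose[OF tail_hom Q] by (simp_all add: comp_def)
  show ?thesis
  proof (rule homI)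
    fix v w assume v: "v \<in> carrier (int_power (n + r))" and w: "w \<in> carrier (int_power (n + r))"
    have c: "B (head u) \<in> carrier (int_power m)" "Q (tail u) \<in> carrier (int_power m)" for u
      using hom_in_carrier[OF B head_closed] hom_in_carrier[OF Q tail_closed] by auto
    show "M v \<in> carrier (int_power m)" unfolding M_eq using c by (rule E.m_closed)
    show "M (v \<otimes>\<^bsub>int_power (n + r)\<^esub> w) = M v \<otimes>\<^bsub>int_power m\<^esub> M w"
      unfolding M_eq hom_mult[OF 1 v w] hom_mult[OF 2 v w] using c by (simp add: E.m_ac)
  qed
qed

sublocale dual_cokernel "n + r" m M
  by unfold_locales (rule block_map_hom)

lemma q_Q: "y \<in> carrier (int_power r) \<Longrightarrow> q (Q y) = \<one>\<^bsub>N\<^esub>"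
  using exact by (auto simp: kernel_def)

lemma q_M: assumes "v \<in> carrier F" shows "q (M v) = \<beta> (head v)"
proof -
  interpret N: comm_group N by (rule N)
  have "q (M v) = q (B (head v)) \<otimes>\<^bsub>N\<^esub> q (Q (tail v))"
    unfolding M_eq using hom_mult[OF q] hom_in_carrier[OF B head_closed] hom_in_carrier[OF Q tail_closed] by blast
  then show ?thesis using q_Q[OF tail_closed] lift[OF head_closed] hom_in_carrier[OF \<beta> head_closed] by simp
qed

lemma beta_head: 
  assumes "v \<in> carrier F" "M v = \<one>\<^bsub>E\<^esub>" shows "\<beta> (head v) = \<one>\<^bsub>N\<^esub>"
  using q_M[OF assms(1)] assms(2) hom_one[OF q E.is_group comm_group.axioms(2)[OF N]] by simp

text \<open>
  A vector is determined by its image under \<open>M\<close> and its first \<open>n\<close>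
  coordinates, as \<open>Q\<close> is injective.
\<close>

lemma kernel_eqI:
  assumes v: "v \<in> carrier F" "w \<in> carrier F" "M v = M w" "head v = head w"
  shows "v = w"
proof (rule head_tail_eqI[OF v(1,2,4)])
  have "Q (tail v) = Q (tail w)"
    using v(3,4) hom_in_carrier[OF B head_closed] hom_in_carrier[OF Q tail_closed] unfolding M_eq by simp
  then show "tail v = tail w" using inj_onD[OF Q_inj] by simp
qed

text \<open>
  \<open>y - B x\<close> lies in the kernel of \<open>q\<close>, hence in the image of
  \<open>Q\<close>.
\<close>

lemma M_preimage:
  assumes y: "y \<in> carrier E" and x: "x \<in> carrier (int_power n)" "\<beta> x = q y"
  shows "\<exists>v\<in>carrier F. M v = y \<and> head v = x"
proof -
  interpret N: comm_group N by (rule N)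
  interpret q: group_hom E N q
    using q by (simp add: group_hom_def group_hom_axioms_def E.is_group N.is_group)
  have Bx: "B x \<in> carrier E" by (rule hom_in_carrier[OF B x(1)])
  let ?d = "y \<otimes>\<^bsub>E\<^esub> inv\<^bsub>E\<^esub> B x"
  have "?d \<in> kernel E N q"
    using y Bx lift[OF x(1)] x(2) by (simp add: kernel_def)
  then obtain z where z: "z \<in> carrier (int_power r)" "Q z = ?d" using exact by (metis imageE)
  have "M (join x z) = B x \<otimes>\<^bsub>E\<^esub> ?d" unfolding M_eq head_join[OF x(1)] tail_join[OF z(1)] z(2) ..
  also have "\<dots> = y" using y Bx E.m_lcomm[of "B x" y "inv\<^bsub>E\<^esub> B x"] by simp
  finally show ?thesis using head_join[OF x(1)] by (intro bexI[of _ "join x z"]) simp_all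
qed

lemma kernel_lift:
  assumes "x \<in> carrier (int_power n)" "\<beta> x = \<one>\<^bsub>N\<^esub>"
  shows "\<exists>v\<in>carrier F. M v = \<one>\<^bsub>E\<^esub> \<and> head v = x"
  by (rule M_preimage) (use assms hom_one[OF q E.is_group comm_group.axioms(2)[OF N]] in simp_all)

lemma M_onto:
  assumes "\<beta> ` carrier (int_power n) = carrier N"
  shows "M ` carrier F = carrier E"
proof
  show "carrier E \<subseteq> M ` carrier F"
  proof
    fix y assume y: "y \<in> carrier E"
    then have "q y \<in> \<beta> ` carrier (int_power n)" unfolding assms by (rule hom_in_carrier[OF q])
    then obtain x where "x \<in> carrier (int_power n)" "\<beta> x = q y" by force
    from M_preimage[OF y this] show "y \<in> M ` carrier F" by blast
  qed
qed auto

lemma kernel_retraction: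
  "\<exists>e\<in>hom F F. \<forall>v\<in>carrier F. M (e v) = \<one>\<^bsub>E\<^esub> \<and> (M v = \<one>\<^bsub>E\<^esub> \<longrightarrow> e v = v)"
proof -
  have \<mu>: "\<forall>i<m. (\<lambda>v. M v i) \<in> hom F integer_group"
  proof (intro allI impI int_homI)
    fix i x y assume i: "i < m" and "x \<in> carrier F" "y \<in> carrier F"
    then have "M (x \<otimes>\<^bsub>F\<^esub> y) i = (M x \<otimes>\<^bsub>E\<^esub> M y) i" by simp
    then show "M (x \<otimes>\<^bsub>F\<^esub> y) i = M x i + M y i" using i int_power_mult[where x = "M x" and y = "M y" and n = m] by simp
  qed
  obtain e where e: "e \<in> hom F F"
    and e0: "\<forall>v\<in>carrier F. (\<forall>i<m. M (e v) i = 0) \<and> ((\<forall>i<m. M v i = 0) \<longrightarrow> e v = v)"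
    using common_kernel_retraction[OF F.comm_group_axioms \<mu>] by blast
  have "M (e v) = \<one>\<^bsub>E\<^esub> \<and> (M v = \<one>\<^bsub>E\<^esub> \<longrightarrow> e v = v)" if v: "v \<in> carrier F" for v
  proof
    have ev: "e v \<in> carrier F" by (rule hom_in_carrier[OF e v])
    show "M (e v) = \<one>\<^bsub>E\<^esub>"
      by (rule extensionalityI[of _ "{..<m}"])
        (use M.hom_closed[OF ev] e0 v in \<open>auto simp: int_power_one int_power_carrier PiE_def\<close>)
    show "M v = \<one>\<^bsub>E\<^esub> \<longrightarrow> e v = v" using e0 v by (auto simp: int_power_one)
  qed
  then show ?thesis using e by blast
qed

text \<open>
  The characters of the action of \<open>G\<close> on the coordinates of
  \<open>\<complex>\<^sup>n\<close>.
\<close>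

definition weight :: "nat \<Rightarrow> ((nat \<Rightarrow> int) \<Rightarrow> int) set"
  where "weight i = beta_dual n r m B Q (\<lambda>v\<in>carrier (int_power n). v i)"

definition head_coord :: "nat \<Rightarrow> (nat \<Rightarrow> int) \<Rightarrow> int"
  where "head_coord i = hom_map F head (\<lambda>v\<in>carrier (int_power n). v i)"

lemma head_coord_eq: "i < n \<Longrightarrow> head_coord i = coord i"
  by (rule extensionalityI[of _ "carrier F"])
    (simp_all add: head_coord_def coord_def hom_map_def, simp add: head_def)

lemma DG_eq: "DG n r m B Q = D"
  by (simp add: DG_def D_def dual_image_def im_def)

lemma weight_eq: "i < n \<Longrightarrow> weight i = cls (coord i)"
  using head_coord_eq[of i]
  by (simp add: weight_def beta_dual_def dual_image_def cls_def im_def head_coord_def head_def[abs_def])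

lemma weight_closed: "i < n \<Longrightarrow> weight i \<in> carrier D"
  by (simp add: weight_eq coord_closed)

lemma toric_group_eq: "toric_group n r m B Q = char_group D"
  by (simp add: toric_group_def DG_eq)

lemma toric_group_topology_eq: "toric_group_topology n r m B Q = char_topology D"
  by (simp add: toric_group_topology_def char_topology_def DG_eq toric_group_eq)

lemma toric_action_eq: "toric_action n r m B Q g z = (\<lambda>i\<in>{..<n}. g (weight i) * z i)"
proof -
  have "(\<lambda>v\<in>carrier (int_power n). v i) \<in> carrier (dual_group (int_power n))" if "i < n" for i
  proof -
    have "(\<lambda>v. v i) \<in> hom (int_power n) integer_group"
      using that by (intro int_homI) (simp add: int_power_mult)
    from hom_restrict[OF comm_group.axioms(2)[OF int_power_group] this]
    show ?thesis by (simp add: hom_group_simps)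
  qed
  then show ?thesis by (auto simp: toric_action_def hom_map_def weight_def intro!: restrict_ext)
qed

lemma toric_action_continuous:
  assumes Z: "Z = subtopology (product_topology (\<lambda>_. euclidean) {..<n}) S"
    and scale: "\<And>z w. z \<in> topspace Z \<Longrightarrow> w \<in> {..<n} \<rightarrow>\<^sub>E UNIV \<Longrightarrow> (\<forall>i<n. w i = 0 \<longleftrightarrow> z i = 0) \<Longrightarrow> w \<in> topspace Z"
  shows "continuous_action (char_group D) (char_topology D) Z (toric_action n r m B Q)"
proof -
  let ?G = "char_group D" and ?P = "prod_topology (char_topology D) Z"
  interpret G: comm_group ?G by (rule hom_group_comm_group[OF D.is_group complex_units_group])
  have Zt: "topspace Z \<subseteq> {..<n} \<rightarrow>\<^sub>E UNIV" unfolding Z by auto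
  have act_in: "toric_action n r m B Q g z \<in> topspace Z" if "g \<in> carrier ?G" "z \<in> topspace Z" for g z
    using char_nonzero[OF that(1) weight_closed]
    by (intro scale[OF that(2)]) (simp_all only: toric_action_eq restrict_PiE_iff, auto)
  have Zs: "topspace Z \<subseteq> S" unfolding Z by auto
  have ev: "continuous_map ?P euclidean (\<lambda>x. fst x (weight i))" if "i < n" for i
    using continuous_map_compose[OF continuous_map_fst continuous_map_eval[OF weight_closed[OF that]]]
    by (simp add: comp_def)
  have zc: "continuous_map Z euclidean (\<lambda>z. z i)" if "i < n" for i
    unfolding Z using that by (intro continuous_map_from_subtopology continuous_map_product_projection) simp
  have ez: "continuous_map ?P euclidean (\<lambda>x. snd x i)" if "i < n" for i
    using continuous_map_compose[OF continuous_map_snd zc[OF that]] by (simp add: comp_def)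
  have cont: "continuous_map ?P Z (\<lambda>(g, z). toric_action n r m B Q g z)"
    unfolding Z continuous_map_in_subtopology continuous_map_componentwise
  proof (fold Z, intro conjI ballI)
    show "(\<lambda>(g, z). toric_action n r m B Q g z) \<in> topspace ?P \<rightarrow> S"
      using act_in Zs by (auto simp: topspace_char_topology)
    show "(\<lambda>(g, z). toric_action n r m B Q g z) ` topspace ?P \<subseteq> extensional {..<n}"
      by (auto simp: toric_action_eq)
    fix i assume i: "i \<in> {..<n}"
    then have "continuous_map ?P euclidean (\<lambda>x. fst x (weight i) * snd x i)"
      by (intro continuous_map_complex_mult ev ez) auto
    then show "continuous_map ?P euclidean (\<lambda>x. (case x of (g, z) \<Rightarrow> toric_action n r m B Q g z) i)"
      using i by (simp add: toric_action_eq case_prod_unfold)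
  qed
  show ?thesis unfolding continuous_action_def
  proof (intro conjI ballI cont)
    fix z assume "z \<in> topspace Z"
    then have z: "z \<in> {..<n} \<rightarrow>\<^sub>E UNIV" using Zt by blast
    show "toric_action n r m B Q \<one>\<^bsub>?G\<^esub> z = z"
      unfolding toric_action_eq
      by (rule extensionalityI[of _ "{..<n}"])
        (use z weight_closed in \<open>auto simp: hom_group_simps complex_units_simps PiE_def\<close>)
    fix g h assume "g \<in> carrier ?G" "h \<in> carrier ?G"
    show "toric_action n r m B Q (g \<otimes>\<^bsub>?G\<^esub> h) z = toric_action n r m B Q g (toric_action n r m B Q h z)"
      unfolding toric_action_eq
      by (rule restrict_ext) (use weight_closed in \<open>simp add: hom_group_simps complex_units_simps\<close>)
  qed
qed

end

text \<open>
  By \<open>kernel_lift\<close> and \<open>kernel_eqI\<close> the first \<open>n\<close>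
  coordinates identify the kernel of \<open>M\<close> with the kernel of \<open>\<beta>\<close>.
  So the kernels of \<open>M\<close> and \<open>M'\<close> are identified, and \<open>a\<close> is
  the projection to the second followed by this identification.
\<close>

lemma kernel_transfer:
  assumes L: "lifted_resolution N \<beta> n r m B Q q" and L': "lifted_resolution N' \<beta> n r' m' B' Q' q'"
    and ker: "\<And>x. x \<in> carrier (int_power n) \<Longrightarrow> \<beta> x = \<one>\<^bsub>N'\<^esub> \<Longrightarrow> \<beta> x = \<one>\<^bsub>N\<^esub>"
  shows "\<exists>a\<in>hom (int_power (n + r')) (int_power (n + r)). \<forall>v\<in>carrier (int_power (n + r')).
    block_map n r m B Q (a v) = \<one>\<^bsub>int_power m\<^esub> \<and>
    (block_map n r' m' B' Q' v = \<one>\<^bsub>int_power m'\<^esub> \<longrightarrow> restrict (a v) {..<n} = restrict v {..<n})"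
proof -
  interpret L: lifted_resolution N \<beta> n r m B Q q by fact
  interpret L': lifted_resolution N' \<beta> n r' m' B' Q' q' by fact
  obtain e where e: "e \<in> hom L'.F L'.F"
    and e1: "\<And>v. v \<in> carrier L'.F \<Longrightarrow> L'.M (e v) = \<one>\<^bsub>L'.E\<^esub>"
    and e2: "\<And>v. v \<in> carrier L'.F \<Longrightarrow> L'.M v = \<one>\<^bsub>L'.E\<^esub> \<Longrightarrow> e v = v"
    using L'.kernel_retraction by blast
  have "\<exists>w\<in>carrier L.F. L.M w = \<one>\<^bsub>L.E\<^esub> \<and> L.head w = L'.head (e v)" if "v \<in> carrier L'.F" for v
    by (rule L.kernel_lift[OF L'.head_closed ker[OF L'.head_closed L'.beta_head]])
      (rule hom_in_carrier[OF e that], rule e1[OF that])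
  then obtain a where a: "\<And>v. v \<in> carrier L'.F \<Longrightarrow> a v \<in> carrier L.F"
    "\<And>v. v \<in> carrier L'.F \<Longrightarrow> L.M (a v) = \<one>\<^bsub>L.E\<^esub>"
    "\<And>v. v \<in> carrier L'.F \<Longrightarrow> L.head (a v) = L'.head (e v)" by metis
  have "a \<in> hom L'.F L.F"
  proof (rule homI)
    fix v w assume v: "v \<in> carrier L'.F" and w: "w \<in> carrier L'.F"
    have vw: "v \<otimes>\<^bsub>L'.F\<^esub> w \<in> carrier L'.F" using v w by simp
    show "a (v \<otimes>\<^bsub>L'.F\<^esub> w) = a v \<otimes>\<^bsub>L.F\<^esub> a w"
    proof (rule L.kernel_eqI)
      show "a (v \<otimes>\<^bsub>L'.F\<^esub> w) \<in> carrier L.F" by (rule a(1)[OF vw])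
      show "a v \<otimes>\<^bsub>L.F\<^esub> a w \<in> carrier L.F" by (intro L.F.m_closed a v w)
      show "L.M (a (v \<otimes>\<^bsub>L'.F\<^esub> w)) = L.M (a v \<otimes>\<^bsub>L.F\<^esub> a w)"
        using L.M.hom_mult[OF a(1)[OF v] a(1)[OF w]] a(2)[OF v] a(2)[OF w] a(2)[OF vw] by simp
      have "L.head (a (v \<otimes>\<^bsub>L'.F\<^esub> w)) = L'.head (e v) \<otimes>\<^bsub>int_power n\<^esub> L'.head (e w)"
        using a(3)[OF vw] hom_mult[OF e v w] hom_mult[OF L'.head_hom hom_in_carrier[OF e v] hom_in_carrier[OF e w]] by simp
      also have "\<dots> = L.head (a v \<otimes>\<^bsub>L.F\<^esub> a w)"
        using hom_mult[OF L.head_hom a(1)[OF v] a(1)[OF w]] a(3)[OF v] a(3)[OF w] by simp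
      finally show "L.head (a (v \<otimes>\<^bsub>L'.F\<^esub> w)) = L.head (a v \<otimes>\<^bsub>L.F\<^esub> a w)" .
    qed
  qed (rule a(1))
  then show ?thesis
    using a(2,3) e2 unfolding L.head_def L'.head_def by (intro bexI[of _ a]) auto
qed

locale lifted_resolution_pair = L: lifted_resolution N \<beta> n r m B Q q + L': lifted_resolution N' \<beta> n r' m' B' Q' q'
  for N \<beta> n r m B Q q N' r' m' B' Q' q' +
  assumes kernels: "\<And>x. x \<in> carrier (int_power n) \<Longrightarrow> \<beta> x = \<one>\<^bsub>N\<^esub> \<longleftrightarrow> \<beta> x = \<one>\<^bsub>N'\<^esub>"
    and onto: "\<beta> ` carrier (int_power n) = carrier N'"
begin

lemma split_dual_cokernels:
  "\<exists>a a'. dual_cokernel_pair (n + r) m L.M (n + r') m' L'.M a a' \<and>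
    (\<forall>v\<in>carrier L'.F. L'.M v = \<one>\<^bsub>L'.E\<^esub> \<longrightarrow> restrict (a v) {..<n} = restrict v {..<n})"
proof -
  obtain a where a: "a \<in> hom L'.F L.F" "\<And>v. v \<in> carrier L'.F \<Longrightarrow> L.M (a v) = \<one>\<^bsub>L.E\<^esub>"
    and ah: "\<And>v. v \<in> carrier L'.F \<Longrightarrow> L'.M v = \<one>\<^bsub>L'.E\<^esub> \<Longrightarrow> restrict (a v) {..<n} = restrict v {..<n}"
    using kernel_transfer[OF L.lifted_resolution_axioms L'.lifted_resolution_axioms] kernels by blast
  obtain a' where a': "a' \<in> hom L.F L'.F" "\<And>v. v \<in> carrier L.F \<Longrightarrow> L'.M (a' v) = \<one>\<^bsub>L'.E\<^esub>"
    and ah': "\<And>v. v \<in> carrier L.F \<Longrightarrow> L.M v = \<one>\<^bsub>L.E\<^esub> \<Longrightarrow> restrict (a' v) {..<n} = restrict v {..<n}"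
    using kernel_transfer[OF L'.lifted_resolution_axioms L.lifted_resolution_axioms] kernels by blast
  have "dual_cokernel_pair (n + r) m L.M (n + r') m' L'.M a a'"
  proof unfold_locales
    fix v assume v: "v \<in> carrier L.F" "L.M v = \<one>\<^bsub>L.E\<^esub>"
    have v': "a' v \<in> carrier L'.F" by (rule hom_in_carrier[OF a'(1) v(1)])
    show "a (a' v) = v"
      by (rule L.kernel_eqI[OF hom_in_carrier[OF a(1) v'] v(1)])
        (simp_all add: a(2)[OF v'] v(2) L.head_def ah[OF v' a'(2)[OF v(1)]] ah'[OF v])
  next
    fix v assume v: "v \<in> carrier L'.F" "L'.M v = \<one>\<^bsub>L'.E\<^esub>"
    have v': "a v \<in> carrier L.F" by (rule hom_in_carrier[OF a(1) v(1)])
    show "a' (a v) = v"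
      by (rule L'.kernel_eqI[OF hom_in_carrier[OF a'(1) v'] v(1)])
        (simp_all add: a'(2)[OF v'] v(2) L'.head_def ah'[OF v' a(2)[OF v(1)]] ah[OF v])
  qed (use a a' L'.M_onto[OF onto] in simp_all)
  then show ?thesis using ah by blast
qed

text \<open>
  The inclusion respects the actions, because \<open>a\<close> preserves the first
  \<open>n\<close> coordinates on the kernel of \<open>M'\<close> and so \<open>\<theta>\<close>
  takes weights to weights.
\<close>

lemma toric_group_splitting:
  "\<exists>\<iota> p. \<iota> \<in> hom (char_group L'.D) (char_group L.D) \<and>
    continuous_map (char_topology L'.D) (char_topology L.D) \<iota> \<and>
    p \<in> hom (char_group L.D) (char_group L'.D) \<and>
    continuous_map (char_topology L.D) (char_topology L'.D) p \<and>
    (\<forall>g\<in>carrier (char_group L'.D). p (\<iota> g) = g) \<and>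
    (\<forall>b. openin (char_topology L.D) {g \<in> carrier (char_group L.D).
      g \<otimes>\<^bsub>char_group L.D\<^esub> inv\<^bsub>char_group L.D\<^esub> (\<iota> (p g)) = b}) \<and>
    (\<forall>g\<in>carrier (char_group L'.D). \<forall>z. toric_action n r' m' B' Q' g z = toric_action n r m B Q (\<iota> g) z) \<and>
    (\<forall>g\<in>carrier (char_group L'.D). \<exists>c. continuous_map (top_of_set {0..1::real}) (char_topology L'.D) c \<and>
      c 0 = \<one>\<^bsub>char_group L'.D\<^esub> \<and> c 1 = g)"
proof -
  obtain a a' where P: "dual_cokernel_pair (n + r) m L.M (n + r') m' L'.M a a'"
    and ah: "\<forall>v\<in>carrier L'.F. L'.M v = \<one>\<^bsub>L'.E\<^esub> \<longrightarrow> restrict (a v) {..<n} = restrict v {..<n}"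
    using split_dual_cokernels by blast
  interpret P: dual_cokernel_pair "n + r" m L.M "n + r'" m' L'.M a a' by (rule P)
  have \<theta>w: "P.\<theta> (L.weight i) = L'.weight i" if i: "i < n" for i
  proof -
    have c: "L.coord i \<in> carrier (dual_group L.F)" "L'.coord i \<in> carrier (dual_group L'.F)"
      using i by (simp_all add: L.coord_closed L'.coord_closed)
    have "P.\<theta> (L.weight i) = L'.cls (hom_map L'.F a (L.coord i))"
      using P.\<theta>(2)[OF c(1)] by (simp add: L.weight_eq[OF i])
    also have "\<dots> = L'.cls (L'.coord i)"
    proof (rule P.cls'_eqI[OF P.dual_a_closed(1)[OF c(1)] c(2)])
      fix v assume v: "v \<in> carrier L'.F" "L'.M v = \<one>\<^bsub>L'.E\<^esub>"
      then have "restrict (a v) {..<n} i = restrict v {..<n} i" using ah by simp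
      then show "hom_map L'.F a (L.coord i) v = L'.coord i v"
        using v(1) i by (simp add: hom_map_def L.coord_def L'.coord_def)
    qed
    finally show ?thesis by (simp add: L'.weight_eq[OF i])
  qed
  have act: "toric_action n r' m' B' Q' g z = toric_action n r m B Q (P.\<iota> g) z" for g z
    unfolding L.toric_action_eq L'.toric_action_eq
    by (rule restrict_ext) (simp add: P.\<iota>_def hom_map_def L.weight_closed \<theta>w)
  show ?thesis
    by (intro exI[of _ P.\<iota>] exI[of _ P.p] conjI ballI allI P.\<iota>_hom P.\<iota>_continuous P.p_hom P.p_continuous
      P.fibres_open act P.p_\<iota> P.char_path)
qed

end

lemma lifted_resolutionI:
  assumes "comm_group N" "\<beta> \<in> hom (int_power n) N" "resolution_with_lift N n \<beta> r B Q q"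
  shows "lifted_resolution N \<beta> n r (abelian_rank N + r) B Q q"
  using assms unfolding resolution_with_lift_def Let_def by (intro lifted_resolution.intro) auto

section \<open>Rays under change of lattice\<close>

text \<open>The map of free abelian groups that induces \<open>f \<otimes> g\<close>.\<close>

definition tensor_lift :: "('a \<Rightarrow> 'c) \<Rightarrow> ('b \<Rightarrow> 'd) \<Rightarrow> ('a \<times> 'b \<Rightarrow>\<^sub>0 int) \<Rightarrow> ('c \<times> 'd \<Rightarrow>\<^sub>0 int)"
  where "tensor_lift f g = frag_extend (\<lambda>(a, b). frag_of (f a, g b))"

lemma tensor_free_simps:
  "x \<in> carrier (tensor_free A B) \<longleftrightarrow> Poly_Mapping.keys x \<subseteq> carrier A \<times> carrier B"
  "x \<otimes>\<^bsub>tensor_free A B\<^esub> y = x + y" "\<one>\<^bsub>tensor_free A B\<^esub> = 0"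
  by (simp_all add: free_Abelian_group_def)

lemma tensor_free_comm_group: "comm_group (tensor_free A B)"
  by (rule abelian_free_Abelian_group)

lemma tensor_lift_simps [simp]:
  "tensor_lift f g (frag_of (a, b)) = frag_of (f a, g b)" "tensor_lift f g 0 = 0"
  "tensor_lift f g (x + y) = tensor_lift f g x + tensor_lift f g y"
  "tensor_lift f g (x - y) = tensor_lift f g x - tensor_lift f g y"
  "tensor_lift f g (- x) = - tensor_lift f g x"
  by (simp_all add: tensor_lift_def frag_extend_add frag_extend_diff frag_extend_minus)

lemma tensor_lift_closed:
  assumes "f \<in> carrier A \<rightarrow> carrier A'" "g \<in> carrier B \<rightarrow> carrier B'" "x \<in> carrier (tensor_free A B)"
  shows "tensor_lift f g x \<in> carrier (tensor_free A' B')"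
  using keys_frag_extend[of "\<lambda>(a, b). frag_of (f a, g b)" x] assms unfolding tensor_free_simps tensor_lift_def
  by fastforce

lemma tensor_generators_subset:
  assumes "group A" "group B"
  shows "{frag_of (a \<otimes>\<^bsub>A\<^esub> a', b) - frag_of (a, b) - frag_of (a', b) | a a' b.
        a \<in> carrier A \<and> a' \<in> carrier A \<and> b \<in> carrier B} \<union>
     {frag_of (a, b \<otimes>\<^bsub>B\<^esub> b') - frag_of (a, b) - frag_of (a, b') | a b b'.
        a \<in> carrier A \<and> b \<in> carrier B \<and> b' \<in> carrier B} \<subseteq> carrier (tensor_free A B)" (is "?S \<subseteq> _")
proof
  interpret A: group A by fact
  interpret B: group B by fact
  have diff: "Poly_Mapping.keys (x - y) \<subseteq> carrier A \<times> carrier B"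
    if "Poly_Mapping.keys x \<subseteq> carrier A \<times> carrier B" "Poly_Mapping.keys y \<subseteq> carrier A \<times> carrier B"
    for x y :: "'a \<times> 'b \<Rightarrow>\<^sub>0 int"
    using keys_diff[of x y] that by blast
  fix x assume "x \<in> ?S"
  then show "x \<in> carrier (tensor_free A B)"
    unfolding tensor_free_simps by (elim UnE CollectE exE conjE) (simp_all add: diff)
qed

lemma tensor_relations_subgroup:
  assumes "group A" "group B"
  shows "subgroup (tensor_relations A B) (tensor_free A B)"
  unfolding tensor_relations_def
  by (rule group.generate_is_subgroup[OF comm_group.axioms(2)[OF tensor_free_comm_group] tensor_generators_subset[OF assms]])

lemma tensor_relations_closed:
  assumes "group A" "group B"
  shows "0 \<in> tensor_relations A B"
    and "x \<in> tensor_relations A B \<Longrightarrow> y \<in> tensor_relations A B \<Longrightarrow> x + y \<in> tensor_relations A B"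
    and "x \<in> tensor_relations A B \<Longrightarrow> - x \<in> tensor_relations A B"
    and "x \<in> tensor_relations A B \<Longrightarrow> x \<in> carrier (tensor_free A B)"
proof -
  note S = tensor_relations_subgroup[OF assms]
  show "0 \<in> tensor_relations A B" using subgroup.one_closed[OF S] by (simp add: tensor_free_simps)
  show "x \<in> tensor_relations A B \<Longrightarrow> y \<in> tensor_relations A B \<Longrightarrow> x + y \<in> tensor_relations A B"
    using subgroup.m_closed[OF S, of x y] by (simp add: tensor_free_simps)
  show c: "x \<in> tensor_relations A B \<Longrightarrow> x \<in> carrier (tensor_free A B)"
    using subgroup.subset[OF S] by blast
  show "x \<in> tensor_relations A B \<Longrightarrow> - x \<in> tensor_relations A B"
    using subgroup.m_inv_closed[OF S, of x] c by (simp add: inv_free_Abelian_group tensor_free_simps(1))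
qed

lemma tensor_lift_generator:
  assumes f: "f \<in> hom A A'" and g: "g \<in> hom B B'"
    and h: "h \<in> {frag_of (a \<otimes>\<^bsub>A\<^esub> a', b) - frag_of (a, b) - frag_of (a', b) | a a' b.
        a \<in> carrier A \<and> a' \<in> carrier A \<and> b \<in> carrier B} \<union>
     {frag_of (a, b \<otimes>\<^bsub>B\<^esub> b') - frag_of (a, b) - frag_of (a, b') | a b b'.
        a \<in> carrier A \<and> b \<in> carrier B \<and> b' \<in> carrier B}"
  shows "tensor_lift f g h \<in> tensor_relations A' B'"
proof -
  consider a a' b where "h = frag_of (a \<otimes>\<^bsub>A\<^esub> a', b) - frag_of (a, b) - frag_of (a', b)"
      "a \<in> carrier A" "a' \<in> carrier A" "b \<in> carrier B"
    | a b b' where "h = frag_of (a, b \<otimes>\<^bsub>B\<^esub> b') - frag_of (a, b) - frag_of (a, b')"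
      "a \<in> carrier A" "b \<in> carrier B" "b' \<in> carrier B"
    using h by blast
  then show ?thesis
  proof cases
    case 1
    then have "tensor_lift f g h = frag_of (f a \<otimes>\<^bsub>A'\<^esub> f a', g b) - frag_of (f a, g b) - frag_of (f a', g b)"
      by (simp add: hom_mult[OF f])
    then show ?thesis unfolding tensor_relations_def
      using hom_in_carrier[OF f 1(2)] hom_in_carrier[OF f 1(3)] hom_in_carrier[OF g 1(4)]
      by (intro generate.incl UnI1) blast
  next
    case 2
    then have "tensor_lift f g h = frag_of (f a, g b \<otimes>\<^bsub>B'\<^esub> g b') - frag_of (f a, g b) - frag_of (f a, g b')"
      by (simp add: hom_mult[OF g])
    then show ?thesis unfolding tensor_relations_def
      using hom_in_carrier[OF f 2(2)] hom_in_carrier[OF g 2(3)] hom_in_carrier[OF g 2(4)]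
      by (intro generate.incl UnI2) blast
  qed
qed

lemma tensor_lift_relations:
  assumes A: "group A" "group A'" "f \<in> hom A A'" and B: "group B" "group B'" "g \<in> hom B B'"
    and x: "x \<in> tensor_relations A B"
  shows "tensor_lift f g x \<in> tensor_relations A' B'"
  using x[unfolded tensor_relations_def]
proof (induction rule: generate.induct)
  case one
  then show ?case using tensor_relations_closed(1)[OF A(2) B(2)] by (simp add: tensor_free_simps)
next
  case (incl h)
  then show ?case by (rule tensor_lift_generator[OF A(3) B(3)])
next
  case (inv h)
  have h: "h \<in> carrier (tensor_free A B)" using tensor_generators_subset[OF A(1) B(1)] inv by blast
  have "tensor_lift f g h \<in> tensor_relations A' B'" by (rule tensor_lift_generator[OF A(3) B(3) inv])
  then show ?case using tensor_relations_closed(3)[OF A(2) B(2)] h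
    by (simp add: inv_free_Abelian_group tensor_free_simps(1))
next
  case (eng h1 h2)
  then show ?case using tensor_relations_closed(2)[OF A(2) B(2)] by (simp add: tensor_free_simps)
qed

lemma tensor_coset: "tensor_relations A B #>\<^bsub>tensor_free A B\<^esub> x = (\<lambda>r. r + x) ` tensor_relations A B"
  by (auto simp: r_coset_def tensor_free_simps)

lemma tensor_map_coset:
  assumes A: "group A" "group A'" "f \<in> hom A A'" and B: "group B" "group B'" "g \<in> hom B B'"
  shows "tensor_map A' B' f g (tensor_relations A B #>\<^bsub>tensor_free A B\<^esub> x)
    = tensor_relations A' B' #>\<^bsub>tensor_free A' B'\<^esub> tensor_lift f g x"
proof -
  have "tensor_map A' B' f g (tensor_relations A B #>\<^bsub>tensor_free A B\<^esub> x)
    = (\<Union>s\<in>tensor_relations A' B'. \<Union>r\<in>tensor_relations A B. {s + (tensor_lift f g r + tensor_lift f g x)})"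
    unfolding tensor_map_def set_mult_def tensor_coset tensor_free_simps tensor_lift_def[symmetric] by simp
  also have "\<dots> = (\<lambda>s. s + tensor_lift f g x) ` tensor_relations A' B'"
  proof (intro equalityI subsetI)
    fix y assume "y \<in> (\<Union>s\<in>tensor_relations A' B'. \<Union>r\<in>tensor_relations A B. {s + (tensor_lift f g r + tensor_lift f g x)})"
    then obtain s r where sr: "s \<in> tensor_relations A' B'" "r \<in> tensor_relations A B"
      "y = (s + tensor_lift f g r) + tensor_lift f g x" by (auto simp: add.assoc)
    have "s + tensor_lift f g r \<in> tensor_relations A' B'"
      by (rule tensor_relations_closed(2)[OF A(2) B(2) sr(1) tensor_lift_relations[OF A B sr(2)]])
    then show "y \<in> (\<lambda>s. s + tensor_lift f g x) ` tensor_relations A' B'" unfolding sr(3) by (rule imageI)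
  next
    fix y assume "y \<in> (\<lambda>s. s + tensor_lift f g x) ` tensor_relations A' B'"
    then obtain s where "s \<in> tensor_relations A' B'" "y = s + (tensor_lift f g 0 + tensor_lift f g x)" by auto
    then show "y \<in> (\<Union>s\<in>tensor_relations A' B'. \<Union>r\<in>tensor_relations A B. {s + (tensor_lift f g r + tensor_lift f g x)})"
      using tensor_relations_closed(1)[OF A(1) B(1)] by blast
  qed
  finally show ?thesis by (simp add: tensor_coset)
qed

lemma tensor_map_pure:
  assumes A: "group A" "group A'" "f \<in> hom A A'" and B: "group B" "group B'" "g \<in> hom B B'"
  shows "tensor_map A' B' f g (pure_tensor A B a b) = pure_tensor A' B' (f a) (g b)"
  unfolding pure_tensor_def tensor_map_coset[OF assms] by simp

lemma tensor_product_carrierE: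
  assumes "v \<in> carrier (tensor_product A B)"
  obtains x where "x \<in> carrier (tensor_free A B)" "v = tensor_relations A B #>\<^bsub>tensor_free A B\<^esub> x"
  using assms unfolding tensor_product_def carrier_FactGroup by blast

lemma tensor_product_comm_group:
  assumes "group A" "group B"
  shows "comm_group (tensor_product A B)"
  unfolding tensor_product_def
  by (rule comm_group.abelian_FactGroup[OF tensor_free_comm_group tensor_relations_subgroup[OF assms]])

lemma pure_tensor_closed:
  assumes "a \<in> carrier A" "b \<in> carrier B"
  shows "pure_tensor A B a b \<in> carrier (tensor_product A B)"
  using assms unfolding pure_tensor_def tensor_product_def carrier_FactGroup
  by (intro imageI) (simp add: tensor_free_simps)

lemma real_group_group: "comm_group real_group"
  by (rule comm_groupI) (auto simp: real_group_def intro: exI[of _ "- x" for x :: real])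

lemma real_mult_hom: "(\<lambda>s. c * s) \<in> hom real_group real_group"
  by (auto simp: hom_def real_group_def distrib_left)

lemma real_group: "group real_group" by (rule comm_group.axioms(2)[OF real_group_group])

context
  fixes N :: "'a monoid"
  assumes N: "group N"
begin

lemma id_hom: "(\<lambda>a. a) \<in> hom N N" by (simp add: hom_def)

lemmas scale_coset = tensor_map_coset[OF N N id_hom real_group real_group real_mult_hom]

lemma scale_pure: "real_scale N c (pure_tensor N real_group a s) = pure_tensor N real_group a (c * s)"
  by (rule tensor_map_pure[OF N N id_hom real_group real_group real_mult_hom])

lemma scale_scale:
  assumes "v \<in> carrier (real_ext N)" shows "real_scale N c (real_scale N d v) = real_scale N (c * d) v"
proof -
  obtain x where v: "v = tensor_relations N real_group #>\<^bsub>tensor_free N real_group\<^esub> x"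
    using assms by (rule tensor_product_carrierE)
  have "tensor_lift (\<lambda>a. a) ((*) c) (tensor_lift (\<lambda>a. a) ((*) d) x) = tensor_lift (\<lambda>a :: 'a. a) ((*) (c * d)) x" for x
    using subset_UNIV[of "Poly_Mapping.keys x"]
    by (induction x rule: frag_induction) (auto simp: mult.assoc)
  then show ?thesis unfolding v scale_coset by simp
qed

lemma scale_one:
  assumes "v \<in> carrier (real_ext N)" shows "real_scale N 1 v = v"
proof -
  obtain x where v: "v = tensor_relations N real_group #>\<^bsub>tensor_free N real_group\<^esub> x"
    using assms by (rule tensor_product_carrierE)
  have "tensor_lift (\<lambda>a :: 'a. a) ((*) (1 :: real)) x = x" for x
    using subset_UNIV[of "Poly_Mapping.keys x"] by (induction x rule: frag_induction) auto
  then show ?thesis unfolding v scale_coset by simp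
qed

lemma scale_closed:
  assumes "v \<in> carrier (real_ext N)" shows "real_scale N c v \<in> carrier (real_ext N)"
proof -
  obtain x where v: "v = tensor_relations N real_group #>\<^bsub>tensor_free N real_group\<^esub> x"
    and x: "x \<in> carrier (tensor_free N real_group)"
    using assms by (rule tensor_product_carrierE)
  have "tensor_lift (\<lambda>a :: 'a. a) ((*) c) x \<in> carrier (tensor_free N real_group)"
    by (rule tensor_lift_closed[OF _ _ x]) (auto simp: real_group_def)
  then show ?thesis unfolding v scale_coset tensor_product_def carrier_FactGroup by (rule imageI)
qed

lemma scale_zero:
  assumes "v \<in> carrier (real_ext N)" shows "real_scale N 0 v = \<one>\<^bsub>real_ext N\<^esub>"
proof -
  let ?R = "tensor_relations N real_group"
  obtain x where v: "v = ?R #>\<^bsub>tensor_free N real_group\<^esub> x"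
    and x: "x \<in> carrier (tensor_free N real_group)"
    using assms by (rule tensor_product_carrierE)
  have "tensor_lift (\<lambda>a :: 'a. a) ((*) (0 :: real)) x \<in> ?R"
    using x unfolding tensor_free_simps
  proof (induction x rule: frag_induction)
    case zero
    then show ?case using tensor_relations_closed(1)[OF N real_group] by simp
  next
    case (one ab)
    then obtain a b where ab: "ab = (a, b)" "a \<in> carrier N" by auto
    have "frag_of (a, (0 :: real) \<otimes>\<^bsub>real_group\<^esub> 0) - frag_of (a, 0) - frag_of (a, 0) \<in> ?R"
      unfolding tensor_relations_def using ab(2)
      by (intro generate.incl UnI2 CollectI exI[of _ a] exI[of _ 0]) (simp add: real_group_def)
    then have "- frag_of (a, 0) \<in> ?R" by (simp add: real_group_def)
    from tensor_relations_closed(3)[OF N real_group this] show ?case by (simp add: ab)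
  next
    case (diff a b)
    then show ?case using tensor_relations_closed(2)[OF N real_group diff(1) tensor_relations_closed(3)[OF N real_group diff(2)]] by simp
  qed
  then have "?R #>\<^bsub>tensor_free N real_group\<^esub> tensor_lift (\<lambda>a :: 'a. a) ((*) (0 :: real)) x = ?R"
    using group.coset_join2[OF comm_group.axioms(2)[OF tensor_free_comm_group] _ tensor_relations_subgroup[OF N real_group]]
      tensor_relations_closed(4)[OF N real_group] by blast
  then show ?thesis unfolding v scale_coset tensor_product_def one_FactGroup .
qed

lemma cone_of_one:
  assumes v: "v \<in> carrier (real_ext N)"
  shows "cone_generated N {v} = {real_scale N c v | c. 0 \<le> c}"
proof -
  interpret comm_group "real_ext N" by (rule tensor_product_comm_group[OF N real_group])
  have "real_comb N c {v} = real_scale N (c v) v" for c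
    unfolding real_comb_def using scale_closed[OF v] by (simp add: finprod_singleton_swap)
  then show ?thesis unfolding cone_generated_def by (auto intro: exI[of _ "\<lambda>_. c" for c])
qed

text \<open>
  A ray consists of the nonnegative multiples of any nonzero point on it, and multiples of a pure
  tensor are pure tensors with the same first factor.
\<close>

lemma ray_through_lattice_point:
  assumes v: "v \<in> carrier (real_ext N)" and p: "lattice_point N a \<in> cone_generated N {v} - {\<one>\<^bsub>real_ext N\<^esub>}"
    and w: "w \<in> cone_generated N {v}"
  shows "\<exists>t. w = pure_tensor N real_group a t"
proof -
  obtain d where d: "lattice_point N a = real_scale N d v" using p cone_of_one[OF v] by auto
  have "d \<noteq> 0" using scale_zero[OF v] d p by auto
  then have "1 / d * d = 1" by simp
  then have "v = real_scale N (1 / d) (lattice_point N a)"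
    unfolding d scale_scale[OF v] by (simp only: scale_one[OF v])
  then have v': "v = pure_tensor N real_group a (1 / d * 1)" unfolding scale_pure .
  obtain c where "w = real_scale N c v" using w cone_of_one[OF v] by auto
  then show ?thesis unfolding v' scale_pure by blast
qed

end

text \<open>
  The ray lies in the image of \<open>N' \<otimes> \<real>\<close>, because it is spanned by a
  lattice point of \<open>N'\<close>.
\<close>

lemma pullback_ray_subset_iff:
  assumes N: "group N" and N': "group N'" and sub: "(\<lambda>a. a) \<in> hom N' N"
    and a: "a \<in> carrier N'" and v: "v \<in> carrier (real_ext N)"
    and p: "lattice_point N a \<in> cone_generated N {v} - {\<one>\<^bsub>real_ext N\<^esub>}"
  shows "pullback_cone N' N (cone_generated N {v}) \<subseteq> pullback_cone N' N \<sigma> \<longleftrightarrow> cone_generated N {v} \<subseteq> \<sigma>"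
proof
  assume *: "pullback_cone N' N (cone_generated N {v}) \<subseteq> pullback_cone N' N \<sigma>"
  show "cone_generated N {v} \<subseteq> \<sigma>"
  proof
    fix w assume w: "w \<in> cone_generated N {v}"
    obtain t where t: "w = pure_tensor N real_group a t"
      using ray_through_lattice_point[OF N v p w] by blast
    have "(\<lambda>s. s) \<in> hom real_group real_group" by (simp add: hom_def)
    from tensor_map_pure[OF N' N sub real_group real_group this]
    have map: "tensor_map N real_group (\<lambda>a. a) (\<lambda>s. s) (pure_tensor N' real_group a t) = w"
      unfolding t .
    have "pure_tensor N' real_group a t \<in> carrier (real_ext N')"
      by (rule pure_tensor_closed[OF a]) (simp add: real_group_def)
    then have "pure_tensor N' real_group a t \<in> pullback_cone N' N (cone_generated N {v})"
      unfolding pullback_cone_def using map w by simp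
    then have "pure_tensor N' real_group a t \<in> pullback_cone N' N \<sigma>" using * by blast
    then show "w \<in> \<sigma>" unfolding pullback_cone_def using map by simp
  qed
qed (auto simp: pullback_cone_def)

section \<open>Bundles inside the universe\<close>

text \<open>An infinite set is equinumerous with its square.\<close>

lemma pairing_exists:
  fixes u :: "real \<Rightarrow> 'u"
  assumes "inj u"
  shows "\<exists>J :: 'u \<times> 'u \<Rightarrow> 'u. inj J"
proof -
  have "infinite (range u)" using finite_imageD[OF _ assms] infinite_UNIV_char_0[where 'a = real] by blast
  then have "infinite (UNIV :: 'u set)" using infinite_super[of "range u" UNIV] by simp
  from card_of_Times_same_infinite[OF this]
  obtain J :: "'u \<times> 'u \<Rightarrow> 'u" where "bij_betw J (UNIV \<times> UNIV) UNIV"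
    unfolding card_of_ordIso[symmetric] by blast
  then show ?thesis by (auto simp: bij_betw_def)
qed

context dual_cokernel begin

text \<open>
  A character is determined by its values at the finitely many coordinate classes; these complex
  numbers are paired with the point of the universe one after the other.
\<close>

lemma char_code_exists:
  fixes u :: "real \<Rightarrow> 'u"
  assumes u: "inj u"
  shows "\<exists>enc :: 'u \<times> (((nat \<Rightarrow> int) \<Rightarrow> int) set \<Rightarrow> complex) \<Rightarrow> 'u. inj_on enc (UNIV \<times> carrier (char_group D))"
proof -
  obtain J :: "'u \<times> 'u \<Rightarrow> 'u" where J: "inj J" using pairing_exists[OF u] by blast
  define c where "c z = J (u (Re z), u (Im z))" for z
  have c: "c z = c w \<longleftrightarrow> z = w" for z w
    using J u by (auto simp: c_def complex_eq_iff inj_eq)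
  define f where "f zs t = foldr (\<lambda>z t. J (c z, t)) zs t" for zs and t :: 'u
  have f: "f zs t = f ws s \<Longrightarrow> zs = ws \<and> t = s" if "length zs = length ws" for zs ws t s
    using that by (induction zs ws rule: list_induct2) (auto simp: f_def inj_eq[OF J] c)
  define v where "v g = map (\<lambda>i. g (cls (coord i))) [0..<k]" for g :: "((nat \<Rightarrow> int) \<Rightarrow> int) set \<Rightarrow> complex"
  have "inj_on (\<lambda>(t, g). f (v g) t) (UNIV \<times> carrier (char_group D))"
  proof (rule inj_onI, clarify)
    fix t s g h assume g: "g \<in> carrier (char_group D)" "h \<in> carrier (char_group D)"
      and "f (v g) t = f (v h) s"
    then have e: "v g = v h" "t = s" using f[of "v g" "v h" t s] by (simp_all add: v_def)
    have "g = h"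
      by (rule char_eqI[OF g]) (use e(1) in \<open>simp add: v_def\<close>)
    then show "t = s \<and> g = h" using e by simp
  qed
  then show ?thesis by blast
qed

end

section \<open>Toric Deligne-Mumford stacks\<close>

text \<open>Every ray of the fan is itself one of the cones.\<close>

lemma fan_zero_patterns:
  assumes "stacky_fan N \<Sigma> n \<rho> \<beta>"
  shows "zero_patterns n (\<lambda>I. \<exists>\<sigma>\<in>\<Sigma>. \<forall>i\<in>I. \<rho> i \<subseteq> \<sigma>)"
proof
  have "\<Sigma> \<noteq> {}" "bij_betw \<rho> {..<n} (fan_rays N \<Sigma>)"
    using assms by (simp_all add: stacky_fan_def rational_simplicial_fan_def)
  moreover have "fan_rays N \<Sigma> \<subseteq> \<Sigma>" by (auto simp: fan_rays_def)
  ultimately show "\<exists>\<sigma>\<in>\<Sigma>. \<forall>i\<in>{}. \<rho> i \<subseteq> \<sigma>" "\<And>i. i < n \<Longrightarrow> \<exists>\<sigma>\<in>\<Sigma>. \<forall>j\<in>{i}. \<rho> j \<subseteq> \<sigma>"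
    by (auto simp: bij_betw_def)
qed blast

lemma subtopology_eqI: "topspace (subtopology T A) = topspace (subtopology T B) \<Longrightarrow> subtopology T A = subtopology T B"
  by (metis subtopology_restrict topspace_subtopology)

lemma Z_space_eq:
  assumes "stacky_fan N \<Sigma> n \<rho> \<beta>"
  shows "Z_space n \<rho> \<Sigma> = zero_patterns.Zp n (\<lambda>I. \<exists>\<sigma>\<in>\<Sigma>. \<forall>i\<in>I. \<rho> i \<subseteq> \<sigma>)"
proof -
  interpret zero_patterns n "\<lambda>I. \<exists>\<sigma>\<in>\<Sigma>. \<forall>i\<in>I. \<rho> i \<subseteq> \<sigma>" by (rule fan_zero_patterns[OF assms])
  have "z \<in> topspace (Z_space n \<rho> \<Sigma>) \<longleftrightarrow> z \<in> topspace Zp" for z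
    unfolding topspace_Zp topspace_Z_space_iff zeros_def by (simp add: imp_conjL)
  then have "topspace (Z_space n \<rho> \<Sigma>) = topspace Zp" by blast
  then show ?thesis unfolding Z_space_def Zp_def by (rule subtopology_eqI)
qed

lemma Z_space_cong:
  assumes "\<And>i \<sigma>. i < n \<Longrightarrow> \<sigma> \<in> \<Sigma> \<Longrightarrow> \<rho>' i \<subseteq> h \<sigma> \<longleftrightarrow> \<rho> i \<subseteq> \<sigma>"
  shows "Z_space n \<rho>' (h ` \<Sigma>) = Z_space n \<rho> \<Sigma>"
proof -
  have "topspace (Z_space n \<rho>' (h ` \<Sigma>)) = topspace (Z_space n \<rho> \<Sigma>)"
    using assms by (auto simp: topspace_Z_space_iff)
  then show ?thesis unfolding Z_space_def by (rule subtopology_eqI)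
qed

lemma image_subgroup_comm_group:
  assumes N: "comm_group N" and \<beta>: "\<beta> \<in> hom (int_power n) N"
  shows "comm_group (image_subgroup N n \<beta>)"
proof -
  have "\<beta> \<one>\<^bsub>int_power n\<^esub> = \<one>\<^bsub>N\<^esub>"
    by (rule hom_one[OF \<beta> comm_group.axioms(2)[OF int_power_group] comm_group.axioms(2)[OF N]])
  then show ?thesis
    using comm_group.hom_imp_img_comm_group[OF int_power_group \<beta>] by (simp add: image_subgroup_def)
qed

lemma pulled_back_Z_space:
  assumes fan: "stacky_fan N \<Sigma> n \<rho> \<beta>" and N': "N' = image_subgroup N n \<beta>"
  shows "Z_space n (\<lambda>j. pullback_cone N' N (\<rho> j)) (pullback_cone N' N ` \<Sigma>) = Z_space n \<rho> \<Sigma>"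
proof (rule Z_space_cong)
  fix i \<sigma> assume i: "i < n"
  have N: "comm_group N" and \<beta>: "\<beta> \<in> hom (int_power n) N" and \<rho>: "bij_betw \<rho> {..<n} (fan_rays N \<Sigma>)"
    and p: "lattice_point N (\<beta> (std_basis n i)) \<in> \<rho> i - {\<one>\<^bsub>real_ext N\<^esub>}"
    using fan i by (auto simp: stacky_fan_def)
  have "\<rho> i \<in> fan_rays N \<Sigma>" using \<rho> i by (auto simp: bij_betw_def)
  then obtain v where v: "v \<in> carrier (real_ext N)" "\<rho> i = cone_generated N {v}"
    by (auto simp: fan_rays_def)
  have "std_basis n i \<in> carrier (int_power n)" by (auto simp: std_basis_def int_power_carrier)
  then have a: "\<beta> (std_basis n i) \<in> carrier N'" by (simp add: N' image_subgroup_def)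
  have "carrier N' \<subseteq> carrier N" using \<beta> by (auto simp: N' image_subgroup_def hom_def)
  then have sub: "(\<lambda>a. a) \<in> hom N' N" by (auto simp: hom_def N' image_subgroup_def)
  have g: "group N" "group N'"
    using N image_subgroup_comm_group[OF N \<beta>] by (simp_all add: N' comm_group.axioms)
  show "pullback_cone N' N (\<rho> i) \<subseteq> pullback_cone N' N \<sigma> \<longleftrightarrow> \<rho> i \<subseteq> \<sigma>"
    unfolding v(2) by (rule pullback_ray_subset_iff[OF g sub a v(1) p[unfolded v(2)]])
qed

lemma (in lifted_resolution) toric_qstack:
  fixes X :: "(nat \<Rightarrow> complex) topology"
  assumes X: "X = Z_space n \<rho> \<Sigma>"
  shows "qstack (char_group D) (char_topology D) X (toric_action n r m B Q)"
proof -
  have "continuous_action (char_group D) (char_topology D) X (toric_action n r m B Q)"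
  proof (rule toric_action_continuous)
    show "X = subtopology (product_topology (\<lambda>_. euclidean) {..<n})
      (({..<n} \<rightarrow>\<^sub>E UNIV) - vanishing_locus n (irrelevant_ideal n \<rho> \<Sigma>))"
      unfolding X Z_space_def ..
  qed (auto simp: X topspace_Z_space_iff)
  then show ?thesis
    by (intro qstack.intro qstack_axioms.intro char_topgroup[OF D.is_group])
qed

theorem proposition5p5:
  fixes N N' :: "'a monoid"
    and \<Sigma> \<Sigma>' :: "'a tensor_real set set"
    and n r r' :: nat
    and \<rho> \<rho>' :: "nat \<Rightarrow> 'a tensor_real set"
    and \<beta> q q' :: "(nat \<Rightarrow> int) \<Rightarrow> 'a"
    and B Q B' Q' :: "(nat \<Rightarrow> int) \<Rightarrow> nat \<Rightarrow> int"
    and u :: "real \<Rightarrow> 'u"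
  assumes universe: "inj u"
    and fan: "stacky_fan N \<Sigma> n \<rho> \<beta>"
    and resolution: "resolution_with_lift N n \<beta> r B Q q"
    and N': "N' = image_subgroup N n \<beta>"
    and \<Sigma>': "\<Sigma>' = pullback_cone N' N ` \<Sigma>"
    and \<rho>': "\<rho>' = (\<lambda>j. pullback_cone N' N (\<rho> j))"
    and resolution': "resolution_with_lift N' n \<beta> r' B' Q' q'"
  shows "universal_cover
    (toric_DM_stack TYPE('u) n \<rho>' \<Sigma>' r' (abelian_rank N' + r') B' Q')
    (toric_DM_stack TYPE('u) n \<rho> \<Sigma> r (abelian_rank N + r) B Q)"
proof -
  define X where "X = Z_space n \<rho> \<Sigma>"
  define m m' where "m = abelian_rank N + r" and "m' = abelian_rank N' + r'"
  have N: "comm_group N" and \<beta>: "\<beta> \<in> hom (int_power n) N" using fan by (simp_all add: stacky_fan_def)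
  have X': "Z_space n \<rho>' \<Sigma>' = X" unfolding X_def \<rho>' \<Sigma>' by (rule pulled_back_Z_space[OF fan N'])
  have N'_group: "comm_group N'" unfolding N' by (rule image_subgroup_comm_group[OF N \<beta>])
  have \<beta>': "\<beta> \<in> hom (int_power n) N'" using \<beta> by (auto simp: hom_def N' image_subgroup_def)
  interpret LP: lifted_resolution_pair N \<beta> n r m B Q q N' r' m' B' Q' q'
    unfolding m_def m'_def
    by (intro lifted_resolution_pair.intro lifted_resolution_pair_axioms.intro lifted_resolutionI
      N N'_group \<beta> \<beta>' resolution resolution') (simp_all add: N' image_subgroup_def)
  let ?G = "char_group LP.L.D" and ?TG = "char_topology LP.L.D" and ?act = "toric_action n r m B Q"
  let ?G' = "char_group LP.L'.D" and ?TG' = "char_topology LP.L'.D" and ?act' = "toric_action n r' m' B' Q'"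
  have QS: "qstack ?G ?TG X ?act" by (rule LP.L.toric_qstack[OF X_def])
  have QS': "qstack ?G' ?TG' X ?act'" by (rule LP.L'.toric_qstack[OF X'[symmetric]])
  obtain enc :: "'u \<times> gale_char \<Rightarrow> 'u" where enc: "inj_on enc (UNIV \<times> carrier ?G)"
    using LP.L.char_code_exists[OF universe] by blast
  obtain enc' :: "'u \<times> gale_char \<Rightarrow> 'u" where enc': "inj_on enc' (UNIV \<times> carrier ?G')"
    using LP.L'.char_code_exists[OF universe] by blast
  obtain \<iota> p where \<iota>: "\<iota> \<in> hom ?G' ?G" "continuous_map ?TG' ?TG \<iota>"
    and p: "p \<in> hom ?G ?G'" "continuous_map ?TG ?TG' p"
    and p\<iota>: "\<forall>g\<in>carrier ?G'. p (\<iota> g) = g"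
    and fib: "\<forall>b. openin ?TG {g \<in> carrier ?G. g \<otimes>\<^bsub>?G\<^esub> inv\<^bsub>?G\<^esub> (\<iota> (p g)) = b}"
    and act: "\<forall>g\<in>carrier ?G'. \<forall>z. ?act' g z = ?act (\<iota> g) z"
    and path: "\<forall>g\<in>carrier ?G'. \<exists>c. continuous_map (top_of_set {0..1::real}) ?TG' c \<and> c 0 = \<one>\<^bsub>?G'\<^esub> \<and> c 1 = g"
    using LP.toric_group_splitting by blast
  have G: "comm_group ?G" by (rule hom_group_comm_group[OF LP.L.D.is_group complex_units_group])
  interpret C: qstack_coded ?G' ?TG' X ?act' "TYPE('u)" enc'
    by (intro qstack_coded.intro QS' qstack_coded_axioms.intro enc')
  interpret I: induced ?G ?TG X ?act "TYPE('u)" enc ?G' ?TG' ?act' \<iota> p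
    by (intro induced.intro qstack_coded.intro QS QS' qstack_coded_axioms.intro enc induced_axioms.intro
      G \<iota> p p\<iota>[rule_format] act[rule_format] fib[rule_format])
  interpret Z: zero_patterns n "\<lambda>I. \<exists>\<sigma>\<in>\<Sigma>. \<forall>i\<in>I. \<rho> i \<subseteq> \<sigma>" by (rule fan_zero_patterns[OF fan])
  have XZ: "X = Z.Zp" unfolding X_def by (rule Z_space_eq[OF fan])
  have one: "(\<lambda>i\<in>{..<n}. 1) \<in> topspace X"
    unfolding XZ Z.topspace_Zp Z.zeros_def using Z.P_small(1) by auto
  have pi1: "is_singleton (pi1 C.QS y)" if "point_of_stack C.QS y" for y
    by (rule C.pi1_singleton[OF universe that])
      (rule path[rule_format], assumption, unfold XZ, rule Z.Zp_based_homotopy)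
  have "universal_covering_projection C.QS I.QS I.ind"
    unfolding universal_covering_projection_def
    using I.induced_covering_projection C.point_exists[OF one] pi1 by blast
  then show ?thesis
    unfolding universal_cover_def toric_DM_stack_def X' X_def[symmetric] m_def[symmetric] m'_def[symmetric]
      LP.L.toric_group_eq LP.L.toric_group_topology_eq LP.L'.toric_group_eq LP.L'.toric_group_topology_eq
    by blast
qed

end
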